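(* Let $R$ be a regular ring containing a field of characteristic $p>0$, and let $\mathfrak a$ be an ideal of $R$ such that the ring $R/\mathfrak a$ is $F$-pure. Then for all integers $i\ge 0$ and all integers $t\ge 0$, the natural map $$\operatorname{Ext}^i_R(R/\mathfrak a^{[p^t]},R)\longrightarrow H^i_{\mathfrak a}(R)$$ is injective.
   Context: All rings are commutative, Noetherian, and contain an identity element. A ring homomorphism $\varphi\colon A\to B$ is pure if the map $\varphi\otimes 1\colon A\otimes_A M\to B\otimes_A M$ is injective for each $A$-module $M$. A ring $A$ containing a field of characteristic $p>0$ is $F$-pure if the Frobenius homomorphism $A\to A$, $r\mapsto r^p$, is pure. For an ideal $\mathfrak a$ of $R$, $\mathfrak a^{[p^t]}$ denotes the ideal of $R$ generated by the elements $a^{p^t}$ with $a\in\mathfrak a$. The local cohomology module is $H^i_{\mathfrak a}(R)=\varinjlim_t \operatorname{Ext}^i_R(R/\mathfrak a_t,R)$, where $\{\mathfrak a_t\}_{t\ge 0}$ is any decreasing chain of ideals cofinal with $\{\mathfrak a^t\}_{t\ge 0}$ and the transition maps are induced by the natural surjections $R/\mathfrak a_{t+1}\to R/\mathfrak a_t$; all such chains give the same limit. The chain $\{\mathfrak a^{[p^t]}\}_{t\ge0}$ is one such chain, and the natural map in the claim is the canonical map to the direct limit. *)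

theory Defs
  imports
    "HOL-Algebra.Free_Abelian_Groups" "HOL-Algebra.Ideal_Product" "HOL-Algebra.Module"
    "HOL-Algebra.QuotRing" "HOL-Algebra.Ring_Divisibility" "HOL-Algebra.Subrings"
    "HOL-Library.Extended_Nat"
begin

section \<open>Regular rings\<close>

text \<open>The equivalence relation on numerator-denominator pairs defining the localization
  of \<open>R\<close> at a multiplicative set \<open>S\<close>.\<close>

definition frac_rel :: "('a, 'x) ring_scheme \<Rightarrow> 'a set \<Rightarrow> (('a \<times> 'a) \<times> ('a \<times> 'a)) set" where
  "frac_rel R S = {((a, s), (b, t)). a \<in> carrier R \<and> s \<in> S \<and> b \<in> carrier R \<and> t \<in> S \<and>
     (\<exists>u\<in>S. u \<otimes>\<^bsub>R\<^esub> (t \<otimes>\<^bsub>R\<^esub> a) = u \<otimes>\<^bsub>R\<^esub> (s \<otimes>\<^bsub>R\<^esub> b))}"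

definition localization :: "('a, 'x) ring_scheme \<Rightarrow> 'a set \<Rightarrow> ('a \<times> 'a) set ring" where
  "localization R S =
    \<lparr>carrier = (carrier R \<times> S) // frac_rel R S,
     monoid.mult = (\<lambda>U V. \<Union>(a, s)\<in>U. \<Union>(b, t)\<in>V.
               frac_rel R S `` {(a \<otimes>\<^bsub>R\<^esub> b, s \<otimes>\<^bsub>R\<^esub> t)}),
     one = frac_rel R S `` {(\<one>\<^bsub>R\<^esub>, \<one>\<^bsub>R\<^esub>)},
     zero = frac_rel R S `` {(\<zero>\<^bsub>R\<^esub>, \<one>\<^bsub>R\<^esub>)},
     add = (\<lambda>U V. \<Union>(a, s)\<in>U. \<Union>(b, t)\<in>V.
               frac_rel R S `` {((t \<otimes>\<^bsub>R\<^esub> a) \<oplus>\<^bsub>R\<^esub> (s \<otimes>\<^bsub>R\<^esub> b), s \<otimes>\<^bsub>R\<^esub> t)})\<rparr>"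

definition krull_dim :: "('a, 'x) ring_scheme \<Rightarrow> enat" where
  "krull_dim R = Sup {enat n | n. \<exists>P :: nat \<Rightarrow> 'a set.
     (\<forall>i\<le>n. primeideal (P i) R) \<and> (\<forall>i<n. P i \<subset> P (Suc i))}"

definition local_ring :: "('a, 'x) ring_scheme \<Rightarrow> bool" where
  "local_ring R \<longleftrightarrow> cring R \<and> (\<exists>!m. maximalideal m R)"

definition regular_local_ring :: "('a, 'x) ring_scheme \<Rightarrow> bool" where
  "regular_local_ring R \<longleftrightarrow> local_ring R \<and> noetherian_ring R \<and>
     (\<exists>U \<subseteq> carrier R. finite U \<and> maximalideal (Idl\<^bsub>R\<^esub> U) R \<and> krull_dim R = enat (card U))"

definition regular_ring :: "('a, 'x) ring_scheme \<Rightarrow> bool" where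
  "regular_ring R \<longleftrightarrow> cring R \<and> noetherian_ring R \<and>
     (\<forall>P. primeideal P R \<longrightarrow> regular_local_ring (localization R (carrier R - P)))"


section \<open>Modules\<close>

text \<open>The library's module record extends rings, but the locale \<^locale>\<open>module\<close> does not
  constrain \<open>mult\<close> and \<open>one\<close>; where a module has no natural multiplication, these two
  fields are left \<open>undefined\<close>.\<close>

definition ring_as_module :: "('a \<Rightarrow> 'b) \<Rightarrow> ('b, 'y) ring_scheme \<Rightarrow> ('a, 'b) module" where
  "ring_as_module \<phi> B =
    \<lparr>carrier = carrier B, monoid.mult = monoid.mult B, one = \<one>\<^bsub>B\<^esub>, zero = \<zero>\<^bsub>B\<^esub>, add = add B,
     smult = (\<lambda>a b. \<phi> a \<otimes>\<^bsub>B\<^esub> b)\<rparr>"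

abbreviation self_module :: "('a, 'x) ring_scheme \<Rightarrow> ('a, 'a) module" where
  "self_module R \<equiv> ring_as_module (\<lambda>r. r) R"

abbreviation cyclic_module :: "('a, 'x) ring_scheme \<Rightarrow> 'a set \<Rightarrow> ('a, 'a set) module" where
  "cyclic_module R I \<equiv> ring_as_module (\<lambda>r. I +>\<^bsub>R\<^esub> r) (R Quot I)"

definition mod_hom ::
  "('a, 'x) ring_scheme \<Rightarrow> ('a, 'm, 'y) module_scheme \<Rightarrow> ('a, 'n, 'z) module_scheme \<Rightarrow> ('m \<Rightarrow> 'n) set"
  where
  "mod_hom R M N = {f \<in> carrier M \<rightarrow> carrier N.
     (\<forall>x\<in>carrier M. \<forall>y\<in>carrier M. f (x \<oplus>\<^bsub>M\<^esub> y) = f x \<oplus>\<^bsub>N\<^esub> f y) \<and>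
     (\<forall>r\<in>carrier R. \<forall>x\<in>carrier M. f (r \<odot>\<^bsub>M\<^esub> x) = r \<odot>\<^bsub>N\<^esub> f x)}"

definition Hom_module ::
  "('a, 'x) ring_scheme \<Rightarrow> ('a, 'm, 'y) module_scheme \<Rightarrow> ('a, 'n, 'z) module_scheme
    \<Rightarrow> ('a, 'm \<Rightarrow> 'n) module" where
  "Hom_module R M N =
    \<lparr>carrier = mod_hom R M N \<inter> extensional (carrier M), monoid.mult = undefined, one = undefined,
     zero = (\<lambda>x\<in>carrier M. \<zero>\<^bsub>N\<^esub>),
     add = (\<lambda>f g. \<lambda>x\<in>carrier M. f x \<oplus>\<^bsub>N\<^esub> g x),
     smult = (\<lambda>r f. \<lambda>x\<in>carrier M. r \<odot>\<^bsub>N\<^esub> f x)\<rparr>"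

definition quotient_module ::
  "('a, 'm, 'y) module_scheme \<Rightarrow> 'm set \<Rightarrow> ('a, 'm set) module" where
  "quotient_module M N =
    \<lparr>carrier = a_rcosets\<^bsub>M\<^esub> N, monoid.mult = undefined, one = undefined,
     zero = N, add = set_add M,
     smult = (\<lambda>r C. \<Union>x\<in>C. N +>\<^bsub>M\<^esub> (r \<odot>\<^bsub>M\<^esub> x))\<rparr>"

text \<open>The free module with basis \<open>B\<close>, as finitely supported functions vanishing off \<open>B\<close>.\<close>

definition free_module :: "('a, 'x) ring_scheme \<Rightarrow> 'b set \<Rightarrow> ('a, 'b \<Rightarrow> 'a) module" where
  "free_module R B =
    \<lparr>carrier = {f. range f \<subseteq> carrier R \<and> finite {b. f b \<noteq> \<zero>\<^bsub>R\<^esub>} \<and> {b. f b \<noteq> \<zero>\<^bsub>R\<^esub>} \<subseteq> B},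
     monoid.mult = undefined, one = undefined,
     zero = (\<lambda>_. \<zero>\<^bsub>R\<^esub>),
     add = (\<lambda>f g b. f b \<oplus>\<^bsub>R\<^esub> g b),
     smult = (\<lambda>r f b. r \<otimes>\<^bsub>R\<^esub> f b)\<rparr>"

definition basis_vec :: "('a, 'x) ring_scheme \<Rightarrow> 'b \<Rightarrow> 'b \<Rightarrow> 'a" where
  "basis_vec R b = (\<lambda>c. if c = b then \<one>\<^bsub>R\<^esub> else \<zero>\<^bsub>R\<^esub>)"

definition lin_extend ::
  "('a, 'x) ring_scheme \<Rightarrow> ('a, 'm, 'y) module_scheme \<Rightarrow> ('b \<Rightarrow> 'm) \<Rightarrow> ('b \<Rightarrow> 'a) \<Rightarrow> 'm" where
  "lin_extend R M h f = (\<Oplus>\<^bsub>M\<^esub>b\<in>{b. f b \<noteq> \<zero>\<^bsub>R\<^esub>}. f b \<odot>\<^bsub>M\<^esub> h b)"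


section \<open>Tensor products, purity, and F-purity\<close>

definition tensor_relators ::
  "('a, 'x) ring_scheme \<Rightarrow> ('a, 'm, 'y) module_scheme \<Rightarrow> ('a, 'n, 'z) module_scheme
    \<Rightarrow> ('m \<times> 'n \<Rightarrow>\<^sub>0 int) set" where
  "tensor_relators R M N =
     {frag_of (x \<oplus>\<^bsub>M\<^esub> x', y) - frag_of (x, y) - frag_of (x', y) | x x' y.
        x \<in> carrier M \<and> x' \<in> carrier M \<and> y \<in> carrier N} \<union>
     {frag_of (x, y \<oplus>\<^bsub>N\<^esub> y') - frag_of (x, y) - frag_of (x, y') | x y y'.
        x \<in> carrier M \<and> y \<in> carrier N \<and> y' \<in> carrier N} \<union>
     {frag_of (r \<odot>\<^bsub>M\<^esub> x, y) - frag_of (x, r \<odot>\<^bsub>N\<^esub> y) | r x y.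
        r \<in> carrier R \<and> x \<in> carrier M \<and> y \<in> carrier N}"

definition tensor_subgroup ::
  "('a, 'x) ring_scheme \<Rightarrow> ('a, 'm, 'y) module_scheme \<Rightarrow> ('a, 'n, 'z) module_scheme
    \<Rightarrow> ('m \<times> 'n \<Rightarrow>\<^sub>0 int) set" where
  "tensor_subgroup R M N =
     generate (free_Abelian_group (carrier M \<times> carrier N)) (tensor_relators R M N)"

text \<open>Only the underlying abelian group of the tensor product is needed, which in line with
  \<^const>\<open>free_Abelian_group\<close> is written multiplicatively.\<close>

definition tensor_product ::
  "('a, 'x) ring_scheme \<Rightarrow> ('a, 'm, 'y) module_scheme \<Rightarrow> ('a, 'n, 'z) module_scheme
    \<Rightarrow> ('m \<times> 'n \<Rightarrow>\<^sub>0 int) set monoid" where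
  "tensor_product R M N =
     free_Abelian_group (carrier M \<times> carrier N) Mod tensor_subgroup R M N"

text \<open>The map \<open>f \<otimes> 1 : M \<otimes> N \<rightarrow> M' \<otimes> N\<close> (a union of equal cosets).\<close>

definition tensor_map_left ::
  "('a, 'x) ring_scheme \<Rightarrow> ('m \<Rightarrow> 'k) \<Rightarrow> ('a, 'k, 'w) module_scheme \<Rightarrow> ('a, 'n, 'z) module_scheme
    \<Rightarrow> ('m \<times> 'n \<Rightarrow>\<^sub>0 int) set \<Rightarrow> ('k \<times> 'n \<Rightarrow>\<^sub>0 int) set" where
  "tensor_map_left R f M' N C =
     (\<Union>c\<in>C. tensor_subgroup R M' N #>\<^bsub>free_Abelian_group (carrier M' \<times> carrier N)\<^esub>
               frag_extend (\<lambda>(x, y). frag_of (f x, y)) c)"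

text \<open>HOL cannot quantify over modules on all types. Every finitely (even countably) generated
  \<open>A\<close>-module is a quotient of the module of finitely supported sequences in \<open>A\<close>, so it is
  isomorphic to one with carrier in the type \<open>(nat \<Rightarrow> 'a) set\<close>. Since tensor products commute
  with directed unions, injectivity for these modules implies it for all modules.\<close>

definition pure_hom ::
  "('a, 'x) ring_scheme \<Rightarrow> ('b, 'y) ring_scheme \<Rightarrow> ('a \<Rightarrow> 'b) \<Rightarrow> bool" where
  "pure_hom A B \<phi> \<longleftrightarrow> \<phi> \<in> ring_hom A B \<and>
     (\<forall>M :: ('a, (nat \<Rightarrow> 'a) set) module. module A M \<longrightarrow>
        inj_on (tensor_map_left A \<phi> (ring_as_module \<phi> B) M)
               (carrier (tensor_product A (self_module A) M)))"

definition contains_field_of_char :: "('a, 'x) ring_scheme \<Rightarrow> nat \<Rightarrow> bool" where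
  "contains_field_of_char A p \<longleftrightarrow>
     (\<exists>K. subfield K A \<and> group.ord (add_monoid (A\<lparr>carrier := K\<rparr>)) \<one>\<^bsub>A\<^esub> = p)"

definition F_pure :: "('a, 'x) ring_scheme \<Rightarrow> nat \<Rightarrow> bool" where
  "F_pure A p \<longleftrightarrow> p > 0 \<and> contains_field_of_char A p \<and> pure_hom A A (\<lambda>r. r [^]\<^bsub>A\<^esub> p)"


section \<open>The standard free resolution\<close>

text \<open>Every \<open>R\<close>-module \<open>M\<close> has a functorial free resolution \<open>\<dots> \<rightarrow> F\<^sub>1 \<rightarrow> F\<^sub>0 \<rightarrow> M\<close>: \<open>F\<^sub>0\<close> is free on
  the elements of \<open>M\<close>, and \<open>F\<^sub>k\<^sub>+\<^sub>1\<close> is free on all formal linear combinations of basis elements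
  of \<open>F\<^sub>k\<close> that are cycles, i.e. are killed by the previous map. \<open>Gen m\<close> is the basis element
  belonging to \<open>m\<close>; \<open>Syz l\<close> is the one belonging to the combination \<open>l\<close>, which is also its
  boundary. See \<open>res_exact_0\<close>, \<open>res_exact_Suc\<close> and \<open>res_map_chain_map\<close> below. The basis elements of all \<open>F\<^sub>k\<close> thus live in one type.\<close>

datatype (dead 'a, 'm) cell = Gen 'm | Syz "('a \<times> ('a, 'm) cell) list"

primrec gen_of :: "('a, 'm) cell \<Rightarrow> 'm" where
  "gen_of (Gen m) = m"

primrec syz_of :: "('a, 'm) cell \<Rightarrow> ('a \<times> ('a, 'm) cell) list" where
  "syz_of (Syz l) = l"

fun list_vec :: "('a, 'x) ring_scheme \<Rightarrow> ('a \<times> 'b) list \<Rightarrow> 'b \<Rightarrow> 'a" where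
  "list_vec R [] = (\<lambda>_. \<zero>\<^bsub>R\<^esub>)"
| "list_vec R ((r, b) # l) = (list_vec R l)(b := r \<oplus>\<^bsub>R\<^esub> list_vec R l b)"

definition res_aug ::
  "('a, 'x) ring_scheme \<Rightarrow> ('a, 'm, 'y) module_scheme \<Rightarrow> (('a, 'm) cell \<Rightarrow> 'a) \<Rightarrow> 'm" where
  "res_aug R M = lin_extend R M gen_of"

definition res_bd ::
  "('a, 'x) ring_scheme \<Rightarrow> (('a, 'm) cell \<Rightarrow> 'a) \<Rightarrow> ('a, 'm) cell \<Rightarrow> 'a" where
  "res_bd R = lin_extend R (free_module R UNIV) (\<lambda>c. list_vec R (syz_of c))"

fun res_basis ::
  "('a, 'x) ring_scheme \<Rightarrow> ('a, 'm, 'y) module_scheme \<Rightarrow> nat \<Rightarrow> ('a, 'm) cell set" where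
  "res_basis R M 0 = Gen ` carrier M"
| "res_basis R M (Suc k) =
     {Syz l | l. set l \<subseteq> carrier R \<times> res_basis R M k \<and>
        (if k = 0 then res_aug R M (list_vec R l) = \<zero>\<^bsub>M\<^esub>
         else res_bd R (list_vec R l) = (\<lambda>_. \<zero>\<^bsub>R\<^esub>))}"

definition res_module ::
  "('a, 'x) ring_scheme \<Rightarrow> ('a, 'm, 'y) module_scheme \<Rightarrow> nat \<Rightarrow> ('a, ('a, 'm) cell \<Rightarrow> 'a) module" where
  "res_module R M k = free_module R (res_basis R M k)"

text \<open>The chain map between standard resolutions induced by \<open>h : M \<rightarrow> M'\<close>.\<close>

definition res_map ::
  "('a, 'x) ring_scheme \<Rightarrow> ('m \<Rightarrow> 'n) \<Rightarrow> (('a, 'm) cell \<Rightarrow> 'a) \<Rightarrow> ('a, 'n) cell \<Rightarrow> 'a" where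
  "res_map R h = lin_extend R (free_module R UNIV) (\<lambda>c. basis_vec R (map_cell h c))"


section \<open>Ext\<close>

definition Ext_cochains ::
  "('a, 'x) ring_scheme \<Rightarrow> ('a, 'm, 'y) module_scheme \<Rightarrow> ('a, 'n, 'z) module_scheme \<Rightarrow> nat
    \<Rightarrow> ('a, (('a, 'm) cell \<Rightarrow> 'a) \<Rightarrow> 'n) module" where
  "Ext_cochains R M N i = Hom_module R (res_module R M i) N"

definition Ext_diff ::
  "('a, 'x) ring_scheme \<Rightarrow> ('a, 'm, 'y) module_scheme \<Rightarrow> nat
    \<Rightarrow> ((('a, 'm) cell \<Rightarrow> 'a) \<Rightarrow> 'n) \<Rightarrow> (('a, 'm) cell \<Rightarrow> 'a) \<Rightarrow> 'n" where
  "Ext_diff R M i \<phi> = (\<lambda>f\<in>carrier (res_module R M (Suc i)). \<phi> (res_bd R f))"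

definition Ext_cocycles ::
  "('a, 'x) ring_scheme \<Rightarrow> ('a, 'm, 'y) module_scheme \<Rightarrow> ('a, 'n, 'z) module_scheme \<Rightarrow> nat
    \<Rightarrow> ((('a, 'm) cell \<Rightarrow> 'a) \<Rightarrow> 'n) set" where
  "Ext_cocycles R M N i =
     {\<phi> \<in> carrier (Ext_cochains R M N i). Ext_diff R M i \<phi> = \<zero>\<^bsub>Ext_cochains R M N (Suc i)\<^esub>}"

primrec Ext_coboundaries ::
  "('a, 'x) ring_scheme \<Rightarrow> ('a, 'm, 'y) module_scheme \<Rightarrow> ('a, 'n, 'z) module_scheme \<Rightarrow> nat
    \<Rightarrow> ((('a, 'm) cell \<Rightarrow> 'a) \<Rightarrow> 'n) set" where
  "Ext_coboundaries R M N 0 = {\<zero>\<^bsub>Ext_cochains R M N 0\<^esub>}"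
| "Ext_coboundaries R M N (Suc i) = Ext_diff R M i ` carrier (Ext_cochains R M N i)"

definition Ext ::
  "('a, 'x) ring_scheme \<Rightarrow> nat \<Rightarrow> ('a, 'm, 'y) module_scheme \<Rightarrow> ('a, 'n, 'z) module_scheme
    \<Rightarrow> ('a, ((('a, 'm) cell \<Rightarrow> 'a) \<Rightarrow> 'n) set) module" where
  "Ext R i M N =
     quotient_module (Ext_cochains R M N i\<lparr>carrier := Ext_cocycles R M N i\<rparr>) (Ext_coboundaries R M N i)"

text \<open>The map \<open>Ext\<^sup>i(M', N) \<rightarrow> Ext\<^sup>i(M, N)\<close> induced by \<open>h : M \<rightarrow> M'\<close> (a union of equal cosets).\<close>

definition Ext_map ::
  "('a, 'x) ring_scheme \<Rightarrow> nat \<Rightarrow> ('m \<Rightarrow> 'k) \<Rightarrow> ('a, 'm, 'y) module_scheme \<Rightarrow> ('a, 'n, 'z) module_scheme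
    \<Rightarrow> ((('a, 'k) cell \<Rightarrow> 'a) \<Rightarrow> 'n) set \<Rightarrow> ((('a, 'm) cell \<Rightarrow> 'a) \<Rightarrow> 'n) set" where
  "Ext_map R i h M N C =
     (\<Union>\<phi>\<in>C. Ext_coboundaries R M N i +>\<^bsub>Ext_cochains R M N i\<^esub>
               (\<lambda>f\<in>carrier (res_module R M i). \<phi> (res_map R h f)))"


section \<open>Direct limits and local cohomology\<close>

text \<open>Direct limit of a sequence of modules \<open>M t\<close> with maps \<open>f t : M t \<rightarrow> M (Suc t)\<close>.\<close>

primrec seq_map :: "(nat \<Rightarrow> 'm \<Rightarrow> 'm) \<Rightarrow> nat \<Rightarrow> nat \<Rightarrow> 'm \<Rightarrow> 'm" where
  "seq_map f t 0 = (\<lambda>x. x)"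
| "seq_map f t (Suc k) = (\<lambda>x. f (t + k) (seq_map f t k x))"

definition dirlim_rel ::
  "(nat \<Rightarrow> ('a, 'm, 'y) module_scheme) \<Rightarrow> (nat \<Rightarrow> 'm \<Rightarrow> 'm) \<Rightarrow> ((nat \<times> 'm) \<times> (nat \<times> 'm)) set" where
  "dirlim_rel M f = {((s, x), (t, y)). x \<in> carrier (M s) \<and> y \<in> carrier (M t) \<and>
     (\<exists>j k. s + j = t + k \<and> seq_map f s j x = seq_map f t k y)}"

definition dirlim ::
  "(nat \<Rightarrow> ('a, 'm, 'y) module_scheme) \<Rightarrow> (nat \<Rightarrow> 'm \<Rightarrow> 'm) \<Rightarrow> ('a, (nat \<times> 'm) set) module" where
  "dirlim M f =
    \<lparr>carrier = (SIGMA t:UNIV. carrier (M t)) // dirlim_rel M f, monoid.mult = undefined, one = undefined,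
     zero = dirlim_rel M f `` {(0, \<zero>\<^bsub>M 0\<^esub>)},
     add = (\<lambda>U V. \<Union>(s, x)\<in>U. \<Union>(t, y)\<in>V.
              dirlim_rel M f `` {(s + t, seq_map f s t x \<oplus>\<^bsub>M (s + t)\<^esub> seq_map f t s y)}),
     smult = (\<lambda>r U. \<Union>(t, x)\<in>U. dirlim_rel M f `` {(t, r \<odot>\<^bsub>M t\<^esub> x)})\<rparr>"

definition dirlim_incl ::
  "(nat \<Rightarrow> ('a, 'm, 'y) module_scheme) \<Rightarrow> (nat \<Rightarrow> 'm \<Rightarrow> 'm) \<Rightarrow> nat \<Rightarrow> 'm \<Rightarrow> (nat \<times> 'm) set" where
  "dirlim_incl M f t x = dirlim_rel M f `` {(t, x)}"

text \<open>A decreasing chain of ideals cofinal with the chain of powers of \<open>I\<close>.\<close>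

definition cofinal_chain :: "('a, 'x) ring_scheme \<Rightarrow> 'a set \<Rightarrow> (nat \<Rightarrow> 'a set) \<Rightarrow> bool" where
  "cofinal_chain R I J \<longleftrightarrow> (\<forall>t. ideal (J t) R \<and> J (Suc t) \<subseteq> J t) \<and>
     (\<forall>n::nat. \<exists>t. J t \<subseteq> I [^]\<^bsub>ideals_set R\<^esub> n) \<and> (\<forall>t. \<exists>n::nat. I [^]\<^bsub>ideals_set R\<^esub> n \<subseteq> J t)"

definition Ext_system ::
  "('a, 'x) ring_scheme \<Rightarrow> (nat \<Rightarrow> 'a set) \<Rightarrow> nat \<Rightarrow> nat
    \<Rightarrow> ('a, ((('a, 'a set) cell \<Rightarrow> 'a) \<Rightarrow> 'a) set) module" where
  "Ext_system R J i t = Ext R i (cyclic_module R (J t)) (self_module R)"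

text \<open>Induced by the natural surjection \<open>R/J\<^sub>t\<^sub>+\<^sub>1 \<rightarrow> R/J\<^sub>t\<close>, \<open>C \<mapsto> J\<^sub>t + C\<close>.\<close>

definition Ext_transition ::
  "('a, 'x) ring_scheme \<Rightarrow> (nat \<Rightarrow> 'a set) \<Rightarrow> nat \<Rightarrow> nat
    \<Rightarrow> ((('a, 'a set) cell \<Rightarrow> 'a) \<Rightarrow> 'a) set \<Rightarrow> ((('a, 'a set) cell \<Rightarrow> 'a) \<Rightarrow> 'a) set" where
  "Ext_transition R J i t =
     Ext_map R i (\<lambda>C. J t <+>\<^bsub>R\<^esub> C) (cyclic_module R (J (Suc t))) (self_module R)"

text \<open>The \<open>i\<close>-th local cohomology module of \<open>R\<close> supported in \<open>I\<close>, computed with a chain \<open>J\<close>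
  such that \<open>cofinal_chain R I J\<close>; for the Frobenius powers of \<open>I\<close> see
  \<open>frobenius_power_cofinal\<close> below.\<close>

definition local_cohomology ::
  "('a, 'x) ring_scheme \<Rightarrow> (nat \<Rightarrow> 'a set) \<Rightarrow> nat
    \<Rightarrow> ('a, (nat \<times> ((('a, 'a set) cell \<Rightarrow> 'a) \<Rightarrow> 'a) set) set) module" where
  "local_cohomology R J i = dirlim (Ext_system R J i) (Ext_transition R J i)"

definition local_cohomology_map ::
  "('a, 'x) ring_scheme \<Rightarrow> (nat \<Rightarrow> 'a set) \<Rightarrow> nat \<Rightarrow> nat
    \<Rightarrow> ((('a, 'a set) cell \<Rightarrow> 'a) \<Rightarrow> 'a) set \<Rightarrow> (nat \<times> ((('a, 'a set) cell \<Rightarrow> 'a) \<Rightarrow> 'a) set) set" where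
  "local_cohomology_map R J i t = dirlim_incl (Ext_system R J i) (Ext_transition R J i) t"

definition frobenius_power :: "('a, 'x) ring_scheme \<Rightarrow> 'a set \<Rightarrow> nat \<Rightarrow> 'a set" where
  "frobenius_power R I q = Idl\<^bsub>R\<^esub> ((\<lambda>x. x [^]\<^bsub>R\<^esub> q) ` I)"


section \<open>The standard resolution is exact and functorial\<close>

lemma (in cring) free_module_module:
  fixes B :: "'i set"
  shows "module R (free_module R B)"
proof (rule moduleI)
  show "cring R" by (rule is_cring)
  have sub: "{b. f b \<oplus> g b \<noteq> \<zero>} \<subseteq> {b. f b \<noteq> \<zero>} \<union> {b. g b \<noteq> \<zero>}" for f g :: "'i \<Rightarrow> 'a"
    by auto
  show "abelian_group (free_module R B)"
  proof (rule abelian_groupI)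
    fix x y assume "x \<in> carrier (free_module R B)" "y \<in> carrier (free_module R B)"
    then show "x \<oplus>\<^bsub>free_module R B\<^esub> y \<in> carrier (free_module R B)"
      using sub[of x y] by (auto simp: free_module_def image_subset_iff intro: finite_subset[OF sub])
  next
    fix x assume x: "x \<in> carrier (free_module R B)"
    then show "\<exists>y\<in>carrier (free_module R B). y \<oplus>\<^bsub>free_module R B\<^esub> x = \<zero>\<^bsub>free_module R B\<^esub>"
      by (intro bexI[of _ "\<lambda>b. \<ominus> x b"]) (auto simp: free_module_def image_subset_iff l_neg)
  qed (auto simp: free_module_def image_subset_iff a_ac fun_eq_iff)
next
  fix a x assume "a \<in> carrier R" "x \<in> carrier (free_module R B)"
  moreover have "{b. a \<otimes> x b \<noteq> \<zero>} \<subseteq> {b. x b \<noteq> \<zero>}" if "a \<in> carrier R" using that by auto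
  ultimately show "a \<odot>\<^bsub>free_module R B\<^esub> x \<in> carrier (free_module R B)"
    by (auto simp: free_module_def image_subset_iff intro: finite_subset)
qed (auto simp: free_module_def image_subset_iff l_distr r_distr m_assoc fun_eq_iff)

lemma (in module) lin_extend_eq:
  assumes "f \<in> carrier (free_module R B)" "h \<in> B \<rightarrow> carrier M"
    "finite A" "{b. f b \<noteq> \<zero>\<^bsub>R\<^esub>} \<subseteq> A" "A \<subseteq> B"
  shows "lin_extend R M h f = (\<Oplus>\<^bsub>M\<^esub>b\<in>A. f b \<odot>\<^bsub>M\<^esub> h b)"
  unfolding lin_extend_def
  proof (intro add.finprod_mono_neutral_cong_left)
  have h: "h b \<in> carrier M" if "b \<in> A" for b using assms that by auto
  have f: "f b \<in> carrier R" for b using assms by (auto simp: free_module_def)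
  show "(\<lambda>b. f b \<odot>\<^bsub>M\<^esub> h b) \<in> A \<rightarrow> carrier M" using h f by auto
  show "f i \<odot>\<^bsub>M\<^esub> h i = \<zero>\<^bsub>M\<^esub>" if "i \<in> A - {b. f b \<noteq> \<zero>\<^bsub>R\<^esub>}" for i using h that by (auto simp: smult_l_null)
qed (use assms in auto)

lemma (in module) lin_extend_closed:
  assumes "f \<in> carrier (free_module R B)" "h \<in> B \<rightarrow> carrier M"
  shows "lin_extend R M h f \<in> carrier M"
  unfolding lin_extend_def
proof (intro finsum_closed funcsetI smult_closed)
  fix b assume "b \<in> {b. f b \<noteq> \<zero>}"
  then have "b \<in> B" using assms by (auto simp: free_module_def)
  then show "h b \<in> carrier M" using assms by auto
qed (use assms in \<open>auto simp: free_module_def\<close>)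

lemma (in module) lin_extend_add:
  assumes f: "f \<in> carrier (free_module R B)" and g: "g \<in> carrier (free_module R B)"
    and h: "h \<in> B \<rightarrow> carrier M"
  shows "lin_extend R M h (f \<oplus>\<^bsub>free_module R B\<^esub> g) = lin_extend R M h f \<oplus>\<^bsub>M\<^esub> lin_extend R M h g"
proof -
  interpret F: module R "free_module R B" by (rule free_module_module)
  define A where "A = {b. f b \<noteq> \<zero>\<^bsub>R\<^esub>} \<union> {b. g b \<noteq> \<zero>\<^bsub>R\<^esub>}"
  have A: "finite A" "A \<subseteq> B" using f g by (auto simp: A_def free_module_def)
  have fg: "f b \<in> carrier R" "g b \<in> carrier R" for b
    using f g by (auto simp: free_module_def)
  have hb: "h b \<in> carrier M" if "b \<in> A" for b using h A that by auto
  have "lin_extend R M h (f \<oplus>\<^bsub>free_module R B\<^esub> g)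
      = (\<Oplus>\<^bsub>M\<^esub>b\<in>A. (f \<oplus>\<^bsub>free_module R B\<^esub> g) b \<odot>\<^bsub>M\<^esub> h b)"
    using f g A h by (intro lin_extend_eq[of _ B]) (auto simp: A_def, auto simp: free_module_def)
  also have "\<dots> = (\<Oplus>\<^bsub>M\<^esub>b\<in>A. f b \<odot>\<^bsub>M\<^esub> h b \<oplus>\<^bsub>M\<^esub> g b \<odot>\<^bsub>M\<^esub> h b)"
    by (intro finsum_cong') (auto simp: free_module_def smult_l_distr fg hb)
  also have "\<dots> = (\<Oplus>\<^bsub>M\<^esub>b\<in>A. f b \<odot>\<^bsub>M\<^esub> h b) \<oplus>\<^bsub>M\<^esub> (\<Oplus>\<^bsub>M\<^esub>b\<in>A. g b \<odot>\<^bsub>M\<^esub> h b)"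
    using fg hb by (intro finsum_addf) auto
  also have "\<dots> = lin_extend R M h f \<oplus>\<^bsub>M\<^esub> lin_extend R M h g"
    using lin_extend_eq[OF f h A(1) _ A(2)] lin_extend_eq[OF g h A(1) _ A(2)] by (auto simp: A_def)
  finally show ?thesis .
qed

lemma (in module) lin_extend_smult:
  assumes f: "f \<in> carrier (free_module R B)" and r: "r \<in> carrier R"
    and h: "h \<in> B \<rightarrow> carrier M"
  shows "lin_extend R M h (r \<odot>\<^bsub>free_module R B\<^esub> f) = r \<odot>\<^bsub>M\<^esub> lin_extend R M h f"
proof -
  interpret F: module R "free_module R B" by (rule free_module_module)
  define A where "A = {b. f b \<noteq> \<zero>\<^bsub>R\<^esub>}"
  have A: "finite A" "A \<subseteq> B" using f by (auto simp: A_def free_module_def)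
  have fg: "f b \<in> carrier R" for b
    using f by (auto simp: free_module_def)
  have hb: "h b \<in> carrier M" if "b \<in> A" for b using h A that by auto
  have "lin_extend R M h (r \<odot>\<^bsub>free_module R B\<^esub> f)
      = (\<Oplus>\<^bsub>M\<^esub>b\<in>A. (r \<odot>\<^bsub>free_module R B\<^esub> f) b \<odot>\<^bsub>M\<^esub> h b)"
    using f r A h by (intro lin_extend_eq[of _ B]) (auto simp: A_def, auto simp: free_module_def)
  also have "\<dots> = (\<Oplus>\<^bsub>M\<^esub>b\<in>A. r \<odot>\<^bsub>M\<^esub> (f b \<odot>\<^bsub>M\<^esub> h b))"
    using r by (intro finsum_cong') (auto simp: free_module_def smult_assoc1 fg hb)
  also have "\<dots> = r \<odot>\<^bsub>M\<^esub> (\<Oplus>\<^bsub>M\<^esub>b\<in>A. f b \<odot>\<^bsub>M\<^esub> h b)"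
    using r fg hb A by (intro finsum_smult_ldistr[symmetric]) auto
  also have "\<dots> = r \<odot>\<^bsub>M\<^esub> lin_extend R M h f"
    using lin_extend_eq[OF f h A(1) _ A(2)] by (auto simp: A_def)
  finally show ?thesis .
qed

lemma (in module) lin_extend_basis_vec:
  assumes "b \<in> B" "h \<in> B \<rightarrow> carrier M"
  shows "lin_extend R M h (basis_vec R b) = h b"
proof -
  have *: "basis_vec R b \<in> carrier (free_module R B)"
    using assms by (auto simp: basis_vec_def free_module_def)
  have "h b \<in> carrier M" using assms by auto
  then have "lin_extend R M h (basis_vec R b) = (\<Oplus>\<^bsub>M\<^esub>c\<in>{b}. basis_vec R b c \<odot>\<^bsub>M\<^esub> h c)"
    using assms by (intro lin_extend_eq[OF * assms(2)]) (auto simp: basis_vec_def)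
  also have "\<dots> = basis_vec R b b \<odot>\<^bsub>M\<^esub> h b"
    using assms by (subst finsum_insert) (auto simp: basis_vec_def Pi_iff)
  finally show ?thesis using \<open>h b \<in> carrier M\<close> by (auto simp: basis_vec_def)
qed

lemma (in cring) basis_vec_closed:
  "b \<in> B \<Longrightarrow> basis_vec R b \<in> carrier (free_module R B)"
  by (auto simp: basis_vec_def free_module_def)

lemma (in cring) list_vec_Cons:
  assumes "r \<in> carrier R" "list_vec R l \<in> carrier (free_module R UNIV)"
  shows "list_vec R ((r, b) # l) =
    (r \<odot>\<^bsub>free_module R UNIV\<^esub> basis_vec R b) \<oplus>\<^bsub>free_module R UNIV\<^esub> list_vec R l"
  using assms by (auto simp: free_module_def basis_vec_def fun_eq_iff image_subset_iff)

lemma (in cring) list_vec_closed: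
  assumes "set l \<subseteq> carrier R \<times> B"
  shows "list_vec R l \<in> carrier (free_module R B)"
  using assms
proof (induction l)
  case Nil
  then show ?case by (auto simp: free_module_def)
next
  case (Cons a l)
  obtain r b where a: "a = (r, b)" by force
  have IH: "list_vec R l \<in> carrier (free_module R B)" using Cons by auto
  have "{c. ((list_vec R l)(b := r \<oplus> list_vec R l b)) c \<noteq> \<zero>} \<subseteq> insert b {c. list_vec R l c \<noteq> \<zero>}"
    by auto
  moreover have "finite (insert b {c. list_vec R l c \<noteq> \<zero>})" using IH by (auto simp: free_module_def)
  ultimately have "finite {c. ((list_vec R l)(b := r \<oplus> list_vec R l b)) c \<noteq> \<zero>}" by (rule finite_subset)
  then show ?case using IH Cons.prems unfolding a
    by (auto simp: free_module_def image_subset_iff simp del: fun_upd_apply) (auto split: if_splits)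
qed

lemma (in cring) ex_list_vec:
  assumes "f \<in> carrier (free_module R B)"
  shows "\<exists>l. set l \<subseteq> carrier R \<times> B \<and> list_vec R l = f"
proof -
  have fin: "finite {b. f b \<noteq> \<zero>}" using assms by (auto simp: free_module_def)
  obtain bs where bs: "set bs = {b. f b \<noteq> \<zero>}" "distinct bs"
    using finite_distinct_list[OF fin] by blast
  have fc: "f b \<in> carrier R" for b using assms by (auto simp: free_module_def)
  have "list_vec R (map (\<lambda>b. (f b, b)) bs) = (\<lambda>b. if b \<in> set bs then f b else \<zero>)"
    using bs(2) by (induction bs) (auto simp: fun_eq_iff fc)
  also have "\<dots> = f" using bs by auto
  finally show ?thesis
    using assms bs by (intro exI[of _ "map (\<lambda>b. (f b, b)) bs"]) (auto simp: free_module_def fc)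
qed

lemma free_module_mono:
  "f \<in> carrier (free_module R B) \<Longrightarrow> B \<subseteq> C \<Longrightarrow> f \<in> carrier (free_module R C)"
  by (auto simp: free_module_def)

lemma (in cring) lin_extend_free:
  fixes B :: "'j set" and C :: "'i set"
  assumes "f \<in> carrier (free_module R B)" "h \<in> B \<rightarrow> carrier (free_module R C)"
  shows "lin_extend R (free_module R UNIV) h f = lin_extend R (free_module R C) h f"
    and "lin_extend R (free_module R UNIV) h f \<in> carrier (free_module R C)"
proof -
  interpret C: module R "free_module R C" by (rule free_module_module)
  interpret U: module R "free_module R UNIV" by (rule free_module_module)
  have fc: "finite {b. f b \<noteq> \<zero>}" "{b. f b \<noteq> \<zero>} \<subseteq> B" "f b \<in> carrier R" for b
    using assms by (auto simp: free_module_def)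
  have eq: "finsum (free_module R UNIV) g A = finsum (free_module R C) g A"
    if "finite A" "g \<in> A \<rightarrow> carrier (free_module R C)" for g and A :: "'j set"
    using that
  proof (induction A rule: finite_induct)
    case empty
    then show ?case by (simp add: U.finsum_empty C.finsum_empty) (simp add: free_module_def)
  next
    case (insert x F)
    have "g \<in> F \<rightarrow> carrier (free_module R UNIV)" "g x \<in> carrier (free_module R UNIV)"
      "g \<in> F \<rightarrow> carrier (free_module R C)" "g x \<in> carrier (free_module R C)"
      using insert.prems by (auto intro!: free_module_mono[of _ R C UNIV] simp: Pi_iff)
    then show ?case using insert
      by (simp add: U.finsum_insert C.finsum_insert) (simp add: free_module_def)
  qed
  have "(\<lambda>b. f b \<odot>\<^bsub>free_module R C\<^esub> h b) \<in> {b. f b \<noteq> \<zero>} \<rightarrow> carrier (free_module R C)"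
    using assms(2) fc by (intro funcsetI C.smult_closed) auto
  from eq[OF fc(1) this] show *: "lin_extend R (free_module R UNIV) h f = lin_extend R (free_module R C) h f"
    by (simp add: lin_extend_def) (simp add: free_module_def)
  show "lin_extend R (free_module R UNIV) h f \<in> carrier (free_module R C)"
    unfolding * using assms by (rule C.lin_extend_closed)
qed

lemma (in cring) res_basis_Suc:
  "c \<in> res_basis R M (Suc k) \<Longrightarrow> list_vec R (syz_of c) \<in> carrier (res_module R M k)"
  by (auto simp: res_module_def intro!: list_vec_closed split: if_splits)

lemma (in cring) res_bd_closed:
  assumes "f \<in> carrier (res_module R M (Suc k))"
  shows "res_bd R f \<in> carrier (res_module R M k)"
  using lin_extend_free(2)[of f "res_basis R M (Suc k)" "\<lambda>c. list_vec R (syz_of c)" "res_basis R M k"]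
    res_basis_Suc[of _ M k] assms unfolding res_module_def res_bd_def by blast

lemma (in cring) res_bd_basis:
  assumes "c \<in> res_basis R M (Suc k)"
  shows "res_bd R (basis_vec R c) = list_vec R (syz_of c)"
proof -
  interpret U: module R "free_module R UNIV" by (rule free_module_module)
  have "list_vec R (syz_of c) \<in> carrier (free_module R UNIV)"
    using res_basis_Suc[OF assms] free_module_mono unfolding res_module_def by blast
  then show ?thesis unfolding res_bd_def
    using res_basis_Suc[of _ M k] free_module_mono unfolding res_module_def
    by (intro U.lin_extend_basis_vec[OF assms]) blast
qed

lemma (in cring) lin_ext_zero_on_basis:
  assumes M: "module R M" and f: "f \<in> carrier (free_module R B)"
    and D: "D \<in> mod_hom R (free_module R B) M" and z: "\<And>b. b \<in> B \<Longrightarrow> D (basis_vec R b) = \<zero>\<^bsub>M\<^esub>"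
  shows "D f = \<zero>\<^bsub>M\<^esub>"
proof -
  interpret M: module R M by fact
  interpret F: module R "free_module R B" by (rule free_module_module)
  have Dz: "D (\<lambda>_. \<zero>) = \<zero>\<^bsub>M\<^esub>"
  proof -
    have z0: "\<zero>\<^bsub>free_module R B\<^esub> = (\<lambda>_. \<zero>)" by (simp add: free_module_def)
    have "D (\<zero> \<odot>\<^bsub>free_module R B\<^esub> \<zero>\<^bsub>free_module R B\<^esub>) = \<zero> \<odot>\<^bsub>M\<^esub> D \<zero>\<^bsub>free_module R B\<^esub>"
      using D F.zero_closed by (simp only: mod_hom_def) blast
    moreover have "D \<zero>\<^bsub>free_module R B\<^esub> \<in> carrier M"
      using D F.zero_closed by (simp only: mod_hom_def) blast
    ultimately show ?thesis by (simp add: z0[symmetric] M.smult_l_null F.smult_r_null)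
  qed
  have "D (list_vec R l) = \<zero>\<^bsub>M\<^esub>" if "set l \<subseteq> carrier R \<times> B" for l
    using that
  proof (induction l)
    case Nil
    then show ?case using Dz by simp
  next
    case (Cons a l)
    obtain r b where a: "a = (r, b)" by force
    have rb: "r \<in> carrier R" "b \<in> B" using Cons a by auto
    have c: "list_vec R l \<in> carrier (free_module R B)" using Cons by (intro list_vec_closed) auto
    have "list_vec R (a # l) =
      (r \<odot>\<^bsub>free_module R B\<^esub> basis_vec R b) \<oplus>\<^bsub>free_module R B\<^esub> list_vec R l"
      using list_vec_Cons[OF rb(1) free_module_mono[OF c subset_UNIV], of b]
      unfolding a by (simp add: free_module_def)
    moreover have "D \<dots> = D (r \<odot>\<^bsub>free_module R B\<^esub> basis_vec R b) \<oplus>\<^bsub>M\<^esub> D (list_vec R l)"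
      using D rb c basis_vec_closed[OF rb(2)] F.smult_closed unfolding mod_hom_def by blast
    moreover have "D (r \<odot>\<^bsub>free_module R B\<^esub> basis_vec R b) = r \<odot>\<^bsub>M\<^esub> D (basis_vec R b)"
      using D rb c basis_vec_closed[OF rb(2)] unfolding mod_hom_def by blast
    ultimately show ?case using Cons z rb by (simp add: M.smult_r_null)
  qed
  then show ?thesis using ex_list_vec[OF f] by auto
qed

lemma (in module) lin_extend_hom:
  "h \<in> B \<rightarrow> carrier M \<Longrightarrow> lin_extend R M h \<in> mod_hom R (free_module R B) M"
  by (auto simp: mod_hom_def lin_extend_closed lin_extend_add lin_extend_smult)

lemma (in cring) res_bd_hom:
  "res_bd R \<in> mod_hom R (res_module R M (Suc k)) (res_module R M k)"
proof -
  interpret U: module R "free_module R UNIV" by (rule free_module_module)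
  have "(\<lambda>c. list_vec R (syz_of c)) \<in> res_basis R M (Suc k) \<rightarrow> carrier (free_module R UNIV)"
    using res_basis_Suc[of _ M k] free_module_mono unfolding res_module_def by blast
  from U.lin_extend_hom[OF this] have "res_bd R \<in> mod_hom R (res_module R M (Suc k)) (free_module R UNIV)"
    by (simp add: res_bd_def res_module_def)
  then show ?thesis using res_bd_closed[of _ M k]
    unfolding mod_hom_def by (auto simp: res_module_def, auto simp: free_module_def)
qed

lemma (in module) res_aug_hom: "res_aug R M \<in> mod_hom R (res_module R M 0) M"
  unfolding res_aug_def res_module_def by (rule lin_extend_hom) auto

lemma mod_hom_comp: "f \<in> mod_hom R A B \<Longrightarrow> g \<in> mod_hom R B C \<Longrightarrow> (\<lambda>x. g (f x)) \<in> mod_hom R A C"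
  by (auto simp: mod_hom_def Pi_iff)

theorem (in module) res_exact_0:
  shows "res_aug R M ` carrier (res_module R M 0) = carrier M"
    and "res_bd R ` carrier (res_module R M 1) =
      {f \<in> carrier (res_module R M 0). res_aug R M f = \<zero>\<^bsub>M\<^esub>}"
proof -
  show "res_aug R M ` carrier (res_module R M 0) = carrier M"
  proof (intro equalityI subsetI)
    fix m assume m: "m \<in> carrier M"
    have "res_aug R M (basis_vec R (Gen m)) = m"
      unfolding res_aug_def using m by (subst lin_extend_basis_vec[where B="Gen ` carrier M"]) auto
    then show "m \<in> res_aug R M ` carrier (res_module R M 0)"
      using m basis_vec_closed[of "Gen m" "Gen ` carrier M"] unfolding res_module_def
      by (intro image_eqI[of _ _ "basis_vec R (Gen m)"]) auto
  qed (use res_aug_hom in \<open>auto simp: mod_hom_def\<close>)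
  have "res_aug R M (res_bd R f) = \<zero>\<^bsub>M\<^esub>" if f: "f \<in> carrier (res_module R M 1)" for f
    using f unfolding res_module_def
  proof (rule lin_ext_zero_on_basis[OF module_axioms])
    show "(\<lambda>f. res_aug R M (res_bd R f)) \<in> mod_hom R (free_module R (res_basis R M 1)) M"
      using mod_hom_comp[OF res_bd_hom res_aug_hom] by (simp add: res_module_def)
    fix b assume "b \<in> res_basis R M 1"
    then show "res_aug R M (res_bd R (basis_vec R b)) = \<zero>\<^bsub>M\<^esub>"
      using res_bd_basis[of b M 0] by auto
  qed
  moreover have "f \<in> res_bd R ` carrier (res_module R M 1)"
    if f: "f \<in> carrier (res_module R M 0)" "res_aug R M f = \<zero>\<^bsub>M\<^esub>" for f
  proof -
    obtain l where l: "set l \<subseteq> carrier R \<times> res_basis R M 0" "list_vec R l = f"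
      using ex_list_vec f unfolding res_module_def by blast
    then have b: "Syz l \<in> res_basis R M (Suc 0)" using f by simp
    show ?thesis
      using res_bd_basis[OF b] l basis_vec_closed[OF b] unfolding res_module_def
      by (intro image_eqI[of _ _ "basis_vec R (Syz l)"]) auto
  qed
  ultimately show "res_bd R ` carrier (res_module R M 1) =
      {f \<in> carrier (res_module R M 0). res_aug R M f = \<zero>\<^bsub>M\<^esub>}"
    using res_bd_closed[of _ M 0] by auto
qed

theorem (in cring) res_exact_Suc:
  "res_bd R ` carrier (res_module R M (Suc (Suc k))) =
      {f \<in> carrier (res_module R M (Suc k)). res_bd R f = (\<lambda>_. \<zero>)}"
proof -
  have z: "\<zero>\<^bsub>res_module R M k\<^esub> = (\<lambda>_. \<zero>)" by (simp add: res_module_def free_module_def)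
  have "res_bd R (res_bd R f) = \<zero>\<^bsub>res_module R M k\<^esub>"
    if f: "f \<in> carrier (res_module R M (Suc (Suc k)))" for f
    using f unfolding res_module_def
  proof (rule lin_ext_zero_on_basis[OF free_module_module])
    show "(\<lambda>f. res_bd R (res_bd R f)) \<in> mod_hom R (free_module R (res_basis R M (Suc (Suc k)))) (free_module R (res_basis R M k))"
      using mod_hom_comp[OF res_bd_hom res_bd_hom] unfolding res_module_def .
    fix b assume "b \<in> res_basis R M (Suc (Suc k))"
    then show "res_bd R (res_bd R (basis_vec R b)) = \<zero>\<^bsub>free_module R (res_basis R M k)\<^esub>"
      using res_bd_basis[of b M "Suc k"] by (auto simp: free_module_def)
  qed
  moreover have "f \<in> res_bd R ` carrier (res_module R M (Suc (Suc k)))"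
    if f: "f \<in> carrier (res_module R M (Suc k))" "res_bd R f = (\<lambda>_. \<zero>)" for f
  proof -
    obtain l where l: "set l \<subseteq> carrier R \<times> res_basis R M (Suc k)" "list_vec R l = f"
      using ex_list_vec f unfolding res_module_def by blast
    then have b: "Syz l \<in> res_basis R M (Suc (Suc k))" using f by simp
    show ?thesis
      using res_bd_basis[OF b] l basis_vec_closed[OF b] unfolding res_module_def
      by (intro image_eqI[of _ _ "basis_vec R (Syz l)"]) auto
  qed
  ultimately show ?thesis
    using res_bd_closed[of _ M "Suc k"] unfolding z by blast
qed


lemma (in cring) res_map_hom_UNIV: "res_map R h \<in> mod_hom R (free_module R UNIV) (free_module R UNIV)"
proof -
  interpret U: module R "free_module R UNIV" by (rule free_module_module)
  show ?thesis unfolding res_map_def by (intro U.lin_extend_hom) (auto intro: basis_vec_closed)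
qed

lemma (in cring) res_map_basis: "res_map R h (basis_vec R c) = basis_vec R (map_cell h c)"
proof -
  interpret U: module R "free_module R UNIV" by (rule free_module_module)
  show ?thesis unfolding res_map_def
    by (rule U.lin_extend_basis_vec[of _ UNIV]) (auto intro: basis_vec_closed)
qed

lemma (in cring) lin_list_vec:
  assumes M: "module R M" and D: "D \<in> mod_hom R (free_module R B) M" "D' \<in> mod_hom R (free_module R B) M"
    and eq: "\<And>b. b \<in> B \<Longrightarrow> D (basis_vec R b) = D' (basis_vec R b)" and f: "f \<in> carrier (free_module R B)"
  shows "D f = D' f"
proof -
  interpret M: module R M by fact
  have "(\<lambda>f. D f \<ominus>\<^bsub>M\<^esub> D' f) \<in> mod_hom R (free_module R B) M"
    using D unfolding mod_hom_def
    by (auto simp: Pi_iff M.minus_eq M.minus_add M.a_ac M.smult_r_distr M.smult_r_minus)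
  moreover have "D (basis_vec R b) \<ominus>\<^bsub>M\<^esub> D' (basis_vec R b) = \<zero>\<^bsub>M\<^esub>" if b: "b \<in> B" for b
  proof -
    have "D' (basis_vec R b) \<in> carrier M" using D basis_vec_closed[OF b] by (auto simp: mod_hom_def)
    then show ?thesis using eq[OF b] by (simp add: M.minus_eq M.r_neg)
  qed
  ultimately have "D f \<ominus>\<^bsub>M\<^esub> D' f = \<zero>\<^bsub>M\<^esub>"
    by (rule lin_ext_zero_on_basis[OF M f])
  moreover have "D f \<in> carrier M" "D' f \<in> carrier M" using D f by (auto simp: mod_hom_def)
  ultimately show ?thesis by (metis M.minus_eq M.minus_equality M.minus_minus M.a_inv_closed)
qed

lemma (in cring) res_map_list_vec:
  assumes "set l \<subseteq> carrier R \<times> UNIV"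
  shows "res_map R h (list_vec R l) = list_vec R (map (map_prod id (map_cell h)) l)"
  using assms
proof (induction l)
  case Nil
  then show ?case
    by (simp add: res_map_def lin_extend_def) (simp add: finsum_def finprod_def free_module_def)
next
  case (Cons a l)
  obtain r b where a: "a = (r, b)" by force
  interpret U: module R "free_module R UNIV" by (rule free_module_module)
  have rb: "r \<in> carrier R" using Cons a by auto
  have c: "list_vec R l \<in> carrier (free_module R UNIV)" using Cons by (intro list_vec_closed) auto
  have c': "list_vec R (map (map_prod id (map_cell h)) l) \<in> carrier (free_module R UNIV)"
    using Cons by (intro list_vec_closed) auto
  have m: "res_map R h (x \<oplus>\<^bsub>free_module R UNIV\<^esub> y) = res_map R h x \<oplus>\<^bsub>free_module R UNIV\<^esub> res_map R h y"
    if "x \<in> carrier (free_module R UNIV)" "y \<in> carrier (free_module R UNIV)" for x y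
    using res_map_hom_UNIV[of h] that by (auto simp: mod_hom_def)
  have m': "res_map R h (r \<odot>\<^bsub>free_module R UNIV\<^esub> y) = r \<odot>\<^bsub>free_module R UNIV\<^esub> res_map R h y"
    if "y \<in> carrier (free_module R UNIV)" for y
    using res_map_hom_UNIV[of h] that rb by (auto simp: mod_hom_def)
  have bc: "basis_vec R b \<in> carrier (free_module R UNIV)" by (rule basis_vec_closed) simp
  have "r \<odot>\<^bsub>free_module R UNIV\<^esub> basis_vec R b \<in> carrier (free_module R UNIV)"
    by (rule module.smult_closed[OF free_module_module rb bc])
  then show ?case
    using Cons m[OF _ c] m'[OF bc] unfolding a
    by (simp add: list_vec_Cons[OF rb c] list_vec_Cons[OF rb c'[unfolded id_def]] res_map_basis del: list_vec.simps)
qed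

theorem (in cring) res_map_chain_map:
  assumes M: "module R M" and M': "module R M'" and h: "h \<in> mod_hom R M M'"
  shows "c \<in> res_basis R M k \<Longrightarrow> map_cell h c \<in> res_basis R M' k"
    and "f \<in> carrier (res_module R M 0) \<Longrightarrow> res_aug R M' (res_map R h f) = h (res_aug R M f)"
    and "f \<in> carrier (res_module R M (Suc k)) \<Longrightarrow> res_bd R (res_map R h f) = res_map R h (res_bd R f)"
proof -
  interpret M: module R M by fact
  interpret M': module R M' by fact
  have hz: "h \<zero>\<^bsub>M\<^esub> = \<zero>\<^bsub>M'\<^esub>"
  proof -
    have zr: "\<zero> \<in> carrier R" by simp
    have "h (\<zero> \<odot>\<^bsub>M\<^esub> \<zero>\<^bsub>M\<^esub>) = \<zero> \<odot>\<^bsub>M'\<^esub> h \<zero>\<^bsub>M\<^esub>" "h \<zero>\<^bsub>M\<^esub> \<in> carrier M'"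
      using h M.zero_closed zr unfolding mod_hom_def by blast+
    then show ?thesis by (simp add: M.smult_r_null M'.smult_l_null)
  qed
  have rm: "res_map R h \<in> mod_hom R (res_module R M k) (res_module R M' k)"
    if *: "\<And>c. c \<in> res_basis R M k \<Longrightarrow> map_cell h c \<in> res_basis R M' k" for k
  proof -
    have "res_map R h f \<in> carrier (free_module R (res_basis R M' k))"
      if "f \<in> carrier (free_module R (res_basis R M k))" for f
      unfolding res_map_def using that * by (intro lin_extend_free(2)) (auto intro: basis_vec_closed)
    then show ?thesis using res_map_hom_UNIV[of h] free_module_mono[OF _ subset_UNIV]
      unfolding mod_hom_def res_module_def by (auto simp: free_module_def image_subset_iff)
  qed
  have aug: "res_aug R M' (res_map R h f) = h (res_aug R M f)" if f: "f \<in> carrier (res_module R M 0)" for f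
    using f unfolding res_module_def
  proof (rule lin_list_vec[OF M', rotated -1])
    have *: "\<And>c. c \<in> res_basis R M 0 \<Longrightarrow> map_cell h c \<in> res_basis R M' 0"
      using h by (auto simp: mod_hom_def)
    show "(\<lambda>f. res_aug R M' (res_map R h f)) \<in> mod_hom R (free_module R (res_basis R M 0)) M'"
      using mod_hom_comp[OF rm[OF *] M'.res_aug_hom] unfolding res_module_def .
    show "(\<lambda>f. h (res_aug R M f)) \<in> mod_hom R (free_module R (res_basis R M 0)) M'"
      using mod_hom_comp[OF M.res_aug_hom h] unfolding res_module_def .
    fix b assume b: "b \<in> res_basis R M 0"
    then obtain m where m: "b = Gen m" "m \<in> carrier M" by auto
    have "res_aug R M (basis_vec R b) = m" unfolding res_aug_def
      by (subst M.lin_extend_basis_vec[OF b]) (auto simp: m)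
    moreover have "res_aug R M' (basis_vec R (map_cell h b)) = h m" unfolding res_aug_def
      by (subst M'.lin_extend_basis_vec[OF *[OF b]]) (auto simp: m)
    ultimately show "res_aug R M' (res_map R h (basis_vec R b)) = h (res_aug R M (basis_vec R b))"
      by (simp add: res_map_basis)
  qed
  have step: "res_bd R (res_map R h f) = res_map R h (res_bd R f)"
    if k: "\<And>c. c \<in> res_basis R M k \<Longrightarrow> map_cell h c \<in> res_basis R M' k"
      "\<And>c. c \<in> res_basis R M (Suc k) \<Longrightarrow> map_cell h c \<in> res_basis R M' (Suc k)"
      and f: "f \<in> carrier (res_module R M (Suc k))" for f k
    using f unfolding res_module_def
  proof (rule lin_list_vec[OF free_module_module, rotated -1])
    show "(\<lambda>f. res_bd R (res_map R h f)) \<in> mod_hom R (free_module R (res_basis R M (Suc k))) (free_module R (res_basis R M' k))"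
      using mod_hom_comp[OF rm[OF k(2)] res_bd_hom] unfolding res_module_def .
    show "(\<lambda>f. res_map R h (res_bd R f)) \<in> mod_hom R (free_module R (res_basis R M (Suc k))) (free_module R (res_basis R M' k))"
      using mod_hom_comp[OF res_bd_hom rm[OF k(1)]] unfolding res_module_def .
    fix b assume b: "b \<in> res_basis R M (Suc k)"
    then obtain l where l: "b = Syz l" "set l \<subseteq> carrier R \<times> res_basis R M k" by (auto split: if_splits)
    have "map_cell h b = Syz (map (map_prod id (map_cell h)) l)" by (simp add: l)
    then show "res_bd R (res_map R h (basis_vec R b)) = res_map R h (res_bd R (basis_vec R b))"
      using res_bd_basis[OF b] res_bd_basis[OF k(2)[OF b]] l
      by (subst res_map_basis) (auto intro!: res_map_list_vec[symmetric])
  qed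
  have basis: "map_cell h c \<in> res_basis R M' k" if "c \<in> res_basis R M k" for c k
    using that
  proof (induction k arbitrary: c rule: less_induct)
    case (less n)
    show ?case
    proof (cases n)
    case 0
    then show ?thesis using less.prems h by (auto simp: mod_hom_def)
  next
    case (Suc k)
    with less.prems obtain l where l: "c = Syz l" "set l \<subseteq> carrier R \<times> res_basis R M k"
      and z: "if k = 0 then res_aug R M (list_vec R l) = \<zero>\<^bsub>M\<^esub> else res_bd R (list_vec R l) = (\<lambda>_. \<zero>)" by auto
    define l' where "l' = map (map_prod id (map_cell h)) l"
    have l': "list_vec R l' = res_map R h (list_vec R l)" unfolding l'_def using l(2)
      by (intro res_map_list_vec[symmetric]) auto
    have fl: "list_vec R l \<in> carrier (res_module R M k)"
      unfolding res_module_def using l(2) by (rule list_vec_closed)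
    have "if k = 0 then res_aug R M' (list_vec R l') = \<zero>\<^bsub>M'\<^esub> else res_bd R (list_vec R l') = (\<lambda>_. \<zero>)"
    proof (cases k)
      case 0
      then show ?thesis using aug fl z hz by (simp add: l')
    next
      case (Suc j)
      have "res_bd R (list_vec R l') = res_map R h (res_bd R (list_vec R l))"
        unfolding l' using Suc \<open>n = Suc k\<close> less.IH fl by (intro step[of j]) (auto simp del: res_basis.simps)
      also have "\<dots> = (\<lambda>_. \<zero>)" using z Suc res_map_list_vec[of "[]" h] by simp
      finally show ?thesis using Suc by simp
    qed
    moreover have "set l' \<subseteq> carrier R \<times> res_basis R M' k" using l(2) less.IH[of k] Suc by (fastforce simp: l'_def)
    ultimately show ?thesis unfolding l(1) Suc by (simp add: l'_def split: if_splits)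
    qed
  qed
  show "c \<in> res_basis R M k \<Longrightarrow> map_cell h c \<in> res_basis R M' k" by (rule basis)
  show "f \<in> carrier (res_module R M 0) \<Longrightarrow> res_aug R M' (res_map R h f) = h (res_aug R M f)" by (rule aug)
  show "f \<in> carrier (res_module R M (Suc k)) \<Longrightarrow> res_bd R (res_map R h f) = res_map R h (res_bd R f)"
    by (rule step) (auto intro: basis simp del: res_basis.simps)
qed


section \<open>Frobenius powers are cofinal with ordinary powers\<close>

lemma ideals_set_simps [simp]:
  "\<one>\<^bsub>ideals_set R\<^esub> = carrier R" "I \<otimes>\<^bsub>ideals_set R\<^esub> K = I \<cdot>\<^bsub>R\<^esub> K"
  by (simp_all add: ideals_set_def)

context cring
begin

lemma ideals_pow_ideal: "ideal I R \<Longrightarrow> ideal (I [^]\<^bsub>ideals_set R\<^esub> (n::nat)) R"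
  by (induction n) (auto simp: oneideal ideal_prod_is_ideal)

lemma ideals_pow_antimono:
  assumes "ideal I R" "m \<le> n"
  shows "I [^]\<^bsub>ideals_set R\<^esub> (n::nat) \<subseteq> I [^]\<^bsub>ideals_set R\<^esub> m"
  using assms(2)
proof (induction rule: dec_induct)
  case (step n)
  have "I [^]\<^bsub>ideals_set R\<^esub> Suc n \<subseteq> I [^]\<^bsub>ideals_set R\<^esub> n"
    using ideal_prod_inter[OF ideals_pow_ideal[OF assms(1)] assms(1)] by auto
  then show ?case using step by blast
qed simp

lemma pow_in_ideals_pow: "ideal I R \<Longrightarrow> x \<in> I \<Longrightarrow> x [^] (n::nat) \<in> I [^]\<^bsub>ideals_set R\<^esub> n"
  by (induction n) (auto intro: ideal_prod.prod)

lemma ideal_prod_subset_iff: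
  assumes "ideal I R" "ideal K R" "ideal J R"
  shows "I \<cdot> K \<subseteq> J \<longleftrightarrow> (\<forall>x\<in>I. \<forall>y\<in>K. x \<otimes> y \<in> J)"
proof
  assume *: "\<forall>x\<in>I. \<forall>y\<in>K. x \<otimes> y \<in> J"
  interpret J: ideal J R by fact
  show "I \<cdot> K \<subseteq> J"
  proof
    fix s assume "s \<in> I \<cdot> K"
    then show "s \<in> J" by induction (use * in auto)
  qed
qed (auto intro: ideal_prod.prod)

lemma ideal_prod_sum_pow_subset:
  assumes "ideal J R" "ideal K R" "ideal L R" "ideal A R"
    "A \<cdot> (K [^]\<^bsub>ideals_set R\<^esub> (m::nat)) \<subseteq> J" "A \<cdot> (L [^]\<^bsub>ideals_set R\<^esub> (n::nat)) \<subseteq> J"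
  shows "A \<cdot> ((K <+> L) [^]\<^bsub>ideals_set R\<^esub> (m + n)) \<subseteq> J"
  using assms(4-)
proof (induction "m + n" arbitrary: m n A rule: less_induct)
  case less
  have KL: "ideal (K <+> L) R" using assms by (intro add_ideals)
  have AX: "A \<cdot> X \<subseteq> A" if "ideal X R" for X using ideal_prod_inter[OF less.prems(1) that] by auto
  note pid = ideals_pow_ideal
  interpret J: ideal J R by fact
  show ?case
  proof (cases "m = 0 \<or> n = 0")
    case True
    then have "A \<subseteq> J" using less.prems ideal_prod_one[OF less.prems(1)] by auto
    then show ?thesis using AX[OF pid[OF KL]] by blast
  next
    case False
    then obtain m' n' where mn: "m = Suc m'" "n = Suc n'" by (meson not0_implies_Suc)
    define P where "P = (K <+> L) [^]\<^bsub>ideals_set R\<^esub> (m' + n)"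
    have P: "ideal P R" unfolding P_def using KL by (rule pid)
    have AK: "ideal (A \<cdot> K) R" "ideal (A \<cdot> L) R" using less.prems(1) assms by (auto intro: ideal_prod_is_ideal)
    have pw: "(X \<cdot> Y) \<cdot> (Y [^]\<^bsub>ideals_set R\<^esub> k) = X \<cdot> (Y [^]\<^bsub>ideals_set R\<^esub> Suc k)"
      if "ideal X R" "ideal Y R" for X Y and k :: nat
      using that pid[OF that(2)] by (simp add: ideal_prod_assoc ideal_prod_commute)
    have sub: "(A \<cdot> Y) \<cdot> X \<subseteq> A \<cdot> X" if "ideal X R" "ideal Y R" for X Y
    proof -
      interpret A: ideal A R by (rule less.prems)
      have "(A \<cdot> Y) \<subseteq> A" by (rule AX[OF that(2)])
      then show ?thesis
        using that less.prems(1)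
        by (subst ideal_prod_subset_iff) (auto intro: ideal_prod_is_ideal ideal_prod.prod)
    qed
    have "(A \<cdot> K) \<cdot> P \<subseteq> J" unfolding P_def
      using less.hyps[of m' n "A \<cdot> K"] mn AK pw[OF less.prems(1) assms(2), of m'] less.prems
        sub[OF pid[OF assms(3)] assms(2), of n] by auto
    moreover have "(A \<cdot> L) \<cdot> P \<subseteq> J"
    proof -
      have "(A \<cdot> L) \<cdot> ((K <+> L) [^]\<^bsub>ideals_set R\<^esub> (m + n')) \<subseteq> J"
        using less.hyps[of m n' "A \<cdot> L"] mn AK pw[OF less.prems(1) assms(3), of n'] less.prems
          sub[OF pid[OF assms(2)] assms(3), of m] by auto
      moreover have "m + n' = m' + n" using mn by simp
      ultimately show ?thesis by (simp add: P_def)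
    qed
    moreover have "A \<cdot> ((K <+> L) [^]\<^bsub>ideals_set R\<^esub> (m + n)) = ((A \<cdot> K) \<cdot> P) <+> ((A \<cdot> L) \<cdot> P)"
    proof -
      have "A \<cdot> ((K <+> L) [^]\<^bsub>ideals_set R\<^esub> (m + n)) = (A \<cdot> (K <+> L)) \<cdot> P"
        using pw[OF less.prems(1) KL, of "m' + n"] by (simp add: mn P_def)
      also have "\<dots> = ((A \<cdot> K) \<cdot> P) <+> ((A \<cdot> L) \<cdot> P)"
        using ideal_prod_distr(1)[OF less.prems(1) assms(2,3)] ideal_prod_distr(2)[OF P AK] by simp
      finally show ?thesis .
    qed
    ultimately show ?thesis by (auto simp: set_add_def' subset_iff)
  qed
qed

lemma Idl_insert:
  assumes "x \<in> carrier R" "S \<subseteq> carrier R"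
  shows "Idl (insert x S) = Idl {x} <+> Idl S"
proof -
  have i: "ideal (Idl {x}) R" "ideal (Idl S) R" using assms by (auto intro: genideal_ideal)
  have "Idl (Idl {x} \<union> Idl S) = Idl {x} <+> Idl S" by (rule union_genideal[OF i])
  moreover have "Idl (Idl {x} \<union> Idl S) = Idl (insert x S)"
  proof (rule equalityI; rule genideal_minimal)
    have c: "insert x S \<subseteq> carrier R" using assms by blast
    have u: "Idl {x} \<union> Idl S \<subseteq> carrier R" using i[THEN ideal.Icarr] by blast
    show c': "ideal (Idl (insert x S)) R" using c by (rule genideal_ideal)
    show "ideal (Idl (Idl {x} \<union> Idl S)) R" using u by (rule genideal_ideal)
    have "insert x S \<subseteq> Idl {x} \<union> Idl S"
      using genideal_self[of "{x}"] genideal_self[of S] assms by blast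
    also have "\<dots> \<subseteq> Idl (Idl {x} \<union> Idl S)" using u by (rule genideal_self)
    finally show "insert x S \<subseteq> Idl (Idl {x} \<union> Idl S)" .
    have "insert x S \<subseteq> Idl (insert x S)" using c by (rule genideal_self)
    then have "Idl {x} \<subseteq> Idl (insert x S)" "Idl S \<subseteq> Idl (insert x S)"
      by (auto intro!: genideal_minimal[OF c'])
    then show "Idl {x} \<union> Idl S \<subseteq> Idl (insert x S)" by blast
  qed
  ultimately show ?thesis by simp
qed

lemma Idl_pow_subset:
  assumes "finite S" "S \<subseteq> carrier R" "ideal J R" "\<And>x. x \<in> S \<Longrightarrow> x [^] (q::nat) \<in> J"
  shows "\<exists>n::nat. (Idl S) [^]\<^bsub>ideals_set R\<^esub> n \<subseteq> J"
  using assms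
proof (induction S rule: finite_induct)
  case empty
  have "Idl {} \<subseteq> J" using empty by (intro genideal_minimal) auto
  then show ?case
    using ideal_prod_inter[OF oneideal genideal_ideal[of "{}"]] by (intro exI[of _ "Suc 0"]) auto
next
  case (insert x S)
  have x: "x \<in> carrier R" using insert by auto
  obtain n :: nat where n: "(Idl S) [^]\<^bsub>ideals_set R\<^esub> n \<subseteq> J" using insert by auto
  interpret J: ideal J R by fact
  have px: "(PIdl x) [^]\<^bsub>ideals_set R\<^esub> (k::nat) \<subseteq> PIdl (x [^] k)" for k
  proof (induction k)
    case 0
    then show ?case by (auto simp: cgenideal_def) (metis r_one)
  next
    case (Suc k)
    have "((PIdl x) [^]\<^bsub>ideals_set R\<^esub> k) \<cdot> (PIdl x) \<subseteq> PIdl (x [^] Suc k)"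
    proof (subst ideal_prod_subset_iff, goal_cases)
      case 4
      show ?case
      proof (intro ballI)
        fix a b assume "a \<in> (PIdl x) [^]\<^bsub>ideals_set R\<^esub> k" "b \<in> PIdl x"
        then obtain c d where cd: "a = c \<otimes> x [^] k" "c \<in> carrier R" "b = d \<otimes> x" "d \<in> carrier R"
          using Suc by (auto simp: cgenideal_def)
        then have "a \<otimes> b = (c \<otimes> d) \<otimes> x [^] Suc k" using x by (simp add: m_ac)
        then show "a \<otimes> b \<in> PIdl (x [^] Suc k)" unfolding cgenideal_def using cd by blast
      qed
    qed (use x in \<open>auto intro: ideals_pow_ideal cgenideal_ideal\<close>)
    then show ?case by simp
  qed
  have "PIdl (x [^] q) \<subseteq> J" using insert by (intro cgenideal_minimal) auto
  then have q: "(Idl {x}) [^]\<^bsub>ideals_set R\<^esub> q \<subseteq> J"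
    using px[of q] cgenideal_eq_genideal[OF x] by auto
  have i: "ideal (Idl {x}) R" "ideal (Idl S) R" using x insert by (auto intro: genideal_ideal)
  have one: "carrier R \<cdot> Y = Y" if "ideal Y R" for Y
    using ideal_prod_one[OF that] ideal_prod_commute[OF oneideal that] by simp
  have "carrier R \<cdot> ((Idl {x} <+> Idl S) [^]\<^bsub>ideals_set R\<^esub> (q + n)) \<subseteq> J"
    using q n one ideals_pow_ideal i
    by (intro ideal_prod_sum_pow_subset[OF insert.prems(2) i oneideal]) auto
  then have "(Idl {x} <+> Idl S) [^]\<^bsub>ideals_set R\<^esub> (q + n) \<subseteq> J"
    using one[OF ideals_pow_ideal[OF add_ideals[OF i]]] by simp
  then show ?case using Idl_insert[OF x, of S] insert by auto
qed

end

lemma frobenius_power_cofinal: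
  assumes "cring R" "noetherian_ring R" "ideal I R" "p \<ge> 2"
  shows "cofinal_chain R I (\<lambda>t. frobenius_power R I (p ^ t))"
proof -
  interpret cring R by fact
  interpret noetherian_ring R by fact
  interpret I: ideal I R by fact
  have pc: "(\<lambda>x. x [^]\<^bsub>R\<^esub> (q::nat)) ` I \<subseteq> carrier R" for q by auto
  have id: "ideal (frobenius_power R I q) R" for q
    unfolding frobenius_power_def by (rule genideal_ideal[OF pc])
  have mem: "x [^]\<^bsub>R\<^esub> q \<in> frobenius_power R I q" if "x \<in> I" for x q
    unfolding frobenius_power_def using genideal_self[OF pc] that by blast
  have "frobenius_power R I (p ^ Suc t) \<subseteq> frobenius_power R I (p ^ t)" for t
    unfolding frobenius_power_def[of R I "p ^ Suc t"]
  proof (intro genideal_minimal id image_subsetI)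
    fix x assume x: "x \<in> I"
    obtain p' where p': "p = Suc p'" using assms by (cases p) auto
    have "x [^]\<^bsub>R\<^esub> p \<in> I" using x by (simp add: p' I.I_l_closed)
    from mem[OF this, of "p ^ t"] show "x [^]\<^bsub>R\<^esub> (p ^ Suc t) \<in> frobenius_power R I (p ^ t)"
      using x by (simp add: nat_pow_pow)
  qed
  moreover have "frobenius_power R I (p ^ n) \<subseteq> I [^]\<^bsub>ideals_set R\<^esub> n" for n :: nat
    unfolding frobenius_power_def
  proof (intro genideal_minimal ideals_pow_ideal I.is_ideal image_subsetI)
    fix x assume x: "x \<in> I"
    have "n \<le> p ^ n" using assms(4) by (simp add: less_imp_le power_gt_expt)
    then show "x [^]\<^bsub>R\<^esub> (p ^ n) \<in> I [^]\<^bsub>ideals_set R\<^esub> n"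
      using pow_in_ideals_pow[OF I.is_ideal x, of "p ^ n"] ideals_pow_antimono[OF I.is_ideal] by blast
  qed
  moreover have "\<exists>n::nat. I [^]\<^bsub>ideals_set R\<^esub> n \<subseteq> frobenius_power R I (p ^ t)" for t
  proof -
    obtain S where S: "finite S" "S \<subseteq> carrier R" "I = Idl\<^bsub>R\<^esub> S"
      using finetely_gen[OF I.is_ideal] by auto
    have "x [^]\<^bsub>R\<^esub> (p ^ t) \<in> frobenius_power R I (p ^ t)" if "x \<in> S" for x
      using mem[of x "p ^ t"] genideal_self[OF S(2)] that S(3) by auto
    from Idl_pow_subset[OF S(1,2) id this] show ?thesis by (simp add: S(3))
  qed
  ultimately show ?thesis unfolding cofinal_chain_def using id by blast
qed

end

theory Submission
 imports Defs "HOL-Computational_Algebra.Primes"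
begin

text \<open>Let \<open>F\<close> denote base change along Frobenius, which is flat because \<open>R\<close> is regular. Let \<open>P\<close> be a
 resolution of \<open>R/a\<close> by finite free modules; then \<open>F^e(P)\<close> resolves \<open>R/a^[q]\<close> for \<open>q = p^e\<close>, and a lift
 \<open>B\<close> from \<open>F(P)\<close> to \<open>P\<close> of the surjection from \<open>R/a^[p]\<close> to \<open>R/a\<close> induces the first transition map.
 Let \<open>z\<close> be a cocycle such that \<open>z B\<close> is a coboundary. The kernels of the maps from the cohomology of
 \<open>Hom(P, R)\<close> to that of \<open>Hom(F^e(P), R)\<close> increase with \<open>e\<close>, so two consecutive ones agree, say those
 for \<open>e\<close> and \<open>e + 1\<close>. An element \<open>c\<close> of \<open>(a^[q] : a)\<close> lifts to a chain map \<open>C\<close> from \<open>P\<close> to \<open>F^e(P)\<close>; the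
 class of \<open>F^e(z) C\<close> lies in the larger kernel, hence in the smaller one, so \<open>c F^e(z)\<close> is a coboundary
 and flatness gives \<open>c \<in> (Ann z)^[q]\<close>, where \<open>Ann z\<close> is the annihilator of the class of \<open>z\<close>. By Fedder's
 criterion, for every maximal ideal \<open>m\<close> there is such a \<open>c\<close> outside \<open>m^[q]\<close>; hence \<open>Ann z = R\<close>. Flatness
 then gives the later transition maps. Flatness itself and Fedder's criterion are reduced to regular
 local rings, where lengths can be counted along the powers of a regular system of parameters.\<close>

section \<open>Ideals in Noetherian rings\<close>

text \<open>Ext is computed from a resolution whose terms are free on very large sets, where an
  ascending chain of kernels need not stop. In a resolution by finite free modules a cochain of
  degree \<open>k\<close> is a vector of length \<open>n k\<close>; the kernels become submodules of
  a Noetherian module, and base change along Frobenius only raises matrix entries to the power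
  \<open>q\<close>. Flatness is therefore wanted in equational form (\<open>flat_system\<close>): a
  solution of the system with \<open>q\<close>-th powers as coefficients is a combination of
  \<open>q\<close>-th powers of solutions of the original system. It follows from the one identity
  (I^[q] : y^q) = (I : y)^[q], which holds in a regular local ring of dimension d because R/m^[q]
  has length exactly q^d. Lengths are counted by chains of ideals of R itself, so that no quotient
  ring is formed. Purity is likewise turned into a statement on linear systems modulo an ideal
  (\<open>lin_pure\<close>), which localizes and iterates by clearing denominators and substituting.
  The exponent \<open>e\<close> is fixed by the stabilization of kernels before Fedder's criterion
  is asked for \<open>c\<close> outside m^[p^e]; hence the criterion is needed for every
  \<open>e\<close>.\<close>

abbreviation (in ring) "CR \<equiv> carrier R"

abbreviation (in cring) "pows n X \<equiv> (%x. x [^] (n::nat)) ` X"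

abbreviation (in cring) "FP \<equiv> frobenius_power R"

abbreviation (in cring) "bv \<equiv> basis_vec R"

abbreviation (in cring) "FM \<equiv> free_module R"

abbreviation (in cring) "SM \<equiv> self_module R"

definition adj :: "('a, 'x) ring_scheme => 'a set => 'a => 'a set" where
 "adj R I x = {i \<oplus>\<^bsub>R\<^esub> r \<otimes>\<^bsub>R\<^esub> x | i r. i \<in> I \<and> r \<in> carrier R}"

definition colon :: "('a, 'x) ring_scheme => 'a set => 'a set => 'a set" where
 "colon R I A = {r \<in> carrier R. \<forall>a\<in>A. r \<otimes>\<^bsub>R\<^esub> a \<in> I}"

text \<open>Multiplication by \<open>x\<close> sends \<open>D\<close> into R/I; this is the preimage
  in R of the image. Chains of ideals above (I : x) are carried to chains above I in this
  form.\<close>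

definition sadj :: "('a, 'x) ring_scheme => 'a set => 'a set => 'a => 'a set" where
 "sadj R I D x = {i \<oplus>\<^bsub>R\<^esub> r \<otimes>\<^bsub>R\<^esub> x | i r. i \<in> I \<and> r \<in> D}"

definition isum :: "('a, 'x) ring_scheme => 'a set => 'a set => 'a set" where
 "isum R I D = {i \<oplus>\<^bsub>R\<^esub> d | i d. i \<in> I \<and> d \<in> D}"

context cring
begin

lemma ideal_intro:
 assumes "I \<subseteq> CR" "\<zero> \<in> I" "!!x y. x \<in> I ==> y \<in> I ==> x \<oplus> y \<in> I"
  "!!r x. r \<in> CR ==> x \<in> I ==> r \<otimes> x \<in> I"
 shows "ideal I R"
proof (rule idealI[OF ring_axioms])
 show "subgroup I (add_monoid R)"
 proof
  fix x assume x: "x \<in> I"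
  then have "\<ominus> x = (\<ominus> \<one>) \<otimes> x" using assms(1) by (auto simp: l_minus)
  then show "inv\<^bsub>add_monoid R\<^esub> x \<in> I" using assms(4)[of "\<ominus> \<one>" x] x by (simp add: a_inv_def)
 qed (use assms in auto)
 show "a \<in> I ==> x \<in> CR ==> x \<otimes> a \<in> I" for a x using assms(4) .
 show "a \<in> I ==> x \<in> CR ==> a \<otimes> x \<in> I" for a x
  using assms(1) assms(4)[of x a] by (simp add: m_comm subset_iff)
qed

lemma idealD:
 assumes "ideal I R"
 shows "I \<subseteq> CR" "\<zero> \<in> I" "!!x y. x \<in> I ==> y \<in> I ==> x \<oplus> y \<in> I"
  "!!r x. r \<in> CR ==> x \<in> I ==> r \<otimes> x \<in> I" "!!r x. r \<in> CR ==> x \<in> I ==> x \<otimes> r \<in> I"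
  "!!x y. x \<in> I ==> y \<in> I ==> x \<ominus> y \<in> I" "!!x. x \<in> I ==> \<ominus> x \<in> I"
  "!!x. x \<in> I ==> x \<in> CR"
proof -
 interpret I: ideal I R by fact
 show "I \<subseteq> CR" by (rule I.a_subset)
 show "!!x y. x \<in> I ==> y \<in> I ==> x \<ominus> y \<in> I" unfolding a_minus_def by blast
qed (use assms in \<open>auto simp: ideal.I_l_closed ideal.I_r_closed additive_subgroup.a_closed ideal_def
  additive_subgroup.zero_closed additive_subgroup.a_inv_closed additive_subgroup.a_Hcarr\<close>)

lemma ideal_minus_cancel:
 assumes "ideal I R" "x \<oplus> y \<in> I" "x \<in> I" "y \<in> CR"
 shows "y \<in> I"
proof -
 have x: "x \<in> CR" using assms idealD by blast
 have "y = (x \<oplus> y) \<ominus> x" using x assms(4) by algebra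
 then show ?thesis using idealD(6)[OF assms(1,2,3)] by simp
qed

lemma ideal_carrier_iff: "ideal I R ==> I = CR \<longleftrightarrow> \<one> \<in> I"
 using idealD(1)[of I] idealD(4)[of I _ \<one>] by auto

lemma adj_I: "i \<in> I ==> r \<in> CR ==> i \<oplus> r \<otimes> x \<in> adj R I x"
 by (auto simp: adj_def)

lemma adjE: "z \<in> adj R I x ==> (!!i r. z = i \<oplus> r \<otimes> x ==> i \<in> I ==> r \<in> CR ==> P) ==> P"
 by (auto simp: adj_def)

lemma diff_eqI: "x = z \<oplus> y ==> z \<in> CR ==> y \<in> CR ==> x \<ominus> y = z"
 by (simp add: a_minus_def a_assoc r_neg)

lemma add_diff_cancel: "z \<in> CR ==> y \<in> CR ==> (z \<ominus> y) \<oplus> y = z"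
 by (simp add: a_minus_def a_assoc l_neg)

lemma adj_ideal [intro]: assumes "ideal I R" "x \<in> CR" shows "ideal (adj R I x) R"
proof (rule ideal_intro)
 note I = idealD[OF assms(1)]
 show "adj R I x \<subseteq> CR" using I assms by (auto simp: adj_def)
 show "\<zero> \<in> adj R I x" using adj_I[OF I(2), of \<zero> x] assms by simp
 fix a b assume "a \<in> adj R I x" "b \<in> adj R I x"
 then obtain i r j s where *: "a = i \<oplus> r \<otimes> x" "b = j \<oplus> s \<otimes> x" "i \<in> I" "j \<in> I" "r \<in> CR" "s \<in> CR"
  by (auto simp: adj_def)
 then have "i \<in> CR" "j \<in> CR" using I by auto
 then have "a \<oplus> b = (i \<oplus> j) \<oplus> (r \<oplus> s) \<otimes> x" unfolding * using * assms(2) by algebra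
 then show "a \<oplus> b \<in> adj R I x" using adj_I[of "i \<oplus> j" I "r \<oplus> s" x] * I by auto
next
 note I = idealD[OF assms(1)]
 fix t a assume "a \<in> adj R I x" and t: "t \<in> CR"
 then obtain i r where *: "a = i \<oplus> r \<otimes> x" "i \<in> I" "r \<in> CR"
  by (auto simp: adj_def)
 then have "i \<in> CR" using I by auto
 then have "t \<otimes> a = t \<otimes> i \<oplus> (t \<otimes> r) \<otimes> x" unfolding * using * assms(2) t by algebra
 then show "t \<otimes> a \<in> adj R I x" using adj_I[of "t \<otimes> i" I "t \<otimes> r" x] * I t by auto
qed

lemma adj_sub: "ideal I R ==> x \<in> CR ==> I \<subseteq> adj R I x"
 using adj_I[of _ I \<zero> x] idealD(8) by fastforce

lemma adj_self: "ideal I R ==> x \<in> CR ==> x \<in> adj R I x"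
 using adj_I[of \<zero> I \<one> x] idealD by fastforce

lemma adj_minimal: "ideal J R ==> I \<subseteq> J ==> x \<in> J ==> adj R I x \<subseteq> J"
 using idealD(3,4)[of J] by (fastforce simp: adj_def)

lemma adj_mono: "I \<subseteq> J ==> adj R I x \<subseteq> adj R J x"
 by (auto simp: adj_def)

lemma adj_absorb: "ideal I R ==> x \<in> I ==> adj R I x = I"
 using adj_minimal[of I I x] adj_sub[of I x] idealD(8)[of I x] by blast

lemma Idl_insert_adj:
 assumes "A \<subseteq> CR" "x \<in> CR"
 shows "Idl (insert x A) = adj R (Idl A) x"
proof
 have A: "ideal (Idl A) R" by (rule genideal_ideal[OF assms(1)])
 show "Idl (insert x A) \<subseteq> adj R (Idl A) x"
  using genideal_self[OF assms(1)] adj_sub[OF A assms(2)] adj_self[OF A assms(2)]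
  by (intro genideal_minimal adj_ideal A assms) auto
 have i: "ideal (Idl (insert x A)) R" using assms by (intro genideal_ideal) auto
 moreover have "insert x A \<subseteq> Idl (insert x A)" using assms by (intro genideal_self) auto
 ultimately show "adj R (Idl A) x \<subseteq> Idl (insert x A)"
  by (intro adj_minimal genideal_minimal) auto
qed

lemma Idl_ideal: "ideal I R ==> Idl I = I"
 using genideal_minimal[of I I] genideal_self[of I] idealD(1) by blast

lemma Idl_mono: "A \<subseteq> B ==> B \<subseteq> CR ==> Idl A \<subseteq> Idl B"
 using genideal_minimal[OF genideal_ideal, of B A] genideal_self[of B] by blast

lemma colon_ideal [intro]: assumes "ideal I R" "A \<subseteq> CR" shows "ideal (colon R I A) R"
proof (rule ideal_intro)
 note I = idealD[OF assms(1)]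
 show "\<zero> \<in> colon R I A" using I assms by (auto simp: colon_def)
 show "r \<in> CR ==> x \<in> colon R I A ==> r \<otimes> x \<in> colon R I A" for r x
  using I assms by (auto simp: colon_def m_assoc)
 show "y \<in> colon R I A ==> x \<in> colon R I A ==> x \<oplus> y \<in> colon R I A" for y x
  using I assms by (auto simp: colon_def l_distr)
qed (auto simp: colon_def)

lemma colon_sub: "ideal I R ==> A \<subseteq> CR ==> I \<subseteq> colon R I A"
 using idealD[of I] by (auto simp: colon_def)

lemma colon_single: "r \<in> colon R I {y} \<longleftrightarrow> r \<in> CR \<and> r \<otimes> y \<in> I"
 by (auto simp: colon_def)

lemma sadj_ideal [intro]: assumes "ideal I R" "ideal D R" "x \<in> CR" shows "ideal (sadj R I D x) R"
proof (rule ideal_intro)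
 note I = idealD[OF assms(1)] note D = idealD[OF assms(2)]
 have sI: "i \<in> I ==> r \<in> D ==> i \<oplus> r \<otimes> x \<in> sadj R I D x" for i r by (auto simp: sadj_def)
 show "sadj R I D x \<subseteq> CR" using I D assms by (auto simp: sadj_def)
 show "\<zero> \<in> sadj R I D x" using sI[OF I(2) D(2)] assms by simp
 fix a b assume "a \<in> sadj R I D x" "b \<in> sadj R I D x"
 then obtain i r j s where *: "a = i \<oplus> r \<otimes> x" "b = j \<oplus> s \<otimes> x" "i \<in> I" "j \<in> I" "r \<in> D" "s \<in> D"
  by (auto simp: sadj_def)
 then have "i \<in> CR" "j \<in> CR" "r \<in> CR" "s \<in> CR" using I D by auto
 then have "a \<oplus> b = (i \<oplus> j) \<oplus> (r \<oplus> s) \<otimes> x" unfolding * using assms(3) by algebra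
 then show "a \<oplus> b \<in> sadj R I D x" using sI[of "i \<oplus> j" "r \<oplus> s"] * I D by auto
next
 note I = idealD[OF assms(1)] note D = idealD[OF assms(2)]
 have sI: "i \<in> I ==> r \<in> D ==> i \<oplus> r \<otimes> x \<in> sadj R I D x" for i r by (auto simp: sadj_def)
 fix t a assume "a \<in> sadj R I D x" and t: "t \<in> CR"
 then obtain i r where *: "a = i \<oplus> r \<otimes> x" "i \<in> I" "r \<in> D"
  by (auto simp: sadj_def)
 then have "i \<in> CR" "r \<in> CR" using I D by auto
 then have "t \<otimes> a = t \<otimes> i \<oplus> (t \<otimes> r) \<otimes> x" unfolding * using assms t by algebra
 then show "t \<otimes> a \<in> sadj R I D x" using sI[of "t \<otimes> i" "t \<otimes> r"] * I D t by simp
qed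

lemma sadj_I: "i \<in> I ==> r \<in> D ==> i \<oplus> r \<otimes> x \<in> sadj R I D x"
 by (auto simp: sadj_def)

lemma sadj_sub:
 assumes "ideal I R" "ideal D R" "x \<in> CR"
 shows "I \<subseteq> sadj R I D x"
proof
 fix i assume "i \<in> I"
 then show "i \<in> sadj R I D x"
  using sadj_I[of i I \<zero> D x] idealD(2)[OF assms(2)] idealD(8)[OF assms(1)] assms(3) by simp
qed

lemma isum_ideal [intro]: assumes "ideal I R" "ideal D R" shows "ideal (isum R I D) R"
proof -
 have "isum R I D = I <+>\<^bsub>R\<^esub> D" by (auto simp: isum_def set_add_def')
 then show ?thesis using add_ideals[OF assms] by simp
qed

lemma isum_sub: assumes "ideal I R" "ideal D R" shows "I \<subseteq> isum R I D" "D \<subseteq> isum R I D"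
proof -
 note I = idealD[OF assms(1)] note D = idealD[OF assms(2)]
 show "I \<subseteq> isum R I D"
 proof
  fix x assume "x \<in> I" then have "x = x \<oplus> \<zero>" using I by simp
  then show "x \<in> isum R I D" unfolding isum_def using \<open>x \<in> I\<close> D(2) by blast
 qed
 show "D \<subseteq> isum R I D"
 proof
  fix x assume "x \<in> D" then have "x = \<zero> \<oplus> x" using D by simp
  then show "x \<in> isum R I D" unfolding isum_def using \<open>x \<in> D\<close> I(2) by blast
 qed
qed

lemma isum_minimal: "ideal J R ==> I \<subseteq> J ==> D \<subseteq> J ==> isum R I D \<subseteq> J"
 using idealD(3)[of J] by (auto simp: isum_def)

lemma isum_adj: assumes "ideal I R" "ideal D R" "x \<in> CR"
 shows "isum R (adj R I x) D = adj R (isum R I D) x"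
proof
 note si = isum_sub[OF assms(1,2)]
 note as = adj_sub[OF isum_ideal[OF assms(1,2)] assms(3)]
 show "isum R (adj R I x) D \<subseteq> adj R (isum R I D) x"
  using si as adj_self[OF isum_ideal[OF assms(1,2)] assms(3)]
  by (intro isum_minimal adj_minimal adj_ideal isum_ideal assms) auto
 have "adj R I x \<subseteq> isum R (adj R I x) D" "D \<subseteq> isum R (adj R I x) D"
  using isum_sub[OF adj_ideal[OF assms(1,3)] assms(2)] by auto
 moreover have "I \<subseteq> adj R I x" "x \<in> adj R I x" using adj_sub adj_self assms by auto
 ultimately show "adj R (isum R I D) x \<subseteq> isum R (adj R I x) D"
  using assms by (intro adj_minimal isum_minimal isum_ideal adj_ideal) auto
qed


end

section \<open>Maximum condition and primes in Noetherian rings\<close>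

locale noeth = cring R + noetherian_ring R for R (structure)
begin

text \<open>A nonempty chain of ideals contains its own union, so Zorn's lemma applies to an
  arbitrary property \<open>P\<close>; no closure of \<open>P\<close> under unions is asked
  for.\<close>

lemma noeth_max:
 assumes "ideal I0 R" "P I0"
 obtains M where "ideal M R" "P M" "I0 \<subseteq> M" "!!J. ideal J R ==> P J ==> M \<subseteq> J ==> J = M"
proof -
 define C where "C = {I. ideal I R \<and> P I \<and> I0 \<subseteq> I}"
 have "\<exists>M\<in>C. \<forall>X\<in>C. M \<subseteq> X --> X = M"
 proof (rule subset_Zorn_nonempty)
  show "C \<noteq> {}" using assms by (auto simp: C_def)
  fix K assume K: "K \<noteq> {}" "subset.chain C K"
  have KC: "K \<subseteq> C" using K(2) unfolding pred_on.chain_def by (rule conjunct1)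
  then have "K \<subseteq> {I. ideal I R}" by (auto simp: C_def)
  then have "subset.chain {I. ideal I R} K"
   using K(2) unfolding pred_on.chain_def by (elim conjE, intro conjI)
  then have "\<Union>K \<in> K" using ideal_chain_is_trivial[OF K(1)] by blast
  with KC show "\<Union>K \<in> C" by (rule subsetD)
 qed
 then obtain M where M: "M \<in> C" "\<forall>X\<in>C. M \<subseteq> X --> X = M" by auto
 show thesis
 proof (rule that[of M])
  fix J assume "ideal J R" "P J" "M \<subseteq> J"
  moreover have "I0 \<subseteq> J" using M(1) \<open>M \<subseteq> J\<close> by (auto simp: C_def)
  ultimately show "J = M" using M(2) by (simp add: C_def)
 qed (use M in \<open>auto simp: C_def\<close>)
qed

lemma noeth_induct:
 assumes "ideal I R" "!!I. ideal I R ==> (!!J. ideal J R ==> I \<subset> J ==> P J) ==> P I"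
 shows "P I"
proof (rule ccontr)
 assume "\<not> P I"
 then obtain M where M: "ideal M R" "\<not> P M" "!!J. ideal J R ==> \<not> P J ==> M \<subseteq> J ==> J = M"
  using noeth_max[of I "%I. \<not> P I"] assms(1) by metis
 show False using assms(2)[OF M(1)] M by (metis psubset_eq)
qed

lemma ex_maximal:
 assumes "ideal I R" "I \<noteq> CR"
 shows "\<exists>M. maximalideal M R \<and> I \<subseteq> M"
proof -
 obtain M where M: "ideal M R" "M \<noteq> CR" "I \<subseteq> M"
  "!!J. ideal J R ==> J \<noteq> CR ==> M \<subseteq> J ==> J = M"
  using noeth_max[of I "%I. I \<noteq> CR"] assms by metis
 have "maximalideal M R" using M by (intro maximalidealI) auto
 then show ?thesis using M by blast
qed


text \<open>An ideal \<open>M\<close> maximal among those disjoint from \<open>W\<close> is prime: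
  if a and b lie outside, then M + Ra and M + Rb both meet \<open>W\<close>, and the product of the
  two elements found lies in \<open>W\<close>, and in \<open>M\<close> as soon as ab does.\<close>

lemma prime_avoiding:
 assumes I: "ideal I R" and W: "\<one> \<in> W" "W \<subseteq> CR" "!!a b. a \<in> W ==> b \<in> W ==> a \<otimes> b \<in> W"
  and d: "I \<inter> W = {}"
 shows "\<exists>Q. primeideal Q R \<and> I \<subseteq> Q \<and> Q \<inter> W = {}"
proof -
 obtain M where M: "ideal M R" "M \<inter> W = {}" "I \<subseteq> M"
  "!!J. ideal J R ==> J \<inter> W = {} ==> M \<subseteq> J ==> J = M"
  using noeth_max[of I "%I. I \<inter> W = {}"] I d by metis
 note Mf = idealD[OF M(1)]
 have "primeideal M R"
 proof (rule primeidealI[OF M(1) is_cring])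
  show "CR \<noteq> M" using W M(2) by auto
  fix a b assume ab: "a \<in> CR" "b \<in> CR" "a \<otimes> b \<in> M"
  show "a \<in> M \<or> b \<in> M"
  proof (rule ccontr)
   assume "\<not> ?thesis"
   then have n: "a \<notin> M" "b \<notin> M" by auto
   have "\<exists>w. w \<in> W \<and> w \<in> adj R M x" if "x \<notin> M" "x \<in> CR" for x
    using M(4)[OF adj_ideal[OF M(1) that(2)]] adj_sub[OF M(1) that(2)] adj_self[OF M(1) that(2)] that by auto
   then obtain v w where "v \<in> W" "v \<in> adj R M a" "w \<in> W" "w \<in> adj R M b" using n ab by meson
   then obtain i r j s where *: "v = i \<oplus> r \<otimes> a" "w = j \<oplus> s \<otimes> b" "i \<in> M" "j \<in> M" "r \<in> CR" "s \<in> CR"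
    by (auto simp: adj_def)
   then have c: "i \<in> CR" "j \<in> CR" using Mf by auto
   have "v \<otimes> w = i \<otimes> w \<oplus> ((r \<otimes> a) \<otimes> j \<oplus> (r \<otimes> s) \<otimes> (a \<otimes> b))" unfolding * using * c ab by algebra
   moreover have "w \<in> CR" using W \<open>w \<in> W\<close> by auto
   ultimately have "v \<otimes> w \<in> M" using Mf * c ab by auto
   then show False using W(3)[OF \<open>v \<in> W\<close> \<open>w \<in> W\<close>] M(2) by auto
  qed
 qed
 then show ?thesis using M by auto
qed

end

section \<open>Lengths over a local ring\<close>

locale noeth_local = noeth +
 fixes m
 assumes max_m: "maximalideal m R" and unit_or_m: "x \<in> carrier R ==> x \<in> m \<or> x \<in> Units R"
begin

lemma m_ideal: "ideal m R"
 using max_m by (rule maximalideal.axioms)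

lemmas m_facts = idealD[OF m_ideal]

lemma one_notin_m: "\<one> \<notin> m"
 using max_m ideal_carrier_iff[OF m_ideal] by (auto simp: maximalideal_def maximalideal_axioms_def)

lemma m_prime: "primeideal m R"
 by (rule maximalideal_prime[OF max_m])

lemma proper_sub_m:
 assumes "ideal I R" "I \<noteq> CR"
 shows "I \<subseteq> m"
proof
 fix x assume x: "x \<in> I"
 note I = idealD[OF assms(1)]
 show "x \<in> m"
 proof (rule ccontr)
  assume "x \<notin> m"
  then have "x \<in> Units R" using unit_or_m x I by auto
  then have "inv x \<otimes> x = \<one>" "inv x \<in> CR" by auto
  then have "\<one> \<in> I" using I(4)[of "inv x" x] x by simp
  then show False using ideal_carrier_iff[OF assms(1)] assms(2) by simp
 qed
qed

text \<open>Says that I'/I is a one-dimensional vector space over the residue field.\<close>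

definition cov :: "'a set => 'a set => bool" where
 "cov I I' \<longleftrightarrow> ideal I R \<and> (\<exists>x\<in>carrier R. x \<notin> I \<and> I' = adj R I x \<and> (\<forall>a\<in>m. a \<otimes> x \<in> I))"

text \<open>A composition series written as a chain of ideals: J/I has length \<open>k\<close>. It
  is a relation because existence (\<open>clen_ex\<close>) and uniqueness
  (\<open>clen_unique\<close>) of the length come only later.\<close>

inductive clen :: "'a set => 'a set => nat => bool" for I where
 base: "ideal I R ==> clen I I 0"
| step: "clen I J k ==> cov J J' ==> clen I J' (Suc k)"

lemma cov_ideal: "cov I I' ==> ideal I R \<and> ideal I' R \<and> I \<subset> I'"
 using adj_sub adj_self by (auto simp: cov_def)

lemma clen_ideal: "clen I J k ==> ideal I R \<and> ideal J R \<and> I \<subseteq> J"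
 by (induction rule: clen.induct) (use cov_ideal in auto)

lemma clen_0: "clen I J 0 ==> I = J"
 by (erule clen.cases) auto

lemma clen_trans: "clen J K l ==> clen I J k ==> clen I K (k + l)"
 by (induction rule: clen.induct) (auto intro: clen.step)

lemma clen_1: "cov I J ==> clen I J 1"
 using clen.step[OF clen.base, of I J] cov_ideal by auto

text \<open>In y = i + r x the coefficient r cannot lie in \<open>m\<close>, since m x is contained
  in I; so r is a unit and x is recovered from y. A simple quotient is generated by each of its
  nonzero elements.\<close>

lemma cov_new_gen:
 assumes "ideal I R" "x \<in> CR" "\<forall>a\<in>m. a \<otimes> x \<in> I" "y \<in> adj R I x" "y \<notin> I"
 shows "adj R I y = adj R I x" "\<forall>a\<in>m. a \<otimes> y \<in> I" "y \<in> CR"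
proof -
 note I = idealD[OF assms(1)]
 obtain i r where y: "y = i \<oplus> r \<otimes> x" "i \<in> I" "r \<in> CR" using assms(4) by (auto simp: adj_def)
 have ic: "i \<in> CR" using y I by auto
 show yc: "y \<in> CR" using y ic assms by auto
 have "r \<notin> m" using y I assms(3,5) by auto
 then have u: "r \<in> Units R" using unit_or_m y by auto
 then have ri: "inv r \<otimes> r = \<one>" "inv r \<in> CR" by auto
 have "\<ominus> (inv r \<otimes> i) \<oplus> inv r \<otimes> y = (inv r \<otimes> r) \<otimes> x"
  unfolding y(1) using ic y(3) ri(2) assms(2) by algebra
 then have "x = \<ominus> (inv r \<otimes> i) \<oplus> inv r \<otimes> y" using ri assms(2) by simp
 moreover have "\<ominus> (inv r \<otimes> i) \<in> I" using ri y I by auto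
 ultimately have "x \<in> adj R I y" using adj_I ri by metis
 then show "adj R I y = adj R I x"
  using adj_minimal[OF adj_ideal[OF assms(1,2)] adj_sub[OF assms(1,2)] assms(4)]
   adj_minimal[OF adj_ideal[OF assms(1) yc] adj_sub[OF assms(1) yc]] by blast
 show "\<forall>a\<in>m. a \<otimes> y \<in> I"
 proof
  fix a assume a: "a \<in> m"
  then have ac: "a \<in> CR" using m_facts by auto
  have "a \<otimes> y = a \<otimes> i \<oplus> r \<otimes> (a \<otimes> x)" unfolding y(1) using ac ic y(3) assms(2) by algebra
  then show "a \<otimes> y \<in> I" using I ac y assms(3) a by auto
 qed
qed

text \<open>A simple step is seen either inside \<open>D\<close> or modulo \<open>D\<close>. If J'
  meets \<open>D\<close> outside J, the generator can be taken in \<open>D\<close> and vanishes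
  modulo \<open>D\<close>; otherwise the old generator survives modulo \<open>D\<close>.\<close>

lemma cov_modular:
 assumes "cov J J'" "ideal D R"
 shows "(cov (J \<inter> D) (J' \<inter> D) \<and> isum R J D = isum R J' D) \<or>
     (J \<inter> D = J' \<inter> D \<and> cov (isum R J D) (isum R J' D))"
proof -
 obtain x where x: "ideal J R" "x \<in> CR" "x \<notin> J" "J' = adj R J x" "\<forall>a\<in>m. a \<otimes> x \<in> J"
  using assms(1) by (auto simp: cov_def)
 note J = idealD[OF x(1)] note D = idealD[OF assms(2)]
 have JD: "ideal (J \<inter> D) R" using i_intersect x(1) assms(2) by blast
 show ?thesis
 proof (cases "J' \<inter> D \<subseteq> J")
  case False
  then obtain y where y: "y \<in> J'" "y \<in> D" "y \<notin> J" by auto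
  note n = cov_new_gen[OF x(1,2,5) y(1)[unfolded x(4)] y(3)]
  have J': "J' = adj R J y" using n x by simp
  have "J' \<inter> D = adj R (J \<inter> D) y"
  proof
   show "adj R (J \<inter> D) y \<subseteq> J' \<inter> D" unfolding J'
    using adj_sub[OF x(1) n(3)] adj_self[OF x(1) n(3)] y(2) adj_ideal[OF x(1) n(3)] assms(2)
    by (intro adj_minimal i_intersect) auto
   show "J' \<inter> D \<subseteq> adj R (J \<inter> D) y"
   proof
    fix z assume "z \<in> J' \<inter> D"
    then obtain i r where z: "z = i \<oplus> r \<otimes> y" "i \<in> J" "r \<in> CR" "z \<in> D" unfolding J' by (auto simp: adj_def)
    have "r \<otimes> y \<oplus> i \<in> D" "r \<otimes> y \<in> D" using z y D J n by (auto simp: a_comm)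
    then have "i \<in> D" using ideal_minus_cancel[OF assms(2)] z J by blast
    then show "z \<in> adj R (J \<inter> D) y" using adj_I[of i "J \<inter> D" r y] z by auto
   qed
  qed
  then have "cov (J \<inter> D) (J' \<inter> D)" unfolding cov_def using JD n y D m_facts by (intro conjI bexI[of _ y]) auto
  moreover have "isum R J D = isum R J' D" unfolding J' isum_adj[OF x(1) assms(2) n(3)]
   using isum_sub[OF x(1) assms(2)] y by (subst adj_absorb) (auto intro: x assms)
  ultimately show ?thesis by blast
 next
  case True
  have eq: "J \<inter> D = J' \<inter> D" using True adj_sub[OF x(1,2)] x(4) by auto
  have "x \<notin> isum R J D"
  proof
   assume "x \<in> isum R J D"
   then obtain j d where *: "x = j \<oplus> d" "j \<in> J" "d \<in> D" by (auto simp: isum_def)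
   have "j \<oplus> d \<in> J'" using adj_self[OF x(1,2)] * x(4) by simp
   moreover have "j \<in> J'" using adj_sub[OF x(1,2)] * x(4) by auto
   ultimately have "d \<in> J'" using ideal_minus_cancel[OF adj_ideal[OF x(1,2)], of j d] D * x(4) by auto
   then have "d \<in> J" using True * by auto
   then show False using * J x(3) by auto
  qed
  then have "cov (isum R J D) (isum R J' D)" unfolding cov_def x(4) isum_adj[OF x(1) assms(2) x(2)]
   using x isum_sub[OF x(1) assms(2)] assms by (intro conjI isum_ideal bexI[of _ x]) auto
  then show ?thesis using eq by blast
 qed
qed

text \<open>Additivity of length for the submodule (J inter D)/I of J/I with quotient (J + D)/D,
  obtained by sorting the steps of the series with \<open>cov_modular\<close>.\<close>

lemma clen_modular:
 assumes "clen I J k" "ideal D R" "I \<subseteq> D"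
 shows "\<exists>i j. i + j = k \<and> clen I (J \<inter> D) i \<and> clen D (isum R J D) j"
 using assms(1)
proof induction
 case base
 have "I \<inter> D = I" using assms by auto
 moreover have "isum R I D = D"
  using isum_minimal[OF assms(2,3) order_refl] isum_sub[OF base assms(2)] by auto
 ultimately show ?case using clen.base[OF base] clen.base[OF assms(2)] by (intro exI[of _ 0]) auto
next
 case (step J k J')
 then obtain i j where ij: "i + j = k" "clen I (J \<inter> D) i" "clen D (isum R J D) j" by auto
 from cov_modular[OF step(2) assms(2)] show ?case
 proof
  assume "cov (J \<inter> D) (J' \<inter> D) \<and> isum R J D = isum R J' D"
  then show ?thesis using ij clen.step[of I "J \<inter> D" i "J' \<inter> D"]
   by (intro exI[of _ "Suc i"] exI[of _ j]) auto
 next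
  assume "J \<inter> D = J' \<inter> D \<and> cov (isum R J D) (isum R J' D)"
  then show ?thesis using ij clen.step[of D "isum R J D" j "isum R J' D"]
   by (intro exI[of _ i] exI[of _ "Suc j"]) auto
 qed
qed

lemma clen_split:
 assumes "clen I J k" "ideal D R" "I \<subseteq> D" "D \<subseteq> J"
 obtains i j where "i + j = k" "clen I D i" "clen D J j"
proof -
 have J: "ideal J R" using clen_ideal[OF assms(1)] by auto
 have "J \<inter> D = D" using assms by auto
 moreover have "isum R J D = J"
  using isum_minimal[OF J order_refl assms(4)] isum_sub[OF J assms(2)] by auto
 ultimately show ?thesis using clen_modular[OF assms(1-3)] that by auto
qed

lemma clen_cov_1:
 assumes "cov I J" "clen I J k"
 shows "k = 1"
proof -
 obtain x where x: "ideal I R" "x \<in> CR" "x \<notin> I" "J = adj R I x" "\<forall>a\<in>m. a \<otimes> x \<in> I"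
  using assms(1) by (auto simp: cov_def)
 have sim: "D = J" if D: "ideal D R" "I \<subset> D" "D \<subseteq> J" for D
 proof -
  obtain y where y: "y \<in> D" "y \<notin> I" using D by auto
  then have "adj R I y = J" using cov_new_gen(1)[OF x(1,2,5), of y] D x by auto
  then show ?thesis using adj_minimal[OF D(1), of I y] D y by auto
 qed
 from assms(2) show ?thesis
 proof cases
  case base
  then show ?thesis using assms(1) cov_ideal by auto
 next
  case (step J' k')
  have "\<not> I \<subset> J'" using sim[of J'] cov_ideal[OF step(3)] by auto
  then have "J' = I" using clen_ideal[OF step(2)] by auto
  then have "clen I I k'" using step by simp
  then show ?thesis
  proof cases
   case base
   then show ?thesis using step by simp
  next
   case (step J'' k'')
   then show ?thesis using clen_ideal[of I J'' k''] cov_ideal[of J'' I] by auto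
  qed
 qed
qed

text \<open>Jordan-Hoelder, by induction on the second series: its last but one ideal splits the
  first series by \<open>clen_split\<close>, and the remaining simple quotient has length 1
  only.\<close>

lemma clen_unique: "clen I J k ==> clen I J l ==> k = l"
proof (induction l arbitrary: J k)
 case 0
 have "I = J" using clen_0[OF 0(2)] .
 with 0(1) have "clen I I k" by simp
 then show ?case
 proof cases
  case (step J'' k'')
  then show ?thesis using clen_ideal[of I J'' k''] cov_ideal[of J'' I] by auto
 qed
next
 case (Suc l)
 from Suc.prems(2) obtain D where D: "clen I D l" "cov D J" by (cases rule: clen.cases) auto
 obtain i j where ij: "i + j = k" "clen I D i" "clen D J j"
  using clen_split[OF Suc.prems(1), of D] clen_ideal[OF D(1)] cov_ideal[OF D(2)] by blast
 then show ?case using Suc.IH[OF _ D(1)] clen_cov_1[OF D(2)] by auto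
qed

definition mprim :: "'a set => bool" where
 "mprim I \<longleftrightarrow> ideal I R \<and> (\<forall>y\<in>m. \<exists>N::nat. y [^] N \<in> I)"

lemma mprim_mono: "mprim I ==> ideal J R ==> I \<subseteq> J ==> mprim J"
 unfolding mprim_def by blast

text \<open>Choose x outside I with (I : x) maximal among such annihilators. If a^(n+1) x lies in I
  but a^n x does not, then (I : a^n x) belongs to the family and contains (I : x), so it equals (I :
  x), and it contains a. Descending from a power of a that lies in I gives a x in I.\<close>

lemma socle_ex:
 assumes "mprim I" "I \<noteq> CR"
 shows "\<exists>x\<in>CR. x \<notin> I \<and> (\<forall>a\<in>m. a \<otimes> x \<in> I)"
proof -
 have I: "ideal I R" using assms by (simp add: mprim_def)
 note If = idealD[OF I]
 define P where "P K \<longleftrightarrow> (\<exists>x\<in>CR. x \<notin> I \<and> K = colon R I {x})" for K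
 have "P (colon R I {\<one>})" unfolding P_def
  using ideal_carrier_iff[OF I] assms by (intro bexI[of _ \<one>]) auto
 moreover have "ideal (colon R I {\<one>}) R" using I by auto
 ultimately obtain K where K: "ideal K R" "P K" "!!J. ideal J R ==> P J ==> K \<subseteq> J ==> J = K"
  using noeth_max[of "colon R I {\<one>}" P] by metis
 then obtain x where x: "x \<in> CR" "x \<notin> I" "K = colon R I {x}" by (auto simp: P_def)
 have "a \<otimes> x \<in> I" if a: "a \<in> m" for a
 proof -
  have ac: "a \<in> CR" using a m_facts by auto
  obtain N :: nat where N: "a [^] N \<in> I" using assms a by (auto simp: mprim_def)
  have "a [^] n \<otimes> x \<in> I ==> a \<otimes> x \<in> I" for n :: nat
  proof (induction n)
   case 0
   then show ?case using x by simp
  next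
   case (Suc n)
   show ?case
   proof (cases "a [^] n \<otimes> x \<in> I")
    case False
    have c: "a [^] n \<otimes> x \<in> CR" using ac x by auto
    have s: "K \<subseteq> colon R I {a [^] n \<otimes> x}"
    proof
     fix k assume "k \<in> K"
     then have k: "k \<in> CR" "k \<otimes> x \<in> I" using x by (auto simp: colon_single)
     have "k \<otimes> (a [^] n \<otimes> x) = a [^] n \<otimes> (k \<otimes> x)" using k ac x by (simp add: m_lcomm)
     then show "k \<in> colon R I {a [^] n \<otimes> x}" using If k ac by (simp add: colon_single)
    qed
    have P: "P (colon R I {a [^] n \<otimes> x})" unfolding P_def using False c by blast
    have "ideal (colon R I {a [^] n \<otimes> x}) R" using I c by auto
    then have "colon R I {a [^] n \<otimes> x} = K" using P s by (rule K(3))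
    moreover have "a \<otimes> (a [^] n \<otimes> x) \<in> I" using Suc.prems ac x by (simp add: m_ac)
    ultimately have "a \<in> K" using ac by (auto simp: colon_single)
    then show ?thesis using x by (simp add: colon_single)
   qed (use Suc in auto)
  qed
  then show ?thesis using If(5)[OF x(1) N] by blast
 qed
 then show ?thesis using x by blast
qed

text \<open>Noetherian induction: a socle element gives one simple step, and the larger ideal is
  again m-primary.\<close>

lemma clen_ex:
 assumes "mprim I"
 shows "\<exists>k. clen I (CR) k"
proof -
 have I: "ideal I R" using assms by (simp add: mprim_def)
 from I have "mprim I --> ?thesis"
 proof (rule noeth_induct)
  fix I assume I: "ideal I R" and IH: "!!J. ideal J R ==> I \<subset> J ==> mprim J --> (\<exists>k. clen J (CR) k)"
  show "mprim I --> (\<exists>k. clen I (CR) k)"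
  proof
   assume mp: "mprim I"
   show "\<exists>k. clen I (CR) k"
   proof (cases "I = CR")
    case True
    then show ?thesis using clen.base[OF I] by auto
   next
    case False
    from socle_ex[OF mp False] obtain x where x: "x \<in> CR" "x \<notin> I" "\<forall>a\<in>m. a \<otimes> x \<in> I" by auto
    have c: "cov I (adj R I x)" unfolding cov_def using I x by auto
    have "mprim (adj R I x)" using mprim_mono[OF mp] cov_ideal[OF c] by auto
    then obtain k where "clen (adj R I x) (CR) k" using IH cov_ideal[OF c] by auto
    then show ?thesis using clen_trans[OF _ clen_1[OF c]] by blast
   qed
  qed
 qed
 then show ?thesis using assms by simp
qed

lemma sadj_colon_sub:
 assumes "ideal I R" "y \<in> CR" "D \<subseteq> colon R I {y}" "\<zero> \<in> D"
 shows "sadj R I D y = I"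
proof
 note I = idealD[OF assms(1)]
 show "sadj R I D y \<subseteq> I" using assms(3) I by (auto simp: sadj_def colon_single)
 show "I \<subseteq> sadj R I D y"
 proof
  fix i assume i: "i \<in> I"
  then have "i = i \<oplus> \<zero> \<otimes> y" using I assms by auto
  then show "i \<in> sadj R I D y" unfolding sadj_def using i assms(4) by blast
 qed
qed

lemma sadj_carrier: "sadj R I (CR) y = adj R I y"
 by (auto simp: sadj_def adj_def)

text \<open>Since (I : y) is contained in \<open>D\<close>, multiplication by y induces an
  isomorphism from D'/D to (I + D'y)/(I + Dy).\<close>

lemma clen_scale:
 assumes "clen D D' k" "ideal I R" "y \<in> CR" "colon R I {y} \<subseteq> D"
 shows "clen (sadj R I D y) (sadj R I D' y) k"
 using assms(1)
proof induction
 case base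
 then show ?case using assms by (intro clen.base sadj_ideal)
next
 case (step J k J')
 note I = idealD[OF assms(2)]
 obtain x where x: "ideal J R" "x \<in> CR" "x \<notin> J" "J' = adj R J x" "\<forall>a\<in>m. a \<otimes> x \<in> J"
  using step(2) by (auto simp: cov_def)
 note J = idealD[OF x(1)]
 have DJ: "D \<subseteq> J" using clen_ideal[OF step(1)] by auto
 have xy: "x \<otimes> y \<in> CR" using x assms by auto
 have "x \<otimes> y \<notin> sadj R I J y"
 proof
  assume "x \<otimes> y \<in> sadj R I J y"
  then obtain i r where *: "x \<otimes> y = i \<oplus> r \<otimes> y" "i \<in> I" "r \<in> J" by (auto simp: sadj_def)
  have c: "i \<in> CR" "r \<in> CR" using * I J by auto
  have "(x \<ominus> r) \<otimes> y = x \<otimes> y \<ominus> r \<otimes> y" using c x assms by algebra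
  also have "... = i" unfolding *(1) using c assms by algebra
  finally have "x \<ominus> r \<in> colon R I {y}" using c x * by (simp add: colon_single)
  then have "x \<ominus> r \<in> J" using DJ assms by auto
  then have "(x \<ominus> r) \<oplus> r \<in> J" using J * by blast
  moreover have "(x \<ominus> r) \<oplus> r = x" using c x by algebra
  ultimately show False using x by simp
 qed
 moreover have "sadj R I J' y = adj R (sadj R I J y) (x \<otimes> y)"
 proof (rule subset_antisym; rule subsetI)
  fix z assume "z \<in> sadj R I J' y"
   then obtain i j r where *: "z = i \<oplus> (j \<oplus> r \<otimes> x) \<otimes> y" "i \<in> I" "j \<in> J" "r \<in> CR"
    unfolding x(4) by (auto simp: sadj_def adj_def)
   have c: "i \<in> CR" "j \<in> CR" using * I J by auto
   have "z = (i \<oplus> j \<otimes> y) \<oplus> r \<otimes> (x \<otimes> y)" unfolding *(1) using c * x(2) assms(3) by algebra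
   then show "z \<in> adj R (sadj R I J y) (x \<otimes> y)"
    using adj_I[of "i \<oplus> j \<otimes> y" "sadj R I J y" r "x \<otimes> y"] * by (auto simp: sadj_def)
 next
  fix z assume "z \<in> adj R (sadj R I J y) (x \<otimes> y)"
   then obtain i j r where *: "z = (i \<oplus> j \<otimes> y) \<oplus> r \<otimes> (x \<otimes> y)" "i \<in> I" "j \<in> J" "r \<in> CR"
    by (auto simp: sadj_def adj_def)
   have c: "i \<in> CR" "j \<in> CR" using * I J by auto
   have "z = i \<oplus> (j \<oplus> r \<otimes> x) \<otimes> y" unfolding *(1) using c * x(2) assms(3) by algebra
   then show "z \<in> sadj R I J' y" unfolding x(4) sadj_def using * adj_I[of j J r x] by blast
 qed
 moreover have "\<forall>a\<in>m. a \<otimes> (x \<otimes> y) \<in> sadj R I J y"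
 proof
  fix a assume a: "a \<in> m"
  then have ac: "a \<in> CR" using m_facts by auto
  have "a \<otimes> (x \<otimes> y) = \<zero> \<oplus> (a \<otimes> x) \<otimes> y" using ac x assms by algebra
  then show "a \<otimes> (x \<otimes> y) \<in> sadj R I J y" unfolding sadj_def using I(2) x(5) a by blast
 qed
 ultimately have "cov (sadj R I J y) (sadj R I J' y)"
  unfolding cov_def using xy sadj_ideal[OF assms(2) x(1) assms(3)] by blast
 then show ?case using clen.step[OF step(3)] by blast
qed

text \<open>The isomorphism of R/(I : y) with (I + Ry)/I; with it, lengths of colon ideals are
  computed below.\<close>

lemma clen_colon:
 assumes "clen (colon R I {y}) (CR) k" "ideal I R" "y \<in> CR"
 shows "clen I (adj R I y) k"
proof -
 have "\<zero> \<in> colon R I {y}" using idealD(2)[OF assms(2)] assms by (simp add: colon_single)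
 then have "sadj R I (colon R I {y}) y = I" using assms by (intro sadj_colon_sub) auto
 then show ?thesis using clen_scale[OF assms order_refl] by (simp add: sadj_carrier)
qed

lemma clen_le_eq:
 assumes "clen I J k" "clen I J' l" "J \<subseteq> J'"
 shows "k \<le> l" "k = l ==> J = J'"
proof -
 obtain i j where *: "i + j = l" "clen I J i" "clen J J' j"
  using clen_split[OF assms(2), of J] clen_ideal[OF assms(1)] assms(3) by metis
 moreover have "i = k" using clen_unique[OF *(2) assms(1)] .
 ultimately show "k \<le> l" "k = l ==> J = J'" using clen_0[of J J'] by auto
qed

end

section \<open>Frobenius powers and the Artin-Rees property\<close>

text \<open>Kept apart from the characteristic because it passes directly to localizations
  (\<open>frob_S\<close>) and to powers of the exponent (\<open>frob_pow\<close>).\<close>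

definition frob :: "('a, 'x) ring_scheme => nat => bool" where
 "frob R q \<longleftrightarrow> q > 0 \<and> (\<forall>x\<in>carrier R. \<forall>y\<in>carrier R.
   (x \<oplus>\<^bsub>R\<^esub> y) [^]\<^bsub>R\<^esub> q = x [^]\<^bsub>R\<^esub> q \<oplus>\<^bsub>R\<^esub> y [^]\<^bsub>R\<^esub> q)"

context cring
begin

lemma frob_add: "frob R q ==> x \<in> CR ==> y \<in> CR ==> (x \<oplus> y) [^] q = x [^] q \<oplus> y [^] q"
 by (auto simp: frob_def)

lemma frob_zero: "frob R q ==> \<zero> [^] q = \<zero>"
 by (cases q) (auto simp: frob_def)

lemma frob_mult: "frob R q ==> frob R q' ==> frob R (q * q')"
 unfolding frob_def by (auto simp flip: nat_pow_pow)

lemma frob_one: "frob R 1"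
 by (auto simp: frob_def)

lemma frob_pow: "frob R p ==> frob R (p ^ e)"
 by (induction e) (auto simp: frob_mult frob_one[simplified])

text \<open>Its purpose: to see that the \<open>q\<close>-th powers of all elements of an ideal lie
  in I, generators suffice.\<close>

lemma frob_preimage_ideal:
 assumes "frob R q" "ideal I R"
 shows "ideal {x \<in> CR. x [^] q \<in> I} R"
proof (rule ideal_intro)
 note I = idealD[OF assms(2)]
 show "\<zero> \<in> {x \<in> CR. x [^] q \<in> I}" using I frob_zero[OF assms(1)] by auto
qed (use assms idealD[OF assms(2)] in \<open>auto simp: frob_add nat_pow_distrib\<close>)

lemma fp_ideal: "I \<subseteq> CR ==> ideal (FP I q) R"
 unfolding frobenius_power_def by (intro genideal_ideal) auto

lemma fp_mem: "I \<subseteq> CR ==> x \<in> I ==> x [^] q \<in> FP I q"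
 unfolding frobenius_power_def using genideal_self[of "pows q I"] by blast

lemma fp_least:
 assumes "ideal K R" "!!x. x \<in> I ==> x [^] q \<in> K"
 shows "FP I q \<subseteq> K"
 unfolding frobenius_power_def using assms by (intro genideal_minimal) auto

lemma fp_mono: "I \<subseteq> J ==> J \<subseteq> CR ==> FP I q \<subseteq> FP J q"
 by (intro fp_least fp_ideal fp_mem) auto

lemma fp_Idl:
 assumes "frob R q" "A \<subseteq> CR"
 shows "FP (Idl A) q = Idl (pows q A)"
proof
 have c: "pows q A \<subseteq> CR" using assms by auto
 note i = genideal_ideal[OF c]
 have "Idl A \<subseteq> {x \<in> CR. x [^] q \<in> Idl (pows q A)}"
  using genideal_self[OF c] assms by (intro genideal_minimal frob_preimage_ideal i) auto
 then show "FP (Idl A) q \<subseteq> Idl (pows q A)"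
  by (intro fp_least i) auto
 have "Idl A \<subseteq> CR" using idealD(1)[OF genideal_ideal[OF assms(2)]] .
 then show "Idl (pows q A) \<subseteq> FP (Idl A) q"
  using genideal_self[OF assms(2)] fp_mem[of "Idl A"] by (intro genideal_minimal[OF fp_ideal]) auto
qed

lemma Idl_insert_ideal: "ideal I R ==> x \<in> CR ==> Idl (insert x I) = adj R I x"
 using Idl_insert_adj[of I x] Idl_ideal[of I] idealD(1)[of I] by simp

lemma fp_adj:
 assumes "frob R q" "ideal I R" "x \<in> CR"
 shows "FP (adj R I x) q = adj R (FP I q) (x [^] q)"
proof -
 have I: "I \<subseteq> CR" using idealD(1)[OF assms(2)] .
 have "FP (adj R I x) q = FP (Idl (insert x I)) q"
  using Idl_insert_ideal[OF assms(2,3)] by simp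
 also have "... = Idl (insert (x [^] q) (pows q I))" using fp_Idl[OF assms(1), of "insert x I"] I assms by simp
 also have "... = adj R (FP I q) (x [^] q)"
  unfolding frobenius_power_def using I assms by (intro Idl_insert_adj) auto
 finally show ?thesis .
qed

lemma fp_fp:
 assumes "frob R q" "frob R q'" "ideal I R"
 shows "FP (FP I q) q' = FP I (q * q')"
proof -
 have I: "I \<subseteq> CR" using idealD(1)[OF assms(3)] .
 have "FP (FP I q) q' = Idl ((%x. x [^] q') ` pows q I)"
  unfolding frobenius_power_def[of R I q] using I by (intro fp_Idl assms) auto
 also have "(%x. x [^] q') ` pows q I = (%x. x [^] (q * q')) ` I"
  unfolding image_image using I by (intro image_cong) (auto simp: nat_pow_pow)
 finally show ?thesis by (simp add: frobenius_power_def)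
qed

lemma fp_one: "ideal I R ==> FP I (Suc 0) = I"
proof -
 assume I: "ideal I R"
 then have "pows (Suc 0) I = I" using idealD(8)[OF I] by (force simp: image_iff)
 then show ?thesis using Idl_ideal[OF I] by (simp only: frobenius_power_def)
qed

lemma fp_sub: "ideal I R ==> q > 0 ==> FP I q \<subseteq> I"
proof (rule fp_least)
 fix x assume I: "ideal I R" "q > 0" "x \<in> I"
 obtain k where "q = Suc k" using I(2) by (cases q) auto
 then show "x [^] q \<in> I" using idealD[OF I(1)] I(3) by auto
qed

lemma fp_carrier: "FP (CR) q = CR"
 using ideal_carrier_iff[OF fp_ideal[of "CR" q]] fp_mem[of "CR" \<one> q] by auto

lemma pow_mem_mono:
 assumes "ideal I R" "x [^] (n::nat) \<in> I" "n \<le> k" "x \<in> CR"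
 shows "x [^] k \<in> I"
proof -
 have "x [^] k = x [^] (k - n) \<otimes> x [^] n" using assms by (simp add: nat_pow_mult)
 then show ?thesis using idealD(4)[OF assms(1) _ assms(2)] assms by simp
qed

lemma prime_pow_mem:
 assumes "primeideal Q R" "x [^] (n::nat) \<in> Q" "x \<in> CR"
 shows "x \<in> Q"
proof -
 interpret Q: primeideal Q R by fact
 from assms(2) show ?thesis
 proof (induction n)
  case 0
  then show ?case using Q.I_notcarr ideal_carrier_iff[OF Q.is_ideal] by auto
 next
  case (Suc n)
  then show ?case using Q.I_prime[of "x [^] n" x] assms(3) by auto
 qed
qed

text \<open>The inclusion that holds in every commutative ring; equality is the flatness of
  Frobenius.\<close>

lemma fp_colon_sub:
 assumes "ideal I R" "y \<in> CR"
 shows "FP (colon R I {y}) q \<subseteq> colon R (FP I q) {y [^] q}"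
proof (rule fp_least)
 have I: "I \<subseteq> CR" using idealD(1)[OF assms(1)] .
 show "ideal (colon R (FP I q) {y [^] q}) R" using assms fp_ideal[OF I] by auto
 show "x \<in> colon R I {y} ==> x [^] q \<in> colon R (FP I q) {y [^] q}" for x
  using assms fp_mem[OF I, of "x \<otimes> y" q] by (auto simp: colon_single nat_pow_distrib)
qed

end

section \<open>Artin-Rees properties and the Krull intersection theorem\<close>

context noeth
begin

lemma colon_stable:
 assumes I: "ideal I R" and x: "x \<in> CR"
 shows "\<exists>n::nat. \<forall>k\<ge>n. colon R I {x [^] k} = colon R I {x [^] n}"
proof -
 have ci: "ideal (colon R I {x [^] k}) R" for k :: nat using I x by auto
 obtain M where M: "\<exists>k::nat. M = colon R I {x [^] k}"
  "!!J. ideal J R ==> \<exists>k::nat. J = colon R I {x [^] k} ==> M \<subseteq> J ==> J = M"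
  using noeth_max[of "colon R I {x [^] (0::nat)}" "%J. \<exists>k::nat. J = colon R I {x [^] k}"] ci by metis
 then obtain n :: nat where n: "M = colon R I {x [^] n}" by auto
 have sub: "colon R I {x [^] n} \<subseteq> colon R I {x [^] k}" if "n \<le> k" for k
 proof
  fix r assume "r \<in> colon R I {x [^] n}"
  then have r: "r \<in> CR" "r \<otimes> x [^] n \<in> I" by (auto simp: colon_single)
  have "r \<otimes> x [^] k = x [^] (k - n) \<otimes> (r \<otimes> x [^] n)"
   using r x that nat_pow_mult[of x "k - n" n] by (simp add: m_ac)
  then show "r \<in> colon R I {x [^] k}" using r idealD(4)[OF I] x by (simp add: colon_single)
 qed
 have "colon R I {x [^] k} = colon R I {x [^] n}" if "n \<le> k" for k
  using M(2)[OF ci exI[of _ k], OF refl] sub[OF that] unfolding n .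
 then show ?thesis by (intro exI[of _ n] allI impI)
qed

text \<open>A substitute for the Artin-Rees lemma that needs no graded rings. Let Q be maximal with
  Q inter L = T. Once the ideals (Q : x^n) are stable, Q + (x^n) still meets L in T: for l = a + r
  x^n in L, the element x^s l lies in T, so r x^(n+s) lies in Q, and by stability r x^n does.
  Maximality puts x^n into Q, for every x in \<open>X\<close>, and then T + (x^n : x in X) is
  contained in Q.\<close>

lemma weak_AR:
 assumes T: "ideal T R" and L: "ideal L R" and TL: "T \<subseteq> L" and X: "finite X" "X \<subseteq> CR"
  and s: "!!x. x \<in> X ==> \<exists>s::nat. \<forall>l\<in>L. x [^] s \<otimes> l \<in> T"
 shows "\<exists>N::nat. \<forall>n\<ge>N. Idl (T \<union> pows n X) \<inter> L \<subseteq> T"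
proof -
 note Lf = idealD[OF L]
 obtain Q where Q: "ideal Q R" "Q \<inter> L = T" "!!J. ideal J R ==> J \<inter> L = T ==> Q \<subseteq> J ==> J = Q"
  using noeth_max[of T "%Q. Q \<inter> L = T"] T TL by (metis inf.absorb1)
 note Qf = idealD[OF Q(1)]
 have ex: "\<exists>n::nat. x [^] n \<in> Q" if x: "x \<in> X" for x
 proof -
  have xc: "x \<in> CR" using x X by auto
  obtain s :: nat where s: "\<forall>l\<in>L. x [^] s \<otimes> l \<in> T" using s[OF x] by auto
  obtain n :: nat where st: "\<forall>k\<ge>n. colon R Q {x [^] k} = colon R Q {x [^] n}"
   using colon_stable[OF Q(1) xc] by (rule exE)
  note st = st[rule_format, OF le_add1[of n s]]
  have xn: "x [^] n \<in> CR" using xc by simp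
  have "adj R Q (x [^] n) \<inter> L \<subseteq> T"
  proof
   fix l assume l: "l \<in> adj R Q (x [^] n) \<inter> L"
   then obtain a r where ar: "l = a \<oplus> r \<otimes> x [^] n" "a \<in> Q" "r \<in> CR" by (auto simp: adj_def)
   have ac: "a \<in> CR" using ar Qf by auto
   have "x [^] s \<otimes> l \<in> Q" using s l Q(2) by auto
   moreover have "x [^] s \<otimes> l = x [^] s \<otimes> a \<oplus> r \<otimes> x [^] (n + s)"
    unfolding ar(1) using ac xc ar(3) by (simp add: r_distr nat_pow_mult[symmetric] m_ac)
   moreover have "x [^] s \<otimes> a \<in> Q" using ar xc Qf by auto
   ultimately have "r \<otimes> x [^] (n + s) \<in> Q" using ideal_minus_cancel[OF Q(1)] ar xc by auto
   then have "r \<in> colon R Q {x [^] (n + s)}" using ar by (simp add: colon_single)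
   then have "r \<otimes> x [^] n \<in> Q" unfolding st by (simp add: colon_single)
   then have "l \<in> Q" using ar Qf by auto
   then show "l \<in> T" using l Q(2) by auto
  qed
  moreover have "T \<subseteq> adj R Q (x [^] n) \<inter> L" using Q(2) adj_sub[OF Q(1) xn] by blast
  ultimately have "adj R Q (x [^] n) = Q"
   using Q(3)[OF adj_ideal[OF Q(1) xn]] adj_sub[OF Q(1) xn] by blast
  then show ?thesis using adj_self[OF Q(1) xn] by auto
 qed
 then obtain e where e: "!!x. x \<in> X ==> x [^] (e x :: nat) \<in> Q" by metis
 show ?thesis
 proof (intro exI[of _ "Max (insert 0 (e ` X))"] allI impI)
  fix n assume n: "n \<ge> Max (insert 0 (e ` X))"
  have "Idl (T \<union> pows n X) \<subseteq> Q"
  proof (intro genideal_minimal Q(1) Un_least image_subsetI)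
   show "T \<subseteq> Q" using Q(2) by auto
   fix x assume x: "x \<in> X"
   have "e x \<le> n" using n x X by (auto simp: Max_ge_iff)
   then show "x [^] n \<in> Q" using pow_mem_mono[OF Q(1) e[OF x]] x X by auto
  qed
  then show "Idl (T \<union> pows n X) \<inter> L \<subseteq> T" using Q(2) by auto
 qed
qed

text \<open>The quotient (I + Ry)/(I + Dy) is killed by \<open>D\<close>, hence by a power of each
  element of \<open>X\<close>, as \<open>weak_AR\<close> requires.\<close>

lemma AR_adj:
 assumes I: "ideal I R" and D: "ideal D R" and y: "y \<in> CR" and X: "finite X" "X \<subseteq> CR"
  and s: "!!x. x \<in> X ==> \<exists>s::nat. x [^] s \<in> D"
 shows "\<exists>N::nat. \<forall>n\<ge>N. Idl (I \<union> pows n X) \<inter> adj R I y \<subseteq> sadj R I D y"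
proof -
 let ?T = "sadj R I D y" and ?L = "adj R I y"
 note Df = idealD[OF D] note If = idealD[OF I]
 have T: "ideal ?T R" using I D y by auto
 have "\<exists>N::nat. \<forall>n\<ge>N. Idl (?T \<union> pows n X) \<inter> ?L \<subseteq> ?T"
 proof (rule weak_AR)
  show "?T \<subseteq> ?L" using Df by (auto simp: sadj_def adj_def)
  fix x assume x: "x \<in> X"
  then have xc: "x \<in> CR" using X by auto
  obtain s :: nat where s: "x [^] s \<in> D" using s[OF x] by auto
  show "\<exists>s::nat. \<forall>l\<in>?L. x [^] s \<otimes> l \<in> ?T"
  proof (intro exI[of _ s] ballI)
   fix l assume "l \<in> ?L"
   then obtain i r where l: "l = i \<oplus> r \<otimes> y" "i \<in> I" "r \<in> CR" by (rule adjE)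
   then have "x [^] s \<otimes> l = x [^] s \<otimes> i \<oplus> (r \<otimes> x [^] s) \<otimes> y"
    using xc y If by (simp add: r_distr m_ac)
   then show "x [^] s \<otimes> l \<in> ?T" using sadj_I[of "x [^] s \<otimes> i" I "r \<otimes> x [^] s" D y] l If xc s Df by auto
  qed
 qed (use T I y X in auto)
 moreover have "Idl (I \<union> pows n X) \<subseteq> Idl (?T \<union> pows n X)" for n :: nat
  using sadj_sub[OF I D y] X idealD(1)[OF T] by (intro Idl_mono) auto
 ultimately show ?thesis by blast
qed

text \<open>With D = (I : y) + (x^s : x in X), \<open>AR_adj\<close> puts r y into I + Dy for every
  r in the colon on the left; so r - t kills y modulo I for some t in \<open>D\<close>, and r lies
  in \<open>D\<close>.\<close>

lemma AR_colon:
 assumes I: "ideal I R" and y: "y \<in> CR" and X: "finite X" "X \<subseteq> CR"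
 shows "\<exists>N::nat. \<forall>n\<ge>N. colon R (Idl (I \<union> pows n X)) {y} \<subseteq> Idl (colon R I {y} \<union> pows (s::nat) X)"
proof -
 define D where "D = Idl (colon R I {y} \<union> pows s X)"
 have Dg: "colon R I {y} \<union> pows s X \<subseteq> CR" using X by (auto simp: colon_def)
 have D: "ideal D R" unfolding D_def using Dg by (rule genideal_ideal)
 have Ds: "colon R I {y} \<subseteq> D" "pows s X \<subseteq> D" unfolding D_def using genideal_self[OF Dg] by auto
 note Df = idealD[OF D] note If = idealD[OF I]
 obtain N :: nat where N: "!!n. n \<ge> N ==> Idl (I \<union> pows n X) \<inter> adj R I y \<subseteq> sadj R I D y"
  using AR_adj[OF I D y X] Ds(2) by (metis image_subset_iff)
 have "colon R (Idl (I \<union> pows n X)) {y} \<subseteq> D" if n: "n \<ge> N" for n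
 proof
  fix r assume "r \<in> colon R (Idl (I \<union> pows n X)) {y}"
  then have r: "r \<in> CR" "r \<otimes> y \<in> Idl (I \<union> pows n X)" by (auto simp: colon_single)
  moreover have "r \<otimes> y \<in> adj R I y" using adj_self[OF I y] adj_ideal[OF I y] r idealD(4) by blast
  ultimately have "r \<otimes> y \<in> sadj R I D y" using N[OF n] by auto
  then obtain i t where it: "r \<otimes> y = i \<oplus> t \<otimes> y" "i \<in> I" "t \<in> D" by (auto simp: sadj_def)
  have c: "i \<in> CR" "t \<in> CR" using it If Df by auto
  have "(r \<ominus> t) \<otimes> y = r \<otimes> y \<ominus> t \<otimes> y" using c r y by algebra
  also have "... = i" unfolding it(1) using c y by algebra
  finally have "r \<ominus> t \<in> D" using Ds it c r by (auto simp: colon_single)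
  then have "(r \<ominus> t) \<oplus> t \<in> D" using Df it by blast
  then show "r \<in> D" using add_diff_cancel[OF r(1) c(2)] by simp
 qed
 then show ?thesis unfolding D_def by auto
qed

text \<open>\<open>AR_adj\<close> for the ideal generated by \<open>X\<close> gives y = i + a y with
  i in I and a in that ideal.\<close>

lemma krull_intersect:
 assumes I: "ideal I R" and y: "y \<in> CR" and X: "finite X" "X \<subseteq> CR"
  and Iy: "!!n::nat. y \<in> Idl (I \<union> pows n X)"
 shows "\<exists>a\<in>Idl X. (\<one> \<ominus> a) \<otimes> y \<in> I"
proof -
 have D: "ideal (Idl X) R" using X by (intro genideal_ideal)
 have "\<exists>s::nat. x [^] s \<in> Idl X" if "x \<in> X" for x
  using genideal_self[OF X(2)] that X(2) by (intro exI[of _ 1]) (auto simp: subset_iff)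
 then obtain N :: nat where "Idl (I \<union> pows N X) \<inter> adj R I y \<subseteq> sadj R I (Idl X) y"
  using AR_adj[OF I D y X] by blast
 then have "y \<in> sadj R I (Idl X) y" using Iy[of N] adj_self[OF I y] by auto
 then obtain i a where ia: "y = i \<oplus> a \<otimes> y" "i \<in> I" "a \<in> Idl X" by (auto simp: sadj_def)
 have c: "i \<in> CR" "a \<in> CR" using ia idealD(8) I D by blast+
 have "(\<one> \<ominus> a) \<otimes> y = y \<ominus> a \<otimes> y" using c y by algebra
 also have "... = i \<oplus> a \<otimes> y \<ominus> a \<otimes> y" using ia(1) by simp
 also have "... = i" using c y by algebra
 finally show ?thesis using ia by auto
qed

end

section \<open>Units, Krull intersection and m-primary ideals in a local ring\<close>

context noeth_local
begin

lemma one_minus_unit: "a \<in> m ==> \<one> \<ominus> a \<in> Units R"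
proof -
 assume a: "a \<in> m"
 then have ac: "a \<in> CR" using m_facts by auto
 have "\<one> \<ominus> a \<notin> m"
 proof
  assume "\<one> \<ominus> a \<in> m"
  then have "(\<one> \<ominus> a) \<oplus> a \<in> m" using a m_facts by blast
  moreover have "(\<one> \<ominus> a) \<oplus> a = \<one>" using ac by algebra
  ultimately show False using one_notin_m by simp
 qed
 then show ?thesis using unit_or_m ac by blast
qed

lemma unit_cancel_ideal:
 assumes "u \<in> Units R" "ideal I R" "u \<otimes> y \<in> I" "y \<in> CR"
 shows "y \<in> I"
proof -
 have "inv u \<otimes> (u \<otimes> y) \<in> I" using assms idealD(4)[OF assms(2)] by auto
 moreover have "inv u \<otimes> (u \<otimes> y) = y" using assms by (simp add: m_assoc[symmetric] Units_closed)
 ultimately show ?thesis by simp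
qed

lemma krull_local:
 assumes I: "ideal I R" and y: "y \<in> CR" and X: "finite X" "X \<subseteq> CR" "m = Idl X"
  and Iy: "!!n::nat. y \<in> Idl (I \<union> pows n X)"
 shows "y \<in> I"
 using krull_intersect[OF I y X(1,2) Iy] unit_cancel_ideal[OF one_minus_unit I _ y] X(3) by metis

text \<open>For an element of \<open>m\<close> without powers in I, \<open>prime_avoiding\<close>
  yields a prime over I that avoids all its powers, so does not contain \<open>m\<close>.\<close>

lemma mprim_criterion:
 assumes "ideal I R" "!!Q. primeideal Q R ==> I \<subseteq> Q ==> m \<subseteq> Q"
 shows "mprim I"
proof -
 have "\<exists>N::nat. y [^] N \<in> I" if y: "y \<in> m" for y
 proof (rule ccontr)
  have yc: "y \<in> CR" using y m_facts by auto
  assume neg: "\<not> ?thesis"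
  have "\<exists>Q. primeideal Q R \<and> I \<subseteq> Q \<and> Q \<inter> range (%n::nat. y [^] n) = {}"
  proof (rule prime_avoiding[OF assms(1)])
   show "\<one> \<in> range (%n::nat. y [^] n)" by (metis nat_pow_0 rangeI)
   show "range (%n::nat. y [^] n) \<subseteq> CR" using yc by auto
   show "I \<inter> range (%n::nat. y [^] n) = {}" using neg by auto
   fix a b assume "a \<in> range (%n::nat. y [^] n)" "b \<in> range (%n::nat. y [^] n)"
   then show "a \<otimes> b \<in> range (%n::nat. y [^] n)" using yc by (auto simp: nat_pow_mult)
  qed
  then obtain Q where Q: "primeideal Q R" "I \<subseteq> Q" "Q \<inter> range (%n::nat. y [^] n) = {}" by auto
  then have "m \<subseteq> Q" using assms by auto
  moreover have "y [^] Suc 0 \<notin> Q" using Q(3) by blast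
  ultimately show False using y yc by auto
 qed
 then show ?thesis unfolding mprim_def using assms(1) by blast
qed

lemma mprim_prime_sub:
 assumes "mprim I" "primeideal Q R" "I \<subseteq> Q"
 shows "m \<subseteq> Q"
proof
 fix y assume y: "y \<in> m"
 then obtain n :: nat where "y [^] n \<in> Q" using assms unfolding mprim_def by blast
 then show "y \<in> Q" using prime_pow_mem[OF assms(2)] y m_facts by auto
qed

lemma mprim_gens:
 assumes "ideal I R" "X \<subseteq> CR" "m = Idl X" "!!x. x \<in> X ==> \<exists>n::nat. x [^] n \<in> I"
 shows "mprim I"
proof (rule mprim_criterion[OF assms(1)])
 fix Q assume Q: "primeideal Q R" "I \<subseteq> Q"
 have "x \<in> Q" if x: "x \<in> X" for x
 proof -
  obtain n :: nat where n: "x [^] n \<in> Q" using assms(4)[OF x] Q by auto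
  then show ?thesis using prime_pow_mem[OF Q(1)] x assms by auto
 qed
 then show "m \<subseteq> Q" unfolding assms(3) using Q(1) by (intro genideal_minimal primeideal.axioms(1)) auto
qed

lemma mprim_fp:
 assumes "mprim I" "q > 0"
 shows "mprim (FP I q)"
 unfolding mprim_def
proof (intro conjI ballI)
 have I: "I \<subseteq> CR" using assms idealD(1) by (auto simp: mprim_def)
 show "ideal (FP I q) R" using I by (rule fp_ideal)
 fix y assume y: "y \<in> m"
 then have yc: "y \<in> CR" using m_facts by auto
 obtain N :: nat where "y [^] N \<in> I" using assms y by (auto simp: mprim_def)
 then have "(y [^] N) [^] q \<in> FP I q" by (rule fp_mem[OF I])
 then show "\<exists>N::nat. y [^] N \<in> FP I q" using yc by (auto simp: nat_pow_pow)
qed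

lemma m_mprim: "mprim m"
 unfolding mprim_def using m_ideal m_facts(8) by (auto intro!: exI[of _ "Suc 0"])

end

text \<open>The numerical content of regularity: R/m^[q] has length q^d for every power q of p. The
  flatness of Frobenius is derived from this count alone; \<open>regular_len\<close> supplies it for
  regular local rings.\<close>

locale noeth_local_len = noeth_local +
 fixes p d :: nat and X
 assumes X: "finite X" "X \<subseteq> CR" "m = Idl X"
  and frp: "frob R p" and p2: "p \<ge> 2"
  and len: "clen (FP m (p ^ e)) (CR) ((p ^ e) ^ d)"
begin

lemma frq: "frob R (p ^ e)"
 using frob_pow[OF frp] .

lemma qpos: "p ^ e > 0"
 using p2 by auto

text \<open>In a simple step J' = J + Rx the ideal (J : x) contains \<open>m\<close>, so (J^[q] :
  x^q) contains m^[q]. The corresponding step between Frobenius powers is R modulo this colon and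
  has length at most q^d.\<close>

lemma clen_fp_le:
 assumes "clen I J k"
 shows "\<exists>k'\<le>(p ^ e) ^ d * k. clen (FP I (p ^ e)) (FP J (p ^ e)) k'"
 using assms
proof induction
 case base
 then show ?case using clen.base[OF fp_ideal[OF idealD(1)]] by auto
next
 case (step J k J')
 let ?q = "p ^ e"
 obtain k' where k': "k' \<le> ?q ^ d * k" "clen (FP I ?q) (FP J ?q) k'"
  using step by auto
 obtain x where x: "ideal J R" "x \<in> CR" "x \<notin> J" "J' = adj R J x" "\<forall>a\<in>m. a \<otimes> x \<in> J"
  using step(2) by (auto simp: cov_def)
 have Jc: "J \<subseteq> CR" using idealD(1)[OF x(1)] .
 have Jq: "ideal (FP J ?q) R" using Jc by (rule fp_ideal)
 let ?D = "colon R (FP J ?q) {x [^] ?q}"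
 have D: "ideal ?D R" using Jq x by auto
 have "m \<subseteq> colon R J {x}" using x m_facts by (auto simp: colon_single)
 then have "FP m ?q \<subseteq> ?D"
  using fp_mono[of m "colon R J {x}" ?q] fp_colon_sub[OF x(1,2), of ?q] by (auto simp: colon_def)
 then obtain i j where ij: "i + j = ?q ^ d" "clen ?D (CR) j"
  using clen_split[OF len[of e] D] idealD(1)[OF D] by metis
 have "clen (FP J ?q) (FP J' ?q) j"
  unfolding x(4) fp_adj[OF frq x(1,2)] using ij x by (intro clen_colon Jq) auto
 from clen_trans[OF this k'(2)] show ?case using k' ij
  by (intro exI[of _ "k' + j"]) (auto simp: add.commute intro: add_le_mono)
qed

text \<open>Pinching: for some Q = p^n the ideal I contains m^[Q]. \<open>clen_fp_le\<close> bounds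
  the two lengths from m^[Qq] to I^[q] and from I^[q] to R by q^d times the lengths from m^[Q] to I
  and from I to R, while the sum of the two is known to be (Qq)^d. Hence both bounds are
  equalities.\<close>

lemma clen_fp:
 assumes "mprim I" "clen I (CR) k"
 shows "clen (FP I (p ^ e)) (CR) ((p ^ e) ^ d * k)"
proof -
 let ?q = "p ^ e"
 have I: "ideal I R" using assms by (simp add: mprim_def)
 have "\<exists>n. \<forall>x\<in>X. x [^] (n::nat) \<in> I"
 proof -
  have "\<forall>x\<in>X. \<exists>n::nat. x [^] n \<in> I" using assms(1) X genideal_self[OF X(2)] unfolding mprim_def by blast
  then obtain f where f: "!!x. x \<in> X ==> x [^] (f x :: nat) \<in> I" by metis
  have "x [^] Max (insert 0 (f ` X)) \<in> I" if "x \<in> X" for x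
   using pow_mem_mono[OF I f[OF that]] that X by auto
  then show ?thesis by auto
 qed
 then obtain n :: nat where n: "!!x. x \<in> X ==> x [^] n \<in> I" by auto
 let ?Q = "p ^ n"
 have "n \<le> ?Q" using p2 by (simp add: less_imp_le power_gt_expt)
 \<comment> \<open>The ideal m^[Q] is generated by the Q-th powers of the generators
   \<open>X\<close>, and n-th powers of these already lie in I, where n is at most Q.\<close>
 then have "FP m ?Q \<subseteq> I"
  unfolding X(3) fp_Idl[OF frq X(2)] using pow_mem_mono[OF I n] X by (intro genideal_minimal I) auto
 then obtain a b where ab: "a + b = ?Q ^ d" "clen (FP m ?Q) I a" "clen I (CR) b"
  using clen_split[OF len[of n] I] idealD(1)[OF I] by metis
 have bk: "b = k" using clen_unique[OF ab(3) assms(2)] .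
 obtain a' where a': "a' \<le> ?q ^ d * a" "clen (FP (FP m ?Q) ?q) (FP I ?q) a'"
  using clen_fp_le[OF ab(2)] by blast
 obtain b' where b': "b' \<le> ?q ^ d * b" "clen (FP I ?q) (CR) b'"
  using clen_fp_le[OF ab(3), of e] fp_carrier by auto
 have "clen (FP m (p ^ (n + e))) (CR) (a' + b')"
  using clen_trans[OF b'(2) a'(2)] fp_fp[OF frq frq m_ideal] by (simp add: power_add)
 then have "a' + b' = (p ^ (n + e)) ^ d" using clen_unique len by blast
 also have "... = ?q ^ d * (a + b)" unfolding ab(1) by (simp add: power_add power_mult_distrib)
 finally have "b' = ?q ^ d * b" using a'(1) b'(1) by (simp add: distrib_left)
 then show ?thesis using b'(2) bk by simp
qed

text \<open>One inclusion is general, so equal colengths suffice. The colength of (I^[q] : y^q) is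
  the length of (I + Ry)^[q] / I^[q]; by \<open>clen_fp\<close> this is q^d times the length of (I +
  Ry)/I, that is q^d times the colength of (I : y), which is the colength of (I : y)^[q].\<close>

lemma flat_mprim:
 assumes "mprim I" "y \<in> CR"
 shows "colon R (FP I (p ^ e)) {y [^] (p ^ e)} = FP (colon R I {y}) (p ^ e)"
proof -
 let ?q = "p ^ e" let ?D = "colon R I {y}"
 have I: "ideal I R" using assms by (simp add: mprim_def)
 have Ic: "I \<subseteq> CR" using idealD(1)[OF I] .
 have D: "ideal ?D R" using I assms by auto
 have Iy: "ideal (adj R I y) R" using I assms by auto
 have mD: "mprim ?D" "mprim (adj R I y)"
  using mprim_mono[OF assms(1)] colon_sub[OF I] adj_sub[OF I] assms D Iy by auto
 obtain b where b: "clen ?D (CR) b" using clen_ex[OF mD(1)] by auto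
 obtain c where c: "clen (adj R I y) (CR) c" using clen_ex[OF mD(2)] by auto
 have "clen I (CR) (b + c)" using clen_trans[OF c clen_colon[OF b I assms(2)]] .
 then have 1: "clen (FP I ?q) (CR) (?q ^ d * (b + c))" by (rule clen_fp[OF assms(1)])
 have 2: "clen (FP (adj R I y) ?q) (CR) (?q ^ d * c)" by (rule clen_fp[OF mD(2) c])
 have 3: "clen (FP ?D ?q) (CR) (?q ^ d * b)" by (rule clen_fp[OF mD(1) b])
 have Iq: "ideal (FP I ?q) R" using Ic by (rule fp_ideal)
 let ?E = "colon R (FP I ?q) {y [^] ?q}"
 have E: "ideal ?E R" using Iq assms by auto
 have "mprim ?E" using mprim_mono[OF mprim_fp[OF assms(1) qpos[of e]] E] colon_sub[OF Iq] assms by auto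
 then obtain l where l: "clen ?E (CR) l" using clen_ex by auto
 have "clen (FP I ?q) (FP (adj R I y) ?q) l"
  unfolding fp_adj[OF frq I assms(2)] using l assms by (intro clen_colon Iq) auto
 from clen_trans[OF 2 this] have "l + ?q ^ d * c = ?q ^ d * (b + c)" using clen_unique 1 by blast
 then have lb: "l = ?q ^ d * b" by (simp add: distrib_left)
 obtain i j where ij: "i + j = ?q ^ d * b" "clen (FP ?D ?q) ?E i" "clen ?E (CR) j"
  using clen_split[OF 3 E fp_colon_sub[OF I assms(2)]] idealD(1)[OF E] by metis
 have "j = l" using clen_unique[OF ij(3) l] .
 then have "i = 0" using ij lb by simp
 then show ?thesis using clen_0 ij(2) by metis
qed

text \<open>Reduction to the m-primary ideal I + (x^N : x in X). For large N its colon by y lies in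
  (I : y) + (x^s : x in X), and the Frobenius power of the latter lies in (I : y)^[q] + (x^s : x in
  X). As s is arbitrary, Krull intersection finishes.\<close>

lemma flat_local:
 assumes "ideal I R" "y \<in> CR"
 shows "colon R (FP I (p ^ e)) {y [^] (p ^ e)} = FP (colon R I {y}) (p ^ e)"
proof
 let ?q = "p ^ e" let ?D = "colon R I {y}"
 show "FP ?D ?q \<subseteq> colon R (FP I ?q) {y [^] ?q}"
  using fp_colon_sub[OF assms] .
 have Ic: "I \<subseteq> CR" using idealD(1)[OF assms(1)] .
 have D: "ideal ?D R" using assms by auto
 have Dc: "?D \<subseteq> CR" by (auto simp: colon_def)
 have Dq: "ideal (FP ?D ?q) R" using Dc by (rule fp_ideal)
 show "colon R (FP I ?q) {y [^] ?q} \<subseteq> FP ?D ?q"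
 proof
  fix c assume "c \<in> colon R (FP I ?q) {y [^] ?q}"
  then have c: "c \<in> CR" "c \<otimes> y [^] ?q \<in> FP I ?q" by (auto simp: colon_single)
  show "c \<in> FP ?D ?q"
  proof (rule krull_local[OF Dq c(1) X])
   fix s :: nat
   obtain N :: nat where N: "!!n. n \<ge> N ==> colon R (Idl (I \<union> pows n X)) {y} \<subseteq> Idl (?D \<union> pows s X)"
    using AR_colon[OF assms X(1,2), of s] by auto
   let ?I = "Idl (I \<union> pows N X)"
   have g: "I \<union> pows N X \<subseteq> CR" using Ic X by auto
   have gI: "ideal ?I R" using g by (rule genideal_ideal)
   have "mprim ?I"
    using genideal_self[OF g] by (intro mprim_gens[OF gI X(2,3)]) blast
   have "FP I ?q \<subseteq> FP ?I ?q"
    using genideal_self[OF g] idealD(1)[OF gI] by (intro fp_mono) auto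
   then have "c \<in> colon R (FP ?I ?q) {y [^] ?q}" using c by (auto simp: colon_single)
   then have "c \<in> FP (colon R ?I {y}) ?q" using flat_mprim[OF \<open>mprim ?I\<close> assms(2)] by simp
   moreover have g': "?D \<union> pows s X \<subseteq> CR" using Dc X by auto
   ultimately have "c \<in> FP (Idl (?D \<union> pows s X)) ?q"
    using fp_mono[OF N[OF order_refl] idealD(1)[OF genideal_ideal[OF g']]] by blast
   also have "... = Idl ((%x. x [^] ?q) ` (?D \<union> pows s X))" using fp_Idl[OF frq g'] .
   also have "... \<subseteq> Idl (FP ?D ?q \<union> pows s X)"
   proof (intro genideal_minimal image_subsetI)
    have g2: "FP ?D ?q \<union> pows s X \<subseteq> CR" using idealD(1)[OF Dq] X by auto
    show i: "ideal (Idl (FP ?D ?q \<union> pows s X)) R" using g2 by (rule genideal_ideal)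
    fix z assume "z \<in> ?D \<union> pows s X"
    then show "z [^] ?q \<in> Idl (FP ?D ?q \<union> pows s X)"
    proof
     assume "z \<in> ?D"
     then show ?thesis using fp_mem[OF Dc] genideal_self[OF g2] by blast
    next
     assume "z \<in> pows s X"
     then have z: "z \<in> Idl (FP ?D ?q \<union> pows s X)" "z \<in> CR"
      using genideal_self[OF g2] g2 by auto
     have "z [^] (1::nat) \<in> Idl (FP ?D ?q \<union> pows s X)" using z by simp
     then show ?thesis using pow_mem_mono[OF i _ _ z(2)] qpos by (metis less_eq_Suc_le One_nat_def)
    qed
   qed
   finally show "c \<in> Idl (FP ?D ?q \<union> pows s X)" .
  qed
 qed
qed

end

section \<open>Krull's principal ideal theorem\<close>

context noeth_local
begin

text \<open>Kaplansky's argument for Krull's principal ideal theorem: for \<open>u\<close> a high power of \<open>x\<close>,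
 comparing lengths of ideals between \<open>Q0 + (u\<^sup>2)\<close> and \<open>Q0 + (u, y)\<close> puts \<open>u\<close> into \<open>Q0 + (u\<^sup>2, y)\<close>.\<close>

lemma krull_pit_local:
 assumes Q0: "primeideal Q0 R" and Q1: "primeideal Q1 R" and sub: "Q0 \<subset> Q1"
  and x: "x \<in> m" and mp: "mprim (adj R Q0 x)"
 shows "x \<in> Q1"
proof (rule ccontr)
 assume xQ1: "x \<notin> Q1"
 interpret Q0: primeideal Q0 R by fact
 interpret Q1: primeideal Q1 R by fact
 note Q0f = idealD[OF Q0.is_ideal] note Q1f = idealD[OF Q1.is_ideal]
 have xc: "x \<in> CR" using x m_facts by auto
 obtain y where y: "y \<in> Q1" "y \<notin> Q0" using sub by auto
 have yc: "y \<in> CR" using y Q1f by auto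
 let ?Y = "adj R Q0 y"
 have Y: "ideal ?Y R" using yc Q0.is_ideal by auto
 obtain n :: nat where st: "!!k. n \<le> k ==> colon R ?Y {x [^] k} = colon R ?Y {x [^] n}"
  using colon_stable[OF Y xc] by blast
 \<comment> \<open>Beyond the stable exponent, b u^2 in Q0 + (y) implies b u in Q0 + (y). The
   successor keeps u inside \<open>m\<close>.\<close>
 define u where "u = x [^] Suc n"
 have uc: "u \<in> CR" using xc by (simp add: u_def)
 have um: "u \<in> m" unfolding u_def using x xc m_facts by simp
 have uQ1: "u \<notin> Q1" unfolding u_def using prime_pow_mem[OF Q1 _ xc] xQ1 by blast
 then have uQ0: "u \<notin> Q0" using sub by auto
 have uu: "u \<otimes> u = x [^] (Suc n + Suc n)" unfolding u_def using xc by (simp only: nat_pow_mult)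
 have stab: "b \<otimes> u \<in> ?Y" if "b \<in> CR" "b \<otimes> (u \<otimes> u) \<in> ?Y" for b
 proof -
  have "b \<in> colon R ?Y {x [^] (Suc n + Suc n)}" using that uu by (simp add: colon_single)
  also have "... = colon R ?Y {x [^] Suc n}" using st[of "Suc n + Suc n"] st[of "Suc n"] by simp
  finally show ?thesis unfolding u_def by (simp only: colon_single)
 qed
 define A where "A = adj R Q0 u"
 define B where "B = adj R Q0 (u \<otimes> u)"
 define C where "C = adj R B (u \<otimes> y)"
 have A: "ideal A R" and B: "ideal B R" and C: "ideal C R"
  using uc yc Q0.is_ideal by (auto simp: A_def B_def C_def)
 define G where "G = adj R A y"
 have G: "ideal G R" unfolding G_def using A yc by auto
 have mpow: "mprim (adj R Q0 (x [^] k))" for k :: nat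
 proof (rule mprim_criterion)
  fix Q assume Q: "primeideal Q R" "adj R Q0 (x [^] k) \<subseteq> Q"
  have "x [^] k \<in> Q" "Q0 \<subseteq> Q" using Q adj_self[OF Q0.is_ideal] adj_sub[OF Q0.is_ideal] xc by blast+
  then have "adj R Q0 x \<subseteq> Q"
   using prime_pow_mem[OF Q(1) _ xc] primeideal.axioms(1)[OF Q(1)] by (intro adj_minimal) auto
  then show "m \<subseteq> Q" using mprim_prime_sub[OF mp Q(1)] by simp
 qed (use xc Q0.is_ideal in auto)
 have mA: "mprim A" "mprim B" unfolding A_def B_def uu using mpow by (simp_all only: u_def)
 obtain a where a: "clen A (CR) a" using clen_ex[OF mA(1)] by auto
 have AG: "A \<subseteq> G" unfolding G_def using A yc by (rule adj_sub)
 obtain g where g: "clen A G g" using clen_split[OF a G AG] idealD(1)[OF G] by metis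
 have Q0A: "Q0 \<subseteq> A" "u \<in> A" unfolding A_def using adj_sub adj_self Q0.is_ideal uc by auto
 have Q0B: "Q0 \<subseteq> B" "u \<otimes> u \<in> B" unfolding B_def using adj_sub adj_self Q0.is_ideal uc by auto
 have BC: "B \<subseteq> C" "u \<otimes> y \<in> C" unfolding C_def using adj_sub adj_self B uc yc by auto
 have AGy: "y \<in> G" unfolding G_def using A yc adj_self by auto
 note Af = idealD[OF A] note Bf = idealD[OF B] note Cf = idealD[OF C]
 have BA: "B \<subseteq> A" unfolding B_def using Q0A Af uc by (intro adj_minimal A) auto
 have cancel: "t \<in> Q0" if "t \<in> CR" "t \<otimes> v \<in> Q0" "v \<notin> Q0" "v \<in> CR" for t v
  using Q0.I_prime that by blast
 \<comment> \<open>Together with B + (u) = A this makes A/B isomorphic to R/A, of length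
   \<open>a\<close>.\<close>
 have "colon R B {u} = A"
 proof
  show "A \<subseteq> colon R B {u}" unfolding A_def
  proof (rule adj_minimal)
   show "ideal (colon R B {u}) R" "u \<in> colon R B {u}" using B uc Q0B by (auto simp: colon_single)
   show "Q0 \<subseteq> colon R B {u}" using Q0B(1) colon_sub[OF B, of "{u}"] uc by auto
  qed
  show "colon R B {u} \<subseteq> A"
  proof
   fix t assume "t \<in> colon R B {u}"
   then obtain i r where t: "t \<in> CR" "t \<otimes> u = i \<oplus> r \<otimes> (u \<otimes> u)" "i \<in> Q0" "r \<in> CR"
    unfolding B_def by (auto simp: colon_single adj_def)
   have ic: "i \<in> CR" using t Q0f by auto
   have "(t \<ominus> r \<otimes> u) \<otimes> u = t \<otimes> u \<ominus> r \<otimes> (u \<otimes> u)" using t(1,4) uc by algebra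
   also have "... = i" using diff_eqI[OF t(2)] t ic uc by simp
   finally have "t \<ominus> r \<otimes> u \<in> Q0" using cancel[OF _ _ uQ0 uc] t(1,3,4) uc by auto
   then have "(t \<ominus> r \<otimes> u) \<oplus> r \<otimes> u \<in> A" unfolding A_def using t by (intro adj_I) auto
   moreover have "(t \<ominus> r \<otimes> u) \<oplus> r \<otimes> u = t" using t uc by (intro add_diff_cancel) auto
   ultimately show "t \<in> A" by simp
  qed
 qed
 moreover have "adj R B u = A"
 proof
  show "adj R B u \<subseteq> A" using BA Q0A by (intro adj_minimal A)
  have "Q0 \<subseteq> adj R B u" using Q0B(1) adj_sub[OF B uc] by blast
  then show "A \<subseteq> adj R B u" unfolding A_def by (intro adj_minimal adj_ideal B uc adj_self)
 qed
 ultimately have BAa: "clen B A a" using clen_colon[of B u a] a B uc by auto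
 have cQ0: "colon R Q0 {u} \<subseteq> A" using cancel[OF _ _ uQ0 uc] Q0A(1) by (auto simp: colon_single)
 \<comment> \<open>Multiplication by u is injective modulo the prime \<open>Q0\<close> and carries
   the pair A, G to the pair B, C, so C/B has the same length \<open>g\<close> as G/A.\<close>
 have "sadj R Q0 A u = B"
 proof
  have s: "ideal (sadj R Q0 A u) R" using Q0.is_ideal A uc by auto
  have "Q0 \<subseteq> sadj R Q0 A u" by (rule sadj_sub[OF Q0.is_ideal A uc])
  moreover have "u \<otimes> u \<in> sadj R Q0 A u" using sadj_I[OF Q0f(2) Q0A(2), of u] uc by simp
  ultimately show "B \<subseteq> sadj R Q0 A u" unfolding B_def by (intro adj_minimal s)
  have "t \<otimes> u \<in> B" if tA: "t \<in> A" for t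
  proof -
   obtain i r where t: "t = i \<oplus> r \<otimes> u" "i \<in> Q0" "r \<in> CR" using tA unfolding A_def by (rule adjE)
   have ic: "i \<in> CR" using t Q0f by auto
   have "t \<otimes> u = i \<otimes> u \<oplus> r \<otimes> (u \<otimes> u)" unfolding t(1) using t(3) ic uc by algebra
   then show ?thesis using t uc Bf Q0B Q0f by auto
  qed
  then show "sadj R Q0 A u \<subseteq> B" using Bf Q0B by (auto simp: sadj_def)
 qed
 moreover have "sadj R Q0 G u = C"
 proof
  have s: "ideal (sadj R Q0 G u) R" using Q0.is_ideal G uc by auto
  note sI = sadj_I[OF Q0f(2), of _ G u]
  have "Q0 \<subseteq> sadj R Q0 G u" by (rule sadj_sub[OF Q0.is_ideal G uc])
  moreover have "u \<otimes> u \<in> sadj R Q0 G u" using sI[of u] Q0A AG uc by auto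
  moreover have "u \<otimes> y \<in> sadj R Q0 G u" using sI[of y] AGy yc uc by (auto simp: m_comm)
  ultimately show "C \<subseteq> sadj R Q0 G u" unfolding C_def B_def by (intro adj_minimal s) auto
  have "t \<otimes> u \<in> C" if tG: "t \<in> G" for t
  proof -
   obtain i r s where t: "t = (i \<oplus> r \<otimes> u) \<oplus> s \<otimes> y" "i \<in> Q0" "r \<in> CR" "s \<in> CR"
    using tG unfolding G_def A_def by (elim adjE) blast
   have ic: "i \<in> CR" using t Q0f by auto
   have "t \<otimes> u = (i \<otimes> u \<oplus> r \<otimes> (u \<otimes> u)) \<oplus> s \<otimes> (u \<otimes> y)" unfolding t(1) using t(3,4) ic uc yc by algebra
   moreover have "i \<otimes> u \<in> C" "r \<otimes> (u \<otimes> u) \<in> C" "s \<otimes> (u \<otimes> y) \<in> C"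
    using Cf(5)[OF uc, of i] Cf(4)[OF t(3), of "u \<otimes> u"] Cf(4)[OF t(4) BC(2)] t(2) Q0B BC(1) by auto
   ultimately show ?thesis using Cf(3) by auto
  qed
  then show "sadj R Q0 G u \<subseteq> C" using Cf Q0B BC by (auto simp: sadj_def)
 qed
 ultimately have BCg: "clen B C g" using clen_scale[OF g Q0.is_ideal uc cQ0] by simp
 \<comment> \<open>Here the stability of u is spent: t y in \<open>C\<close> leads to b u^2 in Q0 +
   (y), hence b u in Q0 + (y), and then a factor y can be cancelled modulo
   \<open>Q0\<close>.\<close>
 have "colon R C {y} = A"
 proof
  show "A \<subseteq> colon R C {y}" unfolding A_def
  proof (rule adj_minimal)
   show "ideal (colon R C {y}) R" "u \<in> colon R C {y}" using C yc uc BC by (auto simp: colon_single)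
   show "Q0 \<subseteq> colon R C {y}" using Q0B(1) BC(1) colon_sub[OF C, of "{y}"] yc by auto
  qed
  show "colon R C {y} \<subseteq> A"
  proof
   fix t assume "t \<in> colon R C {y}"
   then obtain i b s where t: "t \<in> CR" "t \<otimes> y = (i \<oplus> b \<otimes> (u \<otimes> u)) \<oplus> s \<otimes> (u \<otimes> y)"
    "i \<in> Q0" "b \<in> CR" "s \<in> CR"
    unfolding C_def B_def by (auto simp: colon_single adj_def)
   have ic: "i \<in> CR" using t Q0f by auto
   define w where "w = t \<ominus> s \<otimes> u"
   have wc: "w \<in> CR" using t uc by (simp add: w_def)
   have "w \<otimes> y = t \<otimes> y \<ominus> s \<otimes> (u \<otimes> y)" unfolding w_def using t(1,5) uc yc by algebra
   also have "... = i \<oplus> b \<otimes> (u \<otimes> u)" using diff_eqI[OF t(2)] t ic uc yc by simp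
   finally have wy: "w \<otimes> y = i \<oplus> b \<otimes> (u \<otimes> u)" .
   have "b \<otimes> (u \<otimes> u) = \<ominus> i \<oplus> (i \<oplus> b \<otimes> (u \<otimes> u))"
    using t(4) ic uc by (simp add: a_assoc[symmetric] l_neg)
   also have "... = \<ominus> i \<oplus> w \<otimes> y" by (simp add: wy)
   also have "... \<in> ?Y" using t(3) wc Q0f(7) by (intro adj_I) auto
   finally have "b \<otimes> u \<in> ?Y" using stab t by auto
   then obtain j c where jc: "b \<otimes> u = j \<oplus> c \<otimes> y" "j \<in> Q0" "c \<in> CR" by (rule adjE)
   have jcc: "j \<in> CR" using jc Q0f by auto
   have "w \<otimes> y = i \<oplus> (b \<otimes> u) \<otimes> u" unfolding wy using t(4) uc by (simp add: m_assoc)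
   also have "... = (i \<oplus> j \<otimes> u) \<oplus> c \<otimes> (u \<otimes> y)" unfolding jc(1) using jc(3) jcc ic uc yc by algebra
   finally have wy': "w \<otimes> y = (i \<oplus> j \<otimes> u) \<oplus> c \<otimes> (u \<otimes> y)" .
   have "(w \<ominus> c \<otimes> u) \<otimes> y = w \<otimes> y \<ominus> c \<otimes> (u \<otimes> y)" using wc jc(3) uc yc by algebra
   also have "... = i \<oplus> j \<otimes> u" using diff_eqI[OF wy'] jc jcc ic uc yc by simp
   also have "... \<in> Q0" using t(3) jc(2) uc Q0f(3,5) by blast
   finally have "w \<ominus> c \<otimes> u \<in> Q0" using cancel[of "w \<ominus> c \<otimes> u" y] y(2) yc wc jc(3) uc by auto
   then have "(w \<ominus> c \<otimes> u) \<oplus> c \<otimes> u \<in> A" unfolding A_def using jc by (intro adj_I) auto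
   then have "w \<in> A" using add_diff_cancel[of w "c \<otimes> u"] wc jc uc by simp
   then have "w \<oplus> s \<otimes> u \<in> A" using Af(3,4) Q0A(2) t(5) by blast
   moreover have "w \<oplus> s \<otimes> u = t" unfolding w_def using add_diff_cancel t uc by simp
   ultimately show "t \<in> A" by simp
  qed
 qed
 then have CE: "clen C (adj R C y) a" using clen_colon[of C y a] a C yc by auto
 \<comment> \<open>Counted from \<open>B\<close>, both C + (y) and the larger ideal \<open>G\<close>
   have length g + a, so they coincide; and \<open>G\<close> contains u.\<close>
 have E1: "clen B (adj R C y) (g + a)" using clen_trans[OF CE BCg] .
 have E2: "clen B G (g + a)" using clen_trans[OF g BAa] by (simp add: add.commute)
 have "C \<subseteq> G" unfolding C_def using BA AG Q0A AGy idealD(4)[OF G uc AGy] by (intro adj_minimal G) auto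
 then have "adj R C y \<subseteq> G" using AGy by (intro adj_minimal G)
 then have "adj R C y = G" using clen_le_eq(2)[OF E1 E2] by simp
 then have "u \<in> adj R C y" using Q0A AG by auto
 then obtain c r where cr: "u = c \<oplus> r \<otimes> y" "c \<in> C" "r \<in> CR" by (rule adjE)
 from cr(2) obtain e s where es: "c = e \<oplus> s \<otimes> (u \<otimes> y)" "e \<in> B" "s \<in> CR" unfolding C_def by (rule adjE)
 from es(2) obtain i b where ib: "e = i \<oplus> b \<otimes> (u \<otimes> u)" "i \<in> Q0" "b \<in> CR" unfolding B_def by (rule adjE)
 have ic: "i \<in> CR" using ib Q0f by auto
 have "u = ((i \<oplus> b \<otimes> (u \<otimes> u)) \<oplus> s \<otimes> (u \<otimes> y)) \<oplus> r \<otimes> y" using cr(1) es(1) ib(1) by simp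
 also have "... = (i \<oplus> (s \<otimes> u \<oplus> r) \<otimes> y) \<oplus> b \<otimes> (u \<otimes> u)" using cr(3) es(3) ib(3) ic uc yc by algebra
 finally have ur: "u = (i \<oplus> (s \<otimes> u \<oplus> r) \<otimes> y) \<oplus> b \<otimes> (u \<otimes> u)" .
 \<comment> \<open>Writing u by elements of Q0 + (u^2, y) and moving the multiple of u^2 to the left
   leaves u times a unit inside Q0 + (y), which is contained in \<open>Q1\<close>.\<close>
 have "(\<one> \<ominus> b \<otimes> u) \<otimes> u = u \<ominus> b \<otimes> (u \<otimes> u)" using ib(3) uc by algebra
 also have "... = i \<oplus> (s \<otimes> u \<oplus> r) \<otimes> y" using diff_eqI[OF ur] cr(3) es(3) ib(3) ic uc yc by simp
 also have "... \<in> Q1"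
 proof -
  have "(s \<otimes> u \<oplus> r) \<otimes> y \<in> Q1" using Q1f(4)[OF _ y(1)] cr(3) es(3) uc by simp
  then show ?thesis using Q1f(3) ib(2) sub by blast
 qed
 finally have "u \<in> Q1" using unit_cancel_ideal[OF one_minus_unit Q1.is_ideal _ uc] m_facts(4)[OF ib(3) um] by blast
 then show False using uQ1 by simp
qed

end

section \<open>Localization\<close>

text \<open>An axiomatic description of R -> R_P: complements of P become units, every element is a
  fraction, and the kernel is the P-torsion. Later arguments use only this, never classes of
  fractions.\<close>

locale localization_map = R: cring R + S: cring S for R (structure) and S (structure) +
 fixes P h
 assumes P_prime: "primeideal P R" and hom: "h \<in> ring_hom R S"
  and h_unit: "s \<in> carrier R - P ==> h s \<in> Units S"
  and h_frac: "y \<in> carrier S ==> \<exists>r\<in>carrier R. \<exists>s\<in>carrier R - P. h s \<otimes>\<^bsub>S\<^esub> y = h r"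
  and h_ker: "r \<in> carrier R ==> h r = \<zero>\<^bsub>S\<^esub> ==> \<exists>s\<in>carrier R - P. s \<otimes> r = \<zero>"

locale mult_set = cring R for R (structure) +
 fixes W
 assumes W_sub: "W \<subseteq> carrier R" and W_one: "\<one> \<in> W" and W_mult: "a \<in> W ==> b \<in> W ==> a \<otimes> b \<in> W"
begin

lemma W_carrier: "a \<in> W ==> a \<in> carrier R"
 using W_sub by auto

definition fr :: "'a => 'a => ('a \<times> 'a) set" where
 "fr a s = frac_rel R W `` {(a, s)}"

abbreviation "loc \<equiv> localization R W"

lemma frac_rel_iff: "((a, s), (b, t)) \<in> frac_rel R W \<longleftrightarrow>
  a \<in> carrier R \<and> s \<in> W \<and> b \<in> carrier R \<and> t \<in> W \<and> (\<exists>u\<in>W. u \<otimes> (t \<otimes> a) = u \<otimes> (s \<otimes> b))"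
 by (auto simp: frac_rel_def)

lemma equiv_frac_rel: "equiv (carrier R \<times> W) (frac_rel R W)"
proof (rule equivI)
 show "refl_on (carrier R \<times> W) (frac_rel R W)"
  using W_one by (auto simp: refl_on_def frac_rel_iff)
 show "frac_rel R W \<subseteq> (carrier R \<times> W) \<times> (carrier R \<times> W)" by (auto simp: frac_rel_def)
 show "sym (frac_rel R W)" by (auto simp: sym_def frac_rel_iff) metis
 show "trans (frac_rel R W)"
 proof (rule transI)
  fix x y z assume xy: "(x, y) \<in> frac_rel R W" and yz: "(y, z) \<in> frac_rel R W"
  obtain a s b t c v where [simp]: "x = (a, s)" "y = (b, t)" "z = (c, v)" by (cases x, cases y, cases z) auto
  obtain u where u: "u \<in> W" "u \<otimes> (t \<otimes> a) = u \<otimes> (s \<otimes> b)" using xy by (auto simp: frac_rel_iff)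
  obtain w where w: "w \<in> W" "w \<otimes> (v \<otimes> b) = w \<otimes> (t \<otimes> c)" using yz by (auto simp: frac_rel_iff)
  have m: "a \<in> carrier R" "b \<in> carrier R" "c \<in> carrier R" "s \<in> W" "t \<in> W" "v \<in> W"
   using xy yz by (auto simp: frac_rel_iff)
  have cs: "s \<in> carrier R" "t \<in> carrier R" "v \<in> carrier R" "u \<in> carrier R" "w \<in> carrier R" using m u w W_carrier by auto
  have "(u \<otimes> w \<otimes> t) \<otimes> (v \<otimes> a) = (w \<otimes> v) \<otimes> (u \<otimes> (t \<otimes> a))" using m cs by (simp add: m_ac)
  also have "... = (u \<otimes> s) \<otimes> (w \<otimes> (v \<otimes> b))" unfolding u using m cs by (simp add: m_ac)
  also have "... = (u \<otimes> w \<otimes> t) \<otimes> (s \<otimes> c)" unfolding w using m cs by (simp add: m_ac)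
  finally show "(x, z) \<in> frac_rel R W" using m u(1) w(1) W_mult by (auto simp: frac_rel_iff)
 qed
qed

lemma fr_eq:
 assumes "a \<in> carrier R" "s \<in> W" "b \<in> carrier R" "t \<in> W"
 shows "fr a s = fr b t \<longleftrightarrow> (\<exists>u\<in>W. u \<otimes> (t \<otimes> a) = u \<otimes> (s \<otimes> b))"
 unfolding fr_def using eq_equiv_class_iff[OF equiv_frac_rel, of "(a, s)" "(b, t)"] assms
 by (simp add: frac_rel_iff)

lemma fr_eqI:
 assumes "a \<in> carrier R" "s \<in> W" "b \<in> carrier R" "t \<in> W" "t \<otimes> a = s \<otimes> b"
 shows "fr a s = fr b t"
 using assms fr_eq W_one by auto

lemma carrier_loc: "carrier loc = {fr a s | a s. a \<in> carrier R \<and> s \<in> W}"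
 by (auto simp: localization_def quotient_def fr_def)

lemma fr_carrier [simp]: "a \<in> carrier R ==> s \<in> W ==> fr a s \<in> carrier loc"
 by (auto simp: carrier_loc)

lemma fr_mem: "(b, t) \<in> fr a s \<longleftrightarrow> ((a, s), (b, t)) \<in> frac_rel R W"
 by (simp add: fr_def)

lemma UN_const: "A \<noteq> {} ==> (!!x. x \<in> A ==> f x = c) ==> (\<Union>x\<in>A. f x) = c"
 by auto

lemma fr_self: "a \<in> carrier R ==> s \<in> W ==> (a, s) \<in> fr a s"
 using W_one by (auto simp: fr_mem frac_rel_iff)

lemma mult_loc:
 assumes "a \<in> carrier R" "s \<in> W" "b \<in> carrier R" "t \<in> W"
 shows "fr a s \<otimes>\<^bsub>loc\<^esub> fr b t = fr (a \<otimes> b) (s \<otimes> t)"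
proof -
 have "fr (a' \<otimes> b') (s' \<otimes> t') = fr (a \<otimes> b) (s \<otimes> t)"
  if rr: "(a', s') \<in> fr a s" "(b', t') \<in> fr b t" for a' s' b' t'
 proof -
  obtain u where u: "u \<in> W" "u \<otimes> (s' \<otimes> a) = u \<otimes> (s \<otimes> a')" using rr by (auto simp: fr_mem frac_rel_iff)
  obtain w where w: "w \<in> W" "w \<otimes> (t' \<otimes> b) = w \<otimes> (t \<otimes> b')" using rr by (auto simp: fr_mem frac_rel_iff)
  have m: "a' \<in> carrier R" "b' \<in> carrier R" "s' \<in> W" "t' \<in> W" using rr by (auto simp: fr_mem frac_rel_iff)
  have cs: "s \<in> carrier R" "t \<in> carrier R" "s' \<in> carrier R" "t' \<in> carrier R" "u \<in> carrier R" "w \<in> carrier R"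
   using m assms u w W_carrier by auto
  have "(u \<otimes> w) \<otimes> ((s \<otimes> t) \<otimes> (a' \<otimes> b')) = (u \<otimes> (s \<otimes> a')) \<otimes> (w \<otimes> (t \<otimes> b'))"
   using m cs assms by (simp add: m_ac)
  also have "... = (u \<otimes> w) \<otimes> ((s' \<otimes> t') \<otimes> (a \<otimes> b))"
   unfolding u(2)[symmetric] w(2)[symmetric] using m cs assms by (simp add: m_ac)
  finally show ?thesis using m assms W_mult u w by (subst fr_eq) auto
 qed
 then have "fr a s \<otimes>\<^bsub>loc\<^esub> fr b t = (\<Union>x\<in>fr a s. fr (a \<otimes> b) (s \<otimes> t))"
  unfolding localization_def fr_def[symmetric] using fr_self[OF assms(3,4)] by (auto intro!: SUP_cong UN_const)
 also have "... = fr (a \<otimes> b) (s \<otimes> t)" using fr_self[OF assms(1,2)] by auto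
 finally show ?thesis .
qed

lemma add_loc:
 assumes "a \<in> carrier R" "s \<in> W" "b \<in> carrier R" "t \<in> W"
 shows "fr a s \<oplus>\<^bsub>loc\<^esub> fr b t = fr (t \<otimes> a \<oplus> s \<otimes> b) (s \<otimes> t)"
proof -
 have "fr (t' \<otimes> a' \<oplus> s' \<otimes> b') (s' \<otimes> t') = fr (t \<otimes> a \<oplus> s \<otimes> b) (s \<otimes> t)"
  if rr: "(a', s') \<in> fr a s" "(b', t') \<in> fr b t" for a' s' b' t'
 proof -
  obtain u where u: "u \<in> W" "u \<otimes> (s' \<otimes> a) = u \<otimes> (s \<otimes> a')" using rr by (auto simp: fr_mem frac_rel_iff)
  obtain w where w: "w \<in> W" "w \<otimes> (t' \<otimes> b) = w \<otimes> (t \<otimes> b')" using rr by (auto simp: fr_mem frac_rel_iff)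
  have m: "a' \<in> carrier R" "b' \<in> carrier R" "s' \<in> W" "t' \<in> W" using rr by (auto simp: fr_mem frac_rel_iff)
  have cs: "s \<in> carrier R" "t \<in> carrier R" "s' \<in> carrier R" "t' \<in> carrier R" "u \<in> carrier R" "w \<in> carrier R"
   using m assms u w W_carrier by auto
  have "(u \<otimes> w) \<otimes> ((s \<otimes> t) \<otimes> (t' \<otimes> a' \<oplus> s' \<otimes> b')) =
    (w \<otimes> t \<otimes> t') \<otimes> (u \<otimes> (s \<otimes> a')) \<oplus> (u \<otimes> s \<otimes> s') \<otimes> (w \<otimes> (t \<otimes> b'))"
   using m cs assms by (simp add: r_distr m_ac)
  also have "... = (u \<otimes> w) \<otimes> ((s' \<otimes> t') \<otimes> (t \<otimes> a \<oplus> s \<otimes> b))"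
   unfolding u(2)[symmetric] w(2)[symmetric] using m cs assms by (simp add: r_distr m_ac)
  finally show ?thesis using m cs assms W_mult u w by (subst fr_eq) auto
 qed
 then have "fr a s \<oplus>\<^bsub>loc\<^esub> fr b t = (\<Union>x\<in>fr a s. fr (t \<otimes> a \<oplus> s \<otimes> b) (s \<otimes> t))"
  unfolding localization_def fr_def[symmetric] using fr_self[OF assms(3,4)] by (auto intro!: SUP_cong UN_const)
 also have "... = fr (t \<otimes> a \<oplus> s \<otimes> b) (s \<otimes> t)" using fr_self[OF assms(1,2)] by auto
 finally show ?thesis .
qed

lemma one_loc: "\<one>\<^bsub>loc\<^esub> = fr \<one> \<one>" and zero_loc: "\<zero>\<^bsub>loc\<^esub> = fr \<zero> \<one>"
 by (simp_all add: localization_def fr_def)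

lemma loc_cases: "x \<in> carrier loc ==> (!!a s. x = fr a s ==> a \<in> carrier R ==> s \<in> W ==> Q) ==> Q"
 by (auto simp: carrier_loc)

lemma cring_loc: "cring loc"
proof (rule cringI)
 show "abelian_group loc"
 proof (rule abelian_groupI)
  fix x y assume "x \<in> carrier loc" "y \<in> carrier loc"
  then show "x \<oplus>\<^bsub>loc\<^esub> y \<in> carrier loc"
   by (elim loc_cases) (simp add: add_loc W_mult W_carrier)
  show "x \<oplus>\<^bsub>loc\<^esub> y = y \<oplus>\<^bsub>loc\<^esub> x" using \<open>x \<in> carrier loc\<close> \<open>y \<in> carrier loc\<close>
   by (elim loc_cases) (simp add: add_loc W_mult W_carrier a_comm m_comm)
 next
  show "\<zero>\<^bsub>loc\<^esub> \<in> carrier loc" by (simp add: zero_loc W_one)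
 next
  fix x y z assume "x \<in> carrier loc" "y \<in> carrier loc" "z \<in> carrier loc"
  then show "x \<oplus>\<^bsub>loc\<^esub> y \<oplus>\<^bsub>loc\<^esub> z = x \<oplus>\<^bsub>loc\<^esub> (y \<oplus>\<^bsub>loc\<^esub> z)"
   by (elim loc_cases) (simp add: add_loc W_mult W_carrier r_distr m_ac a_ac)
 next
  fix x assume "x \<in> carrier loc"
  then show "\<zero>\<^bsub>loc\<^esub> \<oplus>\<^bsub>loc\<^esub> x = x"
   by (elim loc_cases) (simp add: zero_loc add_loc W_one W_carrier)
 next
  fix x assume "x \<in> carrier loc"
  then obtain a s where x: "x = fr a s" "a \<in> carrier R" "s \<in> W" by (elim loc_cases)
  have "fr (\<ominus> a) s \<oplus>\<^bsub>loc\<^esub> x = fr \<zero> \<one>"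
   unfolding x(1) using x W_carrier W_mult W_one by (simp add: add_loc) (intro fr_eqI; simp add: r_minus l_neg)
  then show "\<exists>y\<in>carrier loc. y \<oplus>\<^bsub>loc\<^esub> x = \<zero>\<^bsub>loc\<^esub>"
   using x by (intro bexI[of _ "fr (\<ominus> a) s"]) (auto simp: zero_loc)
 qed
 show "comm_monoid loc"
 proof (rule comm_monoidI)
  fix x y assume "x \<in> carrier loc" "y \<in> carrier loc"
  then show "x \<otimes>\<^bsub>loc\<^esub> y \<in> carrier loc"
   by (elim loc_cases) (simp add: mult_loc W_mult)
  show "x \<otimes>\<^bsub>loc\<^esub> y = y \<otimes>\<^bsub>loc\<^esub> x" using \<open>x \<in> carrier loc\<close> \<open>y \<in> carrier loc\<close>
   by (elim loc_cases) (simp add: mult_loc W_mult W_carrier m_comm)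
 next
  fix x y z assume "x \<in> carrier loc" "y \<in> carrier loc" "z \<in> carrier loc"
  then show "x \<otimes>\<^bsub>loc\<^esub> y \<otimes>\<^bsub>loc\<^esub> z = x \<otimes>\<^bsub>loc\<^esub> (y \<otimes>\<^bsub>loc\<^esub> z)"
   by (elim loc_cases) (simp add: mult_loc W_mult W_carrier m_assoc)
 next
  fix x assume "x \<in> carrier loc"
  then show "\<one>\<^bsub>loc\<^esub> \<otimes>\<^bsub>loc\<^esub> x = x"
   by (elim loc_cases) (simp add: one_loc mult_loc W_one W_carrier)
 qed (simp add: one_loc W_one)
 fix x y z assume "x \<in> carrier loc" "y \<in> carrier loc" "z \<in> carrier loc"
 then obtain a s b t c v where *: "x = fr a s" "y = fr b t" "z = fr c v"
  "a \<in> carrier R" "b \<in> carrier R" "c \<in> carrier R" "s \<in> W" "t \<in> W" "v \<in> W"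
  by (elim loc_cases)
 have cs: "s \<in> carrier R" "t \<in> carrier R" "v \<in> carrier R" using * W_carrier by auto
 show "(x \<oplus>\<^bsub>loc\<^esub> y) \<otimes>\<^bsub>loc\<^esub> z = x \<otimes>\<^bsub>loc\<^esub> z \<oplus>\<^bsub>loc\<^esub> y \<otimes>\<^bsub>loc\<^esub> z"
  unfolding *(1-3) using *(4-) cs
  by (simp add: add_loc mult_loc W_mult) (intro fr_eqI; simp add: W_mult r_distr l_distr m_ac)
qed

end

section \<open>Localization at a prime\<close>

context cring
begin

lemma mult_set_prime: "primeideal P R ==> mult_set R (CR - P)"
proof -
 assume P: "primeideal P R"
 interpret P: primeideal P R by fact
 show "mult_set R (CR - P)"
  using P.I_prime P.I_notcarr ideal_carrier_iff[OF P.is_ideal] by unfold_locales auto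
qed

lemma localization_map_prime:
 assumes "primeideal P R"
 shows "localization_map R (localization R (CR - P)) P (%r. mult_set.fr R (CR - P) r \<one>)"
proof -
 interpret mult_set R "CR - P" using mult_set_prime[OF assms] .
 show ?thesis
 proof (intro localization_map.intro localization_map_axioms.intro cring_loc is_cring assms)
  show "(%r. fr r \<one>) \<in> ring_hom R loc"
   using W_one by (intro ring_hom_memI) (auto simp: mult_loc add_loc one_loc)
  fix s assume s: "s \<in> CR - P"
  have "fr \<one> s \<otimes>\<^bsub>loc\<^esub> fr s \<one> = \<one>\<^bsub>loc\<^esub>" "fr s \<one> \<otimes>\<^bsub>loc\<^esub> fr \<one> s = \<one>\<^bsub>loc\<^esub>"
   using s W_one by (simp_all add: mult_loc one_loc) (intro fr_eqI; simp)+
  then show "fr s \<one> \<in> Units loc" using s W_one by (auto simp: Units_def intro!: bexI[of _ "fr \<one> s"])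
 next
  fix y assume "y \<in> carrier loc"
  then obtain a s where y: "y = fr a s" "a \<in> CR" "s \<in> CR - P" by (elim loc_cases)
  have "fr s \<one> \<otimes>\<^bsub>loc\<^esub> y = fr a \<one>" unfolding y(1) using y W_one by (simp add: mult_loc) (intro fr_eqI; simp)
  then show "\<exists>r\<in>CR. \<exists>s\<in>CR - P. fr s \<one> \<otimes>\<^bsub>loc\<^esub> y = fr r \<one>" using y by blast
 next
  fix r assume r: "r \<in> CR" "fr r \<one> = \<zero>\<^bsub>loc\<^esub>"
  then have "\<exists>u\<in>CR - P. u \<otimes> (\<one> \<otimes> r) = u \<otimes> (\<one> \<otimes> \<zero>)" using fr_eq[of r \<one> \<zero> \<one>] W_one by (simp add: zero_loc)
  then show "\<exists>s\<in>CR - P. s \<otimes> r = \<zero>" using r by auto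
 qed
qed

end

section \<open>Extension and contraction of ideals\<close>

context localization_map
begin

sublocale h: ring_hom_cring R S h
 using hom by unfold_locales

lemma h_closed [simp]: "r \<in> carrier R ==> h r \<in> carrier S"
 by (rule h.hom_closed)

lemma h_pow: "r \<in> carrier R ==> h (r [^] (n::nat)) = h r [^]\<^bsub>S\<^esub> n"
 by (induction n) auto

lemma P_ideal: "ideal P R"
 using P_prime by (rule primeideal.axioms)

lemma nP_mult: "s \<in> carrier R - P ==> t \<in> carrier R - P ==> s \<otimes> t \<in> carrier R - P"
 using primeideal.I_prime[OF P_prime, of s t] by auto

lemma one_nP: "\<one> \<in> carrier R - P"
 using primeideal.I_notcarr[OF P_prime] R.ideal_carrier_iff[OF P_ideal] by auto

lemma h_eqE:
 assumes "r \<in> carrier R" "r' \<in> carrier R" "h r = h r'"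
 shows "\<exists>s\<in>carrier R - P. s \<otimes> r = s \<otimes> r'"
proof -
 have "h (r \<ominus> r') = \<zero>\<^bsub>S\<^esub>" using assms by (simp add: a_minus_def S.r_neg)
 then obtain s where s: "s \<in> carrier R - P" "s \<otimes> (r \<ominus> r') = \<zero>" using h_ker[of "r \<ominus> r'"] assms by auto
 have "s \<otimes> r \<ominus> s \<otimes> r' = \<zero>" using s assms by (simp add: a_minus_def R.r_distr R.r_minus)
 then have "s \<otimes> r = s \<otimes> r'" using s assms by (simp add: R.r_right_minus_eq)
 then show ?thesis using s by blast
qed

text \<open>The extended ideal I S, in the form that each element becomes the image of an element of
  I after one denominator is cleared.\<close>

definition ext :: "'a set => 'c set" where
 "ext I = {y \<in> carrier S. \<exists>s\<in>carrier R - P. \<exists>i\<in>I. h s \<otimes>\<^bsub>S\<^esub> y = h i}"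

definition ctr :: "'c set => 'a set" where
 "ctr J = {r \<in> carrier R. h r \<in> J}"

lemma ext_ideal: assumes "ideal I R" shows "ideal (ext I) S"
proof (rule S.ideal_intro)
 note I = R.idealD[OF assms]
 show "ext I \<subseteq> carrier S" by (auto simp: ext_def)
 show "\<zero>\<^bsub>S\<^esub> \<in> ext I" unfolding ext_def using one_nP I(2) by (auto intro!: bexI[of _ \<one>] bexI[of _ \<zero>])
 fix x y assume "x \<in> ext I" "y \<in> ext I"
 then obtain s i t j where *: "s \<in> carrier R - P" "i \<in> I" "h s \<otimes>\<^bsub>S\<^esub> x = h i" "x \<in> carrier S"
  "t \<in> carrier R - P" "j \<in> I" "h t \<otimes>\<^bsub>S\<^esub> y = h j" "y \<in> carrier S"
  by (auto simp: ext_def)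
 have c: "i \<in> carrier R" "j \<in> carrier R" "s \<in> carrier R" "t \<in> carrier R" using * I by auto
 have "h (s \<otimes> t) \<otimes>\<^bsub>S\<^esub> (x \<oplus>\<^bsub>S\<^esub> y) = h t \<otimes>\<^bsub>S\<^esub> (h s \<otimes>\<^bsub>S\<^esub> x) \<oplus>\<^bsub>S\<^esub> h s \<otimes>\<^bsub>S\<^esub> (h t \<otimes>\<^bsub>S\<^esub> y)"
  using c *(4,8) by (simp add: S.r_distr S.m_ac)
 also have "... = h (t \<otimes> i \<oplus> s \<otimes> j)" unfolding * using c by simp
 finally show "x \<oplus>\<^bsub>S\<^esub> y \<in> ext I" unfolding ext_def using nP_mult[OF *(1,5)] I(3)[OF I(4)[OF c(4) *(2)] I(4)[OF c(3) *(6)]] *(4,8)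
  by blast
next
 note I = R.idealD[OF assms]
 fix r x assume r: "r \<in> carrier S" and "x \<in> ext I"
 then obtain s i where *: "s \<in> carrier R - P" "i \<in> I" "h s \<otimes>\<^bsub>S\<^esub> x = h i" "x \<in> carrier S" by (auto simp: ext_def)
 obtain a t where at: "a \<in> carrier R" "t \<in> carrier R - P" "h t \<otimes>\<^bsub>S\<^esub> r = h a" using h_frac[OF r] by auto
 have c: "i \<in> carrier R" "s \<in> carrier R" "t \<in> carrier R" using * at I by auto
 have "h (s \<otimes> t) \<otimes>\<^bsub>S\<^esub> (r \<otimes>\<^bsub>S\<^esub> x) = (h t \<otimes>\<^bsub>S\<^esub> r) \<otimes>\<^bsub>S\<^esub> (h s \<otimes>\<^bsub>S\<^esub> x)"
  using c *(4) r by (simp add: S.m_ac)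
 also have "... = h (a \<otimes> i)" unfolding * at using c at by simp
 finally show "r \<otimes>\<^bsub>S\<^esub> x \<in> ext I" unfolding ext_def
  using nP_mult[OF *(1) at(2)] I(4)[OF at(1) *(2)] r *(4) by blast
qed

lemma ctr_ideal: assumes "ideal J S" shows "ideal (ctr J) R"
 using S.idealD[OF assms] by (intro R.ideal_intro) (auto simp: ctr_def)

lemma h_mem_ext:
 assumes "ideal I R" "r \<in> carrier R"
 shows "h r \<in> ext I \<longleftrightarrow> (\<exists>s\<in>carrier R - P. s \<otimes> r \<in> I)"
proof
 note I = R.idealD[OF assms(1)]
 assume "h r \<in> ext I"
 then obtain s i where *: "s \<in> carrier R - P" "i \<in> I" "h s \<otimes>\<^bsub>S\<^esub> h r = h i" by (auto simp: ext_def)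
 have c: "s \<in> carrier R" "i \<in> carrier R" using * I by auto
 have "h (s \<otimes> r) = h i" using * c assms by simp
 then obtain t where t: "t \<in> carrier R - P" "t \<otimes> (s \<otimes> r) = t \<otimes> i" using h_eqE[of "s \<otimes> r" i] c assms by auto
 have "(t \<otimes> s) \<otimes> r \<in> I" using t c assms I(4)[of t i] * by (simp add: R.m_assoc)
 then show "\<exists>s\<in>carrier R - P. s \<otimes> r \<in> I" using nP_mult[OF t(1) *(1)] by blast
next
 assume "\<exists>s\<in>carrier R - P. s \<otimes> r \<in> I"
 then obtain s where s: "s \<in> carrier R - P" "s \<otimes> r \<in> I" by auto
 then have "h s \<otimes>\<^bsub>S\<^esub> h r = h (s \<otimes> r)" using assms by simp
 then show "h r \<in> ext I" unfolding ext_def using s assms by blast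
qed

lemma h_in_ext: "ideal I R ==> i \<in> I ==> h i \<in> ext I"
proof -
 assume I: "ideal I R" "i \<in> I"
 then have "i \<in> carrier R" "\<one> \<otimes> i \<in> I" using R.idealD[OF I(1)] by auto
 then show ?thesis using h_mem_ext[OF I(1)] one_nP by blast
qed

lemma mem_by_h:
 assumes "ideal J S" "y \<in> carrier S" "s \<in> carrier R - P" "h s \<otimes>\<^bsub>S\<^esub> y \<in> J"
 shows "y \<in> J"
proof -
 have u: "h s \<in> Units S" using h_unit assms by auto
 have "inv\<^bsub>S\<^esub> (h s) \<otimes>\<^bsub>S\<^esub> (h s \<otimes>\<^bsub>S\<^esub> y) \<in> J" using S.idealD(4)[OF assms(1)] assms(4) u by auto
 moreover have "inv\<^bsub>S\<^esub> (h s) \<otimes>\<^bsub>S\<^esub> (h s \<otimes>\<^bsub>S\<^esub> y) = y"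
  using u assms by (simp add: S.m_assoc[symmetric] S.Units_closed)
 ultimately show ?thesis by simp
qed

lemma ext_least: assumes "ideal J S" "h ` I \<subseteq> J" shows "ext I \<subseteq> J"
 using mem_by_h[OF assms(1)] assms(2) by (auto simp: ext_def)

lemma ext_ctr: assumes "ideal J S" shows "ext (ctr J) = J"
proof
 show "ext (ctr J) \<subseteq> J" by (rule ext_least[OF assms]) (auto simp: ctr_def)
 show "J \<subseteq> ext (ctr J)"
 proof
  fix y assume y: "y \<in> J"
  have yc: "y \<in> carrier S" using y S.idealD[OF assms] by auto
  obtain a t where at: "a \<in> carrier R" "t \<in> carrier R - P" "h t \<otimes>\<^bsub>S\<^esub> y = h a" using h_frac[OF yc] by auto
  have "h a \<in> J" using S.idealD(4)[OF assms, of "h t" y] y at by auto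
  then show "y \<in> ext (ctr J)" unfolding ext_def using at yc by (auto simp: ctr_def)
 qed
qed

lemma ext_Idl: assumes "A \<subseteq> carrier R" shows "ext (Idl A) = Idl\<^bsub>S\<^esub> (h ` A)"
proof
 have hA: "h ` A \<subseteq> carrier S" using assms by auto
 note i = S.genideal_ideal[OF hA]
 have "Idl A \<subseteq> ctr (Idl\<^bsub>S\<^esub> (h ` A))" using assms S.genideal_self[OF hA]
  by (intro R.genideal_minimal ctr_ideal i) (auto simp: ctr_def)
 then show "ext (Idl A) \<subseteq> Idl\<^bsub>S\<^esub> (h ` A)" by (intro ext_least i) (auto simp: ctr_def)
 show "Idl\<^bsub>S\<^esub> (h ` A) \<subseteq> ext (Idl A)" using R.genideal_self[OF assms] R.genideal_ideal[OF assms]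
  by (intro S.genideal_minimal ext_ideal) (auto intro: h_in_ext)
qed

lemma ext_mono: "I \<subseteq> J ==> ext I \<subseteq> ext J"
 by (auto simp: ext_def)

lemma ext_P_notin_unit: "\<one>\<^bsub>S\<^esub> \<notin> ext P"
proof
 assume "\<one>\<^bsub>S\<^esub> \<in> ext P"
 then have "h \<one> \<in> ext P" by simp
 then obtain s where "s \<in> carrier R - P" "s \<otimes> \<one> \<in> P" using h_mem_ext[OF P_ideal] by blast
 then show False by auto
qed

lemma S_unit_or: assumes "y \<in> carrier S" shows "y \<in> ext P \<or> y \<in> Units S"
proof -
 obtain a t where at: "a \<in> carrier R" "t \<in> carrier R - P" "h t \<otimes>\<^bsub>S\<^esub> y = h a" using h_frac[OF assms] by auto
 show ?thesis
 proof (cases "a \<in> P")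
  case True
  then show ?thesis unfolding ext_def using at assms by blast
 next
  case False
  then have "h t \<otimes>\<^bsub>S\<^esub> y \<in> Units S" using h_unit at by auto
  then have "y \<in> Units S" using S.prod_unit_l[of "h t" y] h_unit[OF at(2)] at(2) assms by auto
  then show ?thesis by simp
 qed
qed

lemma ext_P_maximal: "maximalideal (ext P) S"
proof (rule maximalidealI)
 show "ideal (ext P) S" using ext_ideal[OF P_ideal] .
 show "carrier S \<noteq> ext P" using ext_P_notin_unit by auto
 fix J assume J: "ideal J S" "ext P \<subseteq> J" "J \<subseteq> carrier S"
 show "J = ext P \<or> J = carrier S"
 proof (rule ccontr)
  assume n: "\<not> ?thesis"
  then obtain y where y: "y \<in> J" "y \<notin> ext P" using J by auto
  then have u: "y \<in> Units S" using S_unit_or J by auto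
  have "inv\<^bsub>S\<^esub> y \<otimes>\<^bsub>S\<^esub> y \<in> J" by (rule S.idealD(4)[OF J(1) S.Units_inv_closed[OF u] y(1)])
  then have "\<one>\<^bsub>S\<^esub> \<in> J" using u by simp
  then show False using n S.ideal_carrier_iff[OF J(1)] by auto
 qed
qed

lemma noetherian_S: assumes "noetherian_ring R" shows "noetherian_ring S"
proof (rule S.noetherian_ringI)
 interpret N: noetherian_ring R by fact
 fix J assume J: "ideal J S"
 obtain A where A: "A \<subseteq> carrier R" "finite A" "ctr J = Idl A" using N.finetely_gen[OF ctr_ideal[OF J]] by auto
 have "J = Idl\<^bsub>S\<^esub> (h ` A)" using ext_ctr[OF J] ext_Idl[OF A(1)] A(3) by simp
 then show "\<exists>A\<subseteq>carrier S. finite A \<and> J = Idl\<^bsub>S\<^esub> A" using A by (intro exI[of _ "h ` A"]) auto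
qed

lemma noeth_local_S: assumes "noetherian_ring R" shows "noeth_local S (ext P)"
 by (intro noeth_local.intro noeth.intro noeth_local_axioms.intro noetherian_S assms
   S.is_cring ext_P_maximal S_unit_or)

lemma ctr_ext_prime:
 assumes "primeideal Q R" "Q \<subseteq> P"
 shows "ctr (ext Q) = Q"
proof -
 interpret Q: primeideal Q R by fact
 have "h r \<in> ext Q \<longleftrightarrow> r \<in> Q" if "r \<in> carrier R" for r
  using h_mem_ext[OF Q.is_ideal that] Q.I_prime[of _ r] assms(2) that one_nP h_in_ext[OF Q.is_ideal, of r] by auto
 then show ?thesis using R.idealD(1)[OF Q.is_ideal] by (auto simp: ctr_def)
qed

lemma ext_prime:
 assumes "primeideal Q R" "Q \<subseteq> P"
 shows "primeideal (ext Q) S"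
proof (rule primeidealI)
 interpret Q: primeideal Q R by fact
 show "ideal (ext Q) S" using ext_ideal Q.is_ideal .
 show "cring S" by (rule S.is_cring)
 show "carrier S \<noteq> ext Q" using ext_mono[OF assms(2)] ext_P_notin_unit by auto
 fix a b assume ab: "a \<in> carrier S" "b \<in> carrier S" "a \<otimes>\<^bsub>S\<^esub> b \<in> ext Q"
 obtain x s where x: "x \<in> carrier R" "s \<in> carrier R - P" "h s \<otimes>\<^bsub>S\<^esub> a = h x" using h_frac[OF ab(1)] by auto
 obtain y t where y: "y \<in> carrier R" "t \<in> carrier R - P" "h t \<otimes>\<^bsub>S\<^esub> b = h y" using h_frac[OF ab(2)] by auto
 have "h (x \<otimes> y) = (h s \<otimes>\<^bsub>S\<^esub> a) \<otimes>\<^bsub>S\<^esub> (h t \<otimes>\<^bsub>S\<^esub> b)" using x y by simp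
 also have "... = (h s \<otimes>\<^bsub>S\<^esub> h t) \<otimes>\<^bsub>S\<^esub> (a \<otimes>\<^bsub>S\<^esub> b)" using x(1,2) y(1,2) ab by (simp add: S.m_ac)
 also have "... \<in> ext Q" using S.idealD(4)[OF ext_ideal[OF Q.is_ideal] _ ab(3)] x y by simp
 finally have "x \<otimes> y \<in> ctr (ext Q)" using x y by (simp add: ctr_def)
 then have "x \<in> Q \<or> y \<in> Q" using ctr_ext_prime[OF assms] Q.I_prime x y by auto
 then show "a \<in> ext Q \<or> b \<in> ext Q"
  using x y ab by (auto simp: ext_def)
qed

lemma ctr_prime:
 assumes "primeideal J S"
 shows "primeideal (ctr J) R"
proof (rule primeidealI)
 interpret J: primeideal J S by fact
 show "ideal (ctr J) R" using ctr_ideal J.is_ideal .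
 show "cring R" by (rule R.is_cring)
 show "carrier R \<noteq> ctr J"
  using J.I_notcarr S.ideal_carrier_iff[OF J.is_ideal] by (metis (mono_tags, lifting) R.one_closed ctr_def h.hom_one mem_Collect_eq)
 show "a \<in> ctr J \<or> b \<in> ctr J" if "a \<in> carrier R" "b \<in> carrier R" "a \<otimes> b \<in> ctr J" for a b
  using that J.I_prime[of "h a" "h b"] by (auto simp: ctr_def)
qed

lemma common_denom:
 assumes "finite I" "!!i. i \<in> I ==> y i \<in> carrier S"
 shows "\<exists>t\<in>carrier R - P. \<forall>i\<in>I. \<exists>r\<in>carrier R. h t \<otimes>\<^bsub>S\<^esub> y i = h r"
 using assms
proof (induction I rule: finite_induct)
 case (insert i I)
 then obtain t where t: "t \<in> carrier R - P" "\<forall>i\<in>I. \<exists>r\<in>carrier R. h t \<otimes>\<^bsub>S\<^esub> y i = h r" by auto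
 obtain a s where as: "a \<in> carrier R" "s \<in> carrier R - P" "h s \<otimes>\<^bsub>S\<^esub> y i = h a" using h_frac[of "y i"] insert.prems by auto
 have "\<exists>r\<in>carrier R. h (s \<otimes> t) \<otimes>\<^bsub>S\<^esub> y j = h r" if j: "j \<in> insert i I" for j
 proof (cases "j = i")
  case True
  have "h (s \<otimes> t) \<otimes>\<^bsub>S\<^esub> y i = h t \<otimes>\<^bsub>S\<^esub> (h s \<otimes>\<^bsub>S\<^esub> y i)" using t(1) as(2) insert.prems by (simp add: S.m_ac)
  also have "... = h (t \<otimes> a)" using t as by simp
  finally show ?thesis using True t as by blast
 next
  case False
  then obtain r where r: "r \<in> carrier R" "h t \<otimes>\<^bsub>S\<^esub> y j = h r" using t j by auto
  have "h (s \<otimes> t) \<otimes>\<^bsub>S\<^esub> y j = h s \<otimes>\<^bsub>S\<^esub> (h t \<otimes>\<^bsub>S\<^esub> y j)" using t(1) as(2) insert.prems j by (simp add: S.m_ac)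
  also have "... = h (s \<otimes> r)" using r as by simp
  finally show ?thesis using r as by blast
 qed
 then show ?case using nP_mult[OF as(2) t(1)] by blast
qed (use one_nP in auto)

text \<open>A common denominator t of x and y turns the identity into one between images of elements
  of R; the factor h(t)^q is a unit and cancels.\<close>

lemma frob_S: assumes "frob R q" shows "frob S q"
 unfolding frob_def
proof (intro conjI ballI)
 show "q > 0" using assms by (simp add: frob_def)
 fix x y assume xy: "x \<in> carrier S" "y \<in> carrier S"
 obtain t where t: "t \<in> carrier R - P" "\<forall>i\<in>{x, y}. \<exists>r\<in>carrier R. h t \<otimes>\<^bsub>S\<^esub> i = h r"
  using common_denom[of "{x, y}" "%i. i"] xy by auto
 then obtain a b where ab: "a \<in> carrier R" "h t \<otimes>\<^bsub>S\<^esub> x = h a" "b \<in> carrier R" "h t \<otimes>\<^bsub>S\<^esub> y = h b" by auto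
 have hp: "h (r [^] q) = h r [^]\<^bsub>S\<^esub> q" if "r \<in> carrier R" for r
  using that h_pow by simp
 have tc: "t \<in> carrier R" using t by auto
 have u: "h t [^]\<^bsub>S\<^esub> q \<in> Units S" using h_unit[OF t(1)] by (rule S.Units_pow_closed)
 have "h t [^]\<^bsub>S\<^esub> q \<otimes>\<^bsub>S\<^esub> (x \<oplus>\<^bsub>S\<^esub> y) [^]\<^bsub>S\<^esub> q = (h t \<otimes>\<^bsub>S\<^esub> x \<oplus>\<^bsub>S\<^esub> h t \<otimes>\<^bsub>S\<^esub> y) [^]\<^bsub>S\<^esub> q"
  using xy tc by (simp add: S.nat_pow_distrib[symmetric] S.r_distr)
 also have "... = h ((a \<oplus> b) [^] q)" using ab hp by simp
 also have "... = h (a [^] q \<oplus> b [^] q)" using R.frob_add[OF assms ab(1,3)] by simp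
 also have "... = (h t \<otimes>\<^bsub>S\<^esub> x) [^]\<^bsub>S\<^esub> q \<oplus>\<^bsub>S\<^esub> (h t \<otimes>\<^bsub>S\<^esub> y) [^]\<^bsub>S\<^esub> q" using ab hp by simp
 also have "... = h t [^]\<^bsub>S\<^esub> q \<otimes>\<^bsub>S\<^esub> (x [^]\<^bsub>S\<^esub> q \<oplus>\<^bsub>S\<^esub> y [^]\<^bsub>S\<^esub> q)"
  using xy tc by (simp add: S.nat_pow_distrib S.r_distr)
 finally show "(x \<oplus>\<^bsub>S\<^esub> y) [^]\<^bsub>S\<^esub> q = x [^]\<^bsub>S\<^esub> q \<oplus>\<^bsub>S\<^esub> y [^]\<^bsub>S\<^esub> q"
  using u xy by (simp add: S.Units_l_cancel)
qed

lemma ext_fp: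
 assumes "frob R q" "ideal I R"
 shows "ext (frobenius_power R I q) = frobenius_power S (ext I) q"
proof -
 have I: "I \<subseteq> carrier R" using R.idealD(1)[OF assms(2)] .
 have "ext (frobenius_power R I q) = Idl\<^bsub>S\<^esub> (h ` (%x. x [^] q) ` I)"
  unfolding frobenius_power_def using I by (intro ext_Idl) auto
 also have "h ` (%x. x [^] q) ` I = (%x. x [^]\<^bsub>S\<^esub> q) ` h ` I"
  unfolding image_image using I h_pow by (intro image_cong) auto
 also have "Idl\<^bsub>S\<^esub> ... = frobenius_power S (Idl\<^bsub>S\<^esub> (h ` I)) q"
  using I by (intro S.fp_Idl[symmetric] frob_S assms) auto
 also have "Idl\<^bsub>S\<^esub> (h ` I) = ext I" using ext_Idl[OF I] R.Idl_ideal[OF assms(2)] by simp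
 finally show ?thesis .
qed

end

section \<open>Regular local rings\<close>

definition upd :: "('a => 'b) => 'a => 'b => 'a => 'b" where
 "upd f x v = (%y. if y = x then v else f y)"

lemma upd_simps [simp]: "upd f x v x = v" "y \<noteq> x ==> upd f x v y = f y" "upd f x (f x) = f"
 by (auto simp: upd_def)

section \<open>Chains of primes and dimension\<close>

context noeth
begin

lemma is_noetherian: "noetherian_ring R"
 by (rule noetherian_ring_axioms)

text \<open>If there were no such prime, P2 would be minimal over P0 + (x). After localizing at P2
  the principal ideal theorem puts x into P1, and then P1 itself is such a prime.\<close>

lemma prime_gap:
 assumes P: "primeideal P0 R" "primeideal P1 R" "primeideal P2 R" and sub: "P0 \<subset> P1" "P1 \<subset> P2"
  and x: "x \<in> P2"
 shows "\<exists>P'. primeideal P' R \<and> P0 \<subseteq> P' \<and> x \<in> P' \<and> P' \<subset> P2"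
proof (rule ccontr)
 assume neg: "\<not> ?thesis"
 define h where "h = (%r. mult_set.fr R (CR - P2) r \<one>)"
 define S where "S = localization R (CR - P2)"
 interpret L: localization_map R S P2 h
  unfolding h_def S_def by (rule localization_map_prime[OF P(3)])
 interpret S: noeth_local S "L.ext P2" by (rule L.noeth_local_S[OF is_noetherian])
 have id: "ideal P0 R" "ideal P2 R" using P primeideal.axioms(1) by auto
 have xc: "x \<in> CR" using x idealD(8)[OF id(2)] by auto
 have s02: "P0 \<subseteq> P2" "P1 \<subseteq> P2" using sub by auto
 have e0: "ideal (L.ext P0) S" using L.ext_ideal[OF id(1)] .
 have "S.mprim (adj S (L.ext P0) (h x))"
 proof (rule S.mprim_criterion)
  fix J assume J: "primeideal J S" "adj S (L.ext P0) (h x) \<subseteq> J"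
  have Ji: "ideal J S" using J(1) by (rule primeideal.axioms)
  have "L.ctr J \<subseteq> P2"
  proof -
   have "J \<noteq> carrier S" using primeideal.I_notcarr[OF J(1)] by auto
   then have "J \<subseteq> L.ext P2" using S.proper_sub_m[OF Ji] by simp
   then have "L.ctr J \<subseteq> L.ctr (L.ext P2)" by (auto simp: L.ctr_def)
   then show ?thesis using L.ctr_ext_prime[OF P(3) order_refl] by simp
  qed
  moreover have "P0 \<subseteq> L.ctr J"
  proof
   fix r assume r: "r \<in> P0"
   have "h r \<in> L.ext P0" by (rule L.h_in_ext[OF id(1) r])
   then have "h r \<in> J" using J(2) L.S.adj_sub[OF e0 L.h_closed[OF xc]] by blast
   then show "r \<in> L.ctr J" using idealD(8)[OF id(1) r] by (simp add: L.ctr_def)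
  qed
  moreover have "h x \<in> J" using J(2) L.S.adj_self[OF e0 L.h_closed[OF xc]] by blast
  then have "x \<in> L.ctr J" using xc by (simp add: L.ctr_def)
  ultimately have "\<not> L.ctr J \<subset> P2" "L.ctr J \<subseteq> P2" using neg L.ctr_prime[OF J(1)] by auto
  then have "L.ctr J = P2" by auto
  then show "L.ext P2 \<subseteq> J" using L.ext_ctr[OF Ji] by simp
 qed (use e0 xc in auto)
 moreover have "L.ext P0 \<noteq> L.ext P1"
  using sub(1) L.ctr_ext_prime[OF P(1) s02(1)] L.ctr_ext_prime[OF P(2) s02(2)] by (metis psubset_eq)
 then have "L.ext P0 \<subset> L.ext P1" using L.ext_mono[OF psubset_imp_subset[OF sub(1)]] by (rule psubsetI[rotated])
 moreover have "h x \<in> L.ext P2" by (rule L.h_in_ext[OF id(2) x])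
 ultimately have "h x \<in> L.ext P1"
  using S.krull_pit_local[OF L.ext_prime[OF P(1) s02(1)] L.ext_prime[OF P(2) s02(2)]] by blast
 then have "x \<in> P1" using L.ctr_ext_prime[OF P(2) s02(2)] xc by (auto simp: L.ctr_def)
 then show False using neg P(2) sub by blast
qed

definition pchain :: "(nat => 'a set) => nat => bool" where
 "pchain P n \<longleftrightarrow> (\<forall>i\<le>n. primeideal (P i) R) \<and> (\<forall>i<n. P i \<subset> P (Suc i))"

lemma pchain_extend:
 assumes "pchain P n" "P n \<subset> Q" "primeideal Q R"
 shows "pchain (P(Suc n := Q)) (Suc n)"
 using assms by (auto simp: pchain_def le_Suc_eq less_Suc_eq)

text \<open>Requiring a given element of the top prime to lie in the bottom prime costs one link.
  Working downwards from the top, \<open>prime_gap\<close> exchanges the last but one prime for one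
  that contains x, and the induction treats the chain below it.\<close>

lemma pchain_move:
 assumes "pchain P (Suc n)" "x \<in> P (Suc n)"
 shows "\<exists>P'. pchain P' n \<and> P' n = P (Suc n) \<and> x \<in> P' 0 \<and> P 0 \<subseteq> P' 0"
 using assms
proof (induction n arbitrary: P)
 case 0
 then show ?case by (intro exI[of _ "%_. P 1"]) (auto simp: pchain_def)
next
 case (Suc n)
 have pr: "primeideal (P i) R" if "i \<le> Suc (Suc n)" for i using Suc.prems(1) that by (auto simp: pchain_def)
 have st: "P i \<subset> P (Suc i)" if "i < Suc (Suc n)" for i using Suc.prems(1) that by (auto simp: pchain_def)
 have pc: "pchain P (Suc n)" using pr st by (auto simp: pchain_def)
 show ?case
 proof (cases "x \<in> P (Suc n)")
  case True
  then obtain P' where P': "pchain P' n" "P' n = P (Suc n)" "x \<in> P' 0" "P 0 \<subseteq> P' 0" using Suc.IH pc by blast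
  then have "pchain (P'(Suc n := P (Suc (Suc n)))) (Suc n)" using st pr by (intro pchain_extend) auto
  moreover have "(P'(Suc n := P (Suc (Suc n)))) (Suc n) = P (Suc (Suc n))" "(P'(Suc n := P (Suc (Suc n)))) 0 = P' 0" by simp_all
  ultimately show ?thesis using P' by metis
 next
  case False
  obtain T where T: "primeideal T R" "P n \<subseteq> T" "x \<in> T" "T \<subset> P (Suc (Suc n))"
   using prime_gap[OF pr pr pr st st Suc.prems(2)] by force
  have "P n \<noteq> T" using T False st[of n] by auto
  then have "pchain (P(Suc n := T)) (Suc n)" using T pc by (intro pchain_extend) (auto simp: pchain_def)
  moreover have "(P(Suc n := T)) (Suc n) = T" "(P(Suc n := T)) 0 = P 0" by simp_all
  ultimately obtain P' where P': "pchain P' n" "P' n = T" "x \<in> P' 0" "P 0 \<subseteq> P' 0"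
   using Suc.IH[of "P(Suc n := T)"] T(3) by metis
  then have "pchain (P'(Suc n := P (Suc (Suc n)))) (Suc n)" using T pr by (intro pchain_extend) auto
  moreover have "(P'(Suc n := P (Suc (Suc n)))) (Suc n) = P (Suc (Suc n))" "(P'(Suc n := P (Suc (Suc n)))) 0 = P' 0" by simp_all
  ultimately show ?thesis using P' by metis
 qed
qed

text \<open>States that R/I has dimension at least \<open>n\<close>, without forming the
  quotient.\<close>

definition has_chain :: "'a set => nat => bool" where
 "has_chain I n \<longleftrightarrow> (\<exists>P. pchain P n \<and> I \<subseteq> P 0)"

lemma Idl_Un_adj:
 assumes "ideal I R" "x \<in> CR" "Y \<subseteq> CR"
 shows "Idl (adj R I x \<union> Y) = Idl (I \<union> insert x Y)"
proof
 have c: "adj R I x \<union> Y \<subseteq> CR" "I \<union> insert x Y \<subseteq> CR"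
  using assms idealD(1)[OF adj_ideal[OF assms(1,2)]] idealD(1)[OF assms(1)] by auto
 note i = genideal_ideal[OF c(1)] genideal_ideal[OF c(2)] note s = genideal_self[OF c(1)] genideal_self[OF c(2)]
 have "adj R I x \<subseteq> Idl (I \<union> insert x Y)" using s(2) by (intro adj_minimal i) auto
 then show "Idl (adj R I x \<union> Y) \<subseteq> Idl (I \<union> insert x Y)" using s(2) by (intro genideal_minimal i) auto
 show "Idl (I \<union> insert x Y) \<subseteq> Idl (adj R I x \<union> Y)"
  using s(1) adj_sub[OF assms(1,2)] adj_self[OF assms(1,2)] by (intro genideal_minimal i) auto
qed

end

context noeth_local
begin

lemma prime_sub_m: "primeideal Q R ==> Q \<subseteq> m"
 using proper_sub_m[OF primeideal.axioms(1)] primeideal.I_notcarr by blast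

text \<open>Dividing by one element of \<open>m\<close> lowers the dimension by at most one.\<close>

lemma has_chain_adj:
 assumes "has_chain I (Suc n)" "x \<in> m" "ideal I R"
 shows "has_chain (adj R I x) n"
proof -
 obtain P where P: "pchain P (Suc n)" "I \<subseteq> P 0" using assms(1) by (auto simp: has_chain_def)
 have "P n \<subset> P (Suc n)" "primeideal (P (Suc n)) R" "pchain P n" using P by (auto simp: pchain_def)
 then have "P n \<subset> m" using prime_sub_m by blast
 \<comment> \<open>The top prime is replaced by \<open>m\<close> so that it contains x, as
   \<open>pchain_move\<close> requires.\<close>
 then have "pchain (P(Suc n := m)) (Suc n)" using \<open>pchain P n\<close> m_prime by (intro pchain_extend)
 from pchain_move[OF this, of x] obtain P' where P': "pchain P' n" "x \<in> P' 0" "P 0 \<subseteq> P' 0"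
  using assms(2) by auto
 have "ideal (P' 0) R" using P' by (auto simp: pchain_def intro: primeideal.axioms(1))
 then have "adj R I x \<subseteq> P' 0" using P P' by (intro adj_minimal) auto
 then show ?thesis using P' by (auto simp: has_chain_def)
qed

text \<open>The dimension of R/I is at most the number of generators of m modulo I: each generator
  divided out costs at most one link, and a chain above m has none.\<close>

lemma chain_upper:
 assumes "finite Y" "Y \<subseteq> m" "ideal I R" "m \<subseteq> Idl (I \<union> Y)"
 shows "\<not> has_chain I (Suc (card Y))"
 using assms
proof (induction Y arbitrary: I rule: finite_induct)
 case empty
 have mI: "m \<subseteq> I" using empty Idl_ideal by simp
 show ?case
 proof
  assume "has_chain I (Suc (card {}))"
  then obtain P where P: "pchain P 1" "I \<subseteq> P 0" by (auto simp: has_chain_def)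
  have "P 0 \<subset> P 1" "primeideal (P 1) R" using P by (auto simp: pchain_def)
  then show False using prime_sub_m[of "P 1"] mI P by blast
 qed
next
 case (insert y Y)
 have y: "y \<in> m" "y \<in> CR" "Y \<subseteq> CR" using insert m_facts by auto
 have "m \<subseteq> Idl (adj R I y \<union> Y)" using Idl_Un_adj[OF insert.prems(2) y(2,3)] insert by simp
 then have "\<not> has_chain (adj R I y) (Suc (card Y))" using insert.IH insert.prems y by auto
 then show ?case using has_chain_adj[OF _ y(1) insert.prems(2)] insert.hyps by auto
qed

text \<open>A regular local ring is a domain, stated for R/I. Induction on the number of parameters:
  for y in \<open>Y\<close> outside the bottom prime P0 of a longest chain, I + (y) is prime by
  induction and equals P0 + (y) by dimension. Hence P0 = I + y P0, and Krull intersection gives P0 =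
  I.\<close>

lemma regular_prime:
 assumes "finite Y" "m = Idl (I \<union> Y)" "ideal I R" "Y \<subseteq> CR" "has_chain I (card Y)"
 shows "primeideal I R"
 using assms
proof (induction "card Y" arbitrary: I Y)
 case 0
 then have "m = I" using Idl_ideal by simp
 then show ?case using m_prime by simp
next
 case (Suc e)
 have c: "I \<union> Y \<subseteq> CR" using Suc.prems idealD(1) by auto
 have Ym: "I \<union> Y \<subseteq> m" unfolding Suc.prems(2) by (rule genideal_self[OF c])
 obtain P where P: "pchain P (Suc e)" "I \<subseteq> P 0" using Suc by (auto simp: has_chain_def)
 have P0: "primeideal (P 0) R" using P by (auto simp: pchain_def)
 have P0i: "ideal (P 0) R" using P0 by (rule primeideal.axioms)
 note P0f = idealD[OF P0i]
 have "P 0 \<subset> P 1" "primeideal (P 1) R" using P by (auto simp: pchain_def)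
 then have "P 0 \<subset> m" using prime_sub_m by blast
 \<comment> \<open>The chain has positive length, so P0 is strictly smaller than \<open>m\<close>
   and cannot contain all generators of \<open>m\<close>.\<close>
 then obtain y where y: "y \<in> Y" "y \<notin> P 0"
  using genideal_minimal[OF P0i, of "I \<union> Y"] P Suc.prems(2) by auto
 have yc: "y \<in> CR" and ym: "y \<in> m" using y Suc.prems Ym by auto
 define Y' where "Y' = Y - {y}"
 have Y': "finite Y'" "Y' \<subseteq> CR" "e = card Y'" "Y = insert y Y'" "Y' \<subseteq> m"
  using Suc y Ym by (auto simp: Y'_def)
 have hP0: "has_chain (P 0) (Suc e)" using P(1) by (auto simp: has_chain_def)
 have hI: "has_chain I (Suc e)" using P by (auto simp: has_chain_def)
 have mI: "m = Idl (adj R I y \<union> Y')" using Idl_Un_adj[OF Suc.prems(3) yc Y'(2)] Suc.prems(2) Y'(4) by simp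
 have mP: "m = Idl (adj R (P 0) y \<union> Y')"
 proof
  have c1: "adj R (P 0) y \<union> Y' \<subseteq> CR" using idealD(1)[OF adj_ideal[OF P0i yc]] Y' by auto
  show "m \<subseteq> Idl (adj R (P 0) y \<union> Y')" unfolding mI using adj_mono[OF P(2)] by (intro Idl_mono c1) auto
  have "adj R (P 0) y \<subseteq> m" using prime_sub_m[OF P0] ym by (intro adj_minimal m_ideal)
  then show "Idl (adj R (P 0) y \<union> Y') \<subseteq> m" using Y' by (intro genideal_minimal m_ideal) auto
 qed
 have pI: "primeideal (adj R I y) R"
  using Suc.hyps(1)[OF Y'(3,1) mI] has_chain_adj[OF hI ym Suc.prems(3)] Suc.prems(3) yc Y' by auto
 have hQ: "has_chain (adj R (P 0) y) e" using has_chain_adj[OF hP0 ym P0i] .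
 have "adj R (P 0) y = adj R I y"
 proof (rule ccontr)
  \<comment> \<open>A strict inclusion would allow I + (y), which is prime, to be put below the
    chain for P0 + (y). The resulting length e + 1 exceeds the number e of remaining
    generators.\<close>
  assume ne: "adj R (P 0) y \<noteq> adj R I y"
  obtain K where K: "pchain K e" "adj R (P 0) y \<subseteq> K 0" using hQ by (auto simp: has_chain_def)
  have "adj R I y \<subset> K 0" using ne adj_mono[OF P(2), of y] K by auto
  then have "pchain (case_nat (adj R I y) K) (Suc e)"
   using K pI by (auto simp: pchain_def split: nat.split)
  then have "has_chain (adj R I y) (Suc (card Y'))" unfolding has_chain_def Y'(3)[symmetric]
   by (intro exI[of _ "case_nat (adj R I y) K"]) auto
  then show False using chain_upper[OF Y'(1,5)] mI Suc.prems(3) yc by auto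
 qed
 then have sub: "P 0 \<subseteq> adj R I y" using adj_sub[OF P0i yc] by simp
 have "p \<in> I" if p: "p \<in> P 0" for p
 proof -
  \<comment> \<open>Iterating P0 = I + y P0: an r in P0 has the form j + s y with j in I, and s y in
    P0 forces s into P0 because y is outside this prime.\<close>
  have ex: "\<exists>i\<in>I. \<exists>r\<in>P 0. p = i \<oplus> r \<otimes> y [^] n" for n :: nat
  proof (induction n)
   case 0
   have "p = \<zero> \<oplus> p \<otimes> y [^] (0::nat)" using p P0f by auto
   then show ?case using idealD(2)[OF Suc.prems(3)] p by blast
  next
   case (Suc n)
   then obtain i r where ir: "i \<in> I" "r \<in> P 0" "p = i \<oplus> r \<otimes> y [^] n" by auto
   have "r \<in> adj R I y" using ir(2) sub by auto
   then obtain j s where js: "r = j \<oplus> s \<otimes> y" "j \<in> I" "s \<in> CR" by (rule adjE)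
   have cc: "i \<in> CR" "j \<in> CR" using ir js idealD(8)[OF \<open>ideal I R\<close>] by auto
   have "j \<oplus> s \<otimes> y \<in> P 0" using ir js by simp
   then have "s \<otimes> y \<in> P 0" using ideal_minus_cancel[OF P0i, of j] js P yc by auto
   then have "s \<in> P 0" using primeideal.I_prime[OF P0 js(3) yc] y by auto
   moreover have "p = (i \<oplus> j \<otimes> y [^] n) \<oplus> s \<otimes> y [^] Suc n"
    unfolding ir(3) js(1) nat_pow_Suc using cc js(3) yc nat_pow_closed[OF yc, of n] by algebra
   moreover have "i \<oplus> j \<otimes> y [^] n \<in> I" using ir js yc idealD[OF \<open>ideal I R\<close>] by auto
   ultimately show ?case by blast
  qed
  have "\<exists>a\<in>Idl {y}. (\<one> \<ominus> a) \<otimes> p \<in> I"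
  proof (rule krull_intersect[OF Suc.prems(3)])
   show "p \<in> CR" using p P0f by auto
   fix n :: nat
   obtain i r where ir: "i \<in> I" "r \<in> P 0" "p = i \<oplus> r \<otimes> y [^] n" using ex by blast
   have c2: "I \<union> (%x. x [^] n) ` {y} \<subseteq> CR" using c yc by auto
   note g = idealD[OF genideal_ideal[OF c2]] and s = genideal_self[OF c2]
   have "r \<otimes> y [^] n \<in> Idl (I \<union> (%x. x [^] n) ` {y})" using s ir P0f by (intro g(4)) auto
   then show "p \<in> Idl (I \<union> (%x. x [^] n) ` {y})" unfolding ir(3) using ir(1) s by (intro g(3)) auto
  qed (use yc in auto)
  then obtain a where a: "a \<in> Idl {y}" "(\<one> \<ominus> a) \<otimes> p \<in> I" by auto
  have "a \<in> m" using a genideal_minimal[OF m_ideal, of "{y}"] ym by auto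
  then show "p \<in> I" using unit_cancel_ideal[OF one_minus_unit Suc.prems(3) a(2)] p P0f by auto
 qed
 then have "P 0 = I" using P(2) by auto
 then show ?case using P0 by simp
qed

end

text \<open>\<open>X\<close> is a regular system of parameters: the chain above zero gives dimension
  at least \<open>card X\<close>, and \<open>chain_upper\<close> shows that it cannot be
  larger.\<close>

locale regular_local = noeth_local +
 fixes X
 assumes X: "finite X" "X \<subseteq> CR" "m = Idl X" and dim: "has_chain {\<zero>} (card X)"
begin

lemma X_m: "X \<subseteq> m"
 unfolding X(3) using genideal_self[OF X(2)] .

lemma chain_T:
 assumes "T \<subseteq> X"
 shows "has_chain (Idl T) (card (X - T))"
proof -
 have "finite T" using assms X finite_subset by auto
 then show ?thesis using assms
 proof (induction T rule: finite_induct)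
  case empty
  have "Idl {} = {\<zero>}" using genideal_minimal[OF zeroideal, of "{}"] genideal_ideal[of "{}"] idealD(2) by auto
  then show ?case using dim by simp
 next
  case (insert x T)
  have c: "T \<subseteq> CR" "x \<in> CR" "x \<in> m" using insert X X_m by auto
  have "X - T = insert x (X - insert x T)" using insert by auto
  then have "card (X - T) = Suc (card (X - insert x T))" using X by (metis Diff_iff card_insert_disjoint finite_Diff insertI1)
  then show ?case using insert has_chain_adj[of "Idl T" _ x] c genideal_ideal[OF c(1)]
   by (simp add: Idl_insert_adj)
 qed
qed

lemma m_T: "T \<subseteq> X ==> m = Idl (Idl T \<union> (X - T))"
proof -
 assume T: "T \<subseteq> X"
 then have Tc: "T \<subseteq> CR" using X by auto
 have c: "Idl T \<union> (X - T) \<subseteq> CR" using idealD(1)[OF genideal_ideal[OF Tc]] X by auto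
 have "X \<subseteq> Idl (Idl T \<union> (X - T))" using genideal_self[OF c] genideal_self[OF Tc] by blast
 moreover have "Idl T \<subseteq> m" using X_m T by (intro genideal_minimal m_ideal) auto
 ultimately show ?thesis using genideal_minimal[OF genideal_ideal[OF c], of X] X_m
   genideal_minimal[OF m_ideal, of "Idl T \<union> (X - T)"] X(3) by auto
qed

lemma Idl_T_prime: "T \<subseteq> X ==> primeideal (Idl T) R"
 using X by (intro regular_prime[of "X - T"] m_T chain_T genideal_ideal) auto

text \<open>Otherwise m would have fewer generators modulo \<open>T\<close> than the dimension left
  by \<open>chain_T\<close> allows.\<close>

lemma X_notin:
 assumes "T \<subseteq> X" "x \<in> X - T"
 shows "x \<notin> Idl T"
proof
 assume x: "x \<in> Idl T"
 have Tc: "T \<subseteq> CR" using assms X by auto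
 have Ti: "ideal (Idl T) R" using genideal_ideal[OF Tc] .
 have "Idl T \<union> (X - T) = Idl T \<union> (X - T - {x})" using x by auto
 then have "m \<subseteq> Idl (Idl T \<union> (X - T - {x}))" using m_T[OF assms(1)] by simp
 then have "\<not> has_chain (Idl T) (Suc (card (X - T - {x})))" using X X_m Ti by (intro chain_upper) auto
 moreover have "Suc (card (X - T - {x})) = card (X - T)" using assms X by (intro card_Suc_Diff1) auto
 ultimately show False using chain_T[OF assms(1)] by simp
qed

definition pw :: "('a => nat) => 'a set => 'a set" where
 "pw a T = Idl ((%x. x [^] a x) ` T)"

lemma pw_c: "T \<subseteq> X ==> (%x. x [^] (a x :: nat)) ` T \<subseteq> CR"
 using X by auto

lemma pw_ideal: "T \<subseteq> X ==> ideal (pw a T) R"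
 unfolding pw_def by (intro genideal_ideal pw_c)

lemma pw_insert: "T \<subseteq> X ==> x \<in> X ==> x \<notin> T ==> pw (upd a x (n)) (insert x T) = adj R (pw a T) (x [^] n)"
proof -
 assume *: "T \<subseteq> X" "x \<in> X" "x \<notin> T"
 have "(%y. y [^] upd a x (n) y) ` T = (%y. y [^] a y) ` T"
  using * by (intro image_cong) (auto simp: upd_def)
 then have "(%y. y [^] upd a x (n) y) ` (insert x T) = insert (x [^] n) ((%y. y [^] a y) ` T)" by simp
 then show ?thesis unfolding pw_def using pw_c[OF *(1), of a] X * by (simp add: Idl_insert_adj subset_iff)
qed

text \<open>The remaining parameters are nonzerodivisors modulo powers of those in \<open>T\<close>.
  Induction on the sum of exponents: if all exponents are 1, the ideal is prime and avoids z.
  Otherwise some k occurs with exponent n + 2; the hypothesis is used with this exponent lowered to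
  n + 1 and to 1, and with k removed from \<open>T\<close>.\<close>

lemma nzd:
 assumes "T \<subseteq> X" "\<forall>x\<in>T. a x \<ge> 1" "z \<in> X - T" "y \<in> CR" "z \<otimes> y \<in> pw a T"
 shows "y \<in> pw a T"
 using assms
proof (induction "sum a T" arbitrary: a T z y rule: less_induct)
 case less
 have zc: "z \<in> CR" using less X by auto
 have fin: "finite T" using less X finite_subset by auto
 show ?case
 proof (cases "\<forall>x\<in>T. a x = 1")
  case True
  have "(%x. x [^] a x) ` T = T" using True less X by (auto simp: image_iff subset_iff)
  then have "pw a T = Idl T" by (simp add: pw_def)
  then show ?thesis using primeideal.I_prime[OF Idl_T_prime[OF less.prems(1)] zc less.prems(4)] X_notin[OF less.prems(1,3)] less.prems(5) by auto
 next
  case False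
  then obtain k where k: "k \<in> T" "a k \<noteq> 1" by auto
  obtain n where n: "a k = Suc (Suc n)"
  proof -
   have "a k = Suc (Suc (a k - 2))" using bspec[OF less.prems(2) k(1)] k(2) by arith
   then show ?thesis using that by blast
  qed
  define T' where "T' = T - {k}"
  have T': "T' \<subseteq> X" "k \<notin> T'" "T = insert k T'" "k \<in> X" using k less by (auto simp: T'_def)
  have kc: "k \<in> CR" using T' X by auto
  have fT': "finite T'" using fin by (simp add: T'_def)
  have sm: "sum (upd a k (j)) T = j + sum a T'" for j
   unfolding T'(3) using fT' T'(2) by (simp, intro sum.cong) (auto simp: upd_def)
  have sa: "sum a T = Suc (Suc n) + sum a T'" using sm[of "a k", unfolded upd_simps(3)] n by simp
  note J = idealD[OF pw_ideal[OF T'(1), of a]] and Ji = pw_ideal[OF T'(1), of a]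
  have Tj: "pw (upd a k (j)) T = adj R (pw a T') (k [^] j)" for j using pw_insert[OF T'(1,4,2)] T'(3) by simp
  have TT: "pw a T = adj R (pw a T') (k [^] Suc (Suc n))" using Tj[of "a k", unfolded upd_simps(3)] n by (simp only:)
  have aT: "\<forall>x\<in>T. 1 \<le> upd a k (Suc j) x" for j using less.prems(2) by (auto simp: upd_def)
  have d1: "sum a T' < sum a T" "\<forall>x\<in>T'. 1 \<le> a x" "k \<in> X - T'" using sa T' less.prems(2) by auto
  have d2: "sum (upd a k (Suc n)) T < sum a T" and d3: "sum (upd a k (Suc 0)) T < sum a T" using sa sm by auto
  \<comment> \<open>The parameter k is itself a remaining parameter for the smaller set T', so its
    powers cancel by the induction hypothesis.\<close>
  have knz: "w \<in> pw a T'" if "w \<in> CR" "k [^] i \<otimes> w \<in> pw a T'" for w and i :: nat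
   using that
  proof (induction i arbitrary: w)
   case (Suc i)
   have e: "k [^] Suc i \<otimes> w = k [^] i \<otimes> (k \<otimes> w)" using kc Suc.prems by (simp add: m_assoc)
   have "k [^] i \<otimes> (k \<otimes> w) \<in> pw a T'" using Suc.prems(2) unfolding e .
   then have "k \<otimes> w \<in> pw a T'" using Suc.IH[of "k \<otimes> w"] kc Suc.prems by simp
   then show ?case by (rule less.hyps[OF d1(1) T'(1) d1(2,3) Suc.prems(1)])
  qed auto
  obtain i v where zy: "z \<otimes> y = i \<oplus> v \<otimes> k [^] Suc (Suc n)" "i \<in> pw a T'" "v \<in> CR"
   using less.prems(5) unfolding TT by (rule adjE)
  have "z \<otimes> y = i \<oplus> (v \<otimes> k) \<otimes> k [^] Suc n" unfolding zy(1) using zy(3) kc by (simp add: m_ac)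
  then have "z \<otimes> y \<in> pw (upd a k (Suc n)) T" unfolding Tj using zy kc by (auto intro: adj_I)
  then have "y \<in> pw (upd a k (Suc n)) T"
   by (rule less.hyps[OF d2 less.prems(1) aT less.prems(3,4)])
  then obtain j w where y: "y = j \<oplus> w \<otimes> k [^] Suc n" "j \<in> pw a T'" "w \<in> CR" unfolding Tj by (rule adjE)
  have jc: "j \<in> CR" "i \<in> CR" using y zy J(8) by auto
  define K where "K = k [^] Suc n"
  have Kc: "K \<in> CR" using kc by (simp add: K_def)
  \<comment> \<open>Two expansions of z y are compared. Their difference is k^(n+1) times z w - v k
    and lies in the ideal of the powers from T', where k^(n+1) cancels.\<close>
  have "K \<otimes> (z \<otimes> w \<ominus> v \<otimes> k) = (z \<otimes> (j \<oplus> w \<otimes> K) \<ominus> z \<otimes> j) \<ominus> (v \<otimes> k) \<otimes> K"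
   using Kc zc jc y(3) zy(3) kc by algebra
  also have "z \<otimes> (j \<oplus> w \<otimes> K) = i \<oplus> (v \<otimes> k) \<otimes> K"
   using zy(1) kc zy(3) unfolding y(1) K_def by (simp add: m_ac)
  also have "(i \<oplus> (v \<otimes> k) \<otimes> K \<ominus> z \<otimes> j) \<ominus> (v \<otimes> k) \<otimes> K = i \<ominus> z \<otimes> j"
   using Kc zc jc y(3) zy(3) kc by algebra
  also have "... \<in> pw a T'" using y zy zc J by auto
  finally have "z \<otimes> w \<ominus> v \<otimes> k \<in> pw a T'" using knz[of "z \<otimes> w \<ominus> v \<otimes> k" "Suc n"] zc y zy kc by (simp add: K_def)
  then have "(z \<otimes> w \<ominus> v \<otimes> k) \<oplus> v \<otimes> k \<in> adj R (pw a T') k" using zy by (intro adj_I) auto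
  then have "z \<otimes> w \<in> adj R (pw a T') k" using add_diff_cancel[of "z \<otimes> w" "v \<otimes> k"] zc y zy kc by simp
  then have "z \<otimes> w \<in> pw (upd a k (Suc 0)) T" unfolding Tj using kc by simp
  then have "w \<in> pw (upd a k (Suc 0)) T"
   by (rule less.hyps[OF d3 less.prems(1) aT less.prems(3) y(3)])
  then have "w \<in> adj R (pw a T') k" unfolding Tj using kc by simp
  then obtain j' v' where w: "w = j' \<oplus> v' \<otimes> k" "j' \<in> pw a T'" "v' \<in> CR" by (rule adjE)
  have j'c: "j' \<in> CR" using w J(8) by auto
  have "y = (j \<oplus> j' \<otimes> K) \<oplus> v' \<otimes> (K \<otimes> k)" unfolding y(1) w(1) K_def[symmetric] using jc j'c w(3) Kc kc by algebra
  moreover have "K \<otimes> k = k [^] Suc (Suc n)" by (simp add: K_def)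
  moreover have "j \<oplus> j' \<otimes> K \<in> pw a T'" by (rule J(3)[OF y(2) J(5)[OF Kc w(2)]])
  ultimately show ?thesis unfolding TT using adj_I[of "j \<oplus> j' \<otimes> K" "pw a T'" v' "K \<otimes> k"] w(3) by simp
 qed
qed

lemma colon_pw:
 fixes n k :: nat
 assumes "T \<subseteq> X" "\<forall>x\<in>T. a x \<ge> 1" "x \<in> X" "x \<notin> T"
 shows "colon R (adj R (pw a T) (x [^] (n + k))) {x [^] k} = adj R (pw a T) (x [^] n)"
proof
 have xc: "x \<in> CR" using assms X by auto
 note Ji = pw_ideal[OF assms(1), of a] note J = idealD[OF Ji]
 have xp: "x [^] (n + k) \<in> CR" "x [^] n \<in> CR" "x [^] k \<in> CR" using xc by auto
 have e: "x [^] n \<otimes> x [^] k = x [^] (n + k)" using xc by (simp add: nat_pow_mult)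
 have nz: "w \<in> pw a T" if "w \<in> CR" "x [^] i \<otimes> w \<in> pw a T" for w and i :: nat
  using that
 proof (induction i arbitrary: w)
  case (Suc i)
  have e: "x [^] Suc i \<otimes> w = x [^] i \<otimes> (x \<otimes> w)" using xc Suc.prems by (simp add: m_assoc)
  have "x [^] i \<otimes> (x \<otimes> w) \<in> pw a T" using Suc.prems(2) unfolding e .
  then have "x \<otimes> w \<in> pw a T" using Suc.IH[of "x \<otimes> w"] xc Suc.prems by simp
  then show ?case using nzd[OF assms(1,2), of x w] assms Suc.prems by auto
 qed auto
 show "colon R (adj R (pw a T) (x [^] (n + k))) {x [^] k} \<subseteq> adj R (pw a T) (x [^] n)"
 proof
  fix y assume "y \<in> colon R (adj R (pw a T) (x [^] (n + k))) {x [^] k}"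
  then have y: "y \<in> CR" "y \<otimes> x [^] k \<in> adj R (pw a T) (x [^] (n + k))" by (auto simp: colon_single)
  obtain i r where ir: "y \<otimes> x [^] k = i \<oplus> r \<otimes> x [^] (n + k)" "i \<in> pw a T" "r \<in> CR" using y(2) by (rule adjE)
  have ic: "i \<in> CR" using ir J by auto
  have "x [^] k \<otimes> (y \<ominus> r \<otimes> x [^] n) = y \<otimes> x [^] k \<ominus> r \<otimes> (x [^] n \<otimes> x [^] k)"
   using y(1) xp ir(3) by algebra
  also have "... = i" unfolding e using diff_eqI[OF ir(1)] ic ir xp by simp
  finally have "y \<ominus> r \<otimes> x [^] n \<in> pw a T" using nz[of "y \<ominus> r \<otimes> x [^] n" k] y ir xp by auto
  then have "(y \<ominus> r \<otimes> x [^] n) \<oplus> r \<otimes> x [^] n \<in> adj R (pw a T) (x [^] n)" using ir by (intro adj_I)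
  then show "y \<in> adj R (pw a T) (x [^] n)" using add_diff_cancel[of y "r \<otimes> x [^] n"] y ir xp by simp
 qed
 note A = adj_ideal[OF Ji xp(1)]
 have "pw a T \<subseteq> colon R (adj R (pw a T) (x [^] (n + k))) {x [^] k}"
  using adj_sub[OF Ji xp(1)] colon_sub[OF A, of "{x [^] k}"] xp by auto
 moreover have "x [^] n \<in> colon R (adj R (pw a T) (x [^] (n + k))) {x [^] k}"
  using adj_self[OF Ji xp(1)] xp e by (simp add: colon_single)
 ultimately show "adj R (pw a T) (x [^] n) \<subseteq> colon R (adj R (pw a T) (x [^] (n + k))) {x [^] k}"
  using A xp by (intro adj_minimal colon_ideal) auto
qed

lemma pw_ones: "(!!x. x \<in> X ==> a x = 1) ==> pw a X = m"
proof -
 assume *: "!!x. x \<in> X ==> a x = 1"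
 have "(%x. x [^] a x) ` X = X" using * X by (auto simp: image_iff subset_iff)
 then show ?thesis unfolding pw_def X(3) by simp
qed

lemma cov_m: "cov m (CR)"
proof -
 have "adj R m \<one> = CR"
  using ideal_carrier_iff[OF adj_ideal[OF m_ideal one_closed]] adj_self[OF m_ideal one_closed] by simp
 then show ?thesis unfolding cov_def using m_ideal one_notin_m m_facts by (intro conjI bexI[of _ \<one>]) auto
qed

lemma pw_adj:
 assumes x: "x \<in> X" "a x = Suc n"
 shows "adj R (pw a X) x = pw (upd a x (1)) X" "pw a X = adj R (pw a (X - {x})) (x [^] Suc n)"
  "pw (upd a x (k)) X = adj R (pw a (X - {x})) (x [^] k)"
proof -
 have T: "X - {x} \<subseteq> X" "x \<notin> X - {x}" "insert x (X - {x}) = X" using x by auto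
 have xc: "x \<in> CR" using x X by auto
 show 1: "pw (upd a x (k)) X = adj R (pw a (X - {x})) (x [^] k)" for k
  using pw_insert[OF T(1) x(1) T(2), of a k] T(3) by simp
 show 2: "pw a X = adj R (pw a (X - {x})) (x [^] Suc n)" using 1[of "Suc n"] x by (metis upd_simps(3))
 note J = pw_ideal[OF T(1), of a]
 have xp: "x [^] Suc n \<in> CR" using xc by simp
 have A: "ideal (adj R (pw a (X - {x})) x) R" "ideal (adj R (pw a X) x) R" using J pw_ideal[of X a] xc by auto
 show "adj R (pw a X) x = pw (upd a x (1)) X" unfolding 1
 proof
  have xs: "x \<in> adj R (pw a (X - {x})) x" using J xc adj_self by auto
  have "x [^] Suc n \<in> adj R (pw a (X - {x})) x" using xs xc idealD(4)[OF A(1)] by auto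
  then have "pw a X \<subseteq> adj R (pw a (X - {x})) x" unfolding 2 using A adj_sub[OF J xc] by (intro adj_minimal) auto
  then show "adj R (pw a X) x \<subseteq> adj R (pw a (X - {x})) (x [^] (1::nat))" using xs A xc by (intro adj_minimal) auto
  have "pw a (X - {x}) \<subseteq> pw a X" unfolding 2 using adj_sub[OF J xp] .
  then show "adj R (pw a (X - {x})) (x [^] (1::nat)) \<subseteq> adj R (pw a X) x"
   using adj_sub[OF pw_ideal[of X a] xc] adj_self[OF pw_ideal[of X a] xc] A xc by (intro adj_minimal) auto
 qed
qed

text \<open>For a parameter x of exponent n + 1, the colon by x lowers the exponent to n and adding
  x lowers it to 1. The two lengths, n and 1 times the product of the other exponents, add
  up.\<close>

lemma clen_pw:
 assumes "\<forall>x\<in>X. a x \<ge> 1"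
 shows "clen (pw a X) (CR) (\<Prod>x\<in>X. a x)"
 using assms
proof (induction "sum a X" arbitrary: a rule: less_induct)
 case less
 show ?case
 proof (cases "\<forall>x\<in>X. a x = 1")
  case True
  then have "(\<Prod>x\<in>X. a x) = 1" by simp
  then show ?thesis using clen_1[OF cov_m] pw_ones[of a] True by simp
 next
  case False
  then obtain x where x: "x \<in> X" "a x \<noteq> 1" by auto
  then obtain n where n: "a x = Suc n" "n \<ge> 1" using bspec[OF less.prems x(1)] by (cases "a x") auto
  define T where "T = X - {x}"
  have T: "T \<subseteq> X" "x \<notin> T" "X = insert x T" "finite T" using x X by (auto simp: T_def)
  have xc: "x \<in> CR" using x X by auto
  note pa = pw_adj[of x a n, OF x(1) n(1), folded T_def]
  have pr: "(\<Prod>y\<in>X. (upd a x (k)) y) = k * (\<Prod>y\<in>T. a y)" for k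
  proof -
   have "(\<Prod>y\<in>T. (upd a x (k)) y) = (\<Prod>y\<in>T. a y)" using T(2) by (intro prod.cong) (auto simp: upd_def)
   then show ?thesis unfolding T(3) using T(2,4) by simp
  qed
  have sm: "sum (upd a x (k)) X = k + sum a T" for k
   unfolding T(3) using T(2,4) by (simp, intro sum.cong) (auto simp: upd_def)
  have sa: "sum a X = Suc n + sum a T" using sm[of "a x", unfolded upd_simps(3)] n by simp
  have aT: "\<forall>x\<in>T. a x \<ge> 1" using less.prems T by auto
  have aX: "\<forall>y\<in>X. upd a x n y \<ge> 1" "\<forall>y\<in>X. upd a x 1 y \<ge> 1" using less.prems n by (auto simp: upd_def)
  have c: "colon R (pw a X) {x} = pw (upd a x (n)) X"
   using colon_pw[OF T(1) aT x(1) T(2), of n 1] xc unfolding pa(2) pa(3)[of n] by auto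
  have "clen (pw (upd a x (n)) X) (CR) (n * (\<Prod>y\<in>T. a y))"
   using less.hyps[OF _ aX(1)] sm[of n] sa pr[of n] by simp
  then have 1: "clen (pw a X) (pw (upd a x (1)) X) (n * (\<Prod>y\<in>T. a y))"
   using clen_colon[of "pw a X" x] c pw_ideal xc pa(1) by auto
  have 2: "clen (pw (upd a x (1)) X) (CR) (\<Prod>y\<in>T. a y)"
   using less.hyps[OF _ aX(2)] sm[of 1] sa n(2) pr[of 1] by simp
  have "(\<Prod>y\<in>X. a y) = Suc n * (\<Prod>y\<in>T. a y)" using pr[of "a x", unfolded upd_simps(3)] n by simp
  then show ?thesis using clen_trans[OF 2 1] by (simp add: add.commute)
 qed
qed

text \<open>The socle is generated by the product of the x^(a x - 1). In the induction a socle
  generator for exponent 1 at x is multiplied by x^n, because (pw a X : x^n) is the ideal with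
  exponent 1 at x.\<close>

lemma socle_pw:
 assumes "\<forall>x\<in>X. a x \<ge> 1"
 shows "\<exists>u\<in>CR. u \<notin> pw a X \<and> (\<forall>b\<in>m. b \<otimes> u \<in> pw a X) \<and>
  (\<forall>y\<in>CR. (\<forall>b\<in>m. b \<otimes> y \<in> pw a X) --> y \<in> adj R (pw a X) u)"
 using assms
proof (induction "sum a X" arbitrary: a rule: less_induct)
 case less
 show ?case
 proof (cases "\<forall>x\<in>X. a x = 1")
  case True
  have "adj R m \<one> = CR"
   using ideal_carrier_iff[OF adj_ideal[OF m_ideal one_closed]] adj_self[OF m_ideal one_closed] by simp
  then show ?thesis using pw_ones[of a] True one_notin_m m_facts(8) by (intro bexI[of _ \<one>]) auto
 next
  case False
  then obtain x where x: "x \<in> X" "a x \<noteq> 1" by auto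
  then obtain n where n: "a x = Suc n" "n \<ge> 1" using bspec[OF less.prems x(1)] by (cases "a x") auto
  define T where "T = X - {x}"
  have T: "T \<subseteq> X" "x \<notin> T" "X = insert x T" "finite T" using x X by (auto simp: T_def)
  have xc: "x \<in> CR" using x X by auto
  note pa = pw_adj[of x a n, OF x(1) n(1), folded T_def]
  have sm: "sum (upd a x (k)) X = k + sum a T" for k
   unfolding T(3) using T(2,4) by (simp, intro sum.cong) (auto simp: upd_def)
  have sa: "sum a X = Suc n + sum a T" using sm[of "a x", unfolded upd_simps(3)] n by simp
  note J = idealD[OF pw_ideal[OF order_refl, of a]] and Ji = pw_ideal[OF order_refl, of a]
  note J1 = idealD[OF pw_ideal[OF order_refl, of "upd a x (1)"]] and J1i = pw_ideal[OF order_refl, of "upd a x (1)"]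
  have aT: "\<forall>x\<in>T. a x \<ge> 1" using less.prems T by auto
  have aX: "\<forall>y\<in>X. upd a x 1 y \<ge> 1" using less.prems n by (auto simp: upd_def)
  have c1: "colon R (pw a X) {x} = pw (upd a x (n)) X"
   using colon_pw[OF T(1) aT x(1) T(2), of n 1] xc unfolding pa(2) pa(3)[of n] by auto
  have cn: "colon R (pw a X) {x [^] n} = pw (upd a x (1)) X"
   using colon_pw[OF T(1) aT x(1) T(2), of 1 n] xc unfolding pa(2) pa(3)[of 1] by auto
  obtain u where u: "u \<in> CR" "u \<notin> pw (upd a x (1)) X" "\<forall>b\<in>m. b \<otimes> u \<in> pw (upd a x (1)) X"
   "\<forall>y\<in>CR. (\<forall>b\<in>m. b \<otimes> y \<in> pw (upd a x (1)) X) --> y \<in> adj R (pw (upd a x (1)) X) u"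
   using less.hyps[OF _ aX] sm[of 1] sa n(2) by auto
  have xn: "x [^] n \<in> CR" using xc by simp
  have iff: "r \<otimes> x [^] n \<in> pw a X \<longleftrightarrow> r \<in> pw (upd a x (1)) X" if "r \<in> CR" for r
   unfolding cn[symmetric] using that by (simp add: colon_single)
  show ?thesis
  proof (intro bexI[of _ "u \<otimes> x [^] n"] conjI ballI impI)
   show "u \<otimes> x [^] n \<notin> pw a X" using iff u by simp
   show "b \<otimes> (u \<otimes> x [^] n) \<in> pw a X" if "b \<in> m" for b
    using iff[of "b \<otimes> u"] u that m_facts(8) xn by (simp add: m_assoc)
   fix y assume y: "y \<in> CR" "\<forall>b\<in>m. b \<otimes> y \<in> pw a X"
   have "y \<otimes> x \<in> pw a X" using y x X_m xc by (auto simp: m_comm)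
   then have "y \<in> adj R (pw a T) (x [^] n)" using c1 y pa(3)[of n] by (auto simp: colon_single)
   then obtain j r where jr: "y = j \<oplus> r \<otimes> x [^] n" "j \<in> pw a T" "r \<in> CR" by (rule adjE)
   have "x [^] Suc n \<in> CR" using xc by simp
   then have jJ: "j \<in> pw a X" unfolding pa(2) using adj_sub[OF pw_ideal[OF T(1)]] jr(2) by blast
   have jc: "j \<in> CR" using jJ J by auto
   have "b \<otimes> r \<in> pw (upd a x (1)) X" if b: "b \<in> m" for b
   proof -
    have bc: "b \<in> CR" using b m_facts by auto
    have "b \<otimes> y = b \<otimes> j \<oplus> (b \<otimes> r) \<otimes> x [^] n" unfolding jr(1) using bc jc jr(3) xn by algebra
    then have "b \<otimes> j \<oplus> (b \<otimes> r) \<otimes> x [^] n \<in> pw a X" using y b by metis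
    then have "(b \<otimes> r) \<otimes> x [^] n \<in> pw a X" using ideal_minus_cancel[OF Ji] J(4)[OF bc jJ] bc jr xn by blast
    then show ?thesis using iff bc jr by simp
   qed
   then have "r \<in> adj R (pw (upd a x (1)) X) u" using u(4) jr by auto
   then obtain i s where is_: "r = i \<oplus> s \<otimes> u" "i \<in> pw (upd a x (1)) X" "s \<in> CR" by (rule adjE)
   have ic: "i \<in> CR" using is_ J1 by auto
   have "y = (j \<oplus> i \<otimes> x [^] n) \<oplus> s \<otimes> (u \<otimes> x [^] n)" unfolding jr(1) is_(1) using jc ic is_(3) u(1) xn by algebra
   moreover have "j \<oplus> i \<otimes> x [^] n \<in> pw a X" using jJ iff[OF ic] is_ J by blast
   ultimately show "y \<in> adj R (pw a X) (u \<otimes> x [^] n)" using is_ by (auto intro: adj_I)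
  qed (use u xn in auto)
 qed
qed

lemma fp_m: "frob R q ==> FP m q = pw (%_. q) X"
 unfolding pw_def X(3) using fp_Idl X by simp

lemma regular_len:
 assumes "frob R p" "p \<ge> 2"
 shows "noeth_local_len R m p (card X) X"
proof (intro noeth_local_len.intro noeth_local_axioms noeth_local_len_axioms.intro X assms)
 fix e
 have "p ^ e \<ge> 1" using assms by simp
 then show "clen (FP m (p ^ e)) (CR) ((p ^ e) ^ card X)"
  using clen_pw[of "%_. p ^ e"] fp_m[OF frob_pow[OF assms(1)], of e] by simp
qed

end

section \<open>Artinian Gorenstein quotients and duality of lengths\<close>

context noeth_local
begin

text \<open>R/J is Artinian and Gorenstein: J is m-primary and the socle is one-dimensional, with u
  as generator.\<close>

definition gor :: "'a set => bool" where
 "gor J \<longleftrightarrow> mprim J \<and> (\<exists>u\<in>carrier R. u \<notin> J \<and> (\<forall>b\<in>m. b \<otimes> u \<in> J) \<and>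
   (\<forall>y\<in>carrier R. (\<forall>b\<in>m. b \<otimes> y \<in> J) --> y \<in> adj R J u))"

text \<open>Let I' = I + Rx with m x inside I. Multiplication by x maps (J : I) into the socle of
  R/J, with kernel (J : I') modulo J. As the socle is one-dimensional, the quotient of the two
  colons is zero or simple.\<close>

lemma perp_cov:
 assumes "gor J" "cov I I'" "J \<subseteq> I"
 shows "colon R J I' = colon R J I \<or> cov (colon R J I') (colon R J I)"
proof (rule disjCI)
 assume "\<not> cov (colon R J I') (colon R J I)"
 have J: "ideal J R" using assms by (simp add: gor_def mprim_def)
 note Jf = idealD[OF J]
 obtain u where u: "u \<in> CR" "u \<notin> J" "\<forall>b\<in>m. b \<otimes> u \<in> J"
  "!!y. y \<in> CR ==> (\<forall>b\<in>m. b \<otimes> y \<in> J) ==> y \<in> adj R J u" using assms(1) by (auto simp: gor_def)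
 obtain x where x: "ideal I R" "x \<in> CR" "x \<notin> I" "I' = adj R I x" "\<forall>a\<in>m. a \<otimes> x \<in> I"
  using assms(2) by (auto simp: cov_def)
 note If = idealD[OF x(1)]
 have I': "ideal I' R" "I' \<subseteq> CR" unfolding x(4) using x idealD(1)[OF adj_ideal[OF x(1,2)]] by auto
 have mem: "b \<in> colon R J I' \<longleftrightarrow> b \<in> colon R J I \<and> b \<otimes> x \<in> J" for b
 proof
  assume "b \<in> colon R J I'"
  then show "b \<in> colon R J I \<and> b \<otimes> x \<in> J" unfolding x(4) using adj_sub[OF x(1,2)] adj_self[OF x(1,2)]
   by (auto simp: colon_def)
 next
  assume b: "b \<in> colon R J I \<and> b \<otimes> x \<in> J"
  have "b \<otimes> (i \<oplus> r \<otimes> x) \<in> J" if "i \<in> I" "r \<in> CR" for i r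
  proof -
   have ic: "i \<in> CR" "b \<in> CR" using that If b by (auto simp: colon_def)
   have "b \<otimes> (i \<oplus> r \<otimes> x) = b \<otimes> i \<oplus> r \<otimes> (b \<otimes> x)" using ic that(2) x(2) by algebra
   then show ?thesis using b that Jf by (auto simp: colon_def)
  qed
  then show "b \<in> colon R J I'" using b unfolding x(4) by (auto simp: colon_def adj_def)
 qed
 have soc: "b \<otimes> x \<in> adj R J u" if b: "b \<in> colon R J I" for b
 proof (rule u(4))
  have bc: "b \<in> CR" using b by (auto simp: colon_def)
  then show "b \<otimes> x \<in> CR" using x by simp
  show "\<forall>c\<in>m. c \<otimes> (b \<otimes> x) \<in> J"
  proof
   fix c assume c: "c \<in> m"
   then have "c \<in> CR" using m_facts by auto
   then have "c \<otimes> (b \<otimes> x) = b \<otimes> (c \<otimes> x)" using bc x by (simp add: m_lcomm)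
   then show "c \<otimes> (b \<otimes> x) \<in> J" using b x(5) c by (auto simp: colon_def)
  qed
 qed
 show "colon R J I' = colon R J I"
 proof (rule ccontr)
  assume "colon R J I' \<noteq> colon R J I"
  then obtain b where b: "b \<in> colon R J I" "b \<otimes> x \<notin> J" "b \<in> CR" using mem by (auto simp: colon_def)
  have bI': "b \<notin> colon R J I'" using mem b by auto
  have ci: "ideal (colon R J I') R" "ideal (colon R J I) R" using J I' If by auto
  obtain j r where jr: "b \<otimes> x = j \<oplus> r \<otimes> u" "j \<in> J" "r \<in> CR" using soc[OF b(1)] by (rule adjE)
  have jc: "j \<in> CR" using jr Jf by auto
  have "r \<notin> m" using jr b u(3) Jf by auto
  then have "r \<in> Units R" using unit_or_m jr by auto
  then have ru: "inv r \<otimes> r = \<one>" "inv r \<in> CR" by auto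
  have "adj R (colon R J I') b = colon R J I"
  proof
   show "adj R (colon R J I') b \<subseteq> colon R J I" using mem b(1) ci by (intro adj_minimal) auto
   show "colon R J I \<subseteq> adj R (colon R J I') b"
   proof
    fix b' assume b': "b' \<in> colon R J I"
    have b'c: "b' \<in> CR" using b' by (auto simp: colon_def)
    obtain j' r' where jr': "b' \<otimes> x = j' \<oplus> r' \<otimes> u" "j' \<in> J" "r' \<in> CR" using soc[OF b'] by (rule adjE)
    have j'c: "j' \<in> CR" using jr' Jf by auto
    define t where "t = r' \<otimes> inv r"
    have tc: "t \<in> CR" using ru jr' by (simp add: t_def)
    have "t \<otimes> r = r'" unfolding t_def using ru jr jr' by (simp add: m_assoc)
    then have e: "b' \<otimes> x = j' \<oplus> t \<otimes> (r \<otimes> u)" unfolding jr'(1) using tc jr u by (simp add: m_assoc[symmetric])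
    have "(b' \<ominus> t \<otimes> b) \<otimes> x = b' \<otimes> x \<ominus> t \<otimes> (b \<otimes> x)" using b'c tc b(3) x(2) by algebra
    also have "... = j' \<ominus> t \<otimes> j" unfolding e jr(1) using j'c tc jr(3) u(1) jc by algebra
    also have "... \<in> J" using jr jr' tc Jf by auto
    finally have "b' \<ominus> t \<otimes> b \<in> colon R J I'" using mem b' b(1) tc idealD(4,6)[OF ci(2)] by auto
    then have "(b' \<ominus> t \<otimes> b) \<oplus> t \<otimes> b \<in> adj R (colon R J I') b" using tc by (intro adj_I)
    then show "b' \<in> adj R (colon R J I') b" using add_diff_cancel[of b' "t \<otimes> b"] b'c tc b by simp
   qed
  qed
  moreover have "\<forall>a\<in>m. a \<otimes> b \<in> colon R J I'"
  proof
   fix a assume a: "a \<in> m"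
   then have ac: "a \<in> CR" using m_facts by auto
   have "(a \<otimes> b) \<otimes> x = b \<otimes> (a \<otimes> x)" using ac b(3) x(2) by (simp add: m_ac)
   then have "(a \<otimes> b) \<otimes> x \<in> J" using b(1) x(5) a by (auto simp: colon_def)
   then show "a \<otimes> b \<in> colon R J I'" using mem idealD(4)[OF ci(2) ac b(1)] by auto
  qed
  ultimately have "cov (colon R J I') (colon R J I)" unfolding cov_def using ci(1) b(3) bI' by metis
  then show False using \<open>\<not> cov (colon R J I') (colon R J I)\<close> by simp
 qed
qed

lemma perp_clen:
 assumes "clen I I' k" "gor J" "J \<subseteq> I"
 shows "\<exists>k'\<le>k. clen (colon R J I') (colon R J I) k'"
 using assms(1)
proof induction
 case base
 then have "ideal (colon R J I) R" using assms idealD(1)[OF base] by (auto simp: gor_def mprim_def)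
 then show ?case using clen.base by blast
next
 case (step K k K')
 then obtain k' where k': "k' \<le> k" "clen (colon R J K) (colon R J I) k'" by auto
 have "J \<subseteq> K" using clen_ideal[OF step(1)] assms by auto
 then consider "colon R J K' = colon R J K" | "cov (colon R J K') (colon R J K)"
  using perp_cov[OF assms(2) step(2)] by auto
 then show ?case
 proof cases
  case 1
  then show ?thesis using k' by (intro exI[of _ k']) auto
 next
  case 2
  then show ?thesis using clen_trans[OF k'(2) clen_1[OF 2]] k' by (intro exI[of _ "1 + k'"]) auto
 qed
qed

text \<open>\<open>perp_clen\<close> gives one inequality for the series from J to K and one for the
  series from K to R. Both pairs of lengths add up to the length of R/J, so neither inequality is
  strict.\<close>

lemma perp_len:
 assumes g: "gor J" and K: "ideal K R" "J \<subseteq> K"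
 obtains a b where "clen J K a" "clen K (CR) b" "clen J (colon R J K) b" "clen (colon R J K) (CR) a"
proof -
 have J: "ideal J R" "mprim J" using g by (auto simp: gor_def mprim_def)
 note Jf = idealD[OF J(1)]
 obtain n where n: "clen J (CR) n" using clen_ex[OF J(2)] by auto
 obtain a b where ab: "a + b = n" "clen J K a" "clen K (CR) b"
  using clen_split[OF n K] idealD(1)[OF K(1)] by metis
 have 1: "colon R J J = CR" using Jf by (auto simp: colon_def)
 have 2: "colon R J (CR) = J" using Jf by (auto simp: colon_def) (metis one_closed r_one)
 obtain a' where a': "a' \<le> a" "clen (colon R J K) (CR) a'" using perp_clen[OF ab(2) g order_refl] 1 by auto
 obtain b' where b': "b' \<le> b" "clen J (colon R J K) b'" using perp_clen[OF ab(3) g K(2)] 2 by auto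
 have "b' + a' = n" using clen_unique[OF clen_trans[OF a'(2) b'(2)] n] .
 then have "a' = a" "b' = b" using a' b' ab by auto
 then show ?thesis using that ab a' b' by blast
qed

lemma double_annihilator:
 assumes g: "gor J" and I: "ideal I R" "J \<subseteq> I"
 shows "colon R J (colon R J I) = I"
proof -
 have J: "ideal J R" using g by (auto simp: gor_def mprim_def)
 note If = idealD[OF I(1)]
 obtain a b where ab: "clen J I a" "clen (colon R J I) (CR) a" using perp_len[OF g I] by metis
 have C: "ideal (colon R J I) R" "J \<subseteq> colon R J I" using J(1) If(1) colon_sub by auto
 obtain c d where cd: "clen (colon R J I) (CR) d" "clen J (colon R J (colon R J I)) d"
  using perp_len[OF g C] by metis
 have "d = a" using clen_unique[OF cd(1) ab(2)] .
 moreover have "I \<subseteq> colon R J (colon R J I)" using If by (auto simp: colon_def m_comm)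
 ultimately show ?thesis using clen_le_eq(2)[OF ab(1) cd(2)] by simp
qed

lemma clen_top_eq:
 assumes "clen I (CR) k" "clen J (CR) k" "I \<subseteq> J"
 shows "I = J"
proof -
 obtain i j where ij: "i + j = k" "clen I J i" "clen J (CR) j"
  using clen_split[OF assms(1) _ assms(3)] clen_ideal[OF assms(2)] by metis
 then have "i = 0" using clen_unique[OF ij(3) assms(2)] by simp
 then show ?thesis using clen_0 ij(2) by metis
qed

end

context regular_local
begin

lemma gor_fp:
 assumes "frob R q"
 shows "gor (FP m q)"
proof -
 have q: "q \<ge> 1" "q > 0" using assms by (auto simp: frob_def)
 show ?thesis unfolding gor_def using socle_pw[of "%_. q"] q mprim_fp[OF m_mprim q(2)]
  by (simp add: fp_m[OF assms])
qed

end

section \<open>Linear systems and flatness of Frobenius\<close>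

definition dot :: "('a, 'x) ring_scheme => 'i set => ('i => 'a) => ('i => 'a) => 'a" where
 "dot R I z x = (\<Oplus>\<^bsub>R\<^esub>i\<in>I. z i \<otimes>\<^bsub>R\<^esub> x i)"

text \<open>Generation of vectors that are looked at on \<open>I\<close> only: both rules compare
  values on \<open>I\<close>, so values elsewhere are arbitrary.\<close>

inductive_set lspan :: "('a, 'x) ring_scheme => 'i set => ('i => 'a) set => ('i => 'a) set"
 for R :: "('a, 'x) ring_scheme" and I :: "'i set" and G where
 zero: "(\<forall>i\<in>I. z i = \<zero>\<^bsub>R\<^esub>) ==> z \<in> lspan R I G"
| step: "w \<in> lspan R I G ==> g \<in> G ==> s \<in> carrier R ==>
  (\<forall>i\<in>I. z i = w i \<oplus>\<^bsub>R\<^esub> s \<otimes>\<^bsub>R\<^esub> g i) ==> z \<in> lspan R I G"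

section \<open>Calculus of linear forms and spans\<close>

context cring
begin

lemma dot_closed [simp, intro]: "(!!i. i \<in> I ==> z i \<in> CR) ==> (!!i. i \<in> I ==> x i \<in> CR) ==> dot R I z x \<in> CR"
 unfolding dot_def by (intro finsum_closed) auto

lemma dot_cong: "(!!i. i \<in> I ==> z i = z' i) ==> (!!i. i \<in> I ==> x i = x' i) ==>
  (!!i. i \<in> I ==> z' i \<in> CR) ==> (!!i. i \<in> I ==> x' i \<in> CR) ==> dot R I z x = dot R I z' x'"
 unfolding dot_def by (intro finsum_cong') auto

lemma dot_empty [simp]: "dot R {} z x = \<zero>"
 by (simp add: dot_def)

lemma dot_insert: "finite I ==> k \<notin> I ==> (!!i. i \<in> insert k I ==> z i \<in> CR) ==>
  (!!i. i \<in> insert k I ==> x i \<in> CR) ==> dot R (insert k I) z x = z k \<otimes> x k \<oplus> dot R I z x"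
 unfolding dot_def by (intro finsum_insert) auto

lemma dot_zero: "(!!i. i \<in> I ==> z i = \<zero>) ==> (!!i. i \<in> I ==> x i \<in> CR) ==> dot R I z x = \<zero>"
 unfolding dot_def by (intro add.finprod_one_eqI) auto

lemma dot_comm: "(!!i. i \<in> I ==> z i \<in> CR) ==> (!!i. i \<in> I ==> x i \<in> CR) ==> dot R I z x = dot R I x z"
 unfolding dot_def by (intro finsum_cong') (auto simp: m_comm)

lemma dot_lin:
 assumes "!!i. i \<in> I ==> w i \<in> CR" "!!i. i \<in> I ==> g i \<in> CR"
  "!!i. i \<in> I ==> x i \<in> CR" "s \<in> CR" "!!i. i \<in> I ==> z i = w i \<oplus> s \<otimes> g i" "finite I"
 shows "dot R I z x = dot R I w x \<oplus> s \<otimes> dot R I g x"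
proof -
 have "dot R I z x = (\<Oplus>i\<in>I. w i \<otimes> x i \<oplus> s \<otimes> (g i \<otimes> x i))"
  unfolding dot_def using assms by (intro finsum_cong') (auto simp: l_distr m_assoc)
 also have "... = (\<Oplus>i\<in>I. w i \<otimes> x i) \<oplus> (\<Oplus>i\<in>I. s \<otimes> (g i \<otimes> x i))"
  using assms by (intro finsum_addf) auto
 also have "(\<Oplus>i\<in>I. s \<otimes> (g i \<otimes> x i)) = s \<otimes> (\<Oplus>i\<in>I. g i \<otimes> x i)"
  using assms by (intro finsum_rdistr[symmetric]) auto
 finally show ?thesis by (simp add: dot_def)
qed

lemma dot_smult:
 assumes "finite I" "s \<in> CR" "!!i. i \<in> I ==> z i \<in> CR" "!!i. i \<in> I ==> x i \<in> CR"
 shows "dot R I (%i. s \<otimes> z i) x = s \<otimes> dot R I z x"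
proof -
 have "dot R I (%i. s \<otimes> z i) x = dot R I (%i. \<zero>) x \<oplus> s \<otimes> dot R I z x" using assms by (intro dot_lin) auto
 then show ?thesis using assms dot_zero[of I "%_. \<zero>" x] by (simp add: dot_closed)
qed

lemma dot_minus:
 assumes "finite I" "!!i. i \<in> I ==> z i \<in> CR" "!!i. i \<in> I ==> w i \<in> CR" "!!i. i \<in> I ==> x i \<in> CR"
 shows "dot R I (%i. z i \<ominus> w i) x = dot R I z x \<ominus> dot R I w x"
proof -
 have "dot R I (%i. z i \<ominus> w i) x = dot R I z x \<oplus> (\<ominus> \<one>) \<otimes> dot R I w x"
  using assms by (intro dot_lin) (auto simp: a_minus_def l_minus)
 then show ?thesis using assms by (simp add: a_minus_def l_minus dot_closed)
qed

lemma dot_uminus: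
 assumes "finite I" "!!i. i \<in> I ==> z i \<in> CR" "!!i. i \<in> I ==> x i \<in> CR"
 shows "dot R I (%i. \<ominus> z i) x = \<ominus> dot R I z x"
proof -
 have "dot R I (%i. \<ominus> z i) x = dot R I (%i. \<ominus> \<one> \<otimes> z i) x" using assms by (intro dot_cong) (auto simp: l_minus)
 also have "... = \<ominus> \<one> \<otimes> dot R I z x" using assms by (intro dot_smult) auto
 finally show ?thesis using assms by (simp add: l_minus dot_closed)
qed

lemma dot_frob:
 assumes "frob R q" "finite I" "!!i. i \<in> I ==> z i \<in> CR" "!!i. i \<in> I ==> x i \<in> CR"
 shows "dot R I z x [^] q = dot R I (%i. z i [^] q) (%i. x i [^] q)"
 using assms(2-4)
proof (induction I rule: finite_induct)
 case empty
 then show ?case using frob_zero[OF assms(1)] by simp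
next
 case (insert k I)
 have zk: "z k \<in> CR" "x k \<in> CR" using insert.prems by auto
 have "dot R (insert k I) z x [^] q = (z k \<otimes> x k \<oplus> dot R I z x) [^] q" using insert by (subst dot_insert) auto
 also have "... = (z k \<otimes> x k) [^] q \<oplus> dot R I z x [^] q" using insert.prems by (intro frob_add[OF assms(1)]) auto
 also have "... = z k [^] q \<otimes> x k [^] q \<oplus> dot R I (%i. z i [^] q) (%i. x i [^] q)"
  using insert zk by (simp add: nat_pow_distrib)
 also have "... = dot R (insert k I) (%i. z i [^] q) (%i. x i [^] q)" using insert by (subst dot_insert) auto
 finally show ?case .
qed

lemma dot_swap:
 assumes "finite I" "finite J" "!!i. i \<in> I ==> z i \<in> CR" "!!j. j \<in> J ==> v j \<in> CR"
  "!!i j. i \<in> I ==> j \<in> J ==> A i j \<in> CR"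
 shows "dot R I z (%i. dot R J (A i) v) = dot R J (%j. dot R I z (%i. A i j)) v"
 using assms(1,3,5)
proof (induction I rule: finite_induct)
 case empty
 then show ?case using dot_zero[of J "%j. \<zero>" v] assms by simp
next
 case (insert k I)
 have "dot R (insert k I) z (%i. dot R J (A i) v) = z k \<otimes> dot R J (A k) v \<oplus> dot R I z (%i. dot R J (A i) v)"
  using insert assms by (subst dot_insert) auto
 also have "... = z k \<otimes> dot R J (A k) v \<oplus> dot R J (%j. dot R I z (%i. A i j)) v" using insert by simp
 also have "... = dot R J (%j. dot R I z (%i. A i j)) v \<oplus> z k \<otimes> dot R J (A k) v"
  using insert assms by (intro a_comm) auto
 also have "... = dot R J (%j. dot R (insert k I) z (%i. A i j)) v"
 proof (rule dot_lin[symmetric])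
  fix j assume "j \<in> J"
  then show "dot R (insert k I) z (%i. A i j) = dot R I z (%i. A i j) \<oplus> z k \<otimes> A k j"
   using insert assms by (subst dot_insert) (auto simp: a_comm)
 qed (use insert assms in auto)
 finally show ?case .
qed

lemma dot_unit:
 assumes "finite I" "k \<in> I" "!!i. i \<in> I ==> x i \<in> CR"
 shows "dot R I (%i. if i = k then \<one> else \<zero>) x = x k"
proof -
 have "dot R (insert k (I - {k})) (%i. if i = k then \<one> else \<zero>) x
  = \<one> \<otimes> x k \<oplus> dot R (I - {k}) (%i. if i = k then \<one> else \<zero>) x"
  using assms by (subst dot_insert) auto
 also have "... = x k" using assms by (subst dot_zero) auto
 finally show ?thesis using assms by (simp add: insert_absorb)
qed

lemma lspan_closed:
 assumes "z \<in> lspan R I G" "\<forall>g\<in>G. \<forall>i\<in>I. g i \<in> CR" "i \<in> I"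
 shows "z i \<in> CR"
 using assms by induction auto

lemma lspan_cong: "z \<in> lspan R I G ==> (\<forall>i\<in>I. z' i = z i) ==> z' \<in> lspan R I G"
 by (erule lspan.cases) (auto intro: lspan.intros)

lemma lspan_gen: "g \<in> G ==> (!!i. i \<in> I ==> g i \<in> CR) ==> g \<in> lspan R I G"
 by (rule lspan.step[OF lspan.zero[of I "%_. \<zero>" R G], of g \<one>]) auto

lemma lspan_add:
 assumes "z \<in> lspan R I G" "w \<in> lspan R I G" "\<forall>g\<in>G. \<forall>i\<in>I. g i \<in> CR"
 shows "(%i. w i \<oplus> z i) \<in> lspan R I G"
 using assms(1)
proof induction
 case (zero z)
 then show ?case using lspan_closed[OF assms(2,3)] by (intro lspan_cong[OF assms(2)]) auto
next
 case (step v g s z)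
 then show ?case using lspan_closed[OF assms(2,3)] lspan_closed[OF step(1) assms(3)] assms(3)
  by (intro lspan.step[OF step(5,2,3)]) (auto simp: a_assoc)
qed

lemma lspan_smult:
 assumes "z \<in> lspan R I G" "t \<in> CR" "\<forall>g\<in>G. \<forall>i\<in>I. g i \<in> CR"
 shows "(%i. t \<otimes> z i) \<in> lspan R I G"
 using assms(1)
proof induction
 case (zero z)
 then show ?case using assms by (intro lspan.zero) auto
next
 case (step v g s z)
 then show ?case using lspan_closed[OF step(1) assms(3)] assms(2,3)
  by (intro lspan.step[OF step(5,2), of "t \<otimes> s"]) (auto simp: r_distr m_assoc)
qed

lemma lspan_fin:
 assumes "z \<in> lspan R I G" "\<forall>g\<in>G. \<forall>i\<in>I. g i \<in> CR"
 shows "\<exists>(n::nat) s g. (\<forall>l<n. s l \<in> CR \<and> g l \<in> G) \<and> (\<forall>i\<in>I. z i = dot R {..<n} s (%l. g l i))"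
 using assms(1)
proof induction
 case (zero z)
 then show ?case by (intro exI[of _ 0]) auto
next
 case (step w h t z)
 then obtain n :: nat and s g where *: "\<forall>l<n. s l \<in> CR \<and> g l \<in> G"
  "\<forall>i\<in>I. w i = dot R {..<n} s (%l. g l i)" by blast
 show ?case
 proof (intro exI[of _ "Suc n"] exI conjI)
  show "\<forall>l<Suc n. (if l = n then t else s l) \<in> CR \<and> (if l = n then h else g l) \<in> G"
   using * step by (auto simp: less_Suc_eq)
  show "\<forall>i\<in>I. z i = dot R {..<Suc n} (%l. if l = n then t else s l) (%l. (if l = n then h else g l) i)"
  proof
   fix i assume i: "i \<in> I"
   have "dot R {..<Suc n} (%l. if l = n then t else s l) (%l. (if l = n then h else g l) i)
    = t \<otimes> h i \<oplus> dot R {..<n} (%l. if l = n then t else s l) (%l. (if l = n then h else g l) i)"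
    unfolding lessThan_Suc using * step assms(2) i by (subst dot_insert) auto
   also have "dot R {..<n} (%l. if l = n then t else s l) (%l. (if l = n then h else g l) i) = w i"
    using * assms(2) i by (simp, intro dot_cong) auto
   also have "t \<otimes> h i \<oplus> w i = z i" using step i lspan_closed[OF step(1) assms(2) i] assms(2) by (simp add: a_comm)
   finally show "z i = dot R {..<Suc n} (%l. if l = n then t else s l) (%l. (if l = n then h else g l) i)" by simp
  qed
 qed
qed

lemma Idl_insert_dot:
 assumes "finite I" "!!i. i \<in> I ==> x i \<in> CR"
 shows "c \<in> Idl (x ` I) \<longleftrightarrow> (\<exists>z. (\<forall>i\<in>I. z i \<in> CR) \<and> c = dot R I z x)"
 using assms
proof (induction I arbitrary: c rule: finite_induct)
 case empty
 have "Idl {} = {\<zero>}" using genideal_minimal[OF zeroideal, of "{}"] genideal_ideal[of "{}"] idealD(2) by auto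
 then show ?case by auto
next
 case (insert k I)
 have xc: "x ` I \<subseteq> CR" "x k \<in> CR" using insert by auto
 have "Idl (x ` insert k I) = adj R (Idl (x ` I)) (x k)" using xc by (simp add: Idl_insert_adj)
 moreover have "c \<in> adj R (Idl (x ` I)) (x k) \<longleftrightarrow> (\<exists>z. (\<forall>i\<in>insert k I. z i \<in> CR) \<and> c = dot R (insert k I) z x)"
 proof
  assume "c \<in> adj R (Idl (x ` I)) (x k)"
  then obtain i r where ir: "c = i \<oplus> r \<otimes> x k" "i \<in> Idl (x ` I)" "r \<in> CR" by (rule adjE)
  then obtain z where z: "\<forall>i\<in>I. z i \<in> CR" "i = dot R I z x" using insert by blast
  define z' where "z' = (%i. if i = k then r else z i)"
  have "dot R (insert k I) z' x = r \<otimes> x k \<oplus> dot R I z' x"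
   using insert z ir by (subst dot_insert) (auto simp: z'_def)
  also have "dot R I z' x = i" unfolding z(2) using insert z by (intro dot_cong) (auto simp: z'_def)
  finally have "c = dot R (insert k I) z' x" using ir z insert by (simp add: a_comm)
  moreover have "\<forall>i\<in>insert k I. z' i \<in> CR" using z ir by (auto simp: z'_def)
  ultimately show "\<exists>z. (\<forall>i\<in>insert k I. z i \<in> CR) \<and> c = dot R (insert k I) z x" by blast
 next
  assume "\<exists>z. (\<forall>i\<in>insert k I. z i \<in> CR) \<and> c = dot R (insert k I) z x"
  then obtain z where z: "\<forall>i\<in>insert k I. z i \<in> CR" "c = dot R (insert k I) z x" by blast
  have "dot R I z x \<in> Idl (x ` I)" using insert z by blast
  moreover have "c = dot R I z x \<oplus> z k \<otimes> x k" unfolding z(2) using insert z by (subst dot_insert) (auto simp: a_comm)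
  ultimately show "c \<in> adj R (Idl (x ` I)) (x k)" using z by (auto intro: adj_I)
 qed
 ultimately show ?case by simp
qed

end

text \<open>Flatness of Frobenius tested on a single ideal and a single element. The equational
  criterion \<open>flat_system\<close> is drawn from it.\<close>

locale frob_flat = cring R for R (structure) +
 fixes q :: nat
 assumes frq: "frob R q"
  and flat: "ideal I R ==> y \<in> CR ==>
   colon R (FP I q) {y [^] q} = FP (colon R I {y}) q"
begin

text \<open>The columns \<open>A _ j\<close> are the equations, \<open>I\<close> indexes the
  unknowns; the members are coordinatewise \<open>q\<close>-th powers of solutions.\<close>

definition fker :: "'i set => 'j set => ('i => 'j => 'a) => ('i => 'a) set" where
 "fker I J A = {%i. y i [^] q | y. (\<forall>i. y i \<in> carrier R) \<and> (\<forall>j\<in>J. dot R I y (%i. A i j) = \<zero>)}"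

lemma fker_closed: "g \<in> fker I J A ==> g i \<in> CR"
 by (auto simp: fker_def)

text \<open>One equation, by induction on the number of unknowns. With K generated by the other
  coefficients, z k lies in (K^[q] : x_k^q) = (K : x_k)^[q]. Each w in (K : x_k) is the k-th
  coordinate of a solution, so some vector v in the span has the same k-th coordinate as z, and z -
  v solves an equation in fewer unknowns.\<close>

lemma flat_single:
 assumes "finite I" "!!i. i \<in> I ==> x i \<in> CR" "!!i. i \<in> I ==> z i \<in> CR"
  "dot R I z (%i. x i [^] q) = \<zero>"
 shows "z \<in> lspan R I (fker I {j::'j} (%i _. x i))"
 using assms
proof (induction I arbitrary: z rule: finite_induct)
 case empty
 then show ?case by (intro lspan.zero) auto
next
 case (insert k I)
 let ?x = "%i. x i [^] q"
 let ?G = "fker (insert k I) {j} (%i _. x i)"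
 let ?G' = "fker I {j} (%i _. x i)"
 let ?K = "Idl (x ` I)"
 have xc: "x ` I \<subseteq> CR" "x k \<in> CR" "!!i. i \<in> I ==> x i \<in> CR" using insert by auto
 have K: "ideal ?K R" using xc(1) by (rule genideal_ideal)
 have "FP ?K q = Idl (?x ` I)" using fp_Idl[OF frq xc(1)] by (simp add: image_image)
 moreover have dz: "dot R I z ?x \<in> Idl (?x ` I)"
  using Idl_insert_dot[of I ?x] insert by (auto intro!: exI[of _ z])
 ultimately have KI: "dot R I z ?x \<in> FP ?K q" by simp
 have "z k \<otimes> x k [^] q \<oplus> dot R I z ?x = \<zero>"
  using insert by (subst (asm) dot_insert) auto
 then have "dot R I z ?x \<oplus> z k \<otimes> x k [^] q \<in> FP ?K q"
  using idealD(2)[OF fp_ideal[OF idealD(1)[OF K], of q]] insert by (simp add: a_comm)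
 then have "z k \<otimes> x k [^] q \<in> FP ?K q"
  using ideal_minus_cancel[OF fp_ideal[OF idealD(1)[OF K], of q] _ KI] insert by auto
 then have zk: "z k \<in> FP (colon R ?K {x k}) q"
  using flat[OF K xc(2)] insert by (auto simp: colon_single)
 have Gc: "\<forall>g\<in>?G. \<forall>i\<in>insert k I. g i \<in> CR" by (auto intro: fker_closed)
 \<comment> \<open>The k-th coordinates of vectors in the span form an ideal, so it is enough that
   it contains w^q for every w in (K : x_k).\<close>
 let ?V = "{c \<in> CR. \<exists>v \<in> lspan R (insert k I) ?G. v k = c}"
 have "FP (colon R ?K {x k}) q \<subseteq> ?V"
 proof (rule fp_least)
  show "ideal ?V R"
  proof (rule ideal_intro)
   show "\<zero> \<in> ?V"
    using lspan.zero[of "insert k I" "%_. \<zero>" R ?G] by (auto intro!: bexI[of _ "%_. \<zero>"])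
  next
   fix c d assume "c \<in> ?V"
    "d \<in> ?V"
   then obtain v w where vw: "v \<in> lspan R (insert k I) ?G" "w \<in> lspan R (insert k I) ?G" "v k = c" "w k = d"
    "c \<in> CR" "d \<in> CR" by auto
   then show "c \<oplus> d \<in> ?V"
    using lspan_add[OF vw(2,1) Gc] by (auto intro!: bexI[of _ "%i. v i \<oplus> w i"])
  next
   fix t c assume t: "t \<in> CR" and "c \<in> ?V"
   then obtain v where v: "v \<in> lspan R (insert k I) ?G" "v k = c" "c \<in> CR" by auto
   then show "t \<otimes> c \<in> ?V"
    using lspan_smult[OF v(1) t Gc] t by (auto intro!: bexI[of _ "%i. t \<otimes> v i"])
  qed auto
  fix w assume "w \<in> colon R ?K {x k}"
  then have w: "w \<in> CR" "w \<otimes> x k \<in> ?K" by (auto simp: colon_single)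
  obtain y where y: "\<forall>i\<in>I. y i \<in> CR" "w \<otimes> x k = dot R I y x"
   using w(2) Idl_insert_dot[OF insert.hyps(1) xc(3)] by auto
  \<comment> \<open>The relation w x_k = sum of y_i x_i, read as a solution with k-th coordinate
    w.\<close>
  define y' where "y' = (%i. if i = k then w else if i \<in> I then \<ominus> y i else \<zero>)"
  have yc: "y' i \<in> CR" for i using y w by (auto simp: y'_def)
  have "dot R I y' x = dot R I (%i. \<ominus> y i) x" using insert y by (intro dot_cong) (auto simp: y'_def)
  also have "... = \<ominus> (w \<otimes> x k)" unfolding y(2) using insert y by (intro dot_uminus) auto
  finally have "dot R (insert k I) y' x = \<zero>"
   using insert yc w xc by (subst dot_insert) (auto simp: y'_def r_neg)
  then have "(%i. y' i [^] q) \<in> ?G" unfolding fker_def using yc by blast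
  then have "(%i. y' i [^] q) \<in> lspan R (insert k I) ?G" using yc by (intro lspan_gen) auto
  then show "w [^] q \<in> ?V"
   using w by (auto simp: y'_def intro!: bexI[of _ "%i. y' i [^] q"])
 qed
 then obtain v where v: "v \<in> lspan R (insert k I) ?G" "v k = z k" using zk by auto
 have vc: "v i \<in> CR" if "i \<in> insert k I" for i using lspan_closed[OF v(1) Gc that] .
 have kerG: "u \<in> lspan R (insert k I) ?G ==> dot R (insert k I) u ?x = \<zero>" for u
 proof (induction rule: lspan.induct)
  case (zero u)
  then show ?case using insert by (intro dot_zero) auto
 next
  case (step w g s u)
  obtain y where y: "g = (%i. y i [^] q)" "\<forall>i. y i \<in> CR" "dot R (insert k I) y x = \<zero>"
   using step(2) by (auto simp: fker_def)
  have fI: "finite (insert k I)" using insert by simp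
  have "dot R (insert k I) g ?x = dot R (insert k I) y x [^] q"
   unfolding y(1) using dot_frob[OF frq fI, of y x] y insert by auto
  then have "dot R (insert k I) g ?x = \<zero>" using y frob_zero[OF frq] by simp
  moreover have "dot R (insert k I) u ?x =
    dot R (insert k I) w ?x \<oplus> s \<otimes> dot R (insert k I) g ?x"
   using step lspan_closed[OF step(1) Gc] Gc step(2) insert by (intro dot_lin) auto
  ultimately show ?case using step by simp
 qed
 define u where "u = (%i. z i \<ominus> v i)"
 have uc: "u i \<in> CR" if "i \<in> insert k I" for i using that vc insert by (auto simp: u_def)
 have "dot R (insert k I) u ?x = dot R (insert k I) z ?x \<oplus> (\<ominus> \<one>) \<otimes> dot R (insert k I) v ?x"
  using insert vc by (intro dot_lin) (auto simp: u_def a_minus_def l_minus)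
 then have "dot R (insert k I) u ?x = \<zero>" using kerG[OF v(1)] insert by simp
 moreover have "dot R (insert k I) u ?x = u k \<otimes> x k [^] q \<oplus> dot R I u ?x"
  using insert uc by (subst dot_insert) auto
 moreover have "u k = \<zero>" using v insert by (simp add: u_def r_neg a_minus_def)
 ultimately have "dot R I u ?x = \<zero>" using uc xc by (simp add: dot_closed)
 then have uI: "u \<in> lspan R I ?G'" using insert.IH[OF xc(3), of u] uc by blast
 have ext0: "\<exists>u' \<in> lspan R (insert k I) ?G. (\<forall>i\<in>I. u' i = u i) \<and> u' k = \<zero>"
  using uI
 proof (induction rule: lspan.induct)
  case (zero u)
  then show ?case by (intro bexI[of _ "%_. \<zero>"] lspan.zero) auto
 next
  case (step w g s u)
  then obtain w' where w': "w' \<in> lspan R (insert k I) ?G" "\<forall>i\<in>I. w' i = w i" "w' k = \<zero>" by blast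
  obtain y where y: "g = (%i. y i [^] q)" "\<forall>i. y i \<in> CR" "dot R I y x = \<zero>"
   using step(2) by (auto simp: fker_def)
  define y' where "y' = (%i. if i = k then \<zero> else y i)"
  have yc: "y' i \<in> CR" for i using y by (auto simp: y'_def)
  have "dot R I y' x = \<zero>" unfolding y(3)[symmetric] using insert y by (intro dot_cong) (auto simp: y'_def)
  then have "dot R (insert k I) y' x = \<zero>" using insert yc xc by (subst dot_insert) (auto simp: y'_def)
  then have g': "(%i. y' i [^] q) \<in> ?G" unfolding fker_def using yc by blast
  have "(%i. w' i \<oplus> s \<otimes> y' i [^] q) \<in> lspan R (insert k I) ?G"
   by (rule lspan.step[OF w'(1) g' step(3)]) auto
  moreover have "\<forall>i\<in>I. w' i \<oplus> s \<otimes> y' i [^] q = u i" using w' step(4) insert.hyps y by (auto simp: y'_def)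
  moreover have "w' k \<oplus> s \<otimes> y' k [^] q = \<zero>" using w' step(3) frob_zero[OF frq] by (simp add: y'_def)
  ultimately show ?case by (intro bexI[of _ "%i. w' i \<oplus> s \<otimes> y' i [^] q"] conjI)
 qed
 then obtain u' where u': "u' \<in> lspan R (insert k I) ?G" "\<forall>i\<in>I. u' i = u i" "u' k = \<zero>" by blast
 have "(%i. v i \<oplus> u' i) \<in> lspan R (insert k I) ?G" using lspan_add[OF u'(1) v(1) Gc] .
 moreover have "\<forall>i\<in>insert k I. z i = v i \<oplus> u' i"
 proof
  fix i assume i: "i \<in> insert k I"
  have "u' i = z i \<ominus> v i" using i u' v vc[of k] by (auto simp: u_def a_minus_def r_neg)
  then show "z i = v i \<oplus> u' i" using vc[OF i] insert.prems(2)[OF i] add_diff_cancel[of "z i" "v i"] by (simp add: a_comm)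
 qed
 ultimately show ?case by (rule lspan_cong)
qed

text \<open>Equations are added one by one. By induction z is a combination, with coefficients s, of
  \<open>q\<close>-th powers of solutions Y l of the earlier equations. The new equation for z says
  that s solves a single equation whose coefficients are the \<open>q\<close>-th powers of the
  values x l of the new equation at Y l, so \<open>flat_single\<close> applies to s. Its solutions y
  combine the Y l into solutions of all equations.\<close>

theorem flat_system:
 fixes A :: "'i => 'j => 'a"
 assumes "finite I" "finite J" "!!i j. i \<in> I ==> j \<in> J ==> A i j \<in> CR" "!!i. i \<in> I ==> z i \<in> CR"
  "!!j. j \<in> J ==> dot R I z (%i. A i j [^] q) = \<zero>"
 shows "z \<in> lspan R I (fker I J A)"
 using assms(2,3,5)
proof (induction J rule: finite_induct)
 case empty
 \<comment> \<open>Without equations every vector qualifies, in particular the standard basis.\<close>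
 have "\<exists>w \<in> lspan R I (fker I {} A). (\<forall>i\<in>K. w i = z i) \<and> (\<forall>i\<in>I - K. w i = \<zero>)" if "K \<subseteq> I" for K
 proof -
  have "finite K" using that assms(1) finite_subset by blast
  then show ?thesis using that
  proof (induction K rule: finite_induct)
   case empty
   then show ?case by (intro bexI[of _ "%_. \<zero>"] lspan.zero) auto
  next
   case (insert k K)
   then obtain w where w: "w \<in> lspan R I (fker I {} A)" "\<forall>i\<in>K. w i = z i" "\<forall>i\<in>I - K. w i = \<zero>" by auto
   define y where "y = (%i. if i = k then \<one> else \<zero>)"
   have g: "(%i. y i [^] q) \<in> fker I {} A" unfolding fker_def by (auto simp: y_def)
   have "(%i. w i \<oplus> z k \<otimes> y i [^] q) \<in> lspan R I (fker I {} A)"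
    using insert assms(4) by (intro lspan.step[OF w(1) g, of "z k"]) auto
   moreover have "y i [^] q = (if i = k then \<one> else \<zero>)" for i using frob_zero[OF frq] by (simp add: y_def)
   moreover have zc: "z i \<in> CR" if "i \<in> I" for i using assms(4) that .
   ultimately show ?case using w insert
    by (intro bexI[of _ "%i. w i \<oplus> z k \<otimes> y i [^] q"]) (auto simp: subset_iff)
  qed
 qed
 from this[of I] show ?case using lspan_cong by fastforce
next
 case (insert j J)
 have Gc: "\<forall>g\<in>fker I J A. \<forall>i\<in>I. g i \<in> CR" by (auto intro: fker_closed)
 have "z \<in> lspan R I (fker I J A)" using insert by auto
 then obtain n :: nat and s g where sg: "\<forall>l<n. s l \<in> CR \<and> g l \<in> fker I J A"
  "\<forall>i\<in>I. z i = dot R {..<n} s (%l. g l i)"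
  using lspan_fin[OF _ Gc] by blast
 then have "\<forall>l<n. \<exists>y. g l = (%i. y i [^] q) \<and> (\<forall>i. y i \<in> CR) \<and> (\<forall>j\<in>J. dot R I y (%i. A i j) = \<zero>)"
  by (auto simp: fker_def)
 then obtain Y where Y: "!!l. l < n ==> g l = (%i. Y l i [^] q)" "!!l i. l < n ==> Y l i \<in> CR"
  "!!l j. l < n ==> j \<in> J ==> dot R I (Y l) (%i. A i j) = \<zero>" by metis
 have Ac: "!!i j'. i \<in> I ==> j' \<in> insert j J ==> A i j' \<in> CR" using insert.prems by auto
 define x where "x = (%l. dot R I (Y l) (%i. A i j))"
 have xc: "x l \<in> CR" if "l < n" for l using that Y Ac by (auto simp: x_def)
 have zi: "z i = dot R {..<n} s (%l. Y l i [^] q)" if "i \<in> I" for i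
  using sg that Y by (simp, intro dot_cong) auto
 have "dot R {..<n} s (%l. x l [^] q) = dot R {..<n} s (%l. dot R I (%i. Y l i [^] q) (%i. A i j [^] q))"
  using dot_frob[OF frq assms(1)] Y Ac sg by (intro dot_cong) (auto simp: x_def)
 also have "... = dot R I (%i. dot R {..<n} s (%l. Y l i [^] q)) (%i. A i j [^] q)"
  using Y Ac sg assms(1) by (intro dot_swap) auto
 also have "... = dot R I z (%i. A i j [^] q)" using zi Y Ac sg assms(4) by (intro dot_cong) auto
 also have "... = \<zero>" using insert by auto
 finally have "s \<in> lspan R {..<n} (fker {..<n} {j} (%l _. x l))"
  using sg xc by (intro flat_single) auto
 then have "(%i. dot R {..<n} s (%l. Y l i [^] q)) \<in> lspan R I (fker I (insert j J) A)"
 proof (induction rule: lspan.induct)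
  case (zero s)
  then show ?case using Y by (intro lspan.zero ballI dot_zero) auto
 next
  case (step w g t s)
  obtain y where y: "g = (%i. y i [^] q)" "\<forall>i. y i \<in> CR" "dot R {..<n} y x = \<zero>"
   using step(2) by (auto simp: fker_def)
  define v where "v = (%i. dot R {..<n} y (%l. Y l i))"
  have vc: "v i \<in> CR" for i unfolding v_def using y Y by (intro dot_closed) auto
  have sw: "dot R I v (%i. A i j') = dot R {..<n} y (%l. dot R I (Y l) (%i. A i j'))" if "j' \<in> insert j J" for j'
   unfolding v_def using y Y Ac that assms(1) by (intro dot_swap[symmetric]) auto
  have "dot R I v (%i. A i j') = \<zero>" if "j' \<in> insert j J" for j'
  proof (cases "j' = j")
   case True
   then show ?thesis using sw[OF that] y by (simp add: x_def)
  next
   case False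
   have "dot R {..<n} y (%l. dot R I (Y l) (%i. A i j')) = dot R {..<n} (%l. dot R I (Y l) (%i. A i j')) y"
    using y Y Ac that by (intro dot_comm) auto
   also have "... = \<zero>" using Y(3)[of _ j'] y that False by (intro dot_zero[of "{..<n}"]) auto
   finally show ?thesis using sw[OF that] by simp
  qed
  then have g: "(%i. v i [^] q) \<in> fker I (insert j J) A" unfolding fker_def using vc by blast
  show ?case
  proof (rule lspan.step[OF step(5) g step(3)], rule ballI)
   fix i assume i: "i \<in> I"
   have wc: "w l \<in> CR" if "l < n" for l
    using lspan_closed[OF step(1), of l] that by (auto dest: fker_closed)
   have "dot R {..<n} s (%l. Y l i [^] q) = dot R {..<n} w (%l. Y l i [^] q) \<oplus> t \<otimes> dot R {..<n} g (%l. Y l i [^] q)"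
    using step wc Y y by (intro dot_lin) auto
   also have "dot R {..<n} g (%l. Y l i [^] q) = v i [^] q"
    unfolding y(1) v_def using dot_frob[OF frq, of "{..<n}" y "%l. Y l i"] y Y by auto
   finally show "dot R {..<n} s (%l. Y l i [^] q) = dot R {..<n} w (%l. Y l i [^] q) \<oplus> t \<otimes> v i [^] q" .
  qed
 qed
 then show ?case using zi by (rule lspan_cong[OF _ ballI])
qed

end

section \<open>Fedder's criterion\<close>

text \<open>Purity of \<open>r \<mapsto> r\<^sup>q\<close> on \<open>R/I\<close>, tested on a finite system of linear equations.\<close>

definition lin_pure :: "('a, 'x) ring_scheme => 'a set => nat => bool" where
 "lin_pure R I q \<longleftrightarrow> (\<forall>(k::nat) (n::nat) y s X. (\<forall>j<k. y j \<in> carrier R) -->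
   (\<forall>l<n. s l \<in> carrier R) --> (\<forall>l<n. \<forall>j<k. X l j \<in> carrier R) -->
   (\<forall>j<k. y j [^]\<^bsub>R\<^esub> q \<ominus>\<^bsub>R\<^esub> dot R {..<n} s (%l. X l j [^]\<^bsub>R\<^esub> q) \<in> I) -->
   (\<exists>r. (\<forall>l<n. r l \<in> carrier R) \<and> (\<forall>j<k. y j \<ominus>\<^bsub>R\<^esub> dot R {..<n} r (%l. X l j) \<in> I)))"

context cring
begin

lemma dot_Plus:
 assumes "finite A" "finite B" "!!i. i \<in> A ==> z (Inl i) \<in> CR" "!!i. i \<in> A ==> x (Inl i) \<in> CR"
  "!!i. i \<in> B ==> z (Inr i) \<in> CR" "!!i. i \<in> B ==> x (Inr i) \<in> CR"
 shows "dot R (Inl ` A \<union> Inr ` B) z x = dot R A (%i. z (Inl i)) (%i. x (Inl i)) \<oplus> dot R B (%i. z (Inr i)) (%i. x (Inr i))"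
proof -
 have "dot R (Inl ` A \<union> Inr ` B) z x = (\<Oplus>i\<in>Inl ` A. z i \<otimes> x i) \<oplus> (\<Oplus>i\<in>Inr ` B. z i \<otimes> x i)"
  unfolding dot_def using assms by (intro finsum_Un_disjoint) auto
 also have "(\<Oplus>i\<in>Inl ` A. z i \<otimes> x i) = dot R A (%i. z (Inl i)) (%i. x (Inl i))"
  unfolding dot_def using assms by (intro finsum_reindex) (auto simp: inj_on_def)
 also have "(\<Oplus>i\<in>Inr ` B. z i \<otimes> x i) = dot R B (%i. z (Inr i)) (%i. x (Inr i))"
  unfolding dot_def using assms by (intro finsum_reindex) (auto simp: inj_on_def)
 finally show ?thesis .
qed

lemma dot_mem_ideal:
 assumes "ideal I R" "finite A" "!!i. i \<in> A ==> z i \<in> CR" "!!i. i \<in> A ==> x i \<in> CR"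
  "!!i. i \<in> A ==> z i \<otimes> x i \<in> I"
 shows "dot R A z x \<in> I"
 using assms(2-5)
proof (induction A rule: finite_induct)
 case empty
 then show ?case using idealD(2)[OF assms(1)] by simp
next
 case (insert k A)
 then show ?case using idealD(3)[OF assms(1)] by (subst dot_insert) auto
qed

lemma colon_Idl:
 assumes "ideal I R" "A \<subseteq> CR"
 shows "colon R I (Idl A) = colon R I A"
proof
 show "colon R I (Idl A) \<subseteq> colon R I A" using genideal_self[OF assms(2)] by (auto simp: colon_def)
 show "colon R I A \<subseteq> colon R I (Idl A)"
 proof
  fix r assume r: "r \<in> colon R I A"
  then have rc: "r \<in> CR" by (auto simp: colon_def)
  have "Idl A \<subseteq> colon R I {r}"
   using r rc assms by (intro genideal_minimal colon_ideal) (auto simp: colon_def m_comm subset_iff)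
  then show "r \<in> colon R I (Idl A)" using rc by (auto simp: colon_def m_comm)
 qed
qed

end

section \<open>Artin-Rees for intersections and for colons by finite sets\<close>

context noeth
begin

text \<open>\<open>weak_AR\<close> is applied to T = C2 + (C1 inter K) inside L = C2 + C1, where K
  is the ideal on the right. It applies because x^s multiplies C1 into C1 inter K.\<close>

lemma AR_inter:
 assumes C: "ideal C1 R" "ideal C2 R" and X: "finite X" "X \<subseteq> CR"
 shows "\<exists>N::nat. \<forall>n\<ge>N. Idl (C1 \<union> pows n X) \<inter> Idl (C2 \<union> pows n X)
  \<subseteq> Idl ((C1 \<inter> C2) \<union> pows (s::nat) X)"
proof -
 define K where "K = Idl ((C1 \<inter> C2) \<union> pows s X)"
 note f1 = idealD[OF C(1)] and f2 = idealD[OF C(2)]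
 have kg: "(C1 \<inter> C2) \<union> pows s X \<subseteq> CR" using X f1(1) by auto
 have K: "ideal K R" unfolding K_def using kg by (rule genideal_ideal)
 note Kf = idealD[OF K]
 have Ks: "C1 \<inter> C2 \<subseteq> K" "pows s X \<subseteq> K" unfolding K_def using genideal_self[OF kg] by auto
 have CK: "ideal (C1 \<inter> K) R" using i_intersect C K by blast
 let ?T = "isum R C2 (C1 \<inter> K)" and ?L = "isum R C2 C1"
 have T: "ideal ?T R" "ideal ?L R" using C CK by auto
 have "\<exists>N::nat. \<forall>n\<ge>N. Idl (?T \<union> pows n X) \<inter> ?L \<subseteq> ?T"
 proof (rule weak_AR[OF T(1,2) _ X])
  show "?T \<subseteq> ?L" by (auto simp: isum_def)
  fix x assume x: "x \<in> X"
  show "\<exists>s::nat. \<forall>l\<in>?L. x [^] s \<otimes> l \<in> ?T"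
  proof (intro exI[of _ s] ballI)
   fix l assume "l \<in> ?L"
   then obtain c2 c1 where l: "l = c2 \<oplus> c1" "c2 \<in> C2" "c1 \<in> C1" by (auto simp: isum_def)
   have c: "c1 \<in> CR" "c2 \<in> CR" "x [^] s \<in> CR" using l f1(8) f2(8) x X by auto
   have "x [^] s \<otimes> l = x [^] s \<otimes> c2 \<oplus> x [^] s \<otimes> c1" unfolding l(1) using c by (simp add: r_distr)
   moreover have "x [^] s \<otimes> c2 \<in> C2" "x [^] s \<otimes> c1 \<in> C1" using f2(4)[OF c(3) l(2)] f1(4)[OF c(3) l(3)] by auto
   moreover have "x [^] s \<otimes> c1 \<in> K" using Kf(5)[OF c(1), of "x [^] s"] Ks x by auto
   ultimately show "x [^] s \<otimes> l \<in> ?T" unfolding isum_def by blast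
  qed
 qed
 then obtain N :: nat where N: "!!n. n \<ge> N ==> Idl (?T \<union> pows n X) \<inter> ?L \<subseteq> ?T" by auto
 have split: "\<exists>c\<in>C. \<exists>j\<in>Idl (pows n X). r = c \<oplus> j"
  if C: "ideal C R" and r: "r \<in> Idl (C \<union> pows n X)" for C r and n :: nat
 proof -
  have g: "pows n X \<subseteq> CR" using X by auto
  have J: "ideal (Idl (pows n X)) R" using genideal_ideal[OF g] .
  have "Idl (C \<union> pows n X) \<subseteq> isum R C (Idl (pows n X))"
   using isum_sub[OF C J] genideal_self[OF g] by (intro genideal_minimal isum_ideal C J) auto
  then have "r \<in> isum R C (Idl (pows n X))" using r by blast
  then show ?thesis by (auto simp: isum_def)
 qed
 have "Idl (C1 \<union> pows n X) \<inter> Idl (C2 \<union> pows n X) \<subseteq> K" if n: "n \<ge> max N s" for n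
 proof
  fix r assume "r \<in> Idl (C1 \<union> pows n X) \<inter> Idl (C2 \<union> pows n X)"
  then have r: "r \<in> Idl (C1 \<union> pows n X)" "r \<in> Idl (C2 \<union> pows n X)" by auto
  let ?J = "Idl (pows n X)" and ?M = "Idl (?T \<union> pows n X)"
  have g: "pows n X \<subseteq> CR" using X by auto
  have gT: "?T \<union> pows n X \<subseteq> CR" using g idealD(1)[OF T(1)] by auto
  have M: "ideal ?M R" using genideal_ideal[OF gT] .
  have TM: "?T \<subseteq> ?M" "pows n X \<subseteq> ?M" using genideal_self[OF gT] by auto
  have JM: "?J \<subseteq> ?M" using TM by (intro genideal_minimal M) auto
  obtain c1 j where 1: "c1 \<in> C1" "j \<in> ?J" "r = c1 \<oplus> j" using split[OF C(1) r(1)] by auto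
  have C2T: "C2 \<subseteq> ?T" using isum_sub[OF C(2) CK] by auto
  have "C2 \<union> pows n X \<subseteq> ?M" using C2T TM by auto
  then have "r \<in> ?M" using r(2) genideal_minimal[OF M] by blast
  have jc: "j \<in> CR" "c1 \<in> CR" using 1 f1(8) idealD(8)[OF genideal_ideal[OF g]] by auto
  have "j \<oplus> c1 \<in> ?M" using \<open>r \<in> ?M\<close> 1(3) jc by (simp add: a_comm)
  then have "c1 \<in> ?M" using ideal_minus_cancel[OF M] JM 1(2) jc by blast
  moreover have "c1 \<in> ?L" using isum_sub(2)[OF C(2,1)] 1 by auto
  ultimately have "c1 \<in> ?T" using N[of n] n by auto
  then obtain c2 k where 2: "c1 = c2 \<oplus> k" "c2 \<in> C2" "k \<in> C1" "k \<in> K" by (auto simp: isum_def)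
  have c2c: "c2 \<in> CR" "k \<in> CR" using 2 f2(8) Kf(8) by auto
  have "k \<oplus> c2 \<in> C1" using 1(1) 2(1) c2c by (simp add: a_comm)
  then have "c2 \<in> C1" using ideal_minus_cancel[OF C(1)] 2 c2c by blast
  then have "c1 \<in> K" unfolding 2(1) using 2 Ks Kf(3) by blast
  moreover have "?J \<subseteq> K"
  proof (intro genideal_minimal K image_subsetI)
   fix x assume x: "x \<in> X"
   show "x [^] n \<in> K" using pow_mem_mono[OF K, of x s n] Ks x n X by auto
  qed
  ultimately show "r \<in> K" unfolding 1(3) using 1(2) Kf(3) by blast
 qed
 then show ?thesis unfolding K_def by blast
qed

text \<open>A colon by several elements is an intersection of colons by one element;
  \<open>AR_inter\<close> states how large an exponent M the separate colons must reach for their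
  intersection to reach s.\<close>

lemma AR_colon_set:
 assumes I: "ideal I R" and A: "finite A" "A \<subseteq> CR" and X: "finite X" "X \<subseteq> CR"
 shows "\<exists>N::nat. \<forall>n\<ge>N. colon R (Idl (I \<union> pows n X)) A \<subseteq> Idl (colon R I A \<union> pows (s::nat) X)"
 using A
proof (induction A arbitrary: s rule: finite_induct)
 case empty
 have "colon R I {} \<union> pows s X \<subseteq> CR" using X by (auto simp: colon_def)
 from genideal_self[OF this] show ?case by (auto simp: colon_def)
next
 case (insert a A)
 have Ac: "a \<in> CR" "A \<subseteq> CR" using insert by auto
 have C: "ideal (colon R I {a}) R" "ideal (colon R I A) R" using I Ac by auto
 have ins: "colon R K (insert a A) = colon R K {a} \<inter> colon R K A" for K by (auto simp: colon_def)
 obtain M :: nat where M: "!!n. n \<ge> M ==> Idl (colon R I {a} \<union> pows n X) \<inter> Idl (colon R I A \<union> pows n X)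
  \<subseteq> Idl ((colon R I {a} \<inter> colon R I A) \<union> pows s X)" using AR_inter[OF C X, of s] by auto
 obtain N1 :: nat where N1: "!!n. n \<ge> N1 ==> colon R (Idl (I \<union> pows n X)) {a} \<subseteq> Idl (colon R I {a} \<union> pows M X)"
  using AR_colon[OF I Ac(1) X, of M] by auto
 obtain N2 :: nat where N2: "!!n. n \<ge> N2 ==> colon R (Idl (I \<union> pows n X)) A \<subseteq> Idl (colon R I A \<union> pows M X)"
  using insert.IH[of M] Ac by auto
 show ?case
 proof (intro exI[of _ "max N1 N2"] allI impI)
  fix n assume n: "n \<ge> max N1 N2"
  then show "colon R (Idl (I \<union> pows n X)) (insert a A) \<subseteq> Idl (colon R I (insert a A) \<union> pows s X)"
   unfolding ins using N1[of n] N2[of n] M[OF order_refl] by auto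
 qed
qed

end

section \<open>Fedder's criterion in a regular local ring\<close>

context regular_local
begin

text \<open>Suppose (\<alpha>^[q] : \<alpha>) were contained in m^[q]. In R/J with J = m^[Q], the
  annihilator C/J of \<alpha> contains the socle generator u. Duality in the Gorenstein ring
  R/m^[Qq] then shows that u^q lies in \<alpha> C^[q] + m^[Qq], which says that the class of u in
  C/J dies under base change along Frobenius of R/\<alpha>. By purity u is already zero in C/J, a
  contradiction. Purity enters through generators and relations of C/J.\<close>

theorem fedder_local:
 assumes frp: "frob R p" and p2: "p \<ge> 2" and \<alpha>: "ideal \<alpha> R" and pure: "lin_pure R \<alpha> (p ^ e)"
 shows "\<exists>c\<in>CR. c \<notin> FP m (p ^ e) \<and> (\<forall>a\<in>\<alpha>. c \<otimes> a \<in> FP \<alpha> (p ^ e))"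
proof (rule ccontr)
 assume neg: "\<not> ?thesis"
 interpret noeth_local_len R m p "card X" X by (rule regular_len[OF frp p2])
 let ?q = "p ^ e"
 interpret frob_flat R ?q by unfold_locales (use frq flat_local in auto)
 have q1: "?q > 0" using p2 by simp
 note \<alpha>f = idealD[OF \<alpha>]
 define M where "M = FP m ?q"
 have M: "ideal M R" unfolding M_def using m_facts(1) by (rule fp_ideal)
 have "M \<subseteq> m" unfolding M_def using fp_sub[OF m_ideal q1] .
 then have oneM: "\<one> \<notin> M" using one_notin_m by auto
 define aq where "aq = FP \<alpha> ?q"
 have aq: "ideal aq R" unfolding aq_def using \<alpha>f(1) by (rule fp_ideal)
 have negM: "colon R aq \<alpha> \<subseteq> M"
 proof
  fix c assume "c \<in> colon R aq \<alpha>"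
  then have "c \<in> CR" "\<forall>a\<in>\<alpha>. c \<otimes> a \<in> aq" by (auto simp: colon_def)
  then show "c \<in> M" using neg unfolding aq_def M_def by blast
 qed
 have "\<alpha> \<noteq> CR"
 proof
  assume "\<alpha> = CR"
  then have "aq = CR" unfolding aq_def using fp_carrier by simp
  then have "\<one> \<in> colon R aq \<alpha>" using \<alpha>f(8) by (auto simp: colon_def)
  then show False using negM oneM by auto
 qed
 then have \<alpha>m: "\<alpha> \<subseteq> m" by (rule proper_sub_m[OF \<alpha>])
 obtain A where A: "A \<subseteq> CR" "finite A" "\<alpha> = Idl A" using finetely_gen[OF \<alpha>] by auto
 have cA: "colon R aq A \<subseteq> M" using negM colon_Idl[OF aq A(1)] A(3) by simp
 \<comment> \<open>The target exponent is q because the q-th powers of the elements of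
   \<open>X\<close> lie in m^[q]. So the assumed inclusion survives when high powers of the
   parameters are added to \<alpha>^[q].\<close>
 obtain N :: nat where N: "!!n. n \<ge> N ==> colon R (Idl (aq \<union> pows n X)) A \<subseteq> Idl (colon R aq A \<union> (%x. x [^] ?q) ` X)"
  using AR_colon_set[OF aq A(2,1) X(1,2), of ?q] by auto
 have Mq: "x [^] ?q \<in> M" if "x \<in> m" for x unfolding M_def using m_facts(1) that by (rule fp_mem)
 have "Idl (colon R aq A \<union> (%x. x [^] ?q) ` X) \<subseteq> M"
  using cA X_m Mq by (intro genideal_minimal M) auto
 then have star: "colon R (Idl (aq \<union> pows n X)) A \<subseteq> M" if "n \<ge> N" for n using N[OF that] by auto
 \<comment> \<open>A power of p, so that J is a Frobenius power of \<open>m\<close>; and large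
   enough that Qq is at least \<open>N\<close>, so that the inclusion \<open>star\<close> holds with
   exponent Qq.\<close>
 define Q where "Q = p ^ N"
 have frQ: "frob R Q" unfolding Q_def using frob_pow[OF frp] .
 have NQ: "N \<le> Q * ?q"
 proof -
  have "N \<le> Q" unfolding Q_def using p2 by (simp add: less_imp_le power_gt_expt)
  also have "Q = Q * 1" by simp
  also have "Q * 1 \<le> Q * ?q" by (intro mult_le_mono2) (use q1 in linarith)
  finally show ?thesis .
 qed
 define J where "J = FP m Q"
 define J' where "J' = FP m (Q * ?q)"
 have gJ: "gor J" "gor J'" unfolding J_def J'_def using gor_fp frQ frob_mult[OF frQ frq] by auto
 have J: "ideal J R" "mprim J" "ideal J' R" using gJ by (auto simp: gor_def mprim_def)
 note Jf = idealD[OF J(1)] note J'f = idealD[OF J(3)]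
 have JJ': "FP J ?q = J'" unfolding J_def J'_def by (rule fp_fp[OF frQ frq m_ideal])
 have Jgen: "J = Idl (pows Q X)" unfolding J_def fp_m[OF frQ] pw_def ..
 have J'gen: "J' = Idl (pows (Q * ?q) X)" unfolding J'_def fp_m[OF frob_mult[OF frQ frq]] pw_def ..
 have J'gen2: "J' = Idl ((%x. (x [^] Q) [^] ?q) ` X)"
 proof -
  have "(%x. (x [^] Q) [^] ?q) ` X = pows (Q * ?q) X" using X by (intro image_cong) (auto simp: nat_pow_pow)
  then show ?thesis using J'gen by simp
 qed
 obtain u where u: "u \<in> CR" "u \<notin> J" "\<forall>b\<in>m. b \<otimes> u \<in> J" using gJ(1) by (auto simp: gor_def)
 define \<beta> where "\<beta> = isum R \<alpha> J"
 have \<beta>: "ideal \<beta> R" "\<alpha> \<subseteq> \<beta>" "J \<subseteq> \<beta>" using isum_sub[OF \<alpha> J(1)] \<alpha> J(1) by (auto simp: \<beta>_def)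
 \<comment> \<open>C/J is the annihilator of \<alpha> in the Gorenstein ring R/J. It takes the place
   of the injective hull of the residue field over R/\<alpha>.\<close>
 define C where "C = colon R J \<beta>"
 have C: "ideal C R" "J \<subseteq> C" unfolding C_def using J(1) idealD(1)[OF \<beta>(1)] colon_sub by auto
 note Cf = idealD[OF C(1)]
 have C\<alpha>: "a \<otimes> c \<in> J" if "a \<in> \<alpha>" "c \<in> C" for a c
 proof -
  have "c \<otimes> a \<in> J" using that \<beta>(2) unfolding C_def colon_def by blast
  then show ?thesis using that \<alpha>f(8) Cf(8) by (simp add: m_comm)
 qed
 have "C \<supseteq> colon R J \<alpha>"
 proof
  fix c assume c: "c \<in> colon R J \<alpha>"
  then have cc: "c \<in> CR" by (auto simp: colon_def)
  have "\<beta> \<subseteq> colon R J {c}" unfolding \<beta>_def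
  proof (intro isum_minimal)
   show "ideal (colon R J {c}) R" using J(1) cc by auto
   show "\<alpha> \<subseteq> colon R J {c}" using c \<alpha>f(8) by (auto simp: colon_def m_comm)
   show "J \<subseteq> colon R J {c}" using colon_sub[OF J(1)] cc by simp
  qed
  then show "c \<in> C" unfolding C_def using cc by (auto simp: colon_def m_comm)
 qed
 moreover have "u \<in> colon R J \<alpha>" using u \<alpha>m \<alpha>f(8) by (auto simp: colon_def m_comm)
 ultimately have uC: "u \<in> C" by auto
 define \<beta>q where "\<beta>q = FP \<beta> ?q"
 define Cq where "Cq = FP C ?q"
 have \<beta>q: "ideal \<beta>q R" unfolding \<beta>q_def using idealD(1)[OF \<beta>(1)] by (rule fp_ideal)
 have Cq: "ideal Cq R" unfolding Cq_def using Cf(1) by (rule fp_ideal)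
 have J'\<beta>: "J' \<subseteq> \<beta>q" unfolding \<beta>q_def JJ'[symmetric] using \<beta> idealD(1)[OF \<beta>(1)] by (intro fp_mono)
 have mb: "mprim \<beta>" "mprim C" using mprim_mono[OF J(2)] \<beta> C by auto
 \<comment> \<open>Both colengths are q^d times the length of \<beta>/J: for C^[q] by
   \<open>clen_fp\<close> after duality in R/J, for the colon by duality in R/J' after
   \<open>clen_fp\<close>.\<close>
 obtain k where kk: "clen Cq (CR) k" "clen (colon R J' \<beta>q) (CR) k"
 proof -
  obtain a b where ab: "clen J \<beta> a" "clen \<beta> (CR) b" "clen J C b" "clen C (CR) a"
   using perp_len[OF gJ(1) \<beta>(1,3)] unfolding C_def by metis
  have 1: "clen Cq (CR) (?q ^ card X * a)" unfolding Cq_def by (rule clen_fp[OF mb(2) ab(4)])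
  obtain a' b' where ab': "clen J' \<beta>q a'" "clen \<beta>q (CR) b'" "clen (colon R J' \<beta>q) (CR) a'"
   using perp_len[OF gJ(2) \<beta>q J'\<beta>] by metis
  have "clen J' (CR) (?q ^ card X * (a + b))" unfolding JJ'[symmetric]
   using clen_fp[OF J(2) clen_trans[OF ab(2,1)]] .
  then have "a' + b' = ?q ^ card X * (a + b)" using clen_unique[OF clen_trans[OF ab'(2,1)]] by blast
  moreover have "b' = ?q ^ card X * b" using clen_unique[OF ab'(2)] clen_fp[OF mb(1) ab(2)] unfolding \<beta>q_def by blast
  ultimately have "a' = ?q ^ card X * a" by (simp add: distrib_left)
  then have "clen (colon R J' \<beta>q) (CR) (?q ^ card X * a)" using ab'(3) by simp
  then show thesis using 1 that by blast
 qed
 have "Cq = colon R J' \<beta>q"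
 proof (rule clen_top_eq[OF kk])
  show "Cq \<subseteq> colon R J' \<beta>q" unfolding Cq_def
  proof (rule fp_least)
   show "ideal (colon R J' \<beta>q) R" using J(3) idealD(1)[OF \<beta>q] by auto
   fix c assume c: "c \<in> C"
   have cc: "c \<in> CR" "c [^] ?q \<in> CR" using c Cf by auto
   have "\<beta>q \<subseteq> colon R J' {c [^] ?q}" unfolding \<beta>q_def
   proof (rule fp_least)
    show "ideal (colon R J' {c [^] ?q}) R" using J(3) cc by auto
    fix b assume b: "b \<in> \<beta>"
    then have bc: "b \<in> CR" using idealD(8)[OF \<beta>(1)] by auto
    have "c \<otimes> b \<in> J" using c b unfolding C_def by (auto simp: colon_def)
    then have "(c \<otimes> b) [^] ?q \<in> J'" unfolding JJ'[symmetric] using fp_mem[OF Jf(1)] by blast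
    then show "b [^] ?q \<in> colon R J' {c [^] ?q}" using bc cc by (simp add: colon_single nat_pow_distrib m_comm)
   qed
   then show "c [^] ?q \<in> colon R J' \<beta>q" using cc idealD(8)[OF \<beta>q] by (auto simp: colon_def m_comm)
  qed
 qed
 then have dd: "colon R J' Cq = \<beta>q" using double_annihilator[OF gJ(2) \<beta>q J'\<beta>] by simp
 have \<beta>sub: "\<beta>q \<subseteq> Idl (aq \<union> pows (Q * ?q) X)"
 proof -
  let ?K = "Idl (aq \<union> pows (Q * ?q) X)"
  have g: "aq \<union> pows (Q * ?q) X \<subseteq> CR" using X idealD(1)[OF aq] by auto
  have K: "ideal ?K R" using g by (rule genideal_ideal)
  note s = genideal_self[OF g]
  have JK: "J' \<subseteq> ?K" unfolding J'gen using s by (intro genideal_minimal K[unfolded J'gen]) auto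
  have "\<beta> \<subseteq> {x \<in> CR. x [^] ?q \<in> ?K}" unfolding \<beta>_def
  proof (intro isum_minimal frob_preimage_ideal frq K)
   show "\<alpha> \<subseteq> {x \<in> CR. x [^] ?q \<in> ?K}" using fp_mem[OF \<alpha>f(1), of _ ?q] \<alpha>f(8) s unfolding aq_def by auto
   show "J \<subseteq> {x \<in> CR. x [^] ?q \<in> ?K}" using fp_mem[OF Jf(1), of _ ?q] Jf(8) JK unfolding JJ' by auto
  qed
  then show ?thesis unfolding \<beta>q_def using K by (intro fp_least) auto
 qed
 obtain B where B: "B \<subseteq> CR" "finite B" "C = Idl B" using finetely_gen[OF C(1)] by auto
 obtain r :: nat and g where g: "B = g ` {..<r}" using B(2) finite_imp_nat_seg_image_inj_on[of B]
  by (metis lessThan_def)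
 let ?g = "%l. g l [^] ?q"
 have gc: "g l \<in> CR" if "l < r" for l using g B(1) that by auto
 have gC: "g l \<in> C" if "l < r" for l using genideal_self[OF B(1)] B(3) g that by auto
 have Cqg: "Cq = Idl (?g ` {..<r})"
  unfolding Cq_def B(3) fp_Idl[OF frq B(1)] by (simp add: g image_image)
 \<comment> \<open>The product \<alpha> C^[q], written over fixed generators so that the
   coefficients in \<alpha> can be read off.\<close>
 define L1 where "L1 = {dot R {..<r} s ?g | s. \<forall>l<r. s l \<in> \<alpha>}"
 have L1: "ideal L1 R"
 proof (rule ideal_intro)
  show "L1 \<subseteq> CR" using gc \<alpha>f(8) by (auto simp: L1_def)
  show "\<zero> \<in> L1" using dot_zero[of "{..<r}" "%_. \<zero>" "%l. g l [^] ?q"] gc \<alpha>f(2)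
   unfolding L1_def by (auto intro!: exI[of _ "%_. \<zero>"])
 next
  fix x y assume "x \<in> L1" "y \<in> L1"
  then obtain s t where st: "\<forall>l<r. s l \<in> \<alpha>" "\<forall>l<r. t l \<in> \<alpha>" "x = dot R {..<r} s ?g"
   "y = dot R {..<r} t ?g" by (auto simp: L1_def)
  have "dot R {..<r} (%l. s l \<oplus> \<one> \<otimes> t l) ?g = x \<oplus> \<one> \<otimes> y"
   unfolding st(3,4) using st \<alpha>f(8) gc by (intro dot_lin) auto
  moreover have "y \<in> CR" unfolding st(4) using st \<alpha>f(8) gc by (intro dot_closed) auto
  moreover have "\<forall>l<r. s l \<oplus> \<one> \<otimes> t l \<in> \<alpha>" using st \<alpha>f(3) \<alpha>f(8) by auto
  ultimately show "x \<oplus> y \<in> L1" unfolding L1_def by (auto intro!: exI[of _ "%l. s l \<oplus> \<one> \<otimes> t l"])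
 next
  fix x t assume "x \<in> L1" and t: "t \<in> CR"
  then obtain s where st: "\<forall>l<r. s l \<in> \<alpha>" "x = dot R {..<r} s ?g" by (auto simp: L1_def)
  have "dot R {..<r} (%l. t \<otimes> s l) ?g = t \<otimes> x"
   unfolding st(2) using st \<alpha>f(8) gc t by (intro dot_smult) auto
  moreover have "\<forall>l<r. t \<otimes> s l \<in> \<alpha>" using st \<alpha>f(4)[OF t] by auto
  ultimately show "t \<otimes> x \<in> L1" unfolding L1_def by (auto intro!: exI[of _ "%l. t \<otimes> s l"])
 qed
 define L where "L = isum R L1 J'"
 have L: "ideal L R" "L1 \<subseteq> L" "J' \<subseteq> L" using isum_sub[OF L1 J(3)] L1 J(3) by (auto simp: L_def)
 have aC: "a \<otimes> c \<in> L1" if aCq: "a \<in> \<alpha>" "c \<in> Cq" for a c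
 proof -
  obtain z where z: "\<forall>l\<in>{..<r}. z l \<in> CR" "c = dot R {..<r} z ?g"
   using aCq(2) Idl_insert_dot[of "{..<r}" "%l. g l [^] ?q" c] gc unfolding Cqg by auto
  have ac: "a \<in> CR" using aCq \<alpha>f by auto
  have "dot R {..<r} (%l. a \<otimes> z l) ?g = a \<otimes> c" unfolding z(2) using z gc ac by (intro dot_smult) auto
  moreover have "\<forall>l<r. a \<otimes> z l \<in> \<alpha>" using z \<alpha>f(5)[OF _ aCq(1)] by auto
  ultimately show ?thesis unfolding L1_def by (auto intro!: exI[of _ "%l. a \<otimes> z l"])
 qed
 have uq: "u [^] ?q \<in> CR" using u by simp
 \<comment> \<open>An element c of (J' : L) multiplies \<alpha> into (J' : C^[q]) = \<beta>^[q], so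
   it lies in m^[q] by \<open>star\<close>; and m^[q] u^q lies in J' because m u lies in J.\<close>
 have "u [^] ?q \<in> colon R J' (colon R J' L)"
 proof -
  have "u [^] ?q \<otimes> c \<in> J'" if c: "c \<in> colon R J' L" for c
  proof -
   have cc: "c \<in> CR" using c by (auto simp: colon_def)
   have "c \<otimes> a \<in> \<beta>q" if a: "a \<in> A" for a
   proof -
    have ac: "a \<in> CR" "a \<in> \<alpha>" using a A genideal_self[OF A(1)] by auto
    have "c \<otimes> a \<otimes> d \<in> J'" if d: "d \<in> Cq" for d
    proof -
     have "c \<otimes> (a \<otimes> d) \<in> J'" using c aC[OF ac(2) d] L(2) by (auto simp: colon_def)
     then show ?thesis using cc ac idealD(8)[OF Cq d] by (simp add: m_assoc)
    qed
    then have "c \<otimes> a \<in> colon R J' Cq" using cc ac by (simp add: colon_def)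
    then show ?thesis using dd by simp
   qed
   then have "c \<in> colon R (Idl (aq \<union> pows (Q * ?q) X)) A" using \<beta>sub cc by (auto simp: colon_def)
   then have cM: "c \<in> M" using star[OF NQ] by auto
   have "M \<subseteq> colon R J' {u [^] ?q}" unfolding M_def
   proof (rule fp_least)
    show "ideal (colon R J' {u [^] ?q}) R" using J(3) uq by auto
    fix b assume b: "b \<in> m"
    then have "(b \<otimes> u) [^] ?q \<in> J'" unfolding JJ'[symmetric] using fp_mem[OF Jf(1)] u by blast
    then show "b [^] ?q \<in> colon R J' {u [^] ?q}" using b m_facts(8) u by (simp add: colon_single nat_pow_distrib)
   qed
   then show ?thesis using cM uq cc by (auto simp: colon_def m_comm)
  qed
  then show ?thesis using uq by (simp add: colon_def)
 qed
 then have "u [^] ?q \<in> L" using double_annihilator[OF gJ(2) L(1,3)] by simp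
 then obtain s h where sh: "u [^] ?q = dot R {..<r} s ?g \<oplus> h" "\<forall>l<r. s l \<in> \<alpha>" "h \<in> J'"
  by (auto simp: L_def L1_def isum_def)
 have sc: "s l \<in> CR" if "l < r" for l using sh \<alpha>f that by auto
 obtain t where t: "\<forall>x\<in>X. t x \<in> CR" "h = dot R X t (%x. (x [^] Q) [^] ?q)"
  using sh(3) Idl_insert_dot[OF X(1), of "%x. (x [^] Q) [^] ?q" h] X(2) unfolding J'gen2 by auto
 obtain y where y: "\<forall>l\<in>{..<r}. y l \<in> CR" "u = dot R {..<r} y g"
  using uC Idl_insert_dot[of "{..<r}" g u] gc unfolding B(3) g by auto
 have xQ: "x [^] Q \<in> CR" if "x \<in> X" for x using X that by auto
 \<comment> \<open>The unknowns belong to the generators of C and to the powers x^Q generating J.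
   Two expressions for u^q, one from u = sum of y_l g_l and one from its membership in L, give a
   relation among their \<open>q\<close>-th powers.\<close>
 let ?I = "Inl ` {..<r} \<union> Inr ` X :: (nat + 'a) set"
 define xs where "xs = case_sum g (%x. x [^] Q)"
 define zs where "zs = case_sum (%l. y l [^] ?q \<ominus> s l) (%x. \<ominus> t x)"
 have xsc: "xs i \<in> CR" if "i \<in> ?I" for i using that gc xQ by (auto simp: xs_def)
 have zsc: "zs i \<in> CR" if "i \<in> ?I" for i using that y sc t by (auto simp: zs_def)
 have dc: "dot R {..<r} s ?g \<in> CR" "h \<in> CR" using sc gc sh J'f by auto
 have "dot R ?I zs (%i. xs i [^] ?q) = dot R {..<r} (%l. y l [^] ?q \<ominus> s l) ?g
   \<oplus> dot R X (%x. \<ominus> t x) (%x. (x [^] Q) [^] ?q)"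
  using X(1) y sc gc t xQ by (subst dot_Plus) (auto simp: xs_def zs_def)
 also have "dot R {..<r} (%l. y l [^] ?q \<ominus> s l) ?g = dot R {..<r} (%l. y l [^] ?q) ?g \<ominus> dot R {..<r} s ?g"
  using y sc gc by (intro dot_minus) auto
 also have "dot R {..<r} (%l. y l [^] ?q) ?g = u [^] ?q"
  unfolding y(2) using dot_frob[OF frq, of "{..<r}" y g] y gc by auto
 also have "dot R X (%x. \<ominus> t x) (%x. (x [^] Q) [^] ?q) = \<ominus> h"
  unfolding t(2) using t xQ X(1) by (intro dot_uminus) auto
 also have "u [^] ?q \<ominus> dot R {..<r} s ?g = h"
  using diff_eqI[of "u [^] ?q" h "dot R {..<r} s ?g"] sh(1) dc uq by (simp add: a_comm)
 also have "h \<oplus> \<ominus> h = \<zero>" using dc by (simp add: r_neg)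
 finally have "dot R ?I zs (%i. xs i [^] ?q) = \<zero>" .
 then have zsl: "zs \<in> lspan R ?I (fker ?I {()} (%i _. xs i))" using xsc zsc X(1) by (intro flat_single) auto
 have Gc: "\<forall>g\<in>fker ?I {()} (%i _. xs i). \<forall>i\<in>?I. g i \<in> CR" by (auto intro: fker_closed)
 obtain n :: nat and \<sigma> G where G: "\<forall>l<n. \<sigma> l \<in> CR \<and> G l \<in> fker ?I {()} (%i _. xs i)"
  "\<forall>i\<in>?I. zs i = dot R {..<n} \<sigma> (%l. G l i)" using lspan_fin[OF zsl Gc] by blast
 then have "\<forall>l<n. \<exists>y. G l = (%i. y i [^] ?q) \<and> (\<forall>i. y i \<in> CR) \<and> dot R ?I y xs = \<zero>"
  by (auto simp: fker_def)
 then obtain Y where Y: "!!l. l < n ==> G l = (%i. Y l i [^] ?q)" "!!l i. l < n ==> Y l i \<in> CR"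
  "!!l. l < n ==> dot R ?I (Y l) xs = \<zero>" by metis
 have Yg: "dot R {..<r} (%j. Y l (Inl j)) g \<in> J" if l: "l < n" for l
 proof -
  have "dot R ?I (Y l) xs = dot R {..<r} (%j. Y l (Inl j)) g \<oplus> dot R X (%j. Y l (Inr j)) (%x. x [^] Q)"
   using X(1) gc xQ Y(2)[OF l] by (subst dot_Plus) (auto simp: xs_def)
  moreover have dJ: "dot R X (%j. Y l (Inr j)) (%x. x [^] Q) \<in> J"
  proof (rule dot_mem_ideal[OF J(1) X(1)])
   fix x assume x: "x \<in> X"
   show "Y l (Inr x) \<otimes> x [^] Q \<in> J" using fp_mem[OF m_facts(1), of x Q] X_m x Y(2)[OF l] Jf(4) unfolding J_def[symmetric] by blast
  qed (use Y(2)[OF l] xQ in auto)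
  moreover have dc: "dot R {..<r} (%j. Y l (Inl j)) g \<in> CR" using Y(2)[OF l] gc by auto
  ultimately have "dot R X (%j. Y l (Inr j)) (%x. x [^] Q) \<oplus> dot R {..<r} (%j. Y l (Inl j)) g \<in> J"
   using Y(3)[OF l] Jf(2) Jf(8)[OF dJ] by (simp add: a_comm)
  then show ?thesis using ideal_minus_cancel[OF J(1) _ dJ dc] by simp
 qed
 \<comment> \<open>By flatness y_j^q - s_j is a combination of \<open>q\<close>-th powers of the
   relation vectors Y l of C/J. As s_j lies in \<alpha>, this is the hypothesis of
   \<open>lin_pure\<close>.\<close>
 have "\<forall>j<r. y j [^] ?q \<ominus> dot R {..<n} \<sigma> (%l. Y l (Inl j) [^] ?q) \<in> \<alpha>"
 proof (intro allI impI)
  fix j assume j: "j < r"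
  have "y j [^] ?q \<ominus> s j = dot R {..<n} \<sigma> (%l. G l (Inl j))" using bspec[OF G(2), of "Inl j"] j by (simp add: zs_def)
  also have "... = dot R {..<n} \<sigma> (%l. Y l (Inl j) [^] ?q)" using G(1) Y by (intro dot_cong) auto
  finally have e: "dot R {..<n} \<sigma> (%l. Y l (Inl j) [^] ?q) = y j [^] ?q \<ominus> s j" by simp
  have "y j [^] ?q \<ominus> (y j [^] ?q \<ominus> s j) = s j"
  proof -
   have c: "y j [^] ?q \<in> CR" "s j \<in> CR" using y sc j by auto
   then show ?thesis by algebra
  qed
  then show "y j [^] ?q \<ominus> dot R {..<n} \<sigma> (%l. Y l (Inl j) [^] ?q) \<in> \<alpha>" using e sh(2) j by simp
 qed
 then obtain \<rho> where \<rho>: "\<forall>l<n. \<rho> l \<in> CR" "\<forall>j<r. y j \<ominus> dot R {..<n} \<rho> (%l. Y l (Inl j)) \<in> \<alpha>"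
  using pure[unfolded lin_pure_def, rule_format, of r y n \<sigma> "%l j. Y l (Inl j)"] y G(1) Y(2) by auto
 define w where "w = (%j. y j \<ominus> dot R {..<n} \<rho> (%l. Y l (Inl j)))"
 have wc: "w j \<in> CR" if "j < r" for j using \<rho>(2) that \<alpha>f(8) by (auto simp: w_def)
 have dY: "dot R {..<n} \<rho> (%l. Y l (Inl j)) \<in> CR" for j using \<rho>(1) Y(2) by auto
 \<comment> \<open>Modulo \<alpha> the vector y is a combination of relations of C/J. The remainder
   w has entries in \<alpha>, which C multiplies into J, and the relations themselves evaluate into
   J.\<close>
 have "u = dot R {..<r} w g \<oplus> \<one> \<otimes> dot R {..<r} (%j. dot R {..<n} \<rho> (%l. Y l (Inl j))) g"
  unfolding y(2) using wc dY gc y add_diff_cancel[OF _ dY] by (intro dot_lin) (auto simp: w_def)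
 moreover have "dot R {..<r} w g \<in> J"
  using wc gc gC C\<alpha> \<rho>(2) by (intro dot_mem_ideal[OF J(1)]) (auto simp: w_def)
 moreover have "dot R {..<r} (%j. dot R {..<n} \<rho> (%l. Y l (Inl j))) g \<in> J"
 proof -
  have "dot R {..<r} (%j. dot R {..<n} \<rho> (%l. Y l (Inl j))) g = dot R {..<n} \<rho> (%l. dot R {..<r} (%j. Y l (Inl j)) g)"
   using \<rho>(1) Y(2) gc by (intro dot_swap[symmetric]) auto
  also have "... \<in> J" using \<rho>(1) Yg Jf(4) Jf(8) by (intro dot_mem_ideal[OF J(1)]) auto
  finally show ?thesis .
 qed
 ultimately have "u \<in> J" using Jf(3) Jf(8) by simp
 then show False using u(2) by simp
qed

end

section \<open>Prime characteristic and iterated purity\<close>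

context cring
begin

lemma binomial_cring:
 assumes x: "x \<in> CR" "y \<in> CR"
 shows "(x \<oplus> y) [^] (n::nat) = (\<Oplus>k\<in>{..n}. add_pow R (n choose k) (x [^] k \<otimes> y [^] (n - k)))"
proof (induction n)
 case 0
 then show ?case using x by simp
next
 case (Suc n)
 have c: "!!f::nat=>nat. (%k. add_pow R (f k) (x [^] k \<otimes> y [^] (n - k))) \<in> A \<rightarrow> CR" for A using x by auto
 let ?a = "%k. add_pow R (n choose k) (x [^] Suc k \<otimes> y [^] (n - k))"
 let ?b = "%k. add_pow R (n choose k) (x [^] k \<otimes> y [^] (Suc n - k))"
 let ?s = "%k. add_pow R (n choose k) (x [^] k \<otimes> y [^] (n - k))"
 have sc: "(\<Oplus>k\<in>{..n}. ?s k) \<in> CR" using x by (intro finsum_closed) auto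
 have "(x \<oplus> y) [^] Suc n = (\<Oplus>k\<in>{..n}. ?s k) \<otimes> x \<oplus> (\<Oplus>k\<in>{..n}. ?s k) \<otimes> y"
  using x sc Suc by (simp add: r_distr)
 also have "(\<Oplus>k\<in>{..n}. ?s k) \<otimes> x = (\<Oplus>k\<in>{..n}. ?s k \<otimes> x)" using x by (intro finsum_ldistr) auto
 also have "... = (\<Oplus>k\<in>{..n}. ?a k)"
  using x by (intro finsum_cong') (simp_all add: add_pow_ldistr, auto simp: m_ac)
 also have "(\<Oplus>k\<in>{..n}. ?s k) \<otimes> y = (\<Oplus>k\<in>{..n}. ?s k \<otimes> y)" using x by (intro finsum_ldistr) auto
 also have "... = (\<Oplus>k\<in>{..n}. ?b k)"
  using x by (intro finsum_cong') (simp_all add: add_pow_ldistr, auto simp: m_ac Suc_diff_le)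
 also have "... = (\<Oplus>k\<in>{..Suc n}. ?b k)"
  using x by (subst finsum_Suc) (auto simp: binomial_eq_0)
 also have "... = (\<Oplus>k\<in>{..n}. add_pow R (n choose Suc k) (x [^] Suc k \<otimes> y [^] (n - k))) \<oplus> y [^] Suc n"
  using x by (subst finsum_Suc2) auto
 also have "(\<Oplus>k\<in>{..n}. ?a k) \<oplus> ((\<Oplus>k\<in>{..n}. add_pow R (n choose Suc k) (x [^] Suc k \<otimes> y [^] (n - k))) \<oplus> y [^] Suc n)
   = ((\<Oplus>k\<in>{..n}. ?a k) \<oplus> (\<Oplus>k\<in>{..n}. add_pow R (n choose Suc k) (x [^] Suc k \<otimes> y [^] (n - k)))) \<oplus> y [^] Suc n"
  using x by (intro a_assoc[symmetric] finsum_closed) auto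
 also have "(\<Oplus>k\<in>{..n}. ?a k) \<oplus> (\<Oplus>k\<in>{..n}. add_pow R (n choose Suc k) (x [^] Suc k \<otimes> y [^] (n - k)))
   = (\<Oplus>k\<in>{..n}. ?a k \<oplus> add_pow R (n choose Suc k) (x [^] Suc k \<otimes> y [^] (n - k)))"
  using x by (intro finsum_addf[symmetric]) auto
 also have "... = (\<Oplus>k\<in>{..n}. add_pow R (Suc n choose Suc k) (x [^] Suc k \<otimes> y [^] (n - k)))"
  using x by (intro finsum_cong') (auto simp: add.nat_pow_mult)
 also have "... \<oplus> y [^] Suc n = (\<Oplus>k\<in>{..Suc n}. add_pow R (Suc n choose k) (x [^] k \<otimes> y [^] (Suc n - k)))"
  using x by (subst finsum_Suc2[of _ n]) auto
 finally show ?case .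
qed

lemma frob_prime:
 assumes "normalization_semidom_class.prime (p::nat)" "add_pow R p \<one> = \<zero>"
 shows "frob R p"
 unfolding frob_def
proof (intro conjI ballI)
 show "p > 0" using assms prime_gt_0_nat by auto
 fix x y assume x: "x \<in> CR" "y \<in> CR"
 have z: "add_pow R p a = \<zero>" if "a \<in> CR" for a
 proof -
  have "add_pow R p a = add_pow R p (\<one> \<otimes> a)" using that by simp
  also have "... = add_pow R p \<one> \<otimes> a" using that add_pow_ldistr[of \<one> a p] by simp
  finally show ?thesis using assms(2) that by simp
 qed
 have zz: "add_pow R (p choose k) a = \<zero>" if "0 < k" "k < p" "a \<in> CR" for k a
 proof -
  have "p dvd (p choose k)" using dvd_choose_prime[of k p] that assms(1) by auto
  then obtain c where "p choose k = p * c" by (auto simp: dvd_def)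
  then have "add_pow R (p choose k) a = add_pow R c (add_pow R p a)" using that add.nat_pow_pow[of a c p] by simp
  then show ?thesis using z that by simp
 qed
 obtain n where n: "p = Suc n" using \<open>p > 0\<close> by (cases p) auto
 let ?f = "%k. add_pow R (p choose k) (x [^] k \<otimes> y [^] (p - k))"
 have "(x \<oplus> y) [^] p = (\<Oplus>k\<in>{..p}. ?f k)" by (rule binomial_cring[OF x])
 also have "... = (\<Oplus>k\<in>{0, p}. ?f k)"
 proof (rule add.finprod_mono_neutral_cong_right)
  show "!!i. i \<in> {..p} - {0, p} ==> ?f i = \<zero>\<^bsub>R\<^esub>" using zz x by auto
 qed (use x in auto)
 also have "... = y [^] p \<oplus> x [^] p" using x \<open>p > 0\<close> by (subst finsum_insert) auto
 finally show "(x \<oplus> y) [^] p = x [^] p \<oplus> y [^] p" using x by (simp add: a_comm)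
qed

text \<open>An element of infinite order has order 0 by convention, so p > 0 is what makes the field
  one of positive characteristic.\<close>

lemma char_prime:
 assumes "contains_field_of_char R p" "p > 0"
 shows "normalization_semidom_class.prime p" "add_pow R p \<one> = \<zero>"
proof -
 obtain K where K: "subfield K R" "group.ord (add_monoid (R\<lparr>carrier := K\<rparr>)) \<one> = p"
  using assms(1) by (auto simp: contains_field_of_char_def)
 let ?K = "R\<lparr>carrier := K\<rparr>"
 interpret K: field ?K using subfield_iff(2)[OF K(1)] .
 have pw: "add_pow ?K n x = add_pow R n x" for x and n :: nat
  by (simp add: add_pow_def nat_pow_def)
 have oneK: "\<one> \<in> K" using K.one_closed by simp
 have iff: "add_pow R n \<one> = \<zero> \<longleftrightarrow> p dvd n" for n :: nat
  using K.add.pow_eq_id[of \<one> n] oneK K(2) by (simp add: pw)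
 show "add_pow R p \<one> = \<zero>" using iff by simp
 have nK: "add_pow R n \<one> \<in> K" for n :: nat
  using K.add.nat_pow_closed[of \<one> n] oneK by (simp add: pw)
 show "normalization_semidom_class.prime p"
 proof (rule prime_natI)
  have "\<not> p dvd 1" using iff[of 1] K.one_not_zero by simp
  then show "2 \<le> p" using assms(2) by (cases "p = 1") auto
  fix a b :: nat assume "p dvd a * b"
  then have "add_pow R (a * b) \<one> = \<zero>" using iff by simp
  moreover have "add_pow R (a * b) \<one> = add_pow R a \<one> \<otimes> add_pow R b \<one>"
   using add_pow_ldistr[of \<one> "add_pow R b \<one>" a] add.nat_pow_pow[of \<one> a b] add.nat_pow_pow[of \<one> b a] by (simp add: mult.commute)
  ultimately have "add_pow R a \<one> = \<zero> \<or> add_pow R b \<one> = \<zero>"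
   using K.integral[of "add_pow R a \<one>" "add_pow R b \<one>"] nK by simp
  then show "p dvd a \<or> p dvd b" using iff by simp
 qed
qed

text \<open>A system for p^(e+1) is a system for p in the p^e-th powers. Purity for p lowers the
  exponent, and the induction hypothesis does the rest.\<close>

lemma lin_pure_pow:
 assumes "lin_pure R I p" "ideal I R"
 shows "lin_pure R I (p ^ e)"
proof (induction e)
 case 0
 show ?case unfolding lin_pure_def
 proof (intro allI impI)
  fix k n :: nat and y s X
  assume *: "\<forall>j<k. y j \<in> CR" "\<forall>l<n. s l \<in> CR" "\<forall>l<n. \<forall>j<k. X l j \<in> CR"
   "\<forall>j<k. y j [^] (p ^ 0) \<ominus> dot R {..<n} s (%l. X l j [^] (p ^ 0)) \<in> I"
  have "dot R {..<n} s (%l. X l j [^] (p ^ 0)) = dot R {..<n} s (%l. X l j)" if "j < k" for j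
   using * that by (intro dot_cong) auto
  then show "\<exists>r. (\<forall>l<n. r l \<in> CR) \<and> (\<forall>j<k. y j \<ominus> dot R {..<n} r (%l. X l j) \<in> I)"
   using * by (intro exI[of _ s]) auto
 qed
next
 case (Suc e)
 show ?case unfolding lin_pure_def
 proof (intro allI impI)
  fix k n :: nat and y s X
  assume *: "\<forall>j<k. y j \<in> CR" "\<forall>l<n. s l \<in> CR" "\<forall>l<n. \<forall>j<k. X l j \<in> CR"
   "\<forall>j<k. y j [^] (p ^ Suc e) \<ominus> dot R {..<n} s (%l. X l j [^] (p ^ Suc e)) \<in> I"
  have e: "z [^] (p ^ Suc e) = (z [^] (p ^ e)) [^] p" if "z \<in> CR" for z
   using that by (simp add: nat_pow_pow mult.commute)
  have "(y j [^] (p ^ e)) [^] p \<ominus> dot R {..<n} s (%l. (X l j [^] (p ^ e)) [^] p) \<in> I" if j: "j < k" for j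
  proof -
   have "dot R {..<n} s (%l. X l j [^] (p ^ Suc e)) = dot R {..<n} s (%l. (X l j [^] (p ^ e)) [^] p)"
    using * j e by (intro dot_cong) auto
   then show ?thesis using * j e by auto
  qed
  then obtain r where r: "\<forall>l<n. r l \<in> CR" "\<forall>j<k. y j [^] (p ^ e) \<ominus> dot R {..<n} r (%l. X l j [^] (p ^ e)) \<in> I"
   using assms(1)[unfolded lin_pure_def, rule_format, of k "%j. y j [^] (p ^ e)" n s "%l j. X l j [^] (p ^ e)"] * by auto
  then show "\<exists>r. (\<forall>l<n. r l \<in> CR) \<and> (\<forall>j<k. y j \<ominus> dot R {..<n} r (%l. X l j) \<in> I)"
   using Suc[unfolded lin_pure_def, rule_format, of k y n r X] * by auto
 qed
qed

end

section \<open>Purity passes to localizations\<close>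

context localization_map
begin

lemma h_dot:
 assumes "finite I" "!!i. i \<in> I ==> z i \<in> carrier R" "!!i. i \<in> I ==> x i \<in> carrier R"
 shows "h (dot R I z x) = dot S I (%i. h (z i)) (%i. h (x i))"
 using assms
proof (induction I rule: finite_induct)
 case (insert k I)
 then have "h (dot R (insert k I) z x) = h (z k) \<otimes>\<^bsub>S\<^esub> h (x k) \<oplus>\<^bsub>S\<^esub> h (dot R I z x)"
  by (subst R.dot_insert) auto
 also have "... = dot S (insert k I) (%i. h (z i)) (%i. h (x i))" using insert by (subst S.dot_insert) auto
 finally show ?case .
qed simp

lemma common_mult:
 assumes "ideal I R" "finite A" "!!j. j \<in> A ==> z j \<in> carrier R" "!!j. j \<in> A ==> h (z j) \<in> ext I"
 shows "\<exists>t\<in>carrier R - P. \<forall>j\<in>A. t \<otimes> z j \<in> I"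
 using assms(2-4)
proof (induction A rule: finite_induct)
 case (insert j A)
 then obtain t where t: "t \<in> carrier R - P" "\<forall>j\<in>A. t \<otimes> z j \<in> I" by auto
 obtain s where s: "s \<in> carrier R - P" "s \<otimes> z j \<in> I" using h_mem_ext[OF assms(1), of "z j"] insert.prems by auto
 have "s \<otimes> t \<otimes> z i \<in> I" if i: "i \<in> insert j A" for i
 proof (cases "i = j")
  case True
  have "s \<otimes> t \<otimes> z j = t \<otimes> (s \<otimes> z j)" using s t insert.prems by (simp add: R.m_ac)
  then show ?thesis using True R.idealD(4)[OF assms(1) _ s(2)] t by simp
 next
  case False
  have "s \<otimes> t \<otimes> z i = s \<otimes> (t \<otimes> z i)" using s t insert.prems i by (simp add: R.m_assoc)
  then show ?thesis using False i t R.idealD(4)[OF assms(1), of s] s by simp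
 qed
 then show ?case using nP_mult[OF s(1) t(1)] by blast
qed (use one_nP in auto)

lemma lin_pure_S:
 assumes pure: "lin_pure R I q" and I: "ideal I R" and q: "frob R q"
 shows "lin_pure S (ext I) q"
 unfolding lin_pure_def
proof (intro allI impI)
 fix k n :: nat and y s X
 assume y: "\<forall>j<k. y j \<in> carrier S" and s: "\<forall>l<n. s l \<in> carrier S" and X: "\<forall>l<n. \<forall>j<k. X l j \<in> carrier S"
  and mem: "\<forall>j<k. y j [^]\<^bsub>S\<^esub> q \<ominus>\<^bsub>S\<^esub> dot S {..<n} s (%l. X l j [^]\<^bsub>S\<^esub> q) \<in> ext I"
 note eI = S.idealD[OF ext_ideal[OF I]]
 have "\<exists>t\<in>carrier R - P. \<forall>i\<in>Inl ` {..<k} \<union> Inr ` ({..<n} \<times> {..<k}). \<exists>r\<in>carrier R. h t \<otimes>\<^bsub>S\<^esub> (case_sum y (%(l, j). X l j) i) = h r"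
  using y X by (intro common_denom) auto
 then obtain t where t: "t \<in> carrier R - P" "\<forall>i\<in>Inl ` {..<k} \<union> Inr ` ({..<n} \<times> {..<k}). \<exists>r\<in>carrier R. h t \<otimes>\<^bsub>S\<^esub> (case_sum y (%(l, j). X l j) i) = h r"
  by auto
 have "\<forall>j<k. \<exists>r\<in>carrier R. h t \<otimes>\<^bsub>S\<^esub> y j = h r"
 proof (intro allI impI)
  fix j assume "j < k"
  then show "\<exists>r\<in>carrier R. h t \<otimes>\<^bsub>S\<^esub> y j = h r" using bspec[OF t(2), of "Inl j"] by simp
 qed
 then obtain y' where y': "!!j. j < k ==> y' j \<in> carrier R" "!!j. j < k ==> h t \<otimes>\<^bsub>S\<^esub> y j = h (y' j)" by metis
 have "\<forall>l<n. \<forall>j<k. \<exists>r\<in>carrier R. h t \<otimes>\<^bsub>S\<^esub> X l j = h r"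
 proof (intro allI impI)
  fix l j assume "l < n" "j < k"
  then show "\<exists>r\<in>carrier R. h t \<otimes>\<^bsub>S\<^esub> X l j = h r" using bspec[OF t(2), of "Inr (l, j)"] by simp
 qed
 then obtain X' where X': "!!l j. l < n ==> j < k ==> X' l j \<in> carrier R" "!!l j. l < n ==> j < k ==> h t \<otimes>\<^bsub>S\<^esub> X l j = h (X' l j)"
  by metis
 have "\<exists>t\<in>carrier R - P. \<forall>i\<in>{..<n}. \<exists>r\<in>carrier R. h t \<otimes>\<^bsub>S\<^esub> s i = h r"
  using s by (intro common_denom) auto
 then obtain t' where t': "t' \<in> carrier R - P" "\<forall>l<n. \<exists>r\<in>carrier R. h t' \<otimes>\<^bsub>S\<^esub> s l = h r" by auto
 then obtain s' where s': "!!l. l < n ==> s' l \<in> carrier R" "!!l. l < n ==> h t' \<otimes>\<^bsub>S\<^esub> s l = h (s' l)" by metis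
 have tc: "t \<in> carrier R" "t' \<in> carrier R" using t t' by auto
 define z where "z = (%j. t' \<otimes> y' j [^] q \<ominus> dot R {..<n} s' (%l. X' l j [^] q))"
 have zc: "z j \<in> carrier R" if "j < k" for j unfolding z_def using that tc y' s' X' by (intro R.minus_closed R.m_closed R.dot_closed R.nat_pow_closed) auto
 have hz: "h (z j) \<in> ext I" if j: "j < k" for j
 proof -
  have yc: "y j \<in> carrier S" using y j by simp
  have dc: "dot S {..<n} s (%l. X l j [^]\<^bsub>S\<^esub> q) \<in> carrier S" using s X j by auto
  have tp: "h t [^]\<^bsub>S\<^esub> q \<in> carrier S" "h t' \<in> carrier S" using tc by auto
  let ?c = "h t' \<otimes>\<^bsub>S\<^esub> h t [^]\<^bsub>S\<^esub> q"
  have 1: "h (t' \<otimes> y' j [^] q) = ?c \<otimes>\<^bsub>S\<^esub> y j [^]\<^bsub>S\<^esub> q"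
   using tc y'(1)[OF j] y'(2)[OF j, symmetric] yc by (simp add: h_pow S.nat_pow_distrib S.m_assoc)
  have "h (dot R {..<n} s' (%l. X' l j [^] q)) = dot S {..<n} (%l. h (s' l)) (%l. h (X' l j [^] q))"
   using s' X' j by (intro h_dot) auto
  also have "... = dot S {..<n} (%l. ?c \<otimes>\<^bsub>S\<^esub> s l) (%l. X l j [^]\<^bsub>S\<^esub> q)"
   unfolding dot_def
  proof (rule S.finsum_cong')
   fix l assume l: "l \<in> {..<n}"
   have c: "s l \<in> carrier S" "X l j \<in> carrier S" using l s X j by auto
   have "h (s' l) \<otimes>\<^bsub>S\<^esub> h (X' l j [^] q) = (h t' \<otimes>\<^bsub>S\<^esub> s l) \<otimes>\<^bsub>S\<^esub> (h t \<otimes>\<^bsub>S\<^esub> X l j) [^]\<^bsub>S\<^esub> q"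
    using s'(2)[of l] X'(2)[of l j] X'(1)[of l j] l j by (simp add: h_pow)
   then show "h (s' l) \<otimes>\<^bsub>S\<^esub> h (X' l j [^] q) = (?c \<otimes>\<^bsub>S\<^esub> s l) \<otimes>\<^bsub>S\<^esub> X l j [^]\<^bsub>S\<^esub> q"
    using c tp tc by (simp add: S.nat_pow_distrib S.m_ac)
  qed (use s X j tp in auto)
  also have "... = ?c \<otimes>\<^bsub>S\<^esub> dot S {..<n} s (%l. X l j [^]\<^bsub>S\<^esub> q)"
   using s X j tp by (intro S.dot_smult) auto
  finally have 2: "h (dot R {..<n} s' (%l. X' l j [^] q)) = ?c \<otimes>\<^bsub>S\<^esub> dot S {..<n} s (%l. X l j [^]\<^bsub>S\<^esub> q)" .
  have "h (z j) = h (t' \<otimes> y' j [^] q) \<ominus>\<^bsub>S\<^esub> h (dot R {..<n} s' (%l. X' l j [^] q))"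
  proof -
   have "dot R {..<n} s' (%l. X' l j [^] q) \<in> carrier R" using s' X' j by (intro R.dot_closed) auto
   moreover have "t' \<otimes> y' j [^] q \<in> carrier R" using tc y' j by auto
   ultimately show ?thesis unfolding z_def a_minus_def by simp
  qed
  also have "... = ?c \<otimes>\<^bsub>S\<^esub> (y j [^]\<^bsub>S\<^esub> q \<ominus>\<^bsub>S\<^esub> dot S {..<n} s (%l. X l j [^]\<^bsub>S\<^esub> q))"
   unfolding 1 2 using dc tp yc by (simp add: a_minus_def S.r_distr S.r_minus)
  also have "... \<in> ext I" using mem j tp by (intro eI(4)) auto
  finally show ?thesis .
 qed
 have "\<exists>v\<in>carrier R - P. \<forall>j\<in>{..<k}. v \<otimes> z j \<in> I"
  using zc hz by (intro common_mult[OF I]) auto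
 then obtain v where v: "v \<in> carrier R - P" "!!j. j < k ==> v \<otimes> z j \<in> I" by auto
 obtain q' where q': "q = Suc q'" using q by (cases q) (auto simp: frob_def)
 \<comment> \<open>After clearing denominators the equation carries the factor v t', which need not
   be a \<open>q\<close>-th power. Multiplying further by w^(q-1) turns the factor of y'^q into w^q;
   for the other terms the surplus goes into the coefficients \<sigma>.\<close>
 define w where "w = v \<otimes> t'"
 have w: "w \<in> carrier R - P" unfolding w_def using nP_mult[OF v(1) t'(1)] .
 have vc: "v \<in> carrier R" "w \<in> carrier R" using v w by auto
 define \<sigma> where "\<sigma> = (%l. (w [^] q' \<otimes> v) \<otimes> s' l)"
 have "(w \<otimes> y' j) [^] q \<ominus> dot R {..<n} \<sigma> (%l. X' l j [^] q) \<in> I" if j: "j < k" for j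
 proof -
  have c: "w [^] q' \<in> carrier R" "w [^] q' \<otimes> v \<in> carrier R" using vc by auto
  have dc: "dot R {..<n} s' (%l. X' l j [^] q) \<in> carrier R" using s' X' j by auto
  have d: "dot R {..<n} \<sigma> (%l. X' l j [^] q) = (w [^] q' \<otimes> v) \<otimes> dot R {..<n} s' (%l. X' l j [^] q)"
   unfolding \<sigma>_def using s' X' j c by (intro R.dot_smult) auto
  have "w [^] q = w [^] q' \<otimes> (v \<otimes> t')" by (simp add: q' w_def)
  then have "(w \<otimes> y' j) [^] q = (w [^] q' \<otimes> v) \<otimes> (t' \<otimes> y' j [^] q)"
   using vc y'(1)[OF j] tc c by (simp add: R.nat_pow_distrib R.m_assoc)
  then have "(w \<otimes> y' j) [^] q \<ominus> dot R {..<n} \<sigma> (%l. X' l j [^] q) = w [^] q' \<otimes> (v \<otimes> z j)"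
   unfolding d z_def using c vc dc y'(1)[OF j] tc by (simp add: a_minus_def R.r_distr R.r_minus R.m_assoc)
  then show ?thesis using R.idealD(4)[OF I c(1) v(2)[OF j]] by simp
 qed
 then obtain r where r: "\<forall>l<n. r l \<in> carrier R" "\<forall>j<k. w \<otimes> y' j \<ominus> dot R {..<n} r (%l. X' l j) \<in> I"
  using pure[unfolded lin_pure_def, rule_format, of k "%j. w \<otimes> y' j" n \<sigma> X'] vc y' s' X' by (auto simp: \<sigma>_def)
 have hw: "h (w \<otimes> t) \<in> Units S" using h_unit[OF nP_mult[OF w t(1)]] .
 define u where "u = inv\<^bsub>S\<^esub> (h (w \<otimes> t))"
 have uc: "u \<in> carrier S" "u \<otimes>\<^bsub>S\<^esub> h (w \<otimes> t) = \<one>\<^bsub>S\<^esub>" using hw by (auto simp: u_def)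
 define r' where "r' = (%l. (u \<otimes>\<^bsub>S\<^esub> h t) \<otimes>\<^bsub>S\<^esub> h (r l))"
 have hr: "h (r l) \<in> carrier S" if "l < n" for l using r(1) that by auto
 show "\<exists>r. (\<forall>l<n. r l \<in> carrier S) \<and> (\<forall>j<k. y j \<ominus>\<^bsub>S\<^esub> dot S {..<n} r (%l. X l j) \<in> ext I)"
 proof (intro exI[of _ r'] conjI allI impI)
  show "r' l \<in> carrier S" if "l < n" for l using hr[OF that] uc tc by (auto simp: r'_def)
  fix j assume j: "j < k"
  have yc: "y j \<in> carrier S" using y j by simp
  have utc: "u \<otimes>\<^bsub>S\<^esub> h t \<in> carrier S" using uc tc by auto
  have dc: "dot S {..<n} (%l. h (r l)) (%l. X l j) \<in> carrier S" using hr X j by auto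
  have "dot S {..<n} r' (%l. X l j) = (u \<otimes>\<^bsub>S\<^esub> h t) \<otimes>\<^bsub>S\<^esub> dot S {..<n} (%l. h (r l)) (%l. X l j)"
   unfolding r'_def using hr X j utc by (intro S.dot_smult) auto
  then have 1: "dot S {..<n} r' (%l. X l j) = u \<otimes>\<^bsub>S\<^esub> (h t \<otimes>\<^bsub>S\<^esub> dot S {..<n} (%l. h (r l)) (%l. X l j))"
   using dc uc tc by (simp add: S.m_assoc)
  have "h (dot R {..<n} r (%l. X' l j)) = dot S {..<n} (%l. h (r l)) (%l. h (X' l j))"
   using r(1) X' j by (intro h_dot) auto
  also have "... = dot S {..<n} (%l. h (X' l j)) (%l. h (r l))" using r(1) X' j by (intro S.dot_comm) auto
  also have "... = dot S {..<n} (%l. h t \<otimes>\<^bsub>S\<^esub> X l j) (%l. h (r l))"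
   using X'(2)[symmetric] X j hr tc by (intro S.dot_cong) auto
  also have "... = h t \<otimes>\<^bsub>S\<^esub> dot S {..<n} (%l. X l j) (%l. h (r l))" using X j hr tc by (intro S.dot_smult) auto
  also have "dot S {..<n} (%l. X l j) (%l. h (r l)) = dot S {..<n} (%l. h (r l)) (%l. X l j)"
   using X j hr by (intro S.dot_comm) auto
  finally have 2: "h (dot R {..<n} r (%l. X' l j)) = h t \<otimes>\<^bsub>S\<^esub> dot S {..<n} (%l. h (r l)) (%l. X l j)" .
  have 3: "y j = u \<otimes>\<^bsub>S\<^esub> h (w \<otimes> y' j)"
  proof -
   have "u \<otimes>\<^bsub>S\<^esub> h (w \<otimes> y' j) = u \<otimes>\<^bsub>S\<^esub> (h w \<otimes>\<^bsub>S\<^esub> (h t \<otimes>\<^bsub>S\<^esub> y j))" using vc y'[OF j] by simp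
   also have "... = (u \<otimes>\<^bsub>S\<^esub> h (w \<otimes> t)) \<otimes>\<^bsub>S\<^esub> y j" using uc(1) vc tc yc by (simp add: S.m_assoc)
   also have "... = y j" using uc yc by simp
   finally show ?thesis by simp
  qed
  have dR: "dot R {..<n} r (%l. X' l j) \<in> carrier R" using r(1) X' j by auto
  have "y j \<ominus>\<^bsub>S\<^esub> dot S {..<n} r' (%l. X l j) = u \<otimes>\<^bsub>S\<^esub> h (w \<otimes> y' j \<ominus> dot R {..<n} r (%l. X' l j))"
   unfolding 1 2[symmetric] using uc vc y'(1)[OF j] dR
   by (subst 3) (simp add: a_minus_def S.r_distr S.r_minus)
  also have "... \<in> ext I" using r(2) j uc h_in_ext[OF I] by (intro eI(4)) auto
  finally show "y j \<ominus>\<^bsub>S\<^esub> dot S {..<n} r' (%l. X l j) \<in> ext I" .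
 qed
qed

end

lemma Sup_enat_attained:
 assumes "Sup A = enat d" "A \<noteq> {}"
 shows "enat d \<in> A"
proof (cases "finite A")
 case True
 then show ?thesis using assms Max_in[OF True assms(2)] by (auto simp: Sup_enat_def)
next
 case False
 then show ?thesis using assms by (auto simp: Sup_enat_def)
qed

section \<open>From local to global\<close>

context noeth
begin

lemma regular_local_at:
 assumes "regular_ring R" "maximalideal m R"
 shows "\<exists>X. regular_local (localization R (CR - m)) (localization_map.ext R (localization R (CR - m)) m
   (%r. mult_set.fr R (CR - m) r \<one>) m) X"
proof -
 have P: "primeideal m R" by (rule maximalideal_prime[OF assms(2)])
 define h where "h = (%r. mult_set.fr R (CR - m) r \<one>)"
 define S where "S = localization R (CR - m)"
 interpret L: localization_map R S m h
  unfolding h_def S_def by (rule localization_map_prime[OF P])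
 interpret S: noeth_local S "L.ext m" by (rule L.noeth_local_S[OF is_noetherian])
 have "regular_local_ring S" using assms(1) P unfolding regular_ring_def S_def by blast
 then obtain U where U: "U \<subseteq> carrier S" "finite U" "maximalideal (Idl\<^bsub>S\<^esub> U) S" "krull_dim S = enat (card U)"
  "\<exists>!m. maximalideal m S" by (auto simp: regular_local_ring_def local_ring_def)
 have mU: "L.ext m = Idl\<^bsub>S\<^esub> U" using U(3,5) S.max_m by blast
 let ?A = "{enat n | n. \<exists>P :: nat => ('a \<times> 'a) set set. (\<forall>i\<le>n. primeideal (P i) S) \<and> (\<forall>i<n. P i \<subset> P (Suc i))}"
 have "enat 0 \<in> ?A" using S.m_prime by (auto intro!: exI[of _ 0] exI[of _ "%_. L.ext m"])
 then have "?A \<noteq> {}" by blast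
 \<comment> \<open>A finite supremum of extended naturals is attained, so the Krull dimension is
   realized by an actual chain of primes.\<close>
 then have "enat (card U) \<in> ?A" using U(4) Sup_enat_attained unfolding krull_dim_def by blast
 then obtain P where "S.pchain P (card U)" unfolding S.pchain_def by auto
 moreover from this have "ideal (P 0) S" by (auto simp: S.pchain_def intro: primeideal.axioms(1))
 then have "{\<zero>\<^bsub>S\<^esub>} \<subseteq> P 0" using L.S.idealD(2) by auto
 ultimately have "S.has_chain {\<zero>\<^bsub>S\<^esub>} (card U)" unfolding S.has_chain_def by blast
 then have "regular_local S (L.ext m) U"
  using U mU by (intro regular_local.intro S.noeth_local_axioms regular_local_axioms.intro) auto
 then show ?thesis unfolding S_def h_def by blast
qed

text \<open>Equality of ideals is a local question: if c were not in (I : y)^[q], then ((I : y)^[q]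
  : c) would lie in some maximal ideal m, while the local identity at m provides s outside m with s
  c in (I : y)^[q].\<close>

theorem frobenius_flat:
 assumes reg: "regular_ring R" and frp: "frob R p" "p \<ge> 2"
 shows "frob_flat R (p ^ e)"
proof
 let ?q = "p ^ e"
 show frq: "frob R ?q" using frob_pow[OF frp(1)] .
 fix I y assume I: "ideal I R" and y: "y \<in> CR"
 let ?D = "colon R I {y}"
 note If = idealD[OF I]
 have D: "ideal ?D R" using I y by auto
 have Dq: "ideal (FP ?D ?q) R" using idealD(1)[OF D] by (rule fp_ideal)
 show "colon R (FP I ?q) {y [^] ?q} = FP ?D ?q"
 proof
  show "FP ?D ?q \<subseteq> colon R (FP I ?q) {y [^] ?q}" by (rule fp_colon_sub[OF I y])
  show "colon R (FP I ?q) {y [^] ?q} \<subseteq> FP ?D ?q"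
  proof
   fix c assume "c \<in> colon R (FP I ?q) {y [^] ?q}"
   then have c: "c \<in> CR" "c \<otimes> y [^] ?q \<in> FP I ?q" by (auto simp: colon_single)
   let ?T = "colon R (FP ?D ?q) {c}"
   have T: "ideal ?T R" using Dq c by auto
   show "c \<in> FP ?D ?q"
   proof (rule ccontr)
    assume n: "c \<notin> FP ?D ?q"
    have "?T \<noteq> CR" using n c ideal_carrier_iff[OF T] by (auto simp: colon_single)
    then obtain m where m: "maximalideal m R" "?T \<subseteq> m" using ex_maximal[OF T] by auto
    define h where "h = (%r. mult_set.fr R (CR - m) r \<one>)"
    define S where "S = localization R (CR - m)"
    interpret L: localization_map R S m h
     unfolding h_def S_def by (rule localization_map_prime[OF maximalideal_prime[OF m(1)]])
    obtain X where "regular_local S (L.ext m) X"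
     using regular_local_at[OF reg m(1)] unfolding S_def h_def by blast
    then interpret RL: regular_local S "L.ext m" X .
    interpret NL: noeth_local_len S "L.ext m" p "card X" X
     by (rule RL.regular_len[OF L.frob_S[OF frp(1)] frp(2)])
    have hc: "h c \<otimes>\<^bsub>S\<^esub> h y [^]\<^bsub>S\<^esub> ?q \<in> frobenius_power S (L.ext I) ?q"
     using L.h_in_ext[OF fp_ideal[OF If(1)] c(2)] c(1) y L.ext_fp[OF frq I] by (simp add: L.h_pow)
    then have "h c \<in> frobenius_power S (colon S (L.ext I) {h y}) ?q"
     using NL.flat_local[OF L.ext_ideal[OF I], of "h y" e] c y by (auto simp: colon_def)
    \<comment> \<open>Forming the colon by one element commutes with localization; this is the
      inclusion needed here.\<close>
    moreover have "colon S (L.ext I) {h y} \<subseteq> L.ext ?D"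
    proof
     fix z assume "z \<in> colon S (L.ext I) {h y}"
     then have z: "z \<in> carrier S" "z \<otimes>\<^bsub>S\<^esub> h y \<in> L.ext I" by (auto simp: colon_def)
     obtain r s where rs: "r \<in> CR" "s \<in> CR - m" "h s \<otimes>\<^bsub>S\<^esub> z = h r" using L.h_frac[OF z(1)] by auto
     have "h (r \<otimes> y) = h s \<otimes>\<^bsub>S\<^esub> (z \<otimes>\<^bsub>S\<^esub> h y)" using rs y z by (simp add: L.S.m_assoc[symmetric])
     then have "h (r \<otimes> y) \<in> L.ext I" using L.S.idealD(4)[OF L.ext_ideal[OF I] _ z(2)] rs by simp
     then obtain t where t: "t \<in> CR - m" "t \<otimes> (r \<otimes> y) \<in> I" using L.h_mem_ext[OF I] rs y by blast
     have "t \<otimes> r \<in> ?D" using t rs y by (simp add: colon_single m_assoc)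
     moreover have "h (t \<otimes> s) \<otimes>\<^bsub>S\<^esub> z = h (t \<otimes> r)" using t rs z by (simp add: L.S.m_assoc)
     ultimately show "z \<in> L.ext ?D" unfolding L.ext_def using z(1) L.nP_mult[OF t(1) rs(2)] by blast
    qed
    then have "frobenius_power S (colon S (L.ext I) {h y}) ?q \<subseteq> frobenius_power S (L.ext ?D) ?q"
     using L.S.idealD(1)[OF L.ext_ideal[OF D]] by (intro L.S.fp_mono)
    ultimately have "h c \<in> L.ext (FP ?D ?q)" using L.ext_fp[OF frq D] by auto
    then obtain s where "s \<in> CR - m" "s \<otimes> c \<in> FP ?D ?q" using L.h_mem_ext[OF Dq c(1)] by auto
    then show False using m(2) by (auto simp: colon_single)
   qed
  qed
 qed
qed

text \<open>The local multiplier at m is cleared of denominators by t, and by one s for the finitely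
  many generators of I. Both lie outside m and become units, so the product s r stays outside
  m^[p^e].\<close>

theorem fedder:
 assumes reg: "regular_ring R" and frp: "frob R p" "p \<ge> 2" and I: "ideal I R" and pure: "lin_pure R I p"
  and m: "maximalideal m R"
 shows "\<exists>c\<in>CR. c \<notin> FP m (p ^ e) \<and> (\<forall>a\<in>I. c \<otimes> a \<in> FP I (p ^ e))"
proof -
 let ?q = "p ^ e"
 have frq: "frob R ?q" using frob_pow[OF frp(1)] .
 note If = idealD[OF I]
 have mi: "ideal m R" using m by (rule maximalideal.axioms)
 define h where "h = (%r. mult_set.fr R (CR - m) r \<one>)"
 define S where "S = localization R (CR - m)"
 interpret L: localization_map R S m h
  unfolding h_def S_def by (rule localization_map_prime[OF maximalideal_prime[OF m(1)]])
 obtain X where "regular_local S (L.ext m) X"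
  using regular_local_at[OF reg m(1)] unfolding S_def h_def by blast
 then interpret RL: regular_local S "L.ext m" X .
 have Iq: "ideal (FP I ?q) R" using If(1) by (rule fp_ideal)
 have mq: "ideal (FP m ?q) R" using idealD(1)[OF mi] by (rule fp_ideal)
 obtain c where c: "c \<in> carrier S" "c \<notin> frobenius_power S (L.ext m) ?q"
  "\<forall>a\<in>L.ext I. c \<otimes>\<^bsub>S\<^esub> a \<in> frobenius_power S (L.ext I) ?q"
  using RL.fedder_local[OF L.frob_S[OF frp(1)] frp(2) L.ext_ideal[OF I] L.lin_pure_S[OF lin_pure_pow[OF pure I] I frq]] by auto
 obtain r t where rt: "r \<in> CR" "t \<in> CR - m" "h t \<otimes>\<^bsub>S\<^esub> c = h r" using L.h_frac[OF c(1)] by auto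
 obtain A where A: "A \<subseteq> CR" "finite A" "I = Idl A" using finetely_gen[OF I] by auto
 have "\<exists>s\<in>CR - m. \<forall>a\<in>A. s \<otimes> (r \<otimes> a) \<in> FP I ?q"
 proof (rule L.common_mult[OF Iq A(2)])
  fix a assume a: "a \<in> A"
  then have ac: "a \<in> CR" "a \<in> I" using A genideal_self[OF A(1)] by auto
  show "r \<otimes> a \<in> CR" using rt ac by simp
  have "h (r \<otimes> a) = h t \<otimes>\<^bsub>S\<^esub> (c \<otimes>\<^bsub>S\<^esub> h a)" using rt ac c(1) by (simp add: L.S.m_assoc[symmetric])
  moreover have "c \<otimes>\<^bsub>S\<^esub> h a \<in> frobenius_power S (L.ext I) ?q" using c(3) L.h_in_ext[OF I ac(2)] by auto
  ultimately show "h (r \<otimes> a) \<in> L.ext (FP I ?q)"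
   using L.S.idealD(4)[OF L.ext_ideal[OF Iq], of "h t"] rt L.ext_fp[OF frq I] by simp
 qed
 then obtain s where s: "s \<in> CR - m" "\<forall>a\<in>A. s \<otimes> (r \<otimes> a) \<in> FP I ?q" by auto
 show ?thesis
 proof (intro bexI[of _ "s \<otimes> r"] conjI)
  show src: "s \<otimes> r \<in> CR" using s rt by simp
  have "s \<otimes> r \<in> colon R (FP I ?q) A" using s rt A by (auto simp: colon_def m_assoc subset_iff)
  then have "s \<otimes> r \<in> colon R (FP I ?q) I" using colon_Idl[OF Iq A(1)] A(3) by simp
  then show "\<forall>a\<in>I. (s \<otimes> r) \<otimes> a \<in> FP I ?q" by (auto simp: colon_def)
  show "s \<otimes> r \<notin> FP m ?q"
  proof
   assume "s \<otimes> r \<in> FP m ?q"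
   then have "h r \<in> L.ext (FP m ?q)" using L.h_mem_ext[OF mq rt(1)] s(1) by blast
   then have "h t \<otimes>\<^bsub>S\<^esub> c \<in> L.ext (FP m ?q)" using rt(3) by simp
   then have "c \<in> L.ext (FP m ?q)" by (rule L.mem_by_h[OF L.ext_ideal[OF mq] c(1) rt(2)])
   then show False using c(2) L.ext_fp[OF frq mi] by simp
  qed
 qed
qed

end

section \<open>From purity to linear systems\<close>

lemma (in abelian_subgroup) coset_eq_iff:
 assumes "x \<in> carrier G" "y \<in> carrier G"
 shows "H +> x = H +> y \<longleftrightarrow> x \<ominus> y \<in> H"
proof
 assume "H +> x = H +> y"
 then have "x \<in> H +> y" using a_rcos_self[OF assms(1)] by simp
 then show "x \<ominus> y \<in> H" using a_rcos_module[OF assms(2,1)] by (simp add: a_minus_def)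
next
 assume "x \<ominus> y \<in> H"
 then have "x \<in> H +> y" using a_rcos_module[OF assms(2,1)] by (simp add: a_minus_def)
 then show "H +> x = H +> y" using a_repr_independence'[OF _ assms(2)] by auto
qed

lemma (in abelian_subgroup) rcosetsE:
 assumes "C \<in> a_rcosets H"
 obtains x where "x \<in> carrier G" "C = H +> x"
 using assms by (auto simp: A_RCOSETS_def')

locale submodule_quot = module R F for R (structure) and F (structure) +
 fixes N
 assumes sub: "additive_subgroup N F" and smult_mem: "r \<in> carrier R ==> x \<in> N ==> r \<odot>\<^bsub>F\<^esub> x \<in> N"
begin

abbreviation "Q \<equiv> quotient_module F N"

sublocale abelian_subgroup N F
 using sub abelian_group_axioms by (rule abelian_subgroupI3)

lemma quot_carrier: "x \<in> carrier F ==> N +>\<^bsub>F\<^esub> x \<in> carrier Q"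
 by (simp add: quotient_module_def a_rcosetsI a_subset)

lemma quot_add: "x \<in> carrier F ==> y \<in> carrier F ==>
  (N +>\<^bsub>F\<^esub> x) \<oplus>\<^bsub>Q\<^esub> (N +>\<^bsub>F\<^esub> y) = N +>\<^bsub>F\<^esub> (x \<oplus>\<^bsub>F\<^esub> y)"
 by (simp add: quotient_module_def a_rcos_sum)

lemma quot_smult:
 assumes r: "r \<in> CR" and x: "x \<in> carrier F"
 shows "r \<odot>\<^bsub>Q\<^esub> (N +>\<^bsub>F\<^esub> x) = N +>\<^bsub>F\<^esub> (r \<odot>\<^bsub>F\<^esub> x)"
proof -
 have "N +>\<^bsub>F\<^esub> (r \<odot>\<^bsub>F\<^esub> y) = N +>\<^bsub>F\<^esub> (r \<odot>\<^bsub>F\<^esub> x)" if y: "y \<in> N +>\<^bsub>F\<^esub> x" for y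
 proof -
  have yc: "y \<in> carrier F" using y x a_elemrcos_carrier by blast
  have "y \<ominus>\<^bsub>F\<^esub> x \<in> N" using y a_rcos_module[OF x yc] by (simp add: a_minus_def)
  then have "r \<odot>\<^bsub>F\<^esub> (y \<ominus>\<^bsub>F\<^esub> x) \<in> N" by (rule smult_mem[OF r])
  moreover have "r \<odot>\<^bsub>F\<^esub> (y \<ominus>\<^bsub>F\<^esub> x) = r \<odot>\<^bsub>F\<^esub> y \<ominus>\<^bsub>F\<^esub> r \<odot>\<^bsub>F\<^esub> x"
   using r x yc by (simp add: a_minus_def smult_r_distr smult_r_minus)
  ultimately show ?thesis using coset_eq_iff[of "r \<odot>\<^bsub>F\<^esub> y" "r \<odot>\<^bsub>F\<^esub> x"] r x yc by simp
 qed
 then have "(\<Union>y\<in>N +>\<^bsub>F\<^esub> x. N +>\<^bsub>F\<^esub> (r \<odot>\<^bsub>F\<^esub> y)) = N +>\<^bsub>F\<^esub> (r \<odot>\<^bsub>F\<^esub> x)"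
  using a_rcos_self[OF x] by blast
 then show ?thesis by (simp add: quotient_module_def)
qed

lemma quot_zero: "\<zero>\<^bsub>Q\<^esub> = N +>\<^bsub>F\<^esub> \<zero>\<^bsub>F\<^esub>"
 using a_coset_add_zero[OF a_subset] by (simp add: quotient_module_def)

lemma quot_eq_zero_iff: "x \<in> carrier F ==> N +>\<^bsub>F\<^esub> x = \<zero>\<^bsub>Q\<^esub> \<longleftrightarrow> x \<in> N"
 unfolding quot_zero using coset_eq_iff[of x "\<zero>\<^bsub>F\<^esub>"] M.minus_equality[of "\<zero>\<^bsub>F\<^esub>" "\<zero>\<^bsub>F\<^esub>"] by (simp add: a_minus_def)

lemma quotE:
 assumes "C \<in> carrier Q"
 obtains x where "x \<in> carrier F" "C = N +>\<^bsub>F\<^esub> x"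
 using assms rcosetsE by (auto simp: quotient_module_def)

lemma quotient_module_module: "module R Q"
proof (rule moduleI)
 show "cring R" by (rule is_cring)
 show "abelian_group Q"
 proof (rule abelian_groupI)
  fix U V assume "U \<in> carrier Q" "V \<in> carrier Q"
  then obtain x y where xy: "x \<in> carrier F" "U = N +>\<^bsub>F\<^esub> x" "y \<in> carrier F" "V = N +>\<^bsub>F\<^esub> y" by (meson quotE)
  then show "U \<oplus>\<^bsub>Q\<^esub> V \<in> carrier Q"
   using quot_carrier by (simp add: quot_add)
  show "U \<oplus>\<^bsub>Q\<^esub> V = V \<oplus>\<^bsub>Q\<^esub> U"
   using xy by (simp add: quot_add M.a_comm)
  fix W assume "W \<in> carrier Q"
  then obtain z where z: "z \<in> carrier F" "W = N +>\<^bsub>F\<^esub> z" by (rule quotE)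
  then show "(U \<oplus>\<^bsub>Q\<^esub> V) \<oplus>\<^bsub>Q\<^esub> W
    = U \<oplus>\<^bsub>Q\<^esub> (V \<oplus>\<^bsub>Q\<^esub> W)"
   using xy by (simp add: quot_add M.a_assoc)
 next
  fix U assume "U \<in> carrier Q"
  then obtain x where x: "x \<in> carrier F" "U = N +>\<^bsub>F\<^esub> x" by (rule quotE)
  then show "\<zero>\<^bsub>Q\<^esub> \<oplus>\<^bsub>Q\<^esub> U = U" by (simp add: quot_zero quot_add)
  show "\<exists>y\<in>carrier Q. y \<oplus>\<^bsub>Q\<^esub> U = \<zero>\<^bsub>Q\<^esub>"
   using x by (intro bexI[of _ "N +>\<^bsub>F\<^esub> (\<ominus>\<^bsub>F\<^esub> x)"]) (simp_all add: quot_zero quot_add quot_carrier M.l_neg)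
 next
  show "\<zero>\<^bsub>Q\<^esub> \<in> carrier Q" by (simp add: quot_zero quot_carrier)
 qed
next
 fix r U assume r: "r \<in> CR" and "U \<in> carrier Q"
 then obtain x where x: "x \<in> carrier F" "U = N +>\<^bsub>F\<^esub> x" by (meson quotE)
 show "r \<odot>\<^bsub>Q\<^esub> U \<in> carrier Q" using r x by (simp add: quot_smult quot_carrier)
 fix s assume s: "s \<in> CR"
 show "(r \<oplus> s) \<odot>\<^bsub>Q\<^esub> U = r \<odot>\<^bsub>Q\<^esub> U \<oplus>\<^bsub>Q\<^esub> s \<odot>\<^bsub>Q\<^esub> U"
  using r s x by (simp add: quot_smult quot_add smult_l_distr)
 show "r \<otimes> s \<odot>\<^bsub>Q\<^esub> U = r \<odot>\<^bsub>Q\<^esub> (s \<odot>\<^bsub>Q\<^esub> U)"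
  using r s x by (simp add: quot_smult smult_assoc1)
next
 fix U assume "U \<in> carrier Q"
 then obtain x where x: "x \<in> carrier F" "U = N +>\<^bsub>F\<^esub> x" by (rule quotE)
 then show "\<one> \<odot>\<^bsub>Q\<^esub> U = U" by (simp add: quot_smult smult_one)
next
 fix r U V assume r: "r \<in> CR" and "U \<in> carrier Q" "V \<in> carrier Q"
 then obtain x y where xy: "x \<in> carrier F" "U = N +>\<^bsub>F\<^esub> x" "y \<in> carrier F" "V = N +>\<^bsub>F\<^esub> y" by (meson quotE)
 then show "r \<odot>\<^bsub>Q\<^esub> (U \<oplus>\<^bsub>Q\<^esub> V)
   = r \<odot>\<^bsub>Q\<^esub> U \<oplus>\<^bsub>Q\<^esub> r \<odot>\<^bsub>Q\<^esub> V"
  using r by (simp add: quot_smult quot_add smult_r_distr)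
qed

end

section \<open>Tensor products by generators and relations\<close>

lemma free_Abelian_subgroup:
 assumes "X \<subseteq> carrier (free_Abelian_group S)"
 defines "T \<equiv> generate (free_Abelian_group S) X"
 shows "0 \<in> T" "!!a b. a \<in> T ==> b \<in> T ==> a + b \<in> T" "!!a. a \<in> T ==> - a \<in> T"
  "!!a b. a \<in> T ==> b \<in> T ==> a - b \<in> T"
proof -
 show z: "0 \<in> T" using generate.one[of "free_Abelian_group S" X] by (simp add: T_def)
 show add: "a + b \<in> T" if "a \<in> T" "b \<in> T" for a b using generate.eng[OF that[unfolded T_def]] by (simp add: T_def)
 show neg: "- a \<in> T" if a: "a \<in> T" for a
  using group.generate_m_inv_closed[OF group_free_Abelian_group assms(1) a[unfolded T_def]]
   group.generate_in_carrier[OF group_free_Abelian_group assms(1) a[unfolded T_def]] by (simp add: T_def)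
 show "a - b \<in> T" if "a \<in> T" "b \<in> T" for a b using add[OF that(1) neg[OF that(2)]] by simp
qed

lemma tensor_relators_carrier:
 assumes "module R M" "module R N"
 shows "tensor_relators R M N \<subseteq> carrier (free_Abelian_group (carrier M \<times> carrier N))"
proof -
 interpret M: module R M by fact
 interpret N: module R N by fact
 have *: "frag_of a - frag_of b \<in> carrier (free_Abelian_group S)" if "a \<in> S" "b \<in> S" for a b and S :: "'z set"
  using keys_diff[of "frag_of a" "frag_of b"] that by auto
 have **: "frag_of a - frag_of b - frag_of c \<in> carrier (free_Abelian_group S)" if "a \<in> S" "b \<in> S" "c \<in> S" for a b c and S :: "'z set"
  using keys_diff[of "frag_of a - frag_of b" "frag_of c"] *[OF that(1,2)] that by auto
 show ?thesis
  unfolding tensor_relators_def by (intro Un_least; clarify) (intro * **; simp)+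
qed

lemma (in cring) ring_as_module_module:
 assumes "\<phi> \<in> ring_hom R R"
 shows "module R (ring_as_module \<phi> R)"
proof (rule moduleI)
 show "cring R" by (rule is_cring)
 show "abelian_group (ring_as_module \<phi> R)"
  by (rule abelian_groupI) (auto simp: ring_as_module_def a_assoc intro: a_comm bexI[of _ "\<ominus> x" for x] l_neg)
qed (use assms in \<open>auto simp: ring_as_module_def ring_hom_def Pi_iff l_distr r_distr m_assoc\<close>)


text \<open>The map sending a (x) m to a m is well defined on R (x) M, because it kills all
  relators; it sends 1 (x) y to y.\<close>

lemma (in module) self_tensor_zero:
 assumes y: "y \<in> carrier M" and t: "frag_of (\<one>, y) \<in> tensor_subgroup R (SM) M"
 shows "y = \<zero>\<^bsub>M\<^esub>"
proof -
 let ?S = "CR \<times> carrier M"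
 have "(%(a, m). a \<odot>\<^bsub>M\<^esub> m) ` ?S \<subseteq> carrier (add_monoid M)" by auto
 then obtain h where h: "h \<in> hom (free_Abelian_group ?S) (add_monoid M)"
  and hf: "!!x. x \<in> ?S ==> h (frag_of x) = (case x of (a, m) => a \<odot>\<^bsub>M\<^esub> m)"
  using comm_group.free_Abelian_group_universal[OF M.a_comm_group] by blast
 interpret h: group_hom "free_Abelian_group ?S" "add_monoid M" h
  using h M.a_group by (simp add: group_hom_def group_hom_axioms_def)
 have hc: "h u \<in> carrier M" if "Poly_Mapping.keys u \<subseteq> ?S" for u using h.hom_closed[of u] that by simp
 have hd: "h (u - v) = h u \<ominus>\<^bsub>M\<^esub> h v" if "Poly_Mapping.keys u \<subseteq> ?S" "Poly_Mapping.keys v \<subseteq> ?S" for u v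
  using h.hom_mult[of u "- v"] h.hom_inv[of v] that by (simp add: a_minus_def a_inv_def)
 have kd: "Poly_Mapping.keys (u - v) \<subseteq> ?S" if "Poly_Mapping.keys u \<subseteq> ?S" "Poly_Mapping.keys v \<subseteq> ?S"
  for u v :: "'a \<times> 'c \<Rightarrow>\<^sub>0 int" using keys_diff[of u v] that by blast
 have X: "tensor_relators R (SM) M \<subseteq> carrier (free_Abelian_group ?S)"
  using tensor_relators_carrier[OF ring_as_module_module[of "%r. r"] module_axioms]
  by (auto simp: ring_as_module_def ring_hom_def)
 have rel: "h u = \<zero>\<^bsub>M\<^esub>" if "u \<in> tensor_relators R (SM) M" for u
  using that unfolding tensor_relators_def
 proof (elim UnE CollectE exE conjE)
  fix x x' y assume "u = frag_of (x \<oplus>\<^bsub>self_module R\<^esub> x', y) - frag_of (x, y) - frag_of (x', y)"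
   "x \<in> carrier (SM)" "x' \<in> carrier (SM)" "y \<in> carrier M"
  then have "h u = (x \<oplus> x') \<odot>\<^bsub>M\<^esub> y \<ominus>\<^bsub>M\<^esub> x \<odot>\<^bsub>M\<^esub> y \<ominus>\<^bsub>M\<^esub> x' \<odot>\<^bsub>M\<^esub> y" "x \<in> CR" "x' \<in> CR" "y \<in> carrier M"
   by (auto simp: ring_as_module_def hd kd hf)
  then show "h u = \<zero>\<^bsub>M\<^esub>" by (simp add: smult_l_distr a_minus_def M.a_ac M.r_neg M.r_neg1 M.r_neg2)
 next
  fix x y y' assume "u = frag_of (x, y \<oplus>\<^bsub>M\<^esub> y') - frag_of (x, y) - frag_of (x, y')"
   "x \<in> carrier (SM)" "y' \<in> carrier M" "y \<in> carrier M"
  then have "h u = x \<odot>\<^bsub>M\<^esub> (y \<oplus>\<^bsub>M\<^esub> y') \<ominus>\<^bsub>M\<^esub> x \<odot>\<^bsub>M\<^esub> y \<ominus>\<^bsub>M\<^esub> x \<odot>\<^bsub>M\<^esub> y'" "x \<in> CR" "y' \<in> carrier M" "y \<in> carrier M"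
   by (auto simp: ring_as_module_def hd kd hf)
  then show "h u = \<zero>\<^bsub>M\<^esub>" by (simp add: smult_r_distr a_minus_def M.a_ac M.r_neg M.r_neg1 M.r_neg2)
 next
  fix r x y assume "u = frag_of (r \<odot>\<^bsub>self_module R\<^esub> x, y) - frag_of (x, r \<odot>\<^bsub>M\<^esub> y)"
   "r \<in> CR" "x \<in> carrier (SM)" "y \<in> carrier M"
  then have "h u = (r \<otimes> x) \<odot>\<^bsub>M\<^esub> y \<ominus>\<^bsub>M\<^esub> x \<odot>\<^bsub>M\<^esub> (r \<odot>\<^bsub>M\<^esub> y)" "r \<in> CR" "x \<in> CR" "y \<in> carrier M"
   by (auto simp: ring_as_module_def hd kd hf)
  then show "h u = \<zero>\<^bsub>M\<^esub>" by (simp add: smult_assoc1[symmetric] m_comm a_minus_def M.r_neg)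
 qed
 have "h u = \<zero>\<^bsub>M\<^esub>" if "u \<in> generate (free_Abelian_group ?S) (tensor_relators R (SM) M)" for u
  using that
 proof induction
  case one
  then show ?case using h.hom_one by simp
 next
  case (incl u)
  then show ?case by (rule rel)
 next
  case (inv u)
  then have "u \<in> carrier (free_Abelian_group ?S)" using X by blast
  then show ?case using rel[OF inv] h.hom_inv[of u] M.minus_equality[of "\<zero>\<^bsub>M\<^esub>" "\<zero>\<^bsub>M\<^esub>"] by (simp add: a_inv_def)
 next
  case (eng u v)
  have "u \<in> carrier (free_Abelian_group ?S)" "v \<in> carrier (free_Abelian_group ?S)"
   using eng(1,2) group.generate_in_carrier[OF group_free_Abelian_group X] by blast+
  then show ?case using eng h.hom_mult[of u v] by simp
 qed
 moreover have "carrier (SM) = CR" by (simp add: ring_as_module_def)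
 ultimately have "h (frag_of (\<one>, y)) = \<zero>\<^bsub>M\<^esub>" using t unfolding tensor_subgroup_def by simp
 then show ?thesis using y by (simp add: hf smult_one)
qed

text \<open>The tensor product of M with R viewed as a module through \<phi>. Identities in it are
  expressed as membership of formal sums in the relation subgroup \<open>T\<close>.\<close>

locale frob_tensor = module R M for R (structure) and M (structure) +
 fixes \<phi>
 assumes \<phi>: "\<phi> \<in> ring_hom R R"
begin

abbreviation "T \<equiv> tensor_subgroup R (ring_as_module \<phi> R) M"

lemma T_closed:
 shows "0 \<in> T" and "!!a b. a \<in> T ==> b \<in> T ==> a + b \<in> T" and "!!a. a \<in> T ==> - a \<in> T"
  and "!!a b. a \<in> T ==> b \<in> T ==> a - b \<in> T"
 using free_Abelian_subgroup[OF tensor_relators_carrier[OF ring_as_module_module[OF \<phi>] module_axioms]]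
 unfolding tensor_subgroup_def by blast+

lemma T_rel: "u \<in> tensor_relators R (ring_as_module \<phi> R) M ==> u \<in> T"
 unfolding tensor_subgroup_def by (rule generate.incl)

lemma T_add_left: "a \<in> CR ==> b \<in> CR ==> m \<in> carrier M ==>
  frag_of (a \<oplus> b, m) - frag_of (a, m) - frag_of (b, m) \<in> T"
 by (rule T_rel) (auto simp: tensor_relators_def ring_as_module_def)

lemma T_add_right: "a \<in> CR ==> m \<in> carrier M ==> m' \<in> carrier M ==>
  frag_of (a, m \<oplus>\<^bsub>M\<^esub> m') - frag_of (a, m) - frag_of (a, m') \<in> T"
 by (rule T_rel) (auto simp: tensor_relators_def ring_as_module_def)

lemma T_smult: "a \<in> CR ==> r \<in> CR ==> m \<in> carrier M ==>
  frag_of (\<phi> r \<otimes> a, m) - frag_of (a, r \<odot>\<^bsub>M\<^esub> m) \<in> T"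
 by (rule T_rel) (auto simp: tensor_relators_def ring_as_module_def)

lemma T_zero_left: "m \<in> carrier M ==> frag_of (\<zero>, m) \<in> T"
 using T_closed(3)[OF T_add_left[of \<zero> \<zero> m]] by simp

lemma T_zero_right: "a \<in> CR ==> frag_of (a, \<zero>\<^bsub>M\<^esub>) \<in> T"
 using T_closed(3)[OF T_add_right[of a "\<zero>\<^bsub>M\<^esub>" "\<zero>\<^bsub>M\<^esub>"]] by simp

lemma T_sum_left:
 assumes "finite L" "\<forall>l\<in>L. a l \<in> CR" "m \<in> carrier M"
 shows "frag_of (\<Oplus>l\<in>L. a l, m) - (\<Sum>l\<in>L. frag_of (a l, m)) \<in> T"
 using assms
proof (induction rule: finite_induct)
 case empty
 then show ?case by (simp add: T_zero_left)
next
 case (insert x L)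
 let ?u = "frag_of (a x \<oplus> (\<Oplus>l\<in>L. a l), m) - frag_of (a x, m) - frag_of (\<Oplus>l\<in>L. a l, m)"
 let ?v = "frag_of (\<Oplus>l\<in>L. a l, m) - (\<Sum>l\<in>L. frag_of (a l, m))"
 have "?u \<in> T" using insert by (intro T_add_left finsum_closed) auto
 then have "?u + ?v \<in> T" using insert by (intro T_closed(2)) auto
 moreover have "(\<Oplus>l\<in>insert x L. a l) = a x \<oplus> (\<Oplus>l\<in>L. a l)"
  using insert R.finsum_insert[of L x a] by auto
 ultimately show ?case using insert by (simp add: algebra_simps)
qed

lemma T_sum_right:
 assumes "finite L" "\<forall>l\<in>L. m l \<in> carrier M" "a \<in> CR"
 shows "frag_of (a, \<Oplus>\<^bsub>M\<^esub>l\<in>L. m l) - (\<Sum>l\<in>L. frag_of (a, m l)) \<in> T"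
 using assms
proof (induction rule: finite_induct)
 case empty
 then show ?case by (simp add: T_zero_right)
next
 case (insert x L)
 let ?u = "frag_of (a, m x \<oplus>\<^bsub>M\<^esub> (\<Oplus>\<^bsub>M\<^esub>l\<in>L. m l)) - frag_of (a, m x) - frag_of (a, \<Oplus>\<^bsub>M\<^esub>l\<in>L. m l)"
 let ?v = "frag_of (a, \<Oplus>\<^bsub>M\<^esub>l\<in>L. m l) - (\<Sum>l\<in>L. frag_of (a, m l))"
 have "?u \<in> T" using insert by (intro T_add_right M.finsum_closed) auto
 then have "?u + ?v \<in> T" using insert by (intro T_closed(2)) auto
 moreover have "(\<Oplus>\<^bsub>M\<^esub>l\<in>insert x L. m l) = m x \<oplus>\<^bsub>M\<^esub> (\<Oplus>\<^bsub>M\<^esub>l\<in>L. m l)" using insert by (intro M.finsum_insert) auto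
 ultimately show ?case using insert by (simp add: algebra_simps)
qed

lemma T_sum:
 assumes "\<forall>l\<in>L. f l \<in> T" shows "sum f L \<in> T"
 using assms by (induction L rule: infinite_finite_induct) (auto intro: T_closed)

lemma T_lin:
 assumes "finite J" "\<forall>j\<in>J. y j \<in> CR" "\<forall>j\<in>J. e j \<in> carrier M" "a \<in> CR"
 shows "frag_of (a, \<Oplus>\<^bsub>M\<^esub>j\<in>J. y j \<odot>\<^bsub>M\<^esub> e j) - (\<Sum>j\<in>J. frag_of (\<phi> (y j) \<otimes> a, e j)) \<in> T"
proof -
 have "frag_of (a, \<Oplus>\<^bsub>M\<^esub>j\<in>J. y j \<odot>\<^bsub>M\<^esub> e j) - (\<Sum>j\<in>J. frag_of (a, y j \<odot>\<^bsub>M\<^esub> e j)) \<in> T"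
  using assms by (intro T_sum_right) auto
 moreover have "(\<Sum>j\<in>J. frag_of (\<phi> (y j) \<otimes> a, e j) - frag_of (a, y j \<odot>\<^bsub>M\<^esub> e j)) \<in> T"
  using assms by (intro T_sum ballI T_smult) auto
 ultimately have "frag_of (a, \<Oplus>\<^bsub>M\<^esub>j\<in>J. y j \<odot>\<^bsub>M\<^esub> e j) - (\<Sum>j\<in>J. frag_of (a, y j \<odot>\<^bsub>M\<^esub> e j))
  - (\<Sum>j\<in>J. frag_of (\<phi> (y j) \<otimes> a, e j) - frag_of (a, y j \<odot>\<^bsub>M\<^esub> e j)) \<in> T" by (rule T_closed(4))
 then show ?thesis by (simp add: sum_subtractf)
qed

text \<open>In the tensor product, 1 (x) sum_j y_j e_j = sum_j \<phi>(y_j) (x) e_j = sum_l s_l (x)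
  sum_j X_lj e_j, and each inner sum vanishes.\<close>

lemma T_system:
 assumes fin: "finite J" "finite L" and y: "\<forall>j\<in>J. y j \<in> CR" and e: "\<forall>j\<in>J. e j \<in> carrier M"
  and s: "\<forall>l\<in>L. s l \<in> CR" and X: "\<forall>l\<in>L. \<forall>j\<in>J. X l j \<in> CR"
  and eq: "\<forall>j\<in>J. \<phi> (y j) = (\<Oplus>l\<in>L. s l \<otimes> \<phi> (X l j))"
  and z: "\<forall>l\<in>L. (\<Oplus>\<^bsub>M\<^esub>j\<in>J. X l j \<odot>\<^bsub>M\<^esub> e j) = \<zero>\<^bsub>M\<^esub>"
 shows "frag_of (\<one>, \<Oplus>\<^bsub>M\<^esub>j\<in>J. y j \<odot>\<^bsub>M\<^esub> e j) \<in> T"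
proof -
 have pc: "\<phi> a \<in> CR" if "a \<in> CR" for a using \<phi> that by (auto simp: ring_hom_def)
 have 1: "frag_of (\<one>, \<Oplus>\<^bsub>M\<^esub>j\<in>J. y j \<odot>\<^bsub>M\<^esub> e j) - (\<Sum>j\<in>J. frag_of (\<phi> (y j) \<otimes> \<one>, e j)) \<in> T"
  using assms by (intro T_lin) auto
 have 2: "(\<Sum>j\<in>J. frag_of (\<Oplus>l\<in>L. s l \<otimes> \<phi> (X l j), e j) - (\<Sum>l\<in>L. frag_of (s l \<otimes> \<phi> (X l j), e j))) \<in> T"
  using assms pc by (intro T_sum ballI T_sum_left) auto
 have 3: "(\<Sum>l\<in>L. frag_of (s l, \<Oplus>\<^bsub>M\<^esub>j\<in>J. X l j \<odot>\<^bsub>M\<^esub> e j) - (\<Sum>j\<in>J. frag_of (\<phi> (X l j) \<otimes> s l, e j))) \<in> T"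
  using assms by (intro T_sum ballI T_lin) auto
 have 4: "(\<Sum>l\<in>L. frag_of (s l, \<Oplus>\<^bsub>M\<^esub>j\<in>J. X l j \<odot>\<^bsub>M\<^esub> e j)) \<in> T"
  using s z by (intro T_sum ballI) (simp add: T_zero_right)
 have a: "(\<Sum>j\<in>J. frag_of (\<phi> (y j) \<otimes> \<one>, e j)) = (\<Sum>j\<in>J. frag_of (\<Oplus>l\<in>L. s l \<otimes> \<phi> (X l j), e j))"
  using y pc by (intro sum.cong refl) (auto simp: eq[rule_format, symmetric])
 have b: "(\<Sum>l\<in>L. \<Sum>j\<in>J. frag_of (\<phi> (X l j) \<otimes> s l, e j)) = (\<Sum>j\<in>J. \<Sum>l\<in>L. frag_of (s l \<otimes> \<phi> (X l j), e j))"
  using s X pc by (subst sum.swap) (intro sum.cong refl, simp add: m_comm)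
 have "frag_of (\<one>, \<Oplus>\<^bsub>M\<^esub>j\<in>J. y j \<odot>\<^bsub>M\<^esub> e j) - (\<Sum>j\<in>J. \<Sum>l\<in>L. frag_of (s l \<otimes> \<phi> (X l j), e j)) \<in> T"
  using T_closed(2)[OF 1 2] by (simp add: a sum_subtractf)
 moreover have "(\<Sum>j\<in>J. \<Sum>l\<in>L. frag_of (s l \<otimes> \<phi> (X l j), e j)) \<in> T"
  using T_closed(4)[OF 4 3] by (simp add: b sum_subtractf)
 ultimately show ?thesis using T_closed(2) by fastforce
qed

text \<open>Only one consequence of injectivity is extracted: the class of 1 (x) y and the zero
  class have the same image \<open>T\<close>, so they agree in R (x) M.\<close>

lemma pure_zero:
 assumes inj: "inj_on (tensor_map_left R \<phi> (ring_as_module \<phi> R) M) (carrier (tensor_product R (SM) M))"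
  and y: "y \<in> carrier M" and yT: "frag_of (\<one>, y) \<in> T"
 shows "y = \<zero>\<^bsub>M\<^esub>"
proof -
 let ?S = "CR \<times> carrier M"
 let ?G = "free_Abelian_group ?S"
 let ?T0 = "tensor_subgroup R (SM) M"
 have id: "(%r. r) \<in> ring_hom R R" by (auto simp: ring_hom_def)
 have car: "carrier (SM) = CR" "carrier (ring_as_module \<phi> R) = CR"
  by (simp_all add: ring_as_module_def)
 have pc: "\<phi> a \<in> CR" if "a \<in> CR" for a using \<phi> that by (auto simp: ring_hom_def)
 have X0: "tensor_relators R (SM) M \<subseteq> carrier ?G"
  using tensor_relators_carrier[OF ring_as_module_module[OF id] module_axioms] by (simp add: car)
 have XT: "tensor_relators R (ring_as_module \<phi> R) M \<subseteq> carrier ?G"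
  using tensor_relators_carrier[OF ring_as_module_module[OF \<phi>] module_axioms] by (simp add: car)
 have T0s: "subgroup ?T0 ?G" and Ts: "subgroup T ?G"
  unfolding tensor_subgroup_def car using group.generate_is_subgroup[OF group_free_Abelian_group] X0 XT by blast+
 let ?f = "frag_extend (%(x, y). frag_of (\<phi> x, y))"
 have rel: "?f u \<in> T" if "u \<in> tensor_relators R (SM) M" for u
 proof -
  have pm: "\<phi> (a \<otimes> b) = \<phi> a \<otimes> \<phi> b" "\<phi> (a \<oplus> b) = \<phi> a \<oplus> \<phi> b" if "a \<in> CR" "b \<in> CR" for a b
   using \<phi> that by (auto simp: ring_hom_def)
  show ?thesis using that unfolding tensor_relators_def
  proof (elim UnE CollectE exE conjE)
   fix x x' y assume "u = frag_of (x \<oplus>\<^bsub>self_module R\<^esub> x', y) - frag_of (x, y) - frag_of (x', y)"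
    "x \<in> carrier (SM)" "x' \<in> carrier (SM)" "y \<in> carrier M"
   then show ?thesis using T_add_left[of "\<phi> x" "\<phi> x'" y] pc
    by (simp add: frag_extend_diff pm ring_as_module_def)
  next
   fix x y y' assume "u = frag_of (x, y \<oplus>\<^bsub>M\<^esub> y') - frag_of (x, y) - frag_of (x, y')"
    "x \<in> carrier (SM)" "y' \<in> carrier M" "y \<in> carrier M"
   then show ?thesis using T_add_right[of "\<phi> x" y y'] pc
    by (simp add: frag_extend_diff ring_as_module_def)
  next
   fix r x y assume "u = frag_of (r \<odot>\<^bsub>self_module R\<^esub> x, y) - frag_of (x, r \<odot>\<^bsub>M\<^esub> y)"
    "r \<in> CR" "x \<in> carrier (SM)" "y \<in> carrier M"
   then show ?thesis using T_smult[of "\<phi> x" r y] pc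
    by (simp add: frag_extend_diff pm ring_as_module_def)
  qed
 qed
 have fT: "?f u \<in> T" if "u \<in> ?T0" for u
  using that unfolding tensor_subgroup_def[of R "SM"] car
 proof induction
  case one
  then show ?case using T_closed(1) by simp
 next
  case (incl u)
  then show ?case by (rule rel)
 next
  case (inv u)
  then have "u \<in> carrier ?G" using X0 by blast
  then show ?case using T_closed(3)[OF rel[OF inv]] by (simp add: frag_extend_minus)
 next
  case (eng u v)
  then show ?case using T_closed(2) by (simp add: frag_extend_add)
 qed
 define C where "C = ?T0 #>\<^bsub>?G\<^esub> frag_of (\<one>, y)"
 have C: "C = {t + frag_of (\<one>, y) | t. t \<in> ?T0}" by (auto simp: C_def r_coset_def)
 have Cc: "C \<in> carrier (tensor_product R (SM) M)"
  unfolding tensor_product_def FactGroup_def car C_def using y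
  by (auto simp: RCOSETS_def intro!: bexI[of _ "frag_of (\<one>, y)"])
 have T0e: "?T0 = ?T0 #>\<^bsub>?G\<^esub> 0" by (auto simp: r_coset_def)
 have "?T0 \<in> rcosets\<^bsub>?G\<^esub> ?T0"
  unfolding RCOSETS_def using T0e by (auto intro!: bexI[of _ 0])
 then have T0c: "?T0 \<in> carrier (tensor_product R (SM) M)"
  unfolding tensor_product_def FactGroup_def car by simp
 have cos: "T #>\<^bsub>?G\<^esub> u = T" if "u \<in> T" for u
  using group.coset_join2[OF group_free_Abelian_group _ Ts that] subgroup.subset[OF Ts] that by blast
 have "?f c \<in> T" if c: "c \<in> C" for c
 proof -
  obtain t where t: "c = t + frag_of (\<one>, y)" "t \<in> ?T0" using c C by blast
  have "\<phi> \<one> = \<one>" using \<phi> by (simp add: ring_hom_def)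
  then show ?thesis unfolding t(1) using T_closed(2)[OF fT[OF t(2)] yT] by (simp add: frag_extend_add)
 qed
 moreover have "0 \<in> ?T0" using subgroup.one_closed[OF T0s] by simp
 moreover from this have "frag_of (\<one>, y) \<in> C" unfolding C by force
 ultimately have "tensor_map_left R \<phi> (ring_as_module \<phi> R) M C = T"
  "tensor_map_left R \<phi> (ring_as_module \<phi> R) M ?T0 = T"
  unfolding tensor_map_left_def car using cos fT by auto
 then have "C = ?T0" using inj_onD[OF inj _ Cc T0c] by simp
 then have "frag_of (\<one>, y) \<in> ?T0" using \<open>frag_of (\<one>, y) \<in> C\<close> by simp
 then show ?thesis by (rule self_tensor_zero[OF y])
qed

end


text \<open>Purity is tested on the module R^k modulo the rows X_l and on the class of y. The
  assumed equation kills 1 (x) y by \<open>T_system\<close>, so y lies in the span of the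
  rows.\<close>

lemma (in cring) pure_system:
 fixes \<phi> :: "'a => 'a" and k n :: nat
 assumes pure: "pure_hom R R \<phi>" and y: "\<forall>j<k. y j \<in> CR" and s: "\<forall>l<n. s l \<in> CR"
  and X: "\<forall>l<n. \<forall>j<k. X l j \<in> CR" and eq: "\<forall>j<k. \<phi> (y j) = dot R {..<n} s (%l. \<phi> (X l j))"
 shows "\<exists>r. (\<forall>l<n. r l \<in> CR) \<and> (\<forall>j<k. y j = dot R {..<n} r (%l. X l j))"
proof -
 \<comment> \<open>Sequences over all naturals, cut off at k by \<open>tr\<close>: the quotient then
   has its carrier in \<open>(nat => 'a) set\<close>, the type over which \<open>pure_hom\<close>
   quantifies.\<close>
 let ?F = "FM (UNIV :: nat set)"
 interpret F: module R ?F by (rule free_module_module)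
 have \<phi>: "\<phi> \<in> ring_hom R R" using pure by (simp add: pure_hom_def)
 define tr :: "(nat => 'a) => nat => 'a" where "tr v = (%j. if j < k then v j else \<zero>)" for v
 define N where "N = {tr (%j. dot R {..<n} r (%l. X l j)) | r. \<forall>l<n. r l \<in> CR}"
 have trc: "tr v \<in> carrier ?F" if "\<forall>j<k. v j \<in> CR" for v
 proof -
  have "finite {j. tr v j \<noteq> \<zero>}" by (rule finite_subset[of _ "{..<k}"]) (auto simp: tr_def)
  then show ?thesis using that by (auto simp: free_module_def tr_def)
 qed
 have dc: "dot R {..<n} r (%l. X l j) \<in> CR" if "\<forall>l<n. r l \<in> CR" "j < k" for r j
  using that X by (intro dot_closed) auto
 have dl: "tr (%j. dot R {..<n} (%l. w l \<oplus> t \<otimes> g l) (%l. X l j)) =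
   tr (%j. dot R {..<n} w (%l. X l j) \<oplus> t \<otimes> dot R {..<n} g (%l. X l j))"
  if "\<forall>l<n. w l \<in> CR" "\<forall>l<n. g l \<in> CR" "t \<in> CR" for w g t
  unfolding tr_def using that X by (intro ext if_cong refl dot_lin) auto
 have d0: "tr (%j. dot R {..<n} (%l. \<zero>) (%l. X l j)) = (%_. \<zero>)"
  using X by (auto simp: tr_def fun_eq_iff intro!: dot_zero)
 have addN: "u \<oplus>\<^bsub>?F\<^esub> t \<odot>\<^bsub>?F\<^esub> v \<in> N" if uv: "u \<in> N" "v \<in> N" and t: "t \<in> CR" for u v t
 proof -
  obtain w g where wg: "\<forall>l<n. w l \<in> CR" "\<forall>l<n. g l \<in> CR"
   "u = tr (%j. dot R {..<n} w (%l. X l j))" "v = tr (%j. dot R {..<n} g (%l. X l j))"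
   using uv unfolding N_def by blast
  have "u \<oplus>\<^bsub>?F\<^esub> t \<odot>\<^bsub>?F\<^esub> v = tr (%j. dot R {..<n} (%l. w l \<oplus> t \<otimes> g l) (%l. X l j))"
   unfolding dl[OF wg(1,2) t] wg(3,4) using t by (auto simp: free_module_def tr_def fun_eq_iff)
  moreover have "\<forall>l<n. w l \<oplus> t \<otimes> g l \<in> CR" using wg t by auto
  ultimately show ?thesis unfolding N_def by blast
 qed
 have Nc: "N \<subseteq> carrier ?F" using dc by (auto simp: N_def intro!: trc)
 have N0: "\<zero>\<^bsub>?F\<^esub> \<in> N"
  unfolding N_def using d0 by (auto simp: free_module_def intro!: exI[of _ "%l. \<zero>"])
 have smN: "t \<odot>\<^bsub>?F\<^esub> v \<in> N" if "v \<in> N" "t \<in> CR" for v t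
  using addN[OF N0 that] Nc that by (auto simp: subset_iff)
 interpret Q: submodule_quot R ?F N
 proof (intro submodule_quot.intro submodule_quot_axioms.intro F.module_axioms)
  show "additive_subgroup N ?F"
  proof (rule additive_subgroupI, rule F.add.subgroupI)

   fix u v assume "u \<in> N" "v \<in> N"
   then show "u \<oplus>\<^bsub>?F\<^esub> v \<in> N" using addN[of u v \<one>] Nc by (auto simp: F.smult_one subset_iff)
  next
   fix u assume u: "u \<in> N"
   then have "u \<in> carrier ?F" using Nc by blast
   then have "\<ominus>\<^bsub>?F\<^esub> u = (\<ominus> \<one>) \<odot>\<^bsub>?F\<^esub> u" using F.smult_l_minus[of \<one> u] by (simp add: F.smult_one)
   then show "\<ominus>\<^bsub>?F\<^esub> u \<in> N" using smN[OF u, of "\<ominus> \<one>"] by simp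
  qed (use N0 Nc in auto)
 qed (use smN in auto)
 let ?M = "quotient_module ?F N"
 interpret M: module R ?M by (rule Q.quotient_module_module)
 interpret frob_tensor R ?M \<phi> by unfold_locales (rule \<phi>)
 let ?e = "%j. N +>\<^bsub>?F\<^esub> bv j"
 have ec: "?e j \<in> carrier ?M" for j by (intro Q.quot_carrier basis_vec_closed) simp
 have sumM: "(\<Oplus>\<^bsub>?M\<^esub>j\<in>{..<k}. v j \<odot>\<^bsub>?M\<^esub> ?e j) = N +>\<^bsub>?F\<^esub> tr v" if v: "\<forall>j<k. v j \<in> CR" for v
 proof -
  have "(\<Oplus>\<^bsub>?M\<^esub>j\<in>{..<m}. v j \<odot>\<^bsub>?M\<^esub> ?e j) = N +>\<^bsub>?F\<^esub> (%j. if j < m then v j else \<zero>)" if "m \<le> k" for m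
   using that
  proof (induction m)
   case 0
   then show ?case by (simp add: Q.quot_zero) (simp add: free_module_def)
  next
   case (Suc m)
   have vm: "v m \<in> CR" "\<forall>j<m. v j \<in> CR" using Suc v by auto
   have "finite {j. (if j < m then v j else \<zero>) \<noteq> \<zero>}" by (rule finite_subset[of _ "{..<m}"]) auto
   then have c: "(%j. if j < m then v j else \<zero>) \<in> carrier ?F" using vm by (auto simp: free_module_def)
   have b: "bv m \<in> carrier ?F" by (rule basis_vec_closed) simp
   have "(\<Oplus>\<^bsub>?M\<^esub>j\<in>{..<Suc m}. v j \<odot>\<^bsub>?M\<^esub> ?e j) = v m \<odot>\<^bsub>?M\<^esub> ?e m \<oplus>\<^bsub>?M\<^esub> (\<Oplus>\<^bsub>?M\<^esub>j\<in>{..<m}. v j \<odot>\<^bsub>?M\<^esub> ?e j)"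
    unfolding lessThan_Suc using vm ec by (intro M.M.finsum_insert) auto
   also have "... = N +>\<^bsub>?F\<^esub> (v m \<odot>\<^bsub>?F\<^esub> bv m \<oplus>\<^bsub>?F\<^esub> (%j. if j < m then v j else \<zero>))"
    using Suc vm b c by (simp add: Q.quot_smult Q.quot_add)
   also have "v m \<odot>\<^bsub>?F\<^esub> bv m \<oplus>\<^bsub>?F\<^esub> (%j. if j < m then v j else \<zero>) = (%j. if j < Suc m then v j else \<zero>)"
    using vm by (auto simp: free_module_def basis_vec_def fun_eq_iff less_Suc_eq)
   finally show ?case .
  qed
  from this[of k] show ?thesis by (simp add: tr_def)
 qed
 have "frag_of (\<one>, \<Oplus>\<^bsub>?M\<^esub>j\<in>{..<k}. y j \<odot>\<^bsub>?M\<^esub> ?e j) \<in> T"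
 proof (rule T_system[of "{..<k}" "{..<n}" y ?e s X])
  show "\<forall>j\<in>{..<k}. \<phi> (y j) = (\<Oplus>l\<in>{..<n}. s l \<otimes> \<phi> (X l j))" using eq by (simp add: dot_def)
  show "\<forall>l\<in>{..<n}. (\<Oplus>\<^bsub>?M\<^esub>j\<in>{..<k}. X l j \<odot>\<^bsub>?M\<^esub> ?e j) = \<zero>\<^bsub>?M\<^esub>"
  proof
   fix l assume l: "l \<in> {..<n}"
   have "tr (X l) = tr (%j. dot R {..<n} (%i. if i = l then \<one> else \<zero>) (%l. X l j))"
    unfolding tr_def using l X by (intro ext if_cong refl dot_unit[symmetric]) auto
   then have "tr (X l) \<in> N" unfolding N_def by (auto intro!: exI[of _ "%i. if i = l then \<one> else \<zero>"])
   then show "(\<Oplus>\<^bsub>?M\<^esub>j\<in>{..<k}. X l j \<odot>\<^bsub>?M\<^esub> ?e j) = \<zero>\<^bsub>?M\<^esub>"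
    using l X Q.quot_eq_zero_iff[of "tr (X l)"] Nc by (auto simp: sumM)
  qed
 qed (use y s X ec in auto)
 then have "N +>\<^bsub>?F\<^esub> tr y = \<zero>\<^bsub>?M\<^esub>"
  using pure_zero[of "N +>\<^bsub>?F\<^esub> tr y"] pure M.module_axioms Q.quot_carrier[OF trc[OF y]] y
  unfolding pure_hom_def by (simp add: sumM)
 then have "tr y \<in> N" using Q.quot_eq_zero_iff trc[OF y] by blast
 then obtain r where r: "\<forall>l<n. r l \<in> CR" "tr y = tr (%j. dot R {..<n} r (%l. X l j))"
  unfolding N_def by blast
 have "y j = dot R {..<n} r (%l. X l j)" if "j < k" for j
  using fun_cong[OF r(2), of j] that by (simp add: tr_def)
 then show ?thesis using r(1) by blast
qed

lemma (in cring) F_pure_lin_pure: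
 assumes I: "ideal I R" and pure: "F_pure (R Quot I) p"
 shows "lin_pure R I p"
 unfolding lin_pure_def
proof (intro allI impI)
 fix k n :: nat and y s X
 assume y: "\<forall>j<k. y j \<in> CR" and s: "\<forall>l<n. s l \<in> CR"
  and X: "\<forall>l<n. \<forall>j<k. X l j \<in> CR"
  and eq: "\<forall>j<k. y j [^] p \<ominus> dot R {..<n} s (%l. X l j [^] p) \<in> I"
 interpret I: ideal I R by fact
 interpret A: cring "R Quot I" by (rule I.quotient_is_cring[OF is_cring])
 interpret \<pi>: ring_hom_cring R "R Quot I" "(+>) I" by (rule I.rcos_ring_hom_cring[OF is_cring])
 have pure': "pure_hom (R Quot I) (R Quot I) (%r. r [^]\<^bsub>R Quot I\<^esub> p)" using pure by (simp add: F_pure_def)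
 have cos: "I +> a = I +> b \<longleftrightarrow> a \<ominus> b \<in> I" if "a \<in> CR" "b \<in> CR" for a b
  using quotient_eq_iff_same_a_r_cos[OF I that] by simp
 have dc: "dot R {..<m} u v \<in> CR" if "\<forall>l<m. u l \<in> CR" "\<forall>l<m. v l \<in> CR" for m :: nat and u v
  using that by (intro dot_closed) auto
 have pd: "I +> dot R {..<m} u v = dot (R Quot I) {..<m} (%l. I +> u l) (%l. I +> v l)"
  if "\<forall>l<m. u l \<in> CR" "\<forall>l<m. v l \<in> CR" for m :: nat and u v
  using that
 proof (induction m)
  case 0
  then show ?case using \<pi>.hom_zero by simp
 next
  case (Suc m)
  then have c: "\<forall>l<m. u l \<in> CR" "\<forall>l<m. v l \<in> CR" "u m \<in> CR" "v m \<in> CR" by auto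
  have "I +> dot R {..<Suc m} u v = I +> (u m \<otimes> v m \<oplus> dot R {..<m} u v)"
   unfolding lessThan_Suc using Suc.prems by (subst dot_insert) auto
  also have "... = (I +> u m) \<otimes>\<^bsub>R Quot I\<^esub> (I +> v m) \<oplus>\<^bsub>R Quot I\<^esub> dot (R Quot I) {..<m} (%l. I +> u l) (%l. I +> v l)"
   using c Suc.IH \<pi>.hom_add[OF m_closed[OF c(3,4)] dc[OF c(1,2)]] \<pi>.hom_mult[OF c(3,4)] by simp
  also have "... = dot (R Quot I) {..<Suc m} (%l. I +> u l) (%l. I +> v l)"
   unfolding lessThan_Suc using Suc.prems by (subst A.dot_insert) auto
  finally show ?case .
 qed
 have "\<exists>r. (\<forall>l<n. r l \<in> carrier (R Quot I)) \<and> (\<forall>j<k. I +> y j = dot (R Quot I) {..<n} r (%l. I +> X l j))"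
 proof (rule A.pure_system[OF pure', where s = "%l. I +> s l"])
  show "\<forall>j<k. (I +> y j) [^]\<^bsub>R Quot I\<^esub> p = dot (R Quot I) {..<n} (%l. I +> s l) (%l. (I +> X l j) [^]\<^bsub>R Quot I\<^esub> p)"
  proof (intro allI impI)
   fix j assume j: "j < k"
   have c: "\<forall>l<n. X l j [^] p \<in> CR" using X j by auto
   have "(I +> y j) [^]\<^bsub>R Quot I\<^esub> p = I +> (y j [^] p)" using y j \<pi>.hom_pow by simp
   also have "... = I +> dot R {..<n} s (%l. X l j [^] p)" using y j eq cos[of "y j [^] p" "dot R {..<n} s (%l. X l j [^] p)"] dc[OF s c] by auto
   also have "... = dot (R Quot I) {..<n} (%l. I +> s l) (%l. I +> (X l j [^] p))" by (rule pd[OF s c])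
   also have "... = dot (R Quot I) {..<n} (%l. I +> s l) (%l. (I +> X l j) [^]\<^bsub>R Quot I\<^esub> p)"
   proof (rule A.dot_cong)
    fix l assume "l \<in> {..<n}"
    then have l: "s l \<in> CR" "X l j \<in> CR" using s X j by auto
    show "I +> (X l j [^] p) = (I +> X l j) [^]\<^bsub>R Quot I\<^esub> p" by (rule \<pi>.hom_pow[OF l(2)])
    show "I +> s l \<in> carrier (R Quot I)" by (rule \<pi>.hom_closed[OF l(1)])
    show "(I +> X l j) [^]\<^bsub>R Quot I\<^esub> p \<in> carrier (R Quot I)"
     by (rule A.nat_pow_closed[OF \<pi>.hom_closed[OF l(2)]])
   qed (rule refl)
   finally show "(I +> y j) [^]\<^bsub>R Quot I\<^esub> p = dot (R Quot I) {..<n} (%l. I +> s l) (%l. (I +> X l j) [^]\<^bsub>R Quot I\<^esub> p)" .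
  qed
 qed (use y s X in auto)
 then obtain r where r: "\<forall>l<n. r l \<in> carrier (R Quot I)"
  "\<forall>j<k. I +> y j = dot (R Quot I) {..<n} r (%l. I +> X l j)" by blast
 have "\<exists>t\<in>CR. C = I +> t" if "C \<in> carrier (R Quot I)" for C
 proof -
  have "C \<in> (\<Union>t\<in>CR. {I +> t})" using that unfolding FactRing_def A_RCOSETS_def' by simp
  then show ?thesis by (elim UN_E) (rule bexI, rule singletonD)
 qed
 then have "\<forall>l<n. \<exists>t\<in>CR. r l = I +> t" using r(1) by blast
 then obtain t where t: "\<forall>l<n. t l \<in> CR \<and> r l = I +> t l" by metis
 have "y j \<ominus> dot R {..<n} t (%l. X l j) \<in> I" if j: "j < k" for j
 proof -
  have c: "\<forall>l<n. X l j \<in> CR" "\<forall>l<n. t l \<in> CR" using X j t by auto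
  have "I +> y j = dot (R Quot I) {..<n} r (%l. I +> X l j)" using r(2) j by blast
  also have "... = dot (R Quot I) {..<n} (%l. I +> t l) (%l. I +> X l j)" using t c by (intro A.dot_cong) auto
  also have "... = I +> dot R {..<n} t (%l. X l j)" using pd[OF c(2,1)] by simp
  finally show ?thesis using cos[of "y j" "dot R {..<n} t (%l. X l j)"] y j dc[OF c(2,1)] by auto
 qed
 then show "\<exists>r. (\<forall>l<n. r l \<in> CR) \<and> (\<forall>j<k. y j \<ominus> dot R {..<n} r (%l. X l j) \<in> I)" using t by blast
qed

section \<open>Complexes of modules\<close>

definition cplx :: "('a, 'x) ring_scheme => (nat => ('a, 'm, 'y) module_scheme) => (nat => 'm => 'm) => bool" where
 "cplx R D d \<longleftrightarrow> (\<forall>k. module R (D k) \<and> d k \<in> mod_hom R (D (Suc k)) (D k) \<and>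
   (\<forall>x\<in>carrier (D (Suc (Suc k))). d k (d (Suc k) x) = \<zero>\<^bsub>D k\<^esub>))"

text \<open>Exactness is required in positive degrees only; the cokernel of \<open>d 0\<close> is
  the module being resolved.\<close>

definition acyclic_cplx :: "('a, 'x) ring_scheme => (nat => ('a, 'm, 'y) module_scheme) => (nat => 'm => 'm) => bool" where
 "acyclic_cplx R D d \<longleftrightarrow> cplx R D d \<and>
   (\<forall>k. \<forall>x\<in>carrier (D (Suc k)). d k x = \<zero>\<^bsub>D k\<^esub> --> x \<in> d (Suc k) ` carrier (D (Suc (Suc k))))"

definition chain_map :: "('a, 'x) ring_scheme => (nat => ('a, 'm, 'y) module_scheme) => (nat => 'm => 'm) =>
  (nat => ('a, 'n, 'z) module_scheme) => (nat => 'n => 'n) => (nat => 'm => 'n) => bool" where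
 "chain_map R C \<delta> D d u \<longleftrightarrow> (\<forall>k. u k \<in> mod_hom R (C k) (D k) \<and>
   (\<forall>x\<in>carrier (C (Suc k)). d k (u (Suc k) x) = u k (\<delta> k x)))"

text \<open>In degree 0 there are no coboundaries except zero. Only values on the carriers count, so
  cochains need not be normalized outside them.\<close>

fun coboundary :: "('a, 'x) ring_scheme => (nat => ('a, 'm, 'y) module_scheme) => (nat => 'm => 'm) =>
  ('a, 'n, 'z) module_scheme => nat => ('m => 'n) => bool" where
 "coboundary R C \<delta> N 0 z \<longleftrightarrow> (\<forall>x\<in>carrier (C 0). z x = \<zero>\<^bsub>N\<^esub>)"
| "coboundary R C \<delta> N (Suc k) z \<longleftrightarrow> (\<exists>w\<in>mod_hom R (C k) N. \<forall>x\<in>carrier (C (Suc k)). z x = w (\<delta> k x))"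

lemma mod_homD:
 assumes "f \<in> mod_hom R M N"
 shows "x \<in> carrier M ==> f x \<in> carrier N"
  and "x \<in> carrier M ==> y \<in> carrier M ==> f (x \<oplus>\<^bsub>M\<^esub> y) = f x \<oplus>\<^bsub>N\<^esub> f y"
  and "r \<in> carrier R ==> x \<in> carrier M ==> f (r \<odot>\<^bsub>M\<^esub> x) = r \<odot>\<^bsub>N\<^esub> f x"
 using assms by (auto simp: mod_hom_def)

lemma mod_hom_zero:
 assumes "module R M" "module R N" "f \<in> mod_hom R M N"
 shows "f \<zero>\<^bsub>M\<^esub> = \<zero>\<^bsub>N\<^esub>"
proof -
 interpret M: module R M by fact
 interpret N: module R N by fact
 have "f (\<zero>\<^bsub>R\<^esub> \<odot>\<^bsub>M\<^esub> \<zero>\<^bsub>M\<^esub>) = \<zero>\<^bsub>R\<^esub> \<odot>\<^bsub>N\<^esub> f \<zero>\<^bsub>M\<^esub>" using mod_homD(3)[OF assms(3)] by blast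
 then show ?thesis using mod_homD(1)[OF assms(3)] by (simp add: M.smult_r_null N.smult_l_null)
qed

lemma mod_hom_diff:
 assumes "module R M" "module R N" "f \<in> mod_hom R M N" "x \<in> carrier M" "y \<in> carrier M"
 shows "f (x \<ominus>\<^bsub>M\<^esub> y) = f x \<ominus>\<^bsub>N\<^esub> f y"
proof -
 interpret M: module R M by fact
 interpret N: module R N by fact
 note f = mod_homD[OF assms(3)]
 have "f (x \<ominus>\<^bsub>M\<^esub> y) \<oplus>\<^bsub>N\<^esub> f y = f x"
  using f(2)[of "x \<ominus>\<^bsub>M\<^esub> y" y] assms(4,5) by (simp add: a_minus_def M.a_assoc M.l_neg)
 then show ?thesis using f(1) assms(4,5) M.minus_closed
  by (metis N.add.inv_solve_right' N.minus_eq)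
qed

lemma mod_hom_add_closed:
 assumes "module R N" "f \<in> mod_hom R M N" "g \<in> mod_hom R M N"
 shows "(%x. f x \<oplus>\<^bsub>N\<^esub> g x) \<in> mod_hom R M N"
proof -
 interpret N: module R N by fact
 show ?thesis using assms(2,3) unfolding mod_hom_def
  by (auto simp: Pi_iff N.a_ac N.smult_r_distr)
qed

lemma mod_hom_diff_closed:
 assumes "module R N" "f \<in> mod_hom R M N" "g \<in> mod_hom R M N"
 shows "(%x. f x \<ominus>\<^bsub>N\<^esub> g x) \<in> mod_hom R M N"
proof -
 interpret N: module R N by fact
 show ?thesis using assms(2,3) unfolding mod_hom_def
  by (auto simp: Pi_iff N.minus_eq N.minus_add N.a_ac N.smult_r_distr N.smult_r_minus)
qed

lemma mod_hom_smult_closed: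
 assumes "module R N" "f \<in> mod_hom R M N" "c \<in> carrier R"
 shows "(%x. c \<odot>\<^bsub>N\<^esub> f x) \<in> mod_hom R M N"
proof -
 interpret N: module R N by fact
 show ?thesis using assms(2,3) unfolding mod_hom_def
  by (auto simp: Pi_iff N.smult_r_distr N.smult_assoc1[symmetric] N.m_comm)
qed

lemma mod_hom_zero_closed: "module R N ==> (%x. \<zero>\<^bsub>N\<^esub>) \<in> mod_hom R M N"
proof -
 assume "module R N"
 then interpret N: module R N .
 show ?thesis by (auto simp: mod_hom_def N.smult_r_null)
qed

section \<open>Comparison of complexes of free modules\<close>

lemma (in cring) free_lift:
 assumes D: "module R D" "module R D'" and d: "d \<in> mod_hom R D' D" and h: "h \<in> mod_hom R (FM B) D"
  and im: "\<forall>b\<in>B. h (bv b) \<in> d ` carrier D'"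
 shows "\<exists>s\<in>mod_hom R (FM B) D'. \<forall>x\<in>carrier (FM B). d (s x) = h x"
proof -
 interpret D': module R D' by fact
 have "\<forall>b\<in>B. \<exists>y\<in>carrier D'. d y = h (bv b)" using im by (metis imageE)
 then obtain y where y: "\<forall>b\<in>B. y b \<in> carrier D' \<and> d (y b) = h (bv b)" by metis
 have yB: "y \<in> B \<rightarrow> carrier D'" using y by auto
 have s: "lin_extend R D' y \<in> mod_hom R (FM B) D'" using yB by (rule D'.lin_extend_hom)
 moreover have "d (lin_extend R D' y x) = h x" if x: "x \<in> carrier (FM B)" for x
  using lin_list_vec[OF D(1) mod_hom_comp[OF s d] h _ x] D'.lin_extend_basis_vec[OF _ yB] y by auto
 ultimately show ?thesis by blast
qed

lemma cplxD:
 assumes "cplx R D d"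
 shows "module R (D k)" "d k \<in> mod_hom R (D (Suc k)) (D k)"
  "x \<in> carrier (D (Suc (Suc k))) ==> d k (d (Suc k) x) = \<zero>\<^bsub>D k\<^esub>"
 using assms by (auto simp: cplx_def)

lemma acyclic_cplxD:
 assumes "acyclic_cplx R D d"
 shows "cplx R D d"
  "x \<in> carrier (D (Suc k)) ==> d k x = \<zero>\<^bsub>D k\<^esub> ==> x \<in> d (Suc k) ` carrier (D (Suc (Suc k)))"
 using assms by (auto simp: acyclic_cplx_def)

lemma chain_mapD:
 assumes "chain_map R C \<delta> D d u"
 shows "u k \<in> mod_hom R (C k) (D k)"
  "x \<in> carrier (C (Suc k)) ==> d k (u (Suc k) x) = u k (\<delta> k x)"
 using assms by (auto simp: chain_map_def)

lemma (in cring) chain_map_lift: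
 assumes C: "cplx R (%k. FM (B k)) \<delta>" and D: "acyclic_cplx R D d"
  and g0: "g0 \<in> mod_hom R (FM (B 0)) (D 0)"
  and im: "\<forall>x\<in>carrier (FM (B 1)). g0 (\<delta> 0 x) \<in> d 0 ` carrier (D 1)"
 shows "\<exists>g. g 0 = g0 \<and> chain_map R (%k. FM (B k)) \<delta> D d g"
proof -
 let ?C = "%k. FM (B k)"
 note C' = cplxD[OF C] and D' = cplxD[OF acyclic_cplxD(1)[OF D]]
 \<comment> \<open>Besides being linear, each stage must send boundaries to boundaries; this makes
   the next stage liftable.\<close>
 let ?P = "%k g. g \<in> mod_hom R (?C k) (D k) \<and> (\<forall>x\<in>carrier (?C (Suc k)). g (\<delta> k x) \<in> d k ` carrier (D (Suc k)))"
 let ?Q = "%k g g'. \<forall>x\<in>carrier (?C (Suc k)). d k (g' x) = g (\<delta> k x)"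
 have "\<exists>f. \<forall>k. (?P k (f k) \<and> (k = 0 --> f k = g0)) \<and> ?Q k (f k) (f (Suc k))"
 proof (rule dependent_nat_choice[where P = "%k g. ?P k g \<and> (k = 0 --> g = g0)" and Q = ?Q])
  show "\<exists>g. ?P 0 g \<and> (0 = (0::nat) --> g = g0)" using g0 im by auto
  fix g k assume "?P k g \<and> (k = 0 --> g = g0)"
  then have g: "g \<in> mod_hom R (?C k) (D k)" "\<forall>x\<in>carrier (?C (Suc k)). g (\<delta> k x) \<in> d k ` carrier (D (Suc k))" by auto
  have b: "\<forall>b\<in>B (Suc k). g (\<delta> k (bv b)) \<in> d k ` carrier (D (Suc k))"
   using g(2) basis_vec_closed[of _ "B (Suc k)"] by auto
  obtain g' where g': "g' \<in> mod_hom R (?C (Suc k)) (D (Suc k))" "\<forall>x\<in>carrier (?C (Suc k)). d k (g' x) = g (\<delta> k x)"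
   using free_lift[OF D'(1,1) D'(2)[of k] mod_hom_comp[OF C'(2) g(1)] b] by (auto simp: Bex_def)
  have "g' (\<delta> (Suc k) x) \<in> d (Suc k) ` carrier (D (Suc (Suc k)))" if x: "x \<in> carrier (?C (Suc (Suc k)))" for x
  proof -
   have c: "\<delta> (Suc k) x \<in> carrier (?C (Suc k))" using mod_homD(1)[OF C'(2) x] .
   have "d k (g' (\<delta> (Suc k) x)) = g (\<delta> k (\<delta> (Suc k) x))" using g'(2) c by blast
   also have "... = \<zero>\<^bsub>D k\<^esub>" using C'(3)[OF x] mod_hom_zero[OF C'(1) D'(1) g(1)] by simp
   finally show ?thesis using acyclic_cplxD(2)[OF D mod_homD(1)[OF g'(1) c]] by blast
  qed
  then show "\<exists>g'. (?P (Suc k) g' \<and> (Suc k = 0 --> g' = g0)) \<and> ?Q k g g'" using g' by auto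
 qed
 then obtain f where f: "\<forall>k. ?P k (f k) \<and> (k = 0 --> f k = g0)" "\<forall>k. ?Q k (f k) (f (Suc k))" by blast
 then have "chain_map R ?C \<delta> D d f" unfolding chain_map_def by blast
 then show ?thesis using f(1) by blast
qed

lemma (in cring) null_homotopic:
 assumes C: "cplx R (%k. FM (B k)) \<delta>" and D: "acyclic_cplx R D d"
  and u: "chain_map R (%k. FM (B k)) \<delta> D d u"
  and im: "\<forall>x\<in>carrier (FM (B 0)). u 0 x \<in> d 0 ` carrier (D 1)"
 shows "\<exists>s. (\<forall>k. s k \<in> mod_hom R (FM (B k)) (D (Suc k))) \<and>
   (\<forall>k. \<forall>x\<in>carrier (FM (B (Suc k))). u (Suc k) x = d (Suc k) (s (Suc k) x) \<oplus>\<^bsub>D (Suc k)\<^esub> s k (\<delta> k x)) "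
proof -
 let ?C = "%k. FM (B k)"
 note C' = cplxD[OF C] and D' = cplxD[OF acyclic_cplxD(1)[OF D]] and u' = chain_mapD[OF u]
 \<comment> \<open>The second condition says that u (k+1) - s \<delta> maps into cycles, so by
   acyclicity it can be lifted to the next stage of the homotopy.\<close>
 let ?P = "%k s. s \<in> mod_hom R (?C k) (D (Suc k)) \<and> (\<forall>x\<in>carrier (?C (Suc k)). d k (s (\<delta> k x)) = u k (\<delta> k x))"
 let ?Q = "%k s s'. \<forall>x\<in>carrier (?C (Suc k)). u (Suc k) x = d (Suc k) (s' x) \<oplus>\<^bsub>D (Suc k)\<^esub> s (\<delta> k x)"
 have "\<exists>f. \<forall>k. ?P k (f k) \<and> ?Q k (f k) (f (Suc k))"
 proof (rule dependent_nat_choice[where P = ?P and Q = ?Q])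
  have b: "\<forall>b\<in>B 0. u 0 (bv b) \<in> d 0 ` carrier (D (Suc 0))"
   using im basis_vec_closed[of _ "B 0"] by auto
  obtain s where s: "s \<in> mod_hom R (?C 0) (D (Suc 0))" "\<forall>x\<in>carrier (?C 0). d 0 (s x) = u 0 x"
   using free_lift[OF D'(1,1) D'(2)[of 0] u'(1) b] by (auto simp: Bex_def)
  then show "\<exists>s. ?P 0 s" using mod_homD(1)[OF C'(2)] by blast
  fix s k assume "?P k s"
  then have s: "s \<in> mod_hom R (?C k) (D (Suc k))" "\<forall>x\<in>carrier (?C (Suc k)). d k (s (\<delta> k x)) = u k (\<delta> k x)" by auto
  interpret M: module R "D k" by (rule D'(1))
  interpret N: module R "D (Suc k)" by (rule D'(1))
  let ?h = "%x. u (Suc k) x \<ominus>\<^bsub>D (Suc k)\<^esub> s (\<delta> k x)"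
  have h: "?h \<in> mod_hom R (?C (Suc k)) (D (Suc k))"
   using mod_hom_diff_closed[OF D'(1) u'(1) mod_hom_comp[OF C'(2) s(1)]] .
  have "?h x \<in> d (Suc k) ` carrier (D (Suc (Suc k)))" if x: "x \<in> carrier (?C (Suc k))" for x
  proof -
   have "d k (?h x) = d k (u (Suc k) x) \<ominus>\<^bsub>D k\<^esub> d k (s (\<delta> k x))"
    using mod_hom_diff[OF D'(1) D'(1) D'(2)] mod_homD(1)[OF u'(1) x] mod_homD(1)[OF s(1)] mod_homD(1)[OF C'(2) x] by blast
   also have "... = \<zero>\<^bsub>D k\<^esub>" using u'(2)[OF x] s(2) x mod_homD(1)[OF u'(1)] mod_homD(1)[OF C'(2) x]
    by (simp add: M.minus_eq M.r_neg)
   finally show ?thesis using acyclic_cplxD(2)[OF D mod_homD(1)[OF h x]] by blast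
  qed
  then have b: "\<forall>b\<in>B (Suc k). ?h (bv b) \<in> d (Suc k) ` carrier (D (Suc (Suc k)))"
   using basis_vec_closed[of _ "B (Suc k)"] by auto
  obtain s' where s': "s' \<in> mod_hom R (?C (Suc k)) (D (Suc (Suc k)))"
   "\<forall>x\<in>carrier (?C (Suc k)). d (Suc k) (s' x) = ?h x"
   using free_lift[OF D'(1,1) D'(2)[of "Suc k"] h b] by (auto simp: Bex_def)
  have Q: "?Q k s s'"
   using s'(2) mod_homD(1)[OF u'(1)] mod_homD(1)[OF s(1)] mod_homD(1)[OF C'(2)]
   by (simp add: N.minus_eq N.a_assoc N.l_neg)
  moreover have "d (Suc k) (s' (\<delta> (Suc k) x)) = u (Suc k) (\<delta> (Suc k) x)" if x: "x \<in> carrier (?C (Suc (Suc k)))" for x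
  proof -
   have c: "\<delta> (Suc k) x \<in> carrier (?C (Suc k))" using mod_homD(1)[OF C'(2) x] .
   have "s (\<delta> k (\<delta> (Suc k) x)) = \<zero>\<^bsub>D (Suc k)\<^esub>" using C'(3)[OF x] mod_hom_zero[OF C'(1) D'(1) s(1)] by simp
   then show ?thesis using s'(2) c mod_homD(1)[OF u'(1) c] by (simp add: N.minus_eq N.minus_equality[of "\<zero>\<^bsub>D (Suc k)\<^esub>" "\<zero>\<^bsub>D (Suc k)\<^esub>"])
  qed
  ultimately show "\<exists>s'. ?P (Suc k) s' \<and> ?Q k s s'" using s' by blast
 qed
 then show ?thesis by blast
qed

lemma (in cring) coboundary_null:
 assumes C: "cplx R (%k. FM (B k)) \<delta>" and D: "acyclic_cplx R D d"
  and u: "chain_map R (%k. FM (B k)) \<delta> D d u"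
  and im: "\<forall>x\<in>carrier (FM (B 0)). u 0 x \<in> d 0 ` carrier (D 1)"
  and N: "module R N" and z: "z \<in> mod_hom R (D k) N" and cyc: "\<forall>x\<in>carrier (D (Suc k)). z (d k x) = \<zero>\<^bsub>N\<^esub>"
 shows "coboundary R (%k. FM (B k)) \<delta> N k (%x. z (u k x))"
proof (cases k)
 case 0
 then show ?thesis using im cyc by (auto elim!: ballE) 
next
 case (Suc j)
 interpret N: module R N by fact
 note C' = cplxD[OF C] and D' = cplxD[OF acyclic_cplxD(1)[OF D]]
 obtain s where s: "\<forall>k. s k \<in> mod_hom R (FM (B k)) (D (Suc k))"
  "\<forall>k. \<forall>x\<in>carrier (FM (B (Suc k))). u (Suc k) x = d (Suc k) (s (Suc k) x) \<oplus>\<^bsub>D (Suc k)\<^esub> s k (\<delta> k x)"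
  using null_homotopic[OF C D u im] by blast
 have "z (u k x) = z (s j (\<delta> j x))" if x: "x \<in> carrier (FM (B (Suc j)))" for x
 proof -
  have a: "s (Suc j) x \<in> carrier (D (Suc k))" using mod_homD(1)[OF s(1)[rule_format] x] Suc by simp
  have b: "s j (\<delta> j x) \<in> carrier (D k)" using mod_homD(1)[OF s(1)[rule_format] mod_homD(1)[OF C'(2) x]] Suc by simp
  have "z (u k x) = z (d k (s (Suc j) x) \<oplus>\<^bsub>D k\<^esub> s j (\<delta> j x))" using s(2) x Suc by simp
  also have "... = z (d k (s (Suc j) x)) \<oplus>\<^bsub>N\<^esub> z (s j (\<delta> j x))"
   using mod_homD(2)[OF z mod_homD(1)[OF D'(2) a] b] .
  finally show ?thesis using cyc a mod_homD(1)[OF z b] by simp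
 qed
 moreover have "(%x. z (s j x)) \<in> mod_hom R (FM (B j)) N"
  using mod_hom_comp[OF s(1)[rule_format] z[unfolded Suc]] .
 ultimately show ?thesis unfolding Suc by auto
qed

lemma coboundary_cong:
 "coboundary R C \<delta> N k z ==> (\<forall>x\<in>carrier (C k). z x = z' x) ==> coboundary R C \<delta> N k z'"
 by (cases k) auto

lemma coboundary_zero: "module R N ==> coboundary R C \<delta> N k (%x. \<zero>\<^bsub>N\<^esub>)"
 using mod_hom_zero_closed by (cases k) (auto intro!: bexI[of _ "%x. \<zero>\<^bsub>N\<^esub>"])

lemma coboundary_add:
 assumes "module R N" "coboundary R C \<delta> N k z" "coboundary R C \<delta> N k z'" "cplx R C \<delta>"
 shows "coboundary R C \<delta> N k (%x. z x \<oplus>\<^bsub>N\<^esub> z' x)"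
proof -
 interpret N: module R N by fact
 show ?thesis
 proof (cases k)
  case (Suc j)
  then obtain w w' where "w \<in> mod_hom R (C j) N" "\<forall>x\<in>carrier (C (Suc j)). z x = w (\<delta> j x)"
   "w' \<in> mod_hom R (C j) N" "\<forall>x\<in>carrier (C (Suc j)). z' x = w' (\<delta> j x)" using assms by auto
  then show ?thesis unfolding Suc using mod_hom_add_closed[OF assms(1), of w "C j" w']
   by (auto intro!: bexI[of _ "%x. w x \<oplus>\<^bsub>N\<^esub> w' x"])
 qed (use assms in simp)
qed

lemma coboundary_smult:
 assumes "module R N" "coboundary R C \<delta> N k z" "c \<in> carrier R"
 shows "coboundary R C \<delta> N k (%x. c \<odot>\<^bsub>N\<^esub> z x)"
proof -
 interpret N: module R N by fact
 show ?thesis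
 proof (cases k)
  case 0
  then show ?thesis using assms by (simp add: N.smult_r_null)
 next
  case (Suc j)
  then obtain w where "w \<in> mod_hom R (C j) N" "\<forall>x\<in>carrier (C (Suc j)). z x = w (\<delta> j x)" using assms by auto
  then show ?thesis unfolding Suc using mod_hom_smult_closed[OF assms(1) _ assms(3), of w "C j"]
   by (auto intro!: bexI[of _ "%x. c \<odot>\<^bsub>N\<^esub> w x"])
 qed
qed

lemma coboundary_pull:
 assumes "chain_map R C \<delta> D d u" "coboundary R D d N k z"
 shows "coboundary R C \<delta> N k (%x. z (u k x))"
proof (cases k)
 case 0
 then show ?thesis using assms mod_homD(1)[OF chain_mapD(1)[OF assms(1)]] by simp
next
 case (Suc j)
 then obtain w where w: "w \<in> mod_hom R (D j) N" "\<forall>x\<in>carrier (D (Suc j)). z x = w (d j x)" using assms by auto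
 have "z (u k x) = w (u j (\<delta> j x))" if "x \<in> carrier (C (Suc j))" for x
  using that w(2) mod_homD(1)[OF chain_mapD(1)[OF assms(1)] that] chain_mapD(2)[OF assms(1) that] Suc by simp
 moreover have "(%x. w (u j x)) \<in> mod_hom R (C j) N" using mod_hom_comp[OF chain_mapD(1)[OF assms(1)] w(1)] .
 ultimately show ?thesis unfolding Suc by auto
qed

lemma chain_map_comp:
 assumes "chain_map R C \<delta> D d u" "chain_map R D d E e v"
 shows "chain_map R C \<delta> E e (%k x. v k (u k x))"
 unfolding chain_map_def
 using mod_hom_comp[OF chain_mapD(1)[OF assms(1)] chain_mapD(1)[OF assms(2)]] chain_mapD(2)[OF assms(1)]
  chain_mapD(2)[OF assms(2)] mod_homD(1)[OF chain_mapD(1)[OF assms(1)]] by auto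

lemma chain_map_diff:
 assumes "cplx R C \<delta>" "cplx R D d" "chain_map R C \<delta> D d u" "chain_map R C \<delta> D d v"
 shows "chain_map R C \<delta> D d (%k x. u k x \<ominus>\<^bsub>D k\<^esub> v k x)"
 unfolding chain_map_def
proof (intro allI conjI ballI)
 fix k
 note D' = cplxD[OF assms(2)]
 show "(%x. u k x \<ominus>\<^bsub>D k\<^esub> v k x) \<in> mod_hom R (C k) (D k)"
  using mod_hom_diff_closed[OF D'(1) chain_mapD(1)[OF assms(3)] chain_mapD(1)[OF assms(4)]] .
 fix x assume x: "x \<in> carrier (C (Suc k))"
 show "d k (u (Suc k) x \<ominus>\<^bsub>D (Suc k)\<^esub> v (Suc k) x) = u k (\<delta> k x) \<ominus>\<^bsub>D k\<^esub> v k (\<delta> k x)"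
  using mod_hom_diff[OF D'(1) D'(1) D'(2) mod_homD(1)[OF chain_mapD(1)[OF assms(3)] x] mod_homD(1)[OF chain_mapD(1)[OF assms(4)] x]]
   chain_mapD(2)[OF assms(3) x] chain_mapD(2)[OF assms(4) x] by simp
qed

lemma chain_map_id: "cplx R C \<delta> ==> chain_map R C \<delta> C \<delta> (%k x. x)"
 by (auto simp: chain_map_def mod_hom_def)

text \<open>Two lifts of the same map of modules are homotopic, so they pull a cocycle back to
  cohomologous cochains. In degree 0 they need to agree only up to boundaries.\<close>

lemma (in cring) coboundary_homotopic:
 assumes C: "cplx R (%k. FM (B k)) \<delta>" and D: "acyclic_cplx R D d"
  and u: "chain_map R (%k. FM (B k)) \<delta> D d u" and v: "chain_map R (%k. FM (B k)) \<delta> D d v"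
  and im: "\<forall>x\<in>carrier (FM (B 0)). u 0 x \<ominus>\<^bsub>D 0\<^esub> v 0 x \<in> d 0 ` carrier (D 1)"
  and N: "module R N" and z: "z \<in> mod_hom R (D k) N" and cyc: "\<forall>x\<in>carrier (D (Suc k)). z (d k x) = \<zero>\<^bsub>N\<^esub>"
  and cob: "coboundary R (%k. FM (B k)) \<delta> N k (%x. z (v k x))"
 shows "coboundary R (%k. FM (B k)) \<delta> N k (%x. z (u k x))"
proof -
 interpret N: module R N by fact
 note D' = cplxD[OF acyclic_cplxD(1)[OF D]]
 have "coboundary R (%k. FM (B k)) \<delta> N k (%x. z (u k x \<ominus>\<^bsub>D k\<^esub> v k x))"
  using coboundary_null[OF C D chain_map_diff[OF C acyclic_cplxD(1)[OF D] u v] im N z cyc] .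
 from coboundary_add[OF N this cob C] show ?thesis
 proof (rule coboundary_cong, intro ballI)
  fix x assume x: "x \<in> carrier (FM (B k))"
  have c: "u k x \<in> carrier (D k)" "v k x \<in> carrier (D k)"
   using mod_homD(1)[OF chain_mapD(1)[OF u] x] mod_homD(1)[OF chain_mapD(1)[OF v] x] by auto
  show "z (u k x \<ominus>\<^bsub>D k\<^esub> v k x) \<oplus>\<^bsub>N\<^esub> z (v k x) = z (u k x)"
   unfolding mod_hom_diff[OF D'(1) N z c] using mod_homD(1)[OF z] c by (simp add: N.minus_eq N.a_assoc N.l_neg)
 qed
qed

section \<open>Finite free resolutions and their Frobenius twists\<close>

text \<open>Base change of linear forms and maps along Frobenius: the matrix entries are raised to the power \<open>q\<close>.\<close>

definition twist :: "('a, 'x) ring_scheme => nat => 'b set => (('b => 'a) => 'a) => ('b => 'a) => 'a" where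
 "twist R q B z x = dot R B (%b. z (basis_vec R b) [^]\<^bsub>R\<^esub> q) x"

definition mtwist :: "('a, 'x) ring_scheme => nat => 'b set => (('b => 'a) => 'c => 'a) => ('b => 'a) => 'c => 'a" where
 "mtwist R q B u x = (%c. twist R q B (%x. u x c) x)"

definition submod :: "('a, 'x) ring_scheme => 'b set => ('b => 'a) set => bool" where
 "submod R B S \<longleftrightarrow> S \<subseteq> carrier (free_module R B) \<and> (%_. \<zero>\<^bsub>R\<^esub>) \<in> S \<and>
   (\<forall>x\<in>S. \<forall>y\<in>S. \<forall>r\<in>carrier R. (%b. x b \<oplus>\<^bsub>R\<^esub> r \<otimes>\<^bsub>R\<^esub> y b) \<in> S)"

lemma self_simps [simp]: "carrier (self_module R) = carrier R" "add (self_module R) = add R"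
 "zero (self_module R) = zero R" "r \<odot>\<^bsub>self_module R\<^esub> x = r \<otimes>\<^bsub>R\<^esub> x"
 by (simp_all add: ring_as_module_def)

lemma free_module_simps [simp]: "\<zero>\<^bsub>free_module R B\<^esub> = (%_. \<zero>\<^bsub>R\<^esub>)"
 "x \<oplus>\<^bsub>free_module R B\<^esub> y = (%b. x b \<oplus>\<^bsub>R\<^esub> y b)" "r \<odot>\<^bsub>free_module R B\<^esub> x = (%b. r \<otimes>\<^bsub>R\<^esub> x b)"
 by (simp_all add: free_module_def)

context cring
begin

lemma self_module: "module R (SM)"
 by (rule ring_as_module_module) (auto simp: ring_hom_def)

lemma fm_iff: "finite B ==> x \<in> carrier (FM B) \<longleftrightarrow> (\<forall>b. x b \<in> CR) \<and> (\<forall>b. b \<notin> B --> x b = \<zero>)"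
proof -
 assume "finite B"
 then have "(\<forall>b. b \<notin> B --> x b = \<zero>) ==> finite {b. x b \<noteq> \<zero>}" using finite_subset[of "{b. x b \<noteq> \<zero>}" B] by blast
 then show ?thesis by (auto simp: free_module_def image_subset_iff)
qed

lemma fm_closed: "x \<in> carrier (FM B) ==> x b \<in> CR"
 by (auto simp: free_module_def)

lemma form_hom:
 assumes "finite B" "\<forall>b\<in>B. z b \<in> CR"
 shows "(%x. dot R B z x) \<in> mod_hom R (FM B) (SM)"
proof -
 have c: "x b \<in> CR" if "x \<in> carrier (FM B)" for x b using that by (rule fm_closed)
 have lin: "dot R B z (%b. x b \<oplus> r \<otimes> y b) = dot R B z x \<oplus> r \<otimes> dot R B z y"
  if x: "x \<in> carrier (FM B)" and y: "y \<in> carrier (FM B)" and r: "r \<in> CR" for x y r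
 proof -
  have "dot R B (%b. x b \<oplus> r \<otimes> y b) z = dot R B x z \<oplus> r \<otimes> dot R B y z"
   using assms c[OF x] c[OF y] r by (intro dot_lin) auto
  then show ?thesis using dot_comm[of B "%b. x b \<oplus> r \<otimes> y b" z] dot_comm[of B x z] dot_comm[of B y z] assms c[OF x] c[OF y] r by auto
 qed
 have z: "(%_. \<zero>) \<in> carrier (FM B)" using assms by (simp add: fm_iff)
 have dz: "dot R B z (%_. \<zero>) = \<zero>" using dot_comm[of B "%_. \<zero>" z] dot_zero[of B "%_. \<zero>" z] assms by auto
 have "dot R B z (%b. x b \<oplus> y b) = dot R B z x \<oplus> dot R B z y"
  if "x \<in> carrier (FM B)" "y \<in> carrier (FM B)" for x y
  using lin[OF that one_closed] c[OF that(1)] c[OF that(2)] assms by (simp add: dot_closed)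
 moreover have "dot R B z (%b. r \<otimes> y b) = r \<otimes> dot R B z y"
  if "y \<in> carrier (FM B)" "r \<in> CR" for y r
  using lin[OF z that] c[OF that(1)] that assms by (simp add: dz dot_closed)
 moreover have "dot R B z x \<in> CR" if "x \<in> carrier (FM B)" for x
  using assms c[OF that] by (intro dot_closed) auto
 ultimately show ?thesis by (auto simp: mod_hom_def)
qed

lemma dot_basis:
 assumes "finite B" "b \<in> B" "\<forall>b\<in>B. z b \<in> CR"
 shows "dot R B z (bv b) = z b"
proof -
 have "dot R B z (bv b) = dot R B (bv b) z"
  using assms by (intro dot_comm) (auto simp: basis_vec_def)
 also have "... = z b" unfolding basis_vec_def using assms by (intro dot_unit) auto
 finally show ?thesis .
qed

lemma form_eq:
 assumes "finite B" "z \<in> mod_hom R (FM B) (SM)" "x \<in> carrier (FM B)"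
 shows "z x = dot R B (%b. z (bv b)) x"
proof (rule lin_list_vec[OF self_module assms(2) form_hom _ assms(3)])
 have c: "\<forall>b\<in>B. z (bv b) \<in> CR"
  using mod_homD(1)[OF assms(2)] basis_vec_closed[of _ B] by auto
 show "\<forall>b\<in>B. z (bv b) \<in> CR" by (rule c)
 show "z (bv b) = dot R B (%b. z (bv b)) (bv b)" if "b \<in> B" for b
  using dot_basis[OF assms(1) that c] by simp
qed (rule assms)

lemma coord_hom:
 assumes "u \<in> mod_hom R (FM B) (FM C)"
 shows "(%x. u x c) \<in> mod_hom R (FM B) (SM)"
 using assms by (auto simp: mod_hom_def Pi_iff intro: fm_closed)

lemma into_free:
 assumes "finite C" "!!c. c \<in> C ==> (%x. u x c) \<in> mod_hom R (FM B) (SM)"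
  "!!c x. c \<notin> C ==> x \<in> carrier (FM B) ==> u x c = \<zero>"
 shows "u \<in> mod_hom R (FM B) (FM C)"
proof -
 interpret F: module R "FM B" by (rule free_module_module)
 have u: "u x c \<in> CR" if "x \<in> carrier (FM B)" for x c
  using assms(2)[of c] assms(3)[of c x] that by (cases "c \<in> C") (auto simp: mod_hom_def)
 have "u x \<in> carrier (FM C)" if "x \<in> carrier (FM B)" for x
  using fm_iff[OF assms(1), of "u x"] u[OF that] assms(3) that by blast
 moreover have "u (x \<oplus>\<^bsub>FM B\<^esub> y) = u x \<oplus>\<^bsub>FM C\<^esub> u y"
  if x: "x \<in> carrier (FM B)" and y: "y \<in> carrier (FM B)" for x y
 proof
  fix c show "u (x \<oplus>\<^bsub>FM B\<^esub> y) c = (u x \<oplus>\<^bsub>FM C\<^esub> u y) c"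
   using mod_homD(2)[OF assms(2) x y, of c] assms(3)[of c] x y F.a_closed[OF x y] by (cases "c \<in> C") auto
 qed
 moreover have "u (r \<odot>\<^bsub>FM B\<^esub> x) = r \<odot>\<^bsub>FM C\<^esub> u x"
  if x: "x \<in> carrier (FM B)" and r: "r \<in> CR" for x r
 proof
  fix c show "u (r \<odot>\<^bsub>FM B\<^esub> x) c = (r \<odot>\<^bsub>FM C\<^esub> u x) c"
   using mod_homD(3)[OF assms(2) r x, of c] assms(3)[of c] x r F.smult_closed[OF r x] by (cases "c \<in> C") auto
 qed
 ultimately show ?thesis unfolding mod_hom_def by blast
qed

lemma twist_hom:
 assumes "finite B" "z \<in> mod_hom R (FM B) (SM)"
 shows "twist R q B z \<in> mod_hom R (FM B) (SM)"
proof -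
 have "\<forall>b\<in>B. z (bv b) [^] q \<in> CR"
  using mod_homD(1)[OF assms(2)] basis_vec_closed[of _ B] by auto
 from form_hom[OF assms(1) this] show ?thesis unfolding twist_def[abs_def] .
qed

lemma twist_basis:
 assumes "finite B" "z \<in> mod_hom R (FM B) (SM)" "b \<in> B"
 shows "twist R q B z (bv b) = z (bv b) [^] q"
 unfolding twist_def
 using mod_homD(1)[OF assms(2)] basis_vec_closed[of _ B] by (intro dot_basis[OF assms(1,3)]) auto

lemma twist_cong:
 assumes "z \<in> mod_hom R (FM B) (SM)"
  "\<forall>x\<in>carrier (FM B). z x = z' x" "x \<in> carrier (FM B)"
 shows "twist R q B z x = twist R q B z' x"
 unfolding twist_def
 using assms mod_homD(1)[OF assms(1)] basis_vec_closed[of _ B] fm_closed[OF assms(3)]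
 by (intro dot_cong) auto

lemma twist_pow:
 assumes "frob R q" "finite B" "z \<in> mod_hom R (FM B) (SM)" "x \<in> carrier (FM B)"
 shows "twist R q B z (%b. x b [^] q) = z x [^] q"
 unfolding twist_def form_eq[OF assms(2,3,4)]
 using mod_homD(1)[OF assms(3)] basis_vec_closed[of _ B] fm_closed[OF assms(4)]
 by (intro dot_frob[OF assms(1,2), symmetric]) auto

lemma fm_pow:
 assumes "frob R q" "finite B" "x \<in> carrier (FM B)"
 shows "(%b. x b [^] q) \<in> carrier (FM B)"
 using assms frob_zero[OF assms(1)] by (auto simp: fm_iff)

lemma mtwist_hom:
 assumes "frob R q" "finite B" "finite C" "u \<in> mod_hom R (FM B) (FM C)"
 shows "mtwist R q B u \<in> mod_hom R (FM B) (FM C)"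
proof (rule into_free[OF assms(3)])
 show "(%x. mtwist R q B u x c) \<in> mod_hom R (FM B) (SM)" for c
  unfolding mtwist_def using twist_hom[OF assms(2) coord_hom[OF assms(4)]] .
 fix c x assume c: "c \<notin> C" and x: "x \<in> carrier (FM B)"
 show "mtwist R q B u x c = \<zero>" unfolding mtwist_def twist_def
 proof (rule dot_zero)
  fix b assume "b \<in> B"
  then have "u (bv b) \<in> carrier (FM C)" using mod_homD(1)[OF assms(4) basis_vec_closed] by blast
  then show "u (bv b) c [^] q = \<zero>" using c fm_iff[OF assms(3)] frob_zero[OF assms(1)] by auto
 qed (rule fm_closed[OF x])
qed

lemma mtwist_basis:
 assumes "finite B" "u \<in> mod_hom R (FM B) (FM C)" "b \<in> B"
 shows "mtwist R q B u (bv b) = (%c. u (bv b) c [^] q)"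
 unfolding mtwist_def using twist_basis[OF assms(1) coord_hom[OF assms(2)] assms(3)] by simp

text \<open>Functoriality of base change, checked on basis vectors: there the inner twist gives
  coordinatewise \<open>q\<close>-th powers, on which the outer one is evaluated by
  \<open>twist_pow\<close>.\<close>

lemma twist_comp:
 assumes q: "frob R q" and fin: "finite B" "finite C" and u: "u \<in> mod_hom R (FM B) (FM C)"
  and z: "z \<in> mod_hom R (FM C) (SM)" and x: "x \<in> carrier (FM B)"
 shows "twist R q C z (mtwist R q B u x) = twist R q B (%x. z (u x)) x"
proof (rule lin_list_vec[OF self_module mod_hom_comp[OF mtwist_hom[OF q fin u] twist_hom[OF fin(2) z]]
   twist_hom[OF fin(1) mod_hom_comp[OF u z]] _ x])
 fix b assume b: "b \<in> B"
 have "twist R q C z (mtwist R q B u (bv b)) = z (u (bv b)) [^] q"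
  unfolding mtwist_basis[OF fin(1) u b]
  using twist_pow[OF q fin(2) z mod_homD(1)[OF u basis_vec_closed[OF b]]] .
 then show "twist R q C z (mtwist R q B u (bv b)) = twist R q B (%x. z (u x)) (bv b)"
  using twist_basis[OF fin(1) mod_hom_comp[OF u z] b] by simp
qed

lemma mtwist_comp:
 assumes "frob R q" "finite B" "finite C" "u \<in> mod_hom R (FM B) (FM C)"
  "v \<in> mod_hom R (FM C) (FM D)" "x \<in> carrier (FM B)"
 shows "mtwist R q C v (mtwist R q B u x) = mtwist R q B (%x. v (u x)) x"
 unfolding mtwist_def[of R q C] mtwist_def[of R q B "%x. v (u x)"]
 using twist_comp[OF assms(1-4) coord_hom[OF assms(5)] assms(6)] by simp

lemma mtwist_cong:
 assumes "u \<in> mod_hom R (FM B) (FM C)"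
  "\<forall>x\<in>carrier (FM B). u x = u' x" "x \<in> carrier (FM B)"
 shows "mtwist R q B u x = mtwist R q B u' x"
 unfolding mtwist_def using twist_cong[OF coord_hom[OF assms(1)] _ assms(3)] assms(2) by auto

lemma mtwist_mtwist:
 assumes "frob R q" "finite B" "finite C" "u \<in> mod_hom R (FM B) (FM C)"
  "x \<in> carrier (FM B)"
 shows "mtwist R q B (mtwist R r B u) x = mtwist R (r * q) B u x"
proof -
 have c: "u (bv b) c \<in> CR" if "b \<in> B" for b c
  using fm_closed[OF mod_homD(1)[OF assms(4) basis_vec_closed[OF that]]] .
 show ?thesis
  unfolding mtwist_def[of R q] mtwist_def[of R "r * q"] twist_def
  using mtwist_basis[OF assms(2,4)] fm_closed[OF assms(5)] c nat_pow_pow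
  by (intro ext dot_cong) auto
qed

lemma mtwist_zero:
 assumes "frob R q" "x \<in> carrier (FM B)"
 shows "mtwist R q B (%x. (%_. \<zero>)) x = (%_. \<zero>)"
 unfolding mtwist_def twist_def using frob_zero[OF assms(1)] fm_closed[OF assms(2)] by (intro ext dot_zero) auto

lemma mtwist_id:
 assumes "frob R q" "finite B" "x \<in> carrier (FM B)"
 shows "mtwist R q B (%x. x) x = x"
proof (rule lin_list_vec[OF free_module_module[of B] mtwist_hom[OF assms(1,2,2)] _ _ assms(3)])
 show id: "(%x. x) \<in> mod_hom R (FM B) (FM B)"  "(%x. x) \<in> mod_hom R (FM B) (FM B)"
  by (auto simp: mod_hom_def)
 show "mtwist R q B (%x. x) (bv b) = bv b" if "b \<in> B" for b
  using mtwist_basis[OF assms(2) id(1) that] frob_zero[OF assms(1)] by (auto simp: basis_vec_def)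
qed

end

section \<open>Submodules of finite free modules and finite free resolutions\<close>

context noeth
begin

text \<open>The last coordinates of S form a finitely generated ideal. Lifts of its generators,
  together with generators of the part with vanishing last coordinate, suffice. Generation is
  expressed by minimality among submodules, which avoids writing linear combinations.\<close>

lemma submod_fg:
 "submod R {..<n::nat} S ==> \<exists>G. finite G \<and> G \<subseteq> S \<and> (\<forall>T. submod R {..<n} T --> G \<subseteq> T --> S \<subseteq> T)"
proof (induction n arbitrary: S)
 case 0
 then have "S \<subseteq> {%_. \<zero>}" using fm_iff[of "{..<0::nat}"] by (fastforce simp: submod_def)
 then show ?case by (intro exI[of _ "{}"]) (auto simp: submod_def)
next
 case (Suc n)
 let ?F = "FM {..<Suc n}"
 have Sc: "x b \<in> CR" if "x \<in> T" "submod R {..<Suc n} T" for x b T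
  using that by (auto simp: submod_def intro: fm_closed[of x "{..<Suc n}"])
 have diff: "(%b. x b \<ominus> y b) \<in> T" if "x \<in> T" "y \<in> T" "submod R {..<Suc n} T" for x y T
 proof -
  have "(%b. x b \<oplus> \<ominus> \<one> \<otimes> y b) \<in> T" using that by (auto simp: submod_def)
  moreover have "(%b. x b \<oplus> \<ominus> \<one> \<otimes> y b) = (%b. x b \<ominus> y b)"
   using Sc that by (auto simp: minus_eq l_minus)
  ultimately show ?thesis by simp
 qed
 have lead: "ideal {x n | x. x \<in> T} R" if T: "submod R {..<Suc n} T" for T
 proof (rule ideal_intro)
  show "{x n | x. x \<in> T} \<subseteq> CR" using Sc[OF _ T] by auto
  show "\<zero> \<in> {x n | x. x \<in> T}" using T by (force simp: submod_def)
 next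
  fix a b assume "a \<in> {x n | x. x \<in> T}" "b \<in> {x n | x. x \<in> T}"
  then obtain x y where xy: "x \<in> T" "y \<in> T" "a = x n" "b = y n" by auto
  then have "(%b. x b \<oplus> \<one> \<otimes> y b) \<in> T" using T by (auto simp: submod_def)
  then show "a \<oplus> b \<in> {x n | x. x \<in> T}" using Sc[OF xy(2) T] xy by force
 next
  fix r a assume r: "r \<in> CR" and "a \<in> {x n | x. x \<in> T}"
  then obtain x where x: "x \<in> T" "a = x n" by auto
  then have "(%b. \<zero> \<oplus> r \<otimes> x b) \<in> T" using T r by (auto simp: submod_def)
  then show "r \<otimes> a \<in> {x n | x. x \<in> T}" using Sc[OF x(1) T] x r by force
 qed
 have sub0: "submod R {..<n} {x \<in> T. x n = \<zero>}" if T: "submod R {..<Suc n} T" for T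
  unfolding submod_def
 proof (intro conjI ballI subsetI)
  fix x assume x: "x \<in> {x \<in> T. x n = \<zero>}"
  then have "x \<in> carrier ?F" "x n = \<zero>" using T by (auto simp: submod_def)
  then show "x \<in> carrier (FM {..<n})" by (auto simp: fm_iff less_Suc_eq)
  fix y r assume y: "y \<in> {x \<in> T. x n = \<zero>}" and r: "r \<in> CR"
  then have "(%b. x b \<oplus> r \<otimes> y b) \<in> T" using T x by (simp add: submod_def)
  then show "(%b. x b \<oplus> r \<otimes> y b) \<in> {x \<in> T. x n = \<zero>}" using x y r by simp
 qed (use T in \<open>auto simp: submod_def\<close>)
 define S0 where "S0 = {x \<in> S. x n = \<zero>}"
 have "submod R {..<n} S0"
  unfolding S0_def by (rule sub0[OF Suc.prems])
 then obtain G0 where G0: "finite G0" "G0 \<subseteq> S0" "\<forall>T. submod R {..<n} T --> G0 \<subseteq> T --> S0 \<subseteq> T"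
  using Suc.IH[of S0] by (auto simp only:)
 obtain A where A: "finite A" "A \<subseteq> CR" "{x n | x. x \<in> S} = Idl A"
  using finetely_gen[OF lead[OF Suc.prems]] by auto
 have "A \<subseteq> {x n | x. x \<in> S}" unfolding A(3) using genideal_self[OF A(2)] .
 then have "\<forall>a\<in>A. \<exists>x\<in>S. x n = a" by (fastforce simp: subset_iff)
 then obtain f where f: "\<forall>a\<in>A. f a \<in> S \<and> f a n = a" by metis
 show ?case
 proof (intro exI[of _ "G0 \<union> f ` A"] conjI allI impI subsetI)
  show "finite (G0 \<union> f ` A)" using G0 A by auto
  show "x \<in> S" if "x \<in> G0 \<union> f ` A" for x using that G0 f by (auto simp: S0_def)
  fix T x assume T: "submod R {..<Suc n} T" and G: "G0 \<union> f ` A \<subseteq> T" and x: "x \<in> S"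
  have ST: "submod R {..<Suc n} (S \<inter> T)" using T Suc.prems by (auto simp: submod_def)
  have "f a \<in> S \<inter> T" if "a \<in> A" for a using f G that by auto
  then have "A \<subseteq> {x n | x. x \<in> S \<inter> T}" 
  proof (intro subsetI)
   fix a assume "a \<in> A"
   then have "f a \<in> S \<inter> T" "f a n = a" using f G by auto
   then show "a \<in> {x n | x. x \<in> S \<inter> T}" by (intro CollectI exI[of _ "f a"]) simp
  qed
  then have "{x n | x. x \<in> S} \<subseteq> {x n | x. x \<in> S \<inter> T}" unfolding A(3) by (rule genideal_minimal[OF lead[OF ST]])
  then obtain y where y: "y \<in> S" "y \<in> T" "y n = x n" using x by force
  have "(%b. x b \<ominus> y b) \<in> S0" using diff[OF x y(1) Suc.prems] Sc[OF y(1) Suc.prems, of n] y(3)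
   by (simp add: S0_def minus_eq r_neg)
  moreover have "submod R {..<n} {x \<in> T. x n = \<zero>}"
   using sub0[OF T] by simp
  moreover have "G0 \<subseteq> {x \<in> T. x n = \<zero>}" using G G0 by (auto simp: S0_def)
  ultimately have d: "(%b. x b \<ominus> y b) \<in> T" using G0(3) by blast
  have "(%b. y b \<oplus> \<one> \<otimes> (x b \<ominus> y b)) \<in> T" using d y T by (auto simp: submod_def)
  moreover have "(%b. y b \<oplus> \<one> \<otimes> (x b \<ominus> y b)) = x"
  proof
   fix b
   have "x b \<in> CR" "y b \<in> CR" using Sc x y(1) Suc.prems by auto
   then show "y b \<oplus> \<one> \<otimes> (x b \<ominus> y b) = x b" by (simp add: minus_eq a_ac r_neg1 r_neg)
  qed
  ultimately show "x \<in> T" by simp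
 qed
qed

lemma submod_chain:
 assumes K: "!!e. submod R {..<n::nat} (K e)" and mono: "!!e. K e \<subseteq> K (Suc e)"
 shows "\<exists>e::nat. K (Suc e) = K e"
proof -
 have m: "K e \<subseteq> K f" if "e \<le> f" for e f using lift_Suc_mono_le[of K, OF mono that] .
 have "submod R {..<n} (\<Union>e. K e)"
  unfolding submod_def
 proof (intro conjI ballI)
  fix x y r assume "x \<in> (\<Union>e. K e)" "y \<in> (\<Union>e. K e)" and r: "r \<in> CR"
  then obtain e f where "x \<in> K e" "y \<in> K f" by auto
  then have "x \<in> K (max e f)" "y \<in> K (max e f)" using m[of e "max e f"] m[of f "max e f"] by auto
  then show "(%b. x b \<oplus> r \<otimes> y b) \<in> (\<Union>e. K e)" using K[of "max e f"] r unfolding submod_def by blast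
 next
  show "(\<Union>e. K e) \<subseteq> carrier (FM {..<n})" using K unfolding submod_def by blast
  show "(%_. \<zero>) \<in> (\<Union>e. K e)" using K[of 0] unfolding submod_def by blast
 qed
 then obtain G where G: "finite G" "G \<subseteq> (\<Union>e. K e)" "\<forall>T. submod R {..<n} T --> G \<subseteq> T --> (\<Union>e. K e) \<subseteq> T"
  using submod_fg by meson
 have "\<forall>g\<in>G. \<exists>e. g \<in> K e" using G(2) by auto
 then obtain e where e: "\<forall>g\<in>G. g \<in> K (e g)" by metis
 define N where "N = Max (insert 0 (e ` G))"
 have "e g \<le> N" if "g \<in> G" for g unfolding N_def using that G(1) by (intro Max_ge) auto
 then have "G \<subseteq> K N" using e m by blast
 then have "(\<Union>e. K e) \<subseteq> K N" using G(3) K by blast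
 then show ?thesis using mono[of N] by blast
qed

lemma submod_image:
 assumes S: "submod R {..<n::nat} S"
 shows "\<exists>(m::nat) d. d \<in> mod_hom R (FM {..<m}) (FM {..<n}) \<and> d ` carrier (FM {..<m}) = S"
proof -
 obtain G where G: "finite G" "G \<subseteq> S" "\<forall>T. submod R {..<n} T --> G \<subseteq> T --> S \<subseteq> T" using submod_fg[OF S] by blast
 obtain gs where gs: "set gs = G" using finite_list[OF G(1)] by blast
 let ?m = "length gs" and ?F = "FM {..<n}"
 let ?M = "FM {..<?m}"
 interpret F: module R ?F by (rule free_module_module)
 interpret M: module R ?M by (rule free_module_module)
 let ?d = "lin_extend R ?F (%j. gs ! j)"
 have g: "(%j. gs ! j) \<in> {..<?m} \<rightarrow> carrier ?F" using G(2) gs S nth_mem by (fastforce simp: submod_def)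
 have d: "?d \<in> mod_hom R ?M ?F" using F.lin_extend_hom[OF g] .
 have "?d x \<in> S" if x: "x \<in> carrier ?M" for x
 proof -
  have "(\<Oplus>\<^bsub>?F\<^esub>b\<in>A. x b \<odot>\<^bsub>?F\<^esub> gs ! b) \<in> S" if "finite A" "A \<subseteq> {..<?m}" for A
   using that
  proof (induction A rule: finite_induct)
   case empty
   then show ?case using S F.finsum_empty by (simp add: submod_def)
  next
   case (insert a A)
   have ga: "gs ! a \<in> S" using insert G(2) gs nth_mem by auto
   have xa: "x b \<in> CR" for b using fm_closed[OF x] .
   have fc: "(%b. x b \<odot>\<^bsub>?F\<^esub> gs ! b) \<in> insert a A \<rightarrow> carrier ?F"
    using insert.prems g xa by (intro funcsetI F.smult_closed) auto
   have "(\<Oplus>\<^bsub>?F\<^esub>b\<in>insert a A. x b \<odot>\<^bsub>?F\<^esub> gs ! b) = x a \<odot>\<^bsub>?F\<^esub> gs ! a \<oplus>\<^bsub>?F\<^esub> (\<Oplus>\<^bsub>?F\<^esub>b\<in>A. x b \<odot>\<^bsub>?F\<^esub> gs ! b)"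
    using insert fc by (intro F.finsum_insert) auto
   also have "... = (\<Oplus>\<^bsub>?F\<^esub>b\<in>A. x b \<odot>\<^bsub>?F\<^esub> gs ! b) \<oplus>\<^bsub>?F\<^esub> x a \<odot>\<^bsub>?F\<^esub> gs ! a"
    using fc by (intro F.a_comm F.finsum_closed) auto
   also have "... \<in> S" using S insert ga xa unfolding submod_def by simp
   finally show ?case .
  qed
  moreover have "finite {b. x b \<noteq> \<zero>}" "{b. x b \<noteq> \<zero>} \<subseteq> {..<?m}" using x by (auto simp: free_module_def)
  ultimately show ?thesis unfolding lin_extend_def by blast
 qed
 moreover have "S \<subseteq> ?d ` carrier ?M"
 proof -
  have "submod R {..<n} (?d ` carrier ?M)" unfolding submod_def
  proof (intro conjI ballI)
   show "?d ` carrier ?M \<subseteq> carrier ?F" using mod_homD(1)[OF d] by blast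
   show "(%_. \<zero>) \<in> ?d ` carrier ?M"
    using mod_hom_zero[OF M.module_axioms F.module_axioms d] M.zero_closed by (intro image_eqI) auto
   fix x y r assume "x \<in> ?d ` carrier ?M" "y \<in> ?d ` carrier ?M" and r: "r \<in> CR"
   then obtain v w where vw: "v \<in> carrier ?M" "w \<in> carrier ?M" "x = ?d v" "y = ?d w" by blast
   have "?d (v \<oplus>\<^bsub>?M\<^esub> r \<odot>\<^bsub>?M\<^esub> w) = (%b. x b \<oplus> r \<otimes> y b)"
    using mod_homD(2)[OF d vw(1) M.smult_closed[OF r vw(2)]] mod_homD(3)[OF d r vw(2)] vw(3,4) by simp
   moreover have "v \<oplus>\<^bsub>?M\<^esub> r \<odot>\<^bsub>?M\<^esub> w \<in> carrier ?M"
    by (rule M.a_closed[OF vw(1) M.smult_closed[OF r vw(2)]])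
   ultimately show "(%b. x b \<oplus> r \<otimes> y b) \<in> ?d ` carrier ?M" by (rule image_eqI[OF sym])
  qed
  moreover have "G \<subseteq> ?d ` carrier ?M"
  proof
   fix h assume "h \<in> G"
   then obtain j where j: "j < ?m" "h = gs ! j" using gs by (metis in_set_conv_nth)
   then have "?d (bv j) = h" using F.lin_extend_basis_vec[OF _ g] by simp
   then show "h \<in> ?d ` carrier ?M" using basis_vec_closed[of j "{..<?m}"] j by (metis imageI lessThan_iff)
  qed
  ultimately show ?thesis using G(3) by blast
 qed
 ultimately show ?thesis using d by blast
qed

lemma ex_resolution:
 assumes I: "ideal I R"
 shows "\<exists>n d. n 0 = (1::nat) \<and> acyclic_cplx R (%k. FM {..<n k}) d \<and>
  d 0 ` carrier (FM {..<n 1}) = {x \<in> carrier (FM {..<n 0}). x 0 \<in> I}"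
proof -
 let ?F = "%n::nat. FM {..<n}"
 \<comment> \<open>The state consists of the target rank, the source rank and the map; each new map
   covers the kernel of the previous one.\<close>
 let ?P = "%k (n, m, d). d \<in> mod_hom R (?F m) (?F n) \<and>
  (k = (0::nat) --> n = 1 \<and> d ` carrier (?F m) = {x \<in> carrier (?F n). x 0 \<in> I})"
 let ?Q = "%k (n, m, d) (n', m', d'). n' = m \<and> d' ` carrier (?F m') = {x \<in> carrier (?F m). d x = (%_. \<zero>)}"
 have "\<exists>f. \<forall>k. ?P k (f k) \<and> ?Q k (f k) (f (Suc k))"
 proof (rule dependent_nat_choice[where P = ?P and Q = ?Q])
  have "submod R {..<1} {x \<in> carrier (?F 1). x 0 \<in> I}"
   using idealD(2,3)[OF I] I by (auto simp: submod_def fm_iff intro: ideal.I_l_closed)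
  then show "\<exists>s. ?P 0 s" using submod_image[of 1] by auto
  fix s k assume "?P k s"
  then obtain n m d where s: "s = (n, m, d)" "d \<in> mod_hom R (?F m) (?F n)" by (cases s) auto
  interpret M: module R "?F m" by (rule free_module_module)
  let ?K = "{x \<in> carrier (?F m). d x = (%_. \<zero>)}"
  have "submod R {..<m} ?K"
   unfolding submod_def
  proof (intro conjI ballI)
   show "(%_. \<zero>) \<in> ?K"
    using mod_hom_zero[OF free_module_module free_module_module s(2)] M.zero_closed by simp
   fix x y r assume "x \<in> ?K" "y \<in> ?K" and r: "r \<in> CR"
   then have xy: "x \<in> carrier (?F m)" "d x = (%_. \<zero>)" "y \<in> carrier (?F m)" "d y = (%_. \<zero>)" by auto
   have "d (x \<oplus>\<^bsub>?F m\<^esub> r \<odot>\<^bsub>?F m\<^esub> y) = (%_. \<zero>)"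
    using mod_homD(2)[OF s(2) xy(1) M.smult_closed[OF r xy(3)]] mod_homD(3)[OF s(2) r xy(3)] xy r by simp
   moreover have "x \<oplus>\<^bsub>?F m\<^esub> r \<odot>\<^bsub>?F m\<^esub> y \<in> carrier (?F m)"
    by (rule M.a_closed[OF xy(1) M.smult_closed[OF r xy(3)]])
   ultimately show "(%b. x b \<oplus> r \<otimes> y b) \<in> ?K" by simp
  qed auto
  then show "\<exists>s'. ?P (Suc k) s' \<and> ?Q k s s'" using submod_image[of m] s by fastforce
 qed
 then obtain f where f: "!!k. ?P k (f k) \<and> ?Q k (f k) (f (Suc k))" by blast
 define n where "n k = fst (f k)" for k
 define d where "d k = snd (snd (f k))" for k
 have fe: "f k = (n k, n (Suc k), d k)" for k
  using f[of k] by (cases "f k"; cases "f (Suc k)") (auto simp: n_def d_def)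
 have d: "d k \<in> mod_hom R (?F (n (Suc k))) (?F (n k))" for k using f[of k] by (simp add: fe)
 have im: "d (Suc k) ` carrier (?F (n (Suc (Suc k)))) = {x \<in> carrier (?F (n (Suc k))). d k x = (%_. \<zero>)}" for k
  using f[of k] by (simp add: fe)
 have "acyclic_cplx R (%k. ?F (n k)) d"
  unfolding acyclic_cplx_def cplx_def using d im free_module_module by auto
 moreover have "n 0 = 1" "d 0 ` carrier (?F (n 1)) = {x \<in> carrier (?F (n 0)). x 0 \<in> I}"
  using f[of 0] by (simp_all add: fe)
 ultimately show ?thesis by blast
qed

end

fun fm_pred :: "(nat => nat) => nat => nat" where
 "fm_pred n 0 = 0"
| "fm_pred n (Suc k) = n k"

text \<open>The setting of the cohomological argument: flatness for all powers of p, Fedder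
  multipliers at all maximal ideals, and a finite free resolution of R/I. Purity has left no trace
  other than \<open>fed\<close>.\<close>

locale frob_res = noeth R for R (structure) +
 fixes p :: nat and I :: "'a set" and n :: "nat => nat" and d :: "nat => (nat => 'a) => nat => 'a"
 assumes flat_pow: "!!e. frob_flat R (p ^ e)" and I: "ideal I R"
  and fed: "!!m e. maximalideal m R ==> \<exists>c\<in>CR. c \<notin> FP m (p ^ e) \<and>
   (\<forall>a\<in>I. c \<otimes> a \<in> FP I (p ^ e))"
  and n0: "n 0 = 1" and res: "acyclic_cplx R (%k. FM {..<n k}) d"
  and im0: "d 0 ` carrier (FM {..<n 1}) = {x \<in> carrier (FM {..<n 0}). x 0 \<in> I}"
begin

abbreviation "P k \<equiv> free_module R {..<n k}"
abbreviation "S \<equiv> self_module R"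

text \<open>The differential of the e-th Frobenius twist F^e(P). The modules \<open>P k\<close> stay
  the same, since base change of a free module keeps its basis.\<close>

definition "D e k = mtwist R (p ^ e) {..<n (Suc k)} (d k)"

abbreviation "cob e \<equiv> coboundary R P (D e) S"

abbreviation "chn e f \<equiv> chain_map R P (D e) P (D f)"

lemma frq: "frob R (p ^ e)"
 using flat_pow[of e] by (rule frob_flat.frq)

lemma ppos: "p > 0"
 using frq[of 1] by (simp add: frob_def)

lemma d_hom: "d k \<in> mod_hom R (P (Suc k)) (P k)"
 using cplxD(2)[OF acyclic_cplxD(1)[OF res]] .

lemma D_hom: "D e k \<in> mod_hom R (P (Suc k)) (P k)"
 unfolding D_def using mtwist_hom[OF frq _ _ d_hom] by simp

lemma D_basis: "j < n (Suc k) ==> D e k (bv j) = (%c. d k (bv j) c [^] p ^ e)"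
 unfolding D_def using mtwist_basis[OF _ d_hom] by simp

lemma D_twist: "x \<in> carrier (P (Suc k)) ==> mtwist R (p ^ e) {..<n (Suc k)} (D a k) x = D (a + e) k x"
 unfolding D_def power_add using mtwist_mtwist[OF frq _ _ d_hom] by simp

lemma D_cplx: "cplx R P (D e)"
 unfolding cplx_def
proof (intro allI conjI ballI)
 fix k x assume x: "x \<in> carrier (P (Suc (Suc k)))"
 have "D e k (D e (Suc k) x) = mtwist R (p ^ e) {..<n (Suc (Suc k))} (%x. d k (d (Suc k) x)) x"
  unfolding D_def using mtwist_comp[OF frq _ _ d_hom d_hom x] by simp
 also have "... = mtwist R (p ^ e) {..<n (Suc (Suc k))} (%x. (%_. \<zero>)) x"
  using cplxD(3)[OF acyclic_cplxD(1)[OF res], of _ k] by (intro mtwist_cong[OF mod_hom_comp[OF d_hom d_hom] _ x]) simp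
 also have "... = \<zero>\<^bsub>P k\<^esub>" using mtwist_zero[OF frq x] by simp
 finally show "D e k (D e (Suc k) x) = \<zero>\<^bsub>P k\<^esub>" .
qed (rule free_module_module D_hom)+

text \<open>\<open>lspan\<close> ignores coordinates outside the index set, whereas members of a
  free module vanish there; truncation reconciles the two.\<close>

definition "rstr m x = (%i::nat. if i < m then x i else \<zero>)"

lemma rstr_closed: "\<forall>i<m. x i \<in> CR ==> rstr m x \<in> carrier (FM {..<m})"
 by (simp add: fm_iff rstr_def)

lemma rstr_id: "x \<in> carrier (FM {..<m}) ==> rstr m x = x"
 by (auto simp: fm_iff rstr_def)

text \<open>By \<open>flat_system\<close> a cycle of the twisted complex is a combination of
  \<open>q\<close>-th powers of cycles y of the original one; and y = d u gives y^q = D e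
  (u^q).\<close>

lemma D_acyclic: "acyclic_cplx R P (D e)"
 unfolding acyclic_cplx_def
proof (intro conjI allI ballI impI)
 fix k x assume x: "x \<in> carrier (P (Suc k))" and z: "D e k x = \<zero>\<^bsub>P k\<^esub>"
 interpret q: frob_flat R "p ^ e" by (rule flat_pow)
 interpret P: module R "P (Suc (Suc k))" by (rule free_module_module)
 let ?I = "{..<n (Suc k)}" and ?J = "{..<n k}" and ?A = "%b c. d k (bv b) c"
 have Ac: "?A b c \<in> CR" if "b \<in> ?I" for b c
  using fm_closed[OF mod_homD(1)[OF d_hom basis_vec_closed[OF that]]] .
 have xc: "x b \<in> CR" for b using fm_closed[OF x] .
 have "dot R ?I x (%b. ?A b c [^] p ^ e) = \<zero>" for c
  using fun_cong[OF z, of c] dot_comm[of ?I x "%b. ?A b c [^] p ^ e"] Ac xc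
  by (auto simp: D_def mtwist_def twist_def)
 then have "x \<in> lspan R ?I (q.fker ?I ?J ?A)" using Ac xc by (intro q.flat_system) auto
 then have "rstr (n (Suc k)) x \<in> D e (Suc k) ` carrier (P (Suc (Suc k)))"
 proof (induction rule: lspan.induct)
  case (zero x)
  then have "rstr (n (Suc k)) x = \<zero>\<^bsub>P (Suc k)\<^esub>" by (auto simp: rstr_def)
  then show ?case using mod_hom_zero[OF free_module_module free_module_module D_hom[of e "Suc k"]] P.zero_closed
   by (metis image_eqI)
 next
  case (step w g s x)
  obtain v where v: "v \<in> carrier (P (Suc (Suc k)))" "rstr (n (Suc k)) w = D e (Suc k) v" using step(5) by blast
  obtain y where y: "g = (%i. y i [^] p ^ e)" "\<forall>i. y i \<in> CR" "\<forall>c\<in>?J. dot R ?I y (%b. ?A b c) = \<zero>"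
   using step(2) by (auto simp: q.fker_def)
  let ?y = "rstr (n (Suc k)) y"
  have yP: "?y \<in> carrier (P (Suc k))" using y by (intro rstr_closed) auto
  have "d k ?y c = \<zero>" for c
  proof (cases "c < n k")
   case True
   have "d k ?y c = dot R ?I (%b. ?A b c) ?y" using form_eq[OF _ coord_hom[OF d_hom] yP] by simp
   also have "... = dot R ?I ?y (%b. ?A b c)" using Ac fm_closed[OF yP] by (intro dot_comm) auto
   also have "... = dot R ?I y (%b. ?A b c)" using y Ac by (intro dot_cong) (auto simp: rstr_def)
   finally show ?thesis using y(3) True by simp
  next
   case False
   then show ?thesis using mod_homD(1)[OF d_hom yP] by (simp add: fm_iff)
  qed
  then have "d k ?y = \<zero>\<^bsub>P k\<^esub>" by auto
  then obtain u where u: "u \<in> carrier (P (Suc (Suc k)))" "?y = d (Suc k) u"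
   using acyclic_cplxD(2)[OF res yP] by blast
  have uq: "(%b. u b [^] p ^ e) \<in> carrier (P (Suc (Suc k)))" using fm_pow[OF frq _ u(1)] by simp
  have "D e (Suc k) (%b. u b [^] p ^ e) = (%c. ?y c [^] p ^ e)"
   unfolding u(2) D_def mtwist_def using twist_pow[OF frq _ coord_hom[OF d_hom] u(1)] by simp
  moreover have "(%c. ?y c [^] p ^ e) = rstr (n (Suc k)) g" using frob_zero[OF frq] by (auto simp: rstr_def y(1))
  ultimately have gD: "D e (Suc k) (%b. u b [^] p ^ e) = rstr (n (Suc k)) g" by simp
  let ?t = "v \<oplus>\<^bsub>P (Suc (Suc k))\<^esub> s \<odot>\<^bsub>P (Suc (Suc k))\<^esub> (%b. u b [^] p ^ e)"
  have "D e (Suc k) ?t = D e (Suc k) v \<oplus>\<^bsub>P (Suc k)\<^esub> s \<odot>\<^bsub>P (Suc k)\<^esub> D e (Suc k) (%b. u b [^] p ^ e)"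
   using mod_homD(2)[OF D_hom v(1) P.smult_closed[OF step(3) uq]] mod_homD(3)[OF D_hom step(3) uq] by simp
  also have "... = rstr (n (Suc k)) x"
   unfolding gD v(2)[symmetric] using step(3,4) by (auto simp: rstr_def)
  finally have "rstr (n (Suc k)) x = D e (Suc k) ?t" by simp
  moreover have "?t \<in> carrier (P (Suc (Suc k)))" by (rule P.a_closed[OF v(1) P.smult_closed[OF step(3) uq]])
  ultimately show ?case by (rule image_eqI)
 qed
 then show "x \<in> D e (Suc k) ` carrier (P (Suc (Suc k)))" by (simp add: rstr_id[OF x])
qed (rule D_cplx)

lemma linear_image:
 assumes a: "\<forall>b<m. a b \<in> CR"
 shows "(%x. dot R {..<m} a x) ` carrier (FM {..<m}) = Idl (a ` {..<m::nat})"
proof (intro equalityI subsetI)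
 fix c assume "c \<in> (%x. dot R {..<m} a x) ` carrier (FM {..<m})"
 then obtain x where x: "x \<in> carrier (FM {..<m})" "c = dot R {..<m} a x" by blast
 have "c = dot R {..<m} x a" unfolding x(2) using a fm_closed[OF x(1)] by (intro dot_comm) auto
 then have "\<exists>z. (\<forall>b\<in>{..<m}. z b \<in> CR) \<and> c = dot R {..<m} z a" using fm_closed[OF x(1)] by (intro exI[of _ x]) auto
 then show "c \<in> Idl (a ` {..<m})" using Idl_insert_dot[of "{..<m}" a c] a by auto
next
 fix c assume "c \<in> Idl (a ` {..<m})"
 then obtain z where z: "\<forall>b<m. z b \<in> CR" "c = dot R {..<m} z a"
  using Idl_insert_dot[of "{..<m}" a c] a by auto
 have "c = dot R {..<m} (rstr m z) a" unfolding z(2) using z a by (intro dot_cong) (auto simp: rstr_def)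
 also have "... = dot R {..<m} a (rstr m z)" using z a by (intro dot_comm) (auto simp: rstr_def)
 finally show "c \<in> (%x. dot R {..<m} a x) ` carrier (FM {..<m})" using rstr_closed[OF z(1)] by blast
qed

text \<open>With \<open>D_acyclic\<close> this says that F^e(P) resolves R/I^[q]. The entries of the
  row \<open>d 0\<close> generate I, and the entries of the twisted row are their
  \<open>q\<close>-th powers; the auxiliary fact \<open>im\<close> serves both rows.\<close>

lemma im_D0: "D e 0 ` carrier (P 1) = {x \<in> carrier (P 0). x 0 \<in> FP I (p ^ e)}"
proof -
 let ?a = "%b. d 0 (bv b) 0"
 have ac: "\<forall>b<n 1. ?a b \<in> CR"
  using fm_closed[OF mod_homD(1)[OF d_hom[of 0] basis_vec_closed]] by simp
 have P0: "x = y" if "x \<in> carrier (P 0)" "y \<in> carrier (P 0)" "x 0 = y 0" for x y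
 proof
  fix i show "x i = y i" using that by (cases "i = 0") (auto simp: fm_iff n0)
 qed
 have im: "f ` carrier (P 1) = {x \<in> carrier (P 0). x 0 \<in> Idl (a ` {..<n 1})}"
  if f: "f \<in> mod_hom R (P 1) (P 0)" and a: "\<forall>b<n 1. a b \<in> CR"
   and eq: "!!x. x \<in> carrier (P 1) ==> f x 0 = dot R {..<n 1} a x" for f a
  using linear_image[OF a] mod_homD(1)[OF f] eq P0 by (auto simp: image_iff) (metis (no_types, lifting) imageE)+
 have "{x \<in> carrier (P 0). x 0 \<in> I} = {x \<in> carrier (P 0). x 0 \<in> Idl (?a ` {..<n 1})}"
  unfolding im0[symmetric] using d_hom[of 0] ac form_eq[OF _ coord_hom[OF d_hom[of 0]]] by (intro im) auto
 moreover have "rstr 1 (%_. c) \<in> carrier (P 0)" "rstr 1 (%_. c) 0 = c" if "c \<in> CR" for c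
  using that by (simp_all add: n0 rstr_closed) (simp add: rstr_def)
 ultimately have "c \<in> I \<longleftrightarrow> c \<in> Idl (?a ` {..<n 1})" if "c \<in> CR" for c
  using that by (metis (mono_tags, lifting) mem_Collect_eq)
 moreover have g: "?a ` {..<n 1} \<subseteq> CR" using ac by auto
 ultimately have "I = Idl (?a ` {..<n 1})"
  using idealD(1)[OF I] idealD(1)[OF genideal_ideal[OF g]] by blast
 then have "FP I (p ^ e) = Idl ((%b. ?a b [^] p ^ e) ` {..<n 1})"
  using fp_Idl[OF frq[of e] g] by (simp add: image_image)
 moreover have "D e 0 ` carrier (P 1) = {x \<in> carrier (P 0). x 0 \<in> Idl ((%b. ?a b [^] p ^ e) ` {..<n 1})}"
  using D_hom[of e 0] ac by (intro im) (auto simp: D_def mtwist_def twist_def)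
 ultimately show ?thesis by simp
qed

text \<open>A coboundary of degree \<open>k\<close> is a combination of the columns of the matrix \<open>M k\<close>, which has
 \<open>fm_pred n k\<close> columns: the rank in degree \<open>k - 1\<close>, and none for \<open>k = 0\<close>.\<close>

definition M :: "nat => nat => nat => 'a" where
 "M k j l = (case k of 0 => \<zero> | Suc i => d i (basis_vec R j) l)"

lemma M_closed: "j < n k ==> M k j l \<in> CR"
 using fm_closed[OF mod_homD(1)[OF d_hom basis_vec_closed]] by (auto simp: M_def split: nat.split)

lemma basis_closed: "j < n k ==> bv j \<in> carrier (P k)"
 by (rule basis_vec_closed) simp

text \<open>Turns being a coboundary into solvability of a linear system with \<open>q\<close>-th
  powers as coefficients, the form to which \<open>flat_system\<close> applies.\<close>

lemma cob_iff:
 assumes z: "z \<in> mod_hom R (P k) S"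
 shows "cob e k z \<longleftrightarrow> (\<exists>w. (\<forall>l<fm_pred n k. w l \<in> CR) \<and>
  (\<forall>j<n k. z (bv j) = dot R {..<fm_pred n k} w (%l. M k j l [^] p ^ e)))"
proof (cases k)
 case 0
 have "(\<forall>x\<in>carrier (P 0). z x = \<zero>) \<longleftrightarrow> (\<forall>j<n 0. z (bv j) = \<zero>)"
  using lin_ext_zero_on_basis[OF self_module _ z[unfolded 0]] basis_closed[of _ 0] by auto
 then show ?thesis by (simp add: 0)
next
 case (Suc i)
 have eq: "dot R {..<n i} w (D e i (bv j)) = dot R {..<n i} w (%l. M k j l [^] p ^ e)" if "j < n k" for w j
  using D_basis[of j i e] that by (simp add: M_def Suc)
 show ?thesis
 proof
  assume "cob e k z"
  then obtain w where w: "w \<in> mod_hom R (P i) S" "\<forall>x\<in>carrier (P k). z x = w (D e i x)" by (auto simp: Suc)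
  let ?w = "%l. w (bv l)"
  have "z (bv j) = dot R {..<n i} ?w (%l. M k j l [^] p ^ e)" if j: "j < n k" for j
  proof -
   have "z (bv j) = w (D e i (bv j))" using w(2) basis_closed[OF j] by blast
   also have "... = dot R {..<n i} ?w (D e i (bv j))"
    using form_eq[OF _ w(1)] mod_homD(1)[OF D_hom] basis_closed[OF j] by (simp add: Suc)
   finally show ?thesis using eq[OF j] by simp
  qed
  moreover have "\<forall>l<n i. ?w l \<in> CR" using mod_homD(1)[OF w(1) basis_closed] by simp
  ultimately show "\<exists>w. (\<forall>l<fm_pred n k. w l \<in> CR) \<and>
   (\<forall>j<n k. z (bv j) = dot R {..<fm_pred n k} w (%l. M k j l [^] p ^ e))"
   by (intro exI[of _ ?w]) (simp add: Suc)
 next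
  assume "\<exists>w. (\<forall>l<fm_pred n k. w l \<in> CR) \<and>
   (\<forall>j<n k. z (bv j) = dot R {..<fm_pred n k} w (%l. M k j l [^] p ^ e))"
  then obtain w where w: "\<forall>l<n i. w l \<in> CR" "\<forall>j<n k. z (bv j) = dot R {..<n i} w (%l. M k j l [^] p ^ e)"
   by (auto simp: Suc)
  have h: "(%x. dot R {..<n i} w x) \<in> mod_hom R (P i) S" using w(1) by (intro form_hom) auto
  have "z x = dot R {..<n i} w (D e i x)" if x: "x \<in> carrier (P k)" for x
   by (rule lin_list_vec[OF self_module z mod_hom_comp[OF D_hom h, folded Suc] _ x]) (use w(2) eq in auto)
  then show "cob e k z" using h by (auto simp: Suc)
 qed
qed

lemma twist_cocycle:
 assumes z: "z \<in> mod_hom R (P k) S" and cyc: "\<forall>x\<in>carrier (P (Suc k)). z (D 0 k x) = \<zero>"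
  and x: "x \<in> carrier (P (Suc k))"
 shows "twist R (p ^ e) {..<n k} z (D e k x) = \<zero>"
proof -
 have "twist R (p ^ e) {..<n k} z (D e k x) = twist R (p ^ e) {..<n k} z (mtwist R (p ^ e) {..<n (Suc k)} (D 0 k) x)"
  using D_twist[OF x, of e 0] by simp
 also have "... = twist R (p ^ e) {..<n (Suc k)} (%x. z (D 0 k x)) x"
  using twist_comp[OF frq _ _ D_hom z x] by simp
 also have "... = twist R (p ^ e) {..<n (Suc k)} (%x. \<zero>) x"
  by (rule twist_cong[OF mod_hom_comp[OF D_hom z] cyc x])
 also have "... = \<zero>" unfolding twist_def using frob_zero[OF frq] fm_closed[OF x] by (intro dot_zero) auto
 finally show ?thesis .
qed

lemma twist_coboundary:
 assumes z: "z \<in> mod_hom R (P k) S" and cob: "cob a k z"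
 shows "cob (a + e) k (twist R (p ^ e) {..<n k} z)"
proof (cases k)
 case 0
 have "twist R (p ^ e) {..<n 0} z x = \<zero>" if x: "x \<in> carrier (P 0)" for x
 proof -
  have "twist R (p ^ e) {..<n 0} z x = twist R (p ^ e) {..<n 0} (%x. \<zero>) x"
   using z cob by (intro twist_cong[OF _ _ x]) (simp_all add: 0)
  also have "... = \<zero>" unfolding twist_def using frob_zero[OF frq] fm_closed[OF x] by (intro dot_zero) auto
  finally show ?thesis .
 qed
 then show ?thesis by (simp add: 0)
next
 case (Suc i)
 then obtain w where w: "w \<in> mod_hom R (P i) S" "\<forall>x\<in>carrier (P (Suc i)). z x = w (D a i x)" using cob by auto
 have "twist R (p ^ e) {..<n (Suc i)} z x = twist R (p ^ e) {..<n i} w (D (a + e) i x)" if x: "x \<in> carrier (P (Suc i))" for x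
 proof -
  have "twist R (p ^ e) {..<n (Suc i)} z x = twist R (p ^ e) {..<n (Suc i)} (%x. w (D a i x)) x"
   using z w(2) by (intro twist_cong[OF _ _ x]) (simp_all add: Suc)
  then show ?thesis using twist_comp[OF frq _ _ D_hom w(1) x, of e a] D_twist[OF x, of e a] by simp
 qed
 moreover have "twist R (p ^ e) {..<n i} w \<in> mod_hom R (P i) S" using twist_hom[OF _ w(1)] by simp
 ultimately show ?thesis by (auto simp: Suc)
qed

lemma mtwist_chain:
 assumes u: "chn a b u"
 shows "chn (a + e) (b + e) (%k. mtwist R (p ^ e) {..<n k} (u k))"
 unfolding chain_map_def
proof (intro allI conjI ballI)
 fix k
 note u' = chain_mapD[OF u]
 show "mtwist R (p ^ e) {..<n k} (u k) \<in> mod_hom R (P k) (P k)" using mtwist_hom[OF frq _ _ u'(1)] by simp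
 fix x assume x: "x \<in> carrier (P (Suc k))"
 have ux: "mtwist R (p ^ e) {..<n (Suc k)} (u (Suc k)) x \<in> carrier (P (Suc k))"
  using mod_homD(1)[OF mtwist_hom[OF frq _ _ u'(1)] x] by simp
 have "D (b + e) k (mtwist R (p ^ e) {..<n (Suc k)} (u (Suc k)) x)
   = mtwist R (p ^ e) {..<n (Suc k)} (D b k) (mtwist R (p ^ e) {..<n (Suc k)} (u (Suc k)) x)"
  using D_twist[OF ux] by simp
 also have "... = mtwist R (p ^ e) {..<n (Suc k)} (%x. D b k (u (Suc k) x)) x"
  using mtwist_comp[OF frq _ _ u'(1) D_hom x] by simp
 also have "... = mtwist R (p ^ e) {..<n (Suc k)} (%x. u k (D a k x)) x"
  using u'(2) by (intro mtwist_cong[OF mod_hom_comp[OF u'(1) D_hom] _ x]) auto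
 also have "... = mtwist R (p ^ e) {..<n k} (u k) (mtwist R (p ^ e) {..<n (Suc k)} (D a k) x)"
  using mtwist_comp[OF frq _ _ D_hom u'(1) x] by simp
 also have "... = mtwist R (p ^ e) {..<n k} (u k) (D (a + e) k x)" using D_twist[OF x] by simp
 finally show "D (b + e) k (mtwist R (p ^ e) {..<n (Suc k)} (u (Suc k)) x) = mtwist R (p ^ e) {..<n k} (u k) (D (a + e) k x)" .
qed

text \<open>The assumption makes multiplication by c a well-defined map from R/I^[p^a0] to
  R/I^[p^b0], and the comparison theorem lifts it to the resolutions.\<close>

lemma lift_scalar:
 assumes c: "c \<in> CR" and ca: "\<forall>a\<in>FP I (p ^ a0). c \<otimes> a \<in> FP I (p ^ b0)"
 shows "\<exists>g. (\<forall>x. g 0 x = c \<odot>\<^bsub>P 0\<^esub> x) \<and> chn a0 b0 g"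
proof -
 let ?g = "%x. c \<odot>\<^bsub>P 0\<^esub> x"
 interpret P0: module R "P 0" by (rule free_module_module)
 have id: "(%x. x) \<in> mod_hom R (P 0) (P 0)" by (simp add: mod_hom_def)
 have "?g (D a0 0 x) \<in> D b0 0 ` carrier (P 1)" if x: "x \<in> carrier (P 1)" for x
 proof -
  have "D a0 0 x \<in> {x \<in> carrier (P 0). x 0 \<in> FP I (p ^ a0)}" unfolding im_D0[symmetric] using x by blast
  then have "?g (D a0 0 x) \<in> {x \<in> carrier (P 0). x 0 \<in> FP I (p ^ b0)}"
   using ca P0.smult_closed[OF c] by auto
  then show ?thesis unfolding im_D0 .
 qed
 then have "\<exists>g. g 0 = ?g \<and> chn a0 b0 g"
  by (intro chain_map_lift[OF D_cplx D_acyclic mod_hom_smult_closed[OF free_module_module id c]] ballI) auto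
 then obtain g where "g 0 = ?g" "chn a0 b0 g" by blast
 then show ?thesis by (intro exI[of _ g]) simp
qed

lemma ex_frobenius_lift: "\<exists>B. (\<forall>x\<in>carrier (P 0). B 0 x = x) \<and> chn 1 0 B"
proof -
 interpret P0: module R "P 0" by (rule free_module_module)
 have "FP I (p ^ 0) = I" using fp_one[OF I] by simp
 then have "\<forall>a\<in>FP I (p ^ 1). \<one> \<otimes> a \<in> FP I (p ^ 0)"
  using fp_sub[OF I ppos] idealD(8)[OF I] by auto
 then obtain g where g: "\<forall>x. g 0 x = \<one> \<odot>\<^bsub>P 0\<^esub> x" "chn 1 0 g" using lift_scalar[of \<one> 1 0] by blast
 then have "\<forall>x\<in>carrier (P 0). g 0 x = x" using P0.smult_one by simp
 then show ?thesis using g(2) by blast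
qed

definition "B = (SOME B. (\<forall>x\<in>carrier (P 0). B 0 x = x) \<and> chn 1 0 B)"

lemma B0: "x \<in> carrier (P 0) ==> B 0 x = x" and B_chain: "chn 1 0 B"
 using someI_ex[OF ex_frobenius_lift] unfolding B_def[symmetric] by auto

text \<open>Twisting the one chosen lift \<open>B\<close> produces lifts of all surjections from
  R/I^[p^(e+1)] to R/I^[p^e], each the identity in degree 0. This ties the later transition maps to
  the first.\<close>

definition "b e k = mtwist R (p ^ e) {..<n k} (B k)"

lemma b_chain: "chn (Suc e) e (b e)"
 using mtwist_chain[OF B_chain, of e] by (simp add: b_def[abs_def])

lemma b0: "x \<in> carrier (P 0) ==> b e 0 x = x"
proof -
 assume x: "x \<in> carrier (P 0)"
 have "b e 0 x = mtwist R (p ^ e) {..<n 0} (%x. x) x"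
  unfolding b_def using B0 by (intro mtwist_cong[OF chain_mapD(1)[OF B_chain] _ x]) auto
 then show ?thesis using mtwist_id[OF frq _ x] by simp
qed

text \<open>The composite of the transition lifts from F^e(P) down to P.\<close>

primrec BB where
 "BB 0 = (%k x. x)"
| "BB (Suc e) = (%k x. BB e k (b e k x))"

lemma BB_chain: "chn e 0 (BB e)"
proof (induction e)
 case 0
 then show ?case using chain_map_id[OF D_cplx[of 0]] by simp
next
 case (Suc e)
 show ?case using chain_map_comp[OF b_chain Suc] by simp
qed

lemma BB0: "x \<in> carrier (P 0) ==> BB e 0 x = x"
 by (induction e arbitrary: x) (simp_all add: b0)

lemma scalar_chain: "c \<in> CR ==> chn a a (%k x. c \<odot>\<^bsub>P k\<^esub> x)"
 unfolding chain_map_def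
proof (intro allI conjI ballI)
 fix k assume c: "c \<in> CR"
 have "(%x. x) \<in> mod_hom R (P k) (P k)" by (simp add: mod_hom_def)
 from mod_hom_smult_closed[OF free_module_module this c]
 show "(%x. c \<odot>\<^bsub>P k\<^esub> x) \<in> mod_hom R (P k) (P k)" .
 fix x assume "x \<in> carrier (P (Suc k))"
 then show "D a k (c \<odot>\<^bsub>P (Suc k)\<^esub> x) = c \<odot>\<^bsub>P k\<^esub> D a k x" by (rule mod_homD(3)[OF D_hom c])
qed

lemma zero_in_im: "(%_. \<zero>) \<in> D e 0 ` carrier (P 1)"
proof -
 interpret P0: module R "P 0" by (rule free_module_module)
 show ?thesis unfolding im_D0
  using P0.zero_closed idealD(2)[OF fp_ideal[OF idealD(1)[OF I]]] by simp
qed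

lemma coboundary_agree:
 assumes u: "chn a e u" and v: "chn a e v"
  and eq: "\<forall>x\<in>carrier (P 0). u 0 x = v 0 x"
  and z: "z \<in> mod_hom R (P k) S" and cyc: "\<forall>x\<in>carrier (P (Suc k)). z (D e k x) = \<zero>"
  and cob: "cob a k (%x. z (v k x))"
 shows "cob a k (%x. z (u k x))"
proof (rule coboundary_homotopic[where z = z and v = v, OF D_cplx D_acyclic u v _ self_module z _ cob])
 interpret P0: module R "P 0" by (rule free_module_module)
 show "\<forall>x\<in>carrier (P 0). u 0 x \<ominus>\<^bsub>P 0\<^esub> v 0 x \<in> D e 0 ` carrier (P 1)"
  using eq mod_homD(1)[OF chain_mapD(1)[OF v, of 0]] zero_in_im P0.r_neg by (simp add: P0.minus_eq)
qed (use cyc in simp)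

lemma annihilator_ideal:
 assumes z: "z \<in> mod_hom R (P k) S"
 shows "ideal {a \<in> CR. cob e k (%x. a \<otimes> z x)} R" (is "ideal ?A R")
proof (rule ideal_intro)
 have zc: "z x \<in> CR" if "x \<in> carrier (P k)" for x using mod_homD(1)[OF z that] by simp
 have c0: "cob e k (%x. \<zero>)" using coboundary_zero[OF self_module] by simp
 show "\<zero> \<in> ?A"
  using coboundary_cong[OF c0] zc by simp
 fix x y assume "x \<in> ?A"
  "y \<in> ?A"
 then have xy: "x \<in> CR" "y \<in> CR" "cob e k (%v. x \<otimes> z v)" "cob e k (%v. y \<otimes> z v)" by auto
 then show "x \<oplus> y \<in> ?A"
  using coboundary_cong[OF coboundary_add[OF self_module xy(3,4) D_cplx], of "%v. (x \<oplus> y) \<otimes> z v"] zc by (simp add: l_distr)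
next
 fix r x assume r: "r \<in> CR" and "x \<in> ?A"
 then have x: "x \<in> CR" "cob e k (%v. x \<otimes> z v)" by auto
 then show "r \<otimes> x \<in> ?A"
  using coboundary_cong[OF coboundary_smult[OF self_module x(2) r], of "%v. (r \<otimes> x) \<otimes> z v"] mod_homD(1)[OF z] r by (simp add: m_assoc)
qed auto

lemma dot_single: "z j \<in> CR ==> x j \<in> CR ==> dot R {j} z x = z j \<otimes> x j"
 using dot_insert[of "{}" j z x] by simp

text \<open>That c F^e(z) is a coboundary w of the twist is a linear system in the unknowns c and -w
  whose coefficients are \<open>q\<close>-th powers of the entries of z and of the differential.
  Flatness writes (c, -w) by \<open>q\<close>-th powers of solutions of the original system, and the
  first coordinate a of such a solution makes a z a coboundary.\<close>

lemma annihilator_descent: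
 assumes z: "z \<in> mod_hom R (P k) S" and c: "c \<in> CR"
  and cob: "cob e k (%x. c \<otimes> twist R (p ^ e) {..<n k} z x)"
 shows "c \<in> FP {a \<in> CR. cob 0 k (%x. a \<otimes> z x)} (p ^ e)"
proof -
 interpret q: frob_flat R "p ^ e" by (rule flat_pow)
 let ?A = "{a \<in> CR. cob 0 k (%x. a \<otimes> z x)}"
 let ?L = "{..<fm_pred n k}"
 have zb: "z (bv j) \<in> CR" if "j < n k" for j using mod_homD(1)[OF z basis_closed[OF that]] by simp
 have sm: "(%x. a \<otimes> f x) \<in> mod_hom R (P k) S" if "f \<in> mod_hom R (P k) S" "a \<in> CR" for a f
  using mod_hom_smult_closed[OF self_module that] by simp
 have tw: "twist R (p ^ e) {..<n k} z \<in> mod_hom R (P k) S" using twist_hom[OF _ z] by simp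
 obtain w where w: "\<forall>l<fm_pred n k. w l \<in> CR"
  "\<forall>j<n k. c \<otimes> z (bv j) [^] p ^ e = dot R ?L w (%l. M k j l [^] p ^ e)"
  using cob cob_iff[OF sm[OF tw c], of e] twist_basis[OF _ z] by auto
 define v where "v = case_sum (%_::nat. c) (%l. \<ominus> w l)"
 define X where "X i j = case_sum (%_::nat. z (bv j)) (%l. M k j l) i" for i j
 let ?I = "Inl ` {0::nat} \<union> Inr ` ?L" and ?J = "{..<n k}"
 have Xc: "X i j \<in> CR" if "i \<in> ?I" "j \<in> ?J" for i j
  using that M_closed zb by (auto simp: X_def)
 have vc: "v i \<in> CR" if "i \<in> ?I" for i using that c w by (auto simp: v_def)
 have split: "dot R ?I y (%i. X i j) = y (Inl 0) \<otimes> z (bv j) \<oplus> dot R ?L (%l. y (Inr l)) (%l. M k j l)"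
  if "\<forall>i\<in>?I. y i \<in> CR" "j < n k" for y j
  using that zb M_closed by (subst dot_Plus) (auto simp: X_def dot_single)
 have "dot R ?I v (%i. X i j [^] p ^ e) = \<zero>" if j: "j \<in> ?J" for j
 proof -
  have "dot R ?I v (%i. X i j [^] p ^ e) = c \<otimes> z (bv j) [^] p ^ e \<oplus> dot R ?L (%l. \<ominus> w l) (%l. M k j l [^] p ^ e)"
   using j c w zb M_closed by (subst dot_Plus) (auto simp: X_def v_def dot_single)
  also have "dot R ?L (%l. \<ominus> w l) (%l. M k j l [^] p ^ e) = \<ominus> dot R ?L w (%l. M k j l [^] p ^ e)"
   using j w M_closed by (intro dot_uminus) auto
  also have "... = \<ominus> (c \<otimes> z (bv j) [^] p ^ e)" using w j by simp
  finally show ?thesis using c zb j by (simp add: r_neg)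
 qed
 then have "v \<in> lspan R ?I (q.fker ?I ?J X)" using Xc vc by (intro q.flat_system) auto
 then have "v (Inl 0) \<in> FP ?A (p ^ e)"
 proof (induction rule: lspan.induct)
  case (zero v)
  then show ?case using idealD(2)[OF fp_ideal, of ?A] by auto
 next
  case (step w g s v)
  obtain y where y: "g = (%i. y i [^] p ^ e)" "\<forall>i. y i \<in> CR" "\<forall>j\<in>?J. dot R ?I y (%i. X i j) = \<zero>"
   using step(2) by (auto simp: q.fker_def)
  let ?a = "y (Inl 0)"
  have "?a \<otimes> z (bv j) = dot R ?L (%l. \<ominus> y (Inr l)) (%l. M k j l [^] p ^ 0)" if j: "j < n k" for j
  proof -
   have dc: "dot R ?L (%l. y (Inr l)) (%l. M k j l) \<in> CR" using y(2) M_closed[OF j] by (intro dot_closed) auto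
   have "?a \<otimes> z (bv j) \<oplus> dot R ?L (%l. y (Inr l)) (%l. M k j l) = \<zero>"
    using y(3) split[of y j] y(2) j by auto
   then have "?a \<otimes> z (bv j) = \<ominus> dot R ?L (%l. y (Inr l)) (%l. M k j l)"
    using dc y(2) zb[OF j] minus_equality by (metis m_closed)
   also have "... = dot R ?L (%l. \<ominus> y (Inr l)) (%l. M k j l)"
    using y(2) M_closed[OF j] by (intro dot_uminus[symmetric]) auto
   also have "... = dot R ?L (%l. \<ominus> y (Inr l)) (%l. M k j l [^] p ^ 0)"
    using y(2) M_closed[OF j] by (intro dot_cong) auto
   finally show ?thesis .
  qed
  then have "cob 0 k (%x. ?a \<otimes> z x)"
   unfolding cob_iff[OF sm[OF z y(2)[rule_format]]] using y(2) by (intro exI[of _ "%l. \<ominus> y (Inr l)"]) auto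
  then have "?a [^] p ^ e \<in> FP ?A (p ^ e)" using y(2) by (intro fp_mem) auto
  moreover have "ideal (FP ?A (p ^ e)) R" by (rule fp_ideal) auto
  ultimately show ?case using step(3,4,5) by (auto simp: y(1) intro: ideal.I_l_closed additive_subgroup.a_closed[OF ideal.axioms(1)])
 qed
 then show ?thesis by (simp add: v_def)
qed


theorem twist_injective_0:
 assumes z: "z \<in> mod_hom R (P k) S" and cyc: "\<forall>x\<in>carrier (P (Suc k)). z (D 0 k x) = \<zero>"
  and cob: "cob 1 k (%x. z (B k x))"
 shows "cob 0 k z"
proof -
 let ?f = "%\<zeta> x. dot R {..<n k} \<zeta> x"
 \<comment> \<open>The kernels of the maps into the cohomology of the twists increase, hence stabilize.\<close>
 define K where "K e = {\<zeta> \<in> carrier (P k). (\<forall>x\<in>carrier (P (Suc k)). ?f \<zeta> (D 0 k x) = \<zero>) \<and>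
  cob e k (%x. ?f \<zeta> (BB e k x))}" for e
 have fh: "?f \<zeta> \<in> mod_hom R (P k) S" if "\<zeta> \<in> carrier (P k)" for \<zeta>
  using fm_closed[OF that] by (intro form_hom) auto
 have flin: "?f (%i. \<zeta> i \<oplus> r \<otimes> \<xi> i) x = ?f \<zeta> x \<oplus> r \<otimes> ?f \<xi> x"
  if "\<zeta> \<in> carrier (P k)" "\<xi> \<in> carrier (P k)" "r \<in> CR" "x \<in> carrier (P k)" for \<zeta> \<xi> r x
  using fm_closed[OF that(1)] fm_closed[OF that(2)] fm_closed[OF that(4)] that(3) by (intro dot_lin) auto
 have f0: "?f (%_. \<zero>) x = \<zero>" if "x \<in> carrier (P k)" for x
  using fm_closed[OF that] by (intro dot_zero) auto
 have BBc: "BB e k x \<in> carrier (P k)" if "x \<in> carrier (P k)" for e x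
  using mod_homD(1)[OF chain_mapD(1)[OF BB_chain] that] .
 have Dc: "D e k x \<in> carrier (P k)" if "x \<in> carrier (P (Suc k))" for e x
  using mod_homD(1)[OF D_hom that] .
 have fc: "?f \<zeta> x \<in> CR" if "\<zeta> \<in> carrier (P k)" "x \<in> carrier (P k)" for \<zeta> x
  using mod_homD(1)[OF fh[OF that(1)] that(2)] by simp
 have "submod R {..<n k} (K e)" for e
  unfolding submod_def
 proof (intro conjI ballI)
  interpret Pk: module R "P k" by (rule free_module_module)
  show "K e \<subseteq> carrier (P k)" by (auto simp: K_def)
  have "cob e k (%x. \<zero>)" using coboundary_zero[OF self_module] by simp
  then have "cob e k (%x. ?f (%_. \<zero>) (BB e k x))"
   by (rule coboundary_cong) (use f0 BBc in auto)
  then show "(%_. \<zero>) \<in> K e" using Pk.zero_closed f0 Dc by (simp add: K_def)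
  fix \<zeta> \<xi> r assume "\<zeta> \<in> K e" "\<xi> \<in> K e" and r: "r \<in> CR"
  then have *: "\<zeta> \<in> carrier (P k)" "\<xi> \<in> carrier (P k)" "\<forall>x\<in>carrier (P (Suc k)). ?f \<zeta> (D 0 k x) = \<zero>"
   "\<forall>x\<in>carrier (P (Suc k)). ?f \<xi> (D 0 k x) = \<zero>" "cob e k (%x. ?f \<zeta> (BB e k x))"
   "cob e k (%x. ?f \<xi> (BB e k x))" by (auto simp: K_def)
  have c: "(%b. \<zeta> b \<oplus> r \<otimes> \<xi> b) \<in> carrier (P k)"
   using Pk.a_closed[OF *(1) Pk.smult_closed[OF r *(2)]] by simp
  have "cob e k (%x. ?f (%b. \<zeta> b \<oplus> r \<otimes> \<xi> b) (BB e k x))"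
   by (rule coboundary_cong[OF coboundary_add[OF self_module *(5) coboundary_smult[OF self_module *(6) r] D_cplx]])
    (use flin[OF *(1,2) r] BBc in auto)
  moreover have "\<forall>x\<in>carrier (P (Suc k)). ?f (%b. \<zeta> b \<oplus> r \<otimes> \<xi> b) (D 0 k x) = \<zero>"
   using flin[OF *(1,2) r] *(3,4) r Dc by simp
  ultimately show "(%b. \<zeta> b \<oplus> r \<otimes> \<xi> b) \<in> K e" using c by (simp add: K_def)
 qed
 moreover have "K e \<subseteq> K (Suc e)" for e
 proof
  fix \<zeta> assume "\<zeta> \<in> K e"
  then show "\<zeta> \<in> K (Suc e)" using coboundary_pull[OF b_chain[of e], of S k "%x. ?f \<zeta> (BB e k x)"] by (simp add: K_def)
 qed
 \<comment> \<open>This choice of e precedes that of m and c, and Fedder's criterion is then used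
   for exactly this e.\<close>
 ultimately obtain e where e: "K (Suc e) = K e" using submod_chain[of "n k" K] by blast
 let ?A = "{a \<in> CR. cob 0 k (%x. a \<otimes> z x)}"
 let ?z = "twist R (p ^ e) {..<n k} z"
 have zh: "?z \<in> mod_hom R (P k) S" using twist_hom[OF _ z] by simp
 have zcyc: "\<forall>x\<in>carrier (P (Suc k)). ?z (D e k x) = \<zero>" using twist_cocycle[OF z cyc] by blast
 have A: "ideal ?A R" by (rule annihilator_ideal[OF z])
 have "?A = CR"
 proof (rule ccontr)
  assume "?A \<noteq> CR"
  then obtain m where m: "maximalideal m R" "?A \<subseteq> m" using ex_maximal[OF A] by blast
  obtain c where c: "c \<in> CR" "c \<notin> FP m (p ^ e)" "\<forall>a\<in>I. c \<otimes> a \<in> FP I (p ^ e)"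
   using fed[OF m(1)] by blast
  have "FP I (p ^ 0) = I" using fp_one[OF I] by simp
  then obtain C where C: "\<forall>x. C 0 x = c \<odot>\<^bsub>P 0\<^esub> x" "chn 0 e C"
   using lift_scalar[of c 0 e] c by auto
  note C' = chain_mapD[OF C(2)]
  have CBB: "chn e e (%k x. C k (BB e k x))" by (rule chain_map_comp[OF BB_chain C(2)])
  \<comment> \<open>Two chain maps from F^(e+1)(P) to F^e(P) that both multiply by c in degree 0:
    descend to P and come back by C, or descend one stage and multiply by c. They induce the same
    map on classes.\<close>
  have CB: "chn (Suc e) e (%k x. C k (BB e k (b e k x)))"
   using chain_map_comp[OF b_chain CBB] .
  have cb: "chn (Suc e) e (%k x. c \<odot>\<^bsub>P k\<^esub> b e k x)"
   using chain_map_comp[OF b_chain scalar_chain[OF c(1)]] .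
  have zs: "?z (c \<odot>\<^bsub>P k\<^esub> x) = c \<otimes> ?z x" if "x \<in> carrier (P k)" for x
   using mod_homD(3)[OF zh c(1) that] by simp
  have bc: "b e k x \<in> carrier (P k)" if "x \<in> carrier (P k)" for x
   using mod_homD(1)[OF chain_mapD(1)[OF b_chain] that] .
  \<comment> \<open>The hypothesis that z B is a coboundary, twisted e times.\<close>
  have "cob (1 + e) k (twist R (p ^ e) {..<n k} (%x. z (B k x)))"
   using twist_coboundary[OF mod_hom_comp[OF chain_mapD(1)[OF B_chain] z] cob] .
  then have "cob (Suc e) k (%x. c \<otimes> twist R (p ^ e) {..<n k} (%x. z (B k x)) x)"
   using coboundary_smult[OF self_module _ c(1), of P "D (Suc e)" k] by simp
  then have "cob (Suc e) k (%x. ?z (c \<odot>\<^bsub>P k\<^esub> b e k x))"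
   by (rule coboundary_cong) (use zs[OF bc] twist_comp[OF frq _ _ chain_mapD(1)[OF B_chain] z] in \<open>auto simp: b_def\<close>)
  then have 1: "cob (Suc e) k (%x. ?z (C k (BB e k (b e k x))))"
   by (intro coboundary_agree[OF CB cb _ zh zcyc]) (use C(1) BB0 b0 in auto)
  \<comment> \<open>The coefficient vector of F^e(z) C. As a cocycle on P it is a candidate for the
    kernels \<open>K\<close>; the coboundary just found puts it into \<open>K (Suc e)\<close>, which
    equals \<open>K e\<close>.\<close>
  define \<xi> where "\<xi> = rstr (n k) (%j. ?z (C k (bv j)))"
  have zC: "(%x. ?z (C k x)) \<in> mod_hom R (P k) S" by (rule mod_hom_comp[OF C'(1) zh])
  have zCb: "?z (C k (bv j)) \<in> CR" if "j < n k" for j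
   using mod_homD(1)[OF zC basis_closed[OF that]] by simp
  have \<xi>P: "\<xi> \<in> carrier (P k)" unfolding \<xi>_def using zCb by (intro rstr_closed) auto
  have \<xi>: "?f \<xi> x = ?z (C k x)" if x: "x \<in> carrier (P k)" for x
  proof -
   have "?z (C k x) = ?f (%j. ?z (C k (bv j))) x" using form_eq[OF _ zC x] by simp
   also have "... = ?f \<xi> x" using zCb fm_closed[OF x] fm_closed[OF \<xi>P] by (intro dot_cong) (auto simp: \<xi>_def rstr_def)
   finally show ?thesis by simp
  qed
  have "?f \<xi> (D 0 k x) = \<zero>" if x: "x \<in> carrier (P (Suc k))" for x
  proof -
   have "?f \<xi> (D 0 k x) = ?z (D e k (C (Suc k) x))" using \<xi>[OF Dc[OF x]] C'(2)[OF x] by simp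
   then show ?thesis using zcyc mod_homD(1)[OF C'(1) x] by simp
  qed
  moreover have "cob (Suc e) k (%x. ?f \<xi> (BB (Suc e) k x))"
   by (rule coboundary_cong[OF 1]) (use \<xi> BBc bc in auto)
  ultimately have "\<xi> \<in> K (Suc e)" using \<xi>P by (simp add: K_def)
  then have "cob e k (%x. ?f \<xi> (BB e k x))" unfolding e by (simp add: K_def)
  then have "cob e k (%x. ?z (C k (BB e k x)))"
   by (rule coboundary_cong) (use \<xi> BBc in auto)
  \<comment> \<open>On F^e(P) the composite of \<open>BB\<close> and C multiplies by c in degree 0,
    so it may be replaced by multiplication by c.\<close>
  then have "cob e k (%x. ?z (c \<odot>\<^bsub>P k\<^esub> x))"
   by (intro coboundary_agree[OF scalar_chain[OF c(1)] CBB _ zh zcyc]) (use C(1) BB0 in auto)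
  then have "cob e k (%x. c \<otimes> ?z x)"
   by (rule coboundary_cong) (use zs in auto)
  \<comment> \<open>Since Ann z was assumed to lie in m, its Frobenius power lies in m^[p^e], which
    excludes c.\<close>
  then have "c \<in> FP ?A (p ^ e)" by (rule annihilator_descent[OF z c(1)])
  moreover have "m \<subseteq> CR" using idealD(1)[OF maximalideal.axioms(1)[OF m(1)]] .
  ultimately show False using fp_mono[OF m(2), of "p ^ e"] c(2) by blast
 qed
 then have "cob 0 k (%x. \<one> \<otimes> z x)" by blast
 then show ?thesis by (rule coboundary_cong) (use mod_homD(1)[OF z] in auto)
qed

text \<open>The two facts that z is a cocycle of F^e(P) and that its pullback to F^(e+1)(P) is a
  coboundary w form one linear system with \<open>q\<close>-th powers as coefficients. Flatness
  writes (z, -w) by \<open>q\<close>-th powers of solutions of the same system for e = 0; to these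
  \<open>twist_injective_0\<close> applies.\<close>

theorem twist_injective:
 assumes z: "z \<in> mod_hom R (P k) S" and cyc: "\<forall>x\<in>carrier (P (Suc k)). z (D e k x) = \<zero>"
  and cob: "cob (Suc e) k (%x. z (b e k x))"
 shows "cob e k z"
proof -
 interpret q: frob_flat R "p ^ e" by (rule flat_pow)
 let ?L = "{..<fm_pred n k}" and ?N = "{..<n k}" and ?N' = "{..<n (Suc k)}"
 define \<zeta> where "\<zeta> j = z (bv j)" for j
 have zb: "\<zeta> j \<in> CR" if "j < n k" for j using mod_homD(1)[OF z basis_closed[OF that]] by (simp add: \<zeta>_def)
 have zf: "z x = dot R ?N \<zeta> x" if "x \<in> carrier (P k)" for x using form_eq[OF _ z that] by (simp add: \<zeta>_def[abs_def])
 have db: "d k (bv m) \<in> carrier (P k)" if "m < n (Suc k)" for m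
  using mod_homD(1)[OF d_hom basis_closed[OF that]] .
 have Bb: "B k (bv i) \<in> carrier (P k)" if "i < n k" for i
  using mod_homD(1)[OF chain_mapD(1)[OF B_chain] basis_closed[OF that]] .
 have bh: "b e k \<in> mod_hom R (P k) (P k)" using chain_mapD(1)[OF b_chain] .
 have bb: "b e k (bv i) = (%c. B k (bv i) c [^] p ^ e)" if "i < n k" for i
  unfolding b_def using mtwist_basis[OF _ chain_mapD(1)[OF B_chain]] that by simp
 obtain w where w: "\<forall>l<fm_pred n k. w l \<in> CR"
  "\<forall>i<n k. z (b e k (bv i)) = dot R ?L w (%l. M k i l [^] p ^ Suc e)"
  using cob unfolding cob_iff[OF mod_hom_comp[OF bh z]] by blast
 define v where "v = case_sum \<zeta> (%l. \<ominus> w l)"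
 \<comment> \<open>Unknowns: coordinates of z (\<open>Inl\<close>) and of -w (\<open>Inr\<close>).
   Equations: the cocycle condition for each basis vector of degree k + 1 (\<open>Inl\<close>), and
   the coboundary condition for each basis vector of degree k (\<open>Inr\<close>). There the
   entries of the differential appear to the power p, since w lives on the twist
   \<open>Suc e\<close>.\<close>
 define X where "X i = case_sum (%m. case_sum (%j. d k (bv m) j) (%l. \<zero>) i)
  (%i'. case_sum (%j. B k (bv i') j) (%l. M k i' l [^] p) i)" for i :: "nat + nat"
 let ?I = "Inl ` ?N \<union> Inr ` ?L" and ?J = "Inl ` ?N' \<union> Inr ` ?N"
 have Xc: "X i j \<in> CR" if "i \<in> ?I" "j \<in> ?J" for i j
  using that M_closed fm_closed[OF db] fm_closed[OF Bb] by (auto simp: X_def)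
 have vc: "v i \<in> CR" if "i \<in> ?I" for i using that zb w by (auto simp: v_def)
 have "dot R ?I v (%i. X i j [^] p ^ e) = \<zero>" if "j \<in> ?J" for j
  using that
 proof (elim UnE imageE)
  fix m assume m: "j = Inl m" "m \<in> ?N'"
  have "dot R ?I v (%i. X i j [^] p ^ e) = dot R ?N \<zeta> (%j. d k (bv m) j [^] p ^ e) \<oplus> dot R ?L (%l. \<ominus> w l) (%l. \<zero> [^] p ^ e)"
   unfolding m(1) using m(2) w zb fm_closed[OF db] by (subst dot_Plus) (auto simp: X_def v_def)
  also have "dot R ?L (%l. \<ominus> w l) (%l. \<zero> [^] p ^ e) = dot R ?L (%l. \<zero> [^] p ^ e) (%l. \<ominus> w l)"
   using w by (intro dot_comm) auto
  also have "... = \<zero>" using w frob_zero[OF frq] by (intro dot_zero) auto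
  also have "dot R ?N \<zeta> (%j. d k (bv m) j [^] p ^ e) = z (D e k (bv m))"
   using zf[OF mod_homD(1)[OF D_hom basis_closed]] D_basis m(2) by simp
  also have "... = \<zero>" using cyc basis_closed m(2) by simp
  finally show ?thesis by simp
 next
  fix i assume i: "j = Inr i" "i \<in> ?N"
  have "dot R ?I v (%i. X i j [^] p ^ e) = dot R ?N \<zeta> (%j. B k (bv i) j [^] p ^ e)
   \<oplus> dot R ?L (%l. \<ominus> w l) (%l. (M k i l [^] p) [^] p ^ e)"
   unfolding i(1) using i(2) w zb fm_closed[OF Bb] M_closed by (subst dot_Plus) (auto simp: X_def v_def)
  also have "dot R ?L (%l. \<ominus> w l) (%l. (M k i l [^] p) [^] p ^ e) = \<ominus> dot R ?L w (%l. (M k i l [^] p) [^] p ^ e)"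
   using i w M_closed by (intro dot_uminus) auto
  also have "dot R ?L w (%l. (M k i l [^] p) [^] p ^ e) = dot R ?L w (%l. M k i l [^] p ^ Suc e)"
   using i w M_closed by (intro dot_cong) (auto simp: nat_pow_pow)
  also have "... = z (b e k (bv i))" using w(2) i by simp
  also have "dot R ?N \<zeta> (%j. B k (bv i) j [^] p ^ e) = z (b e k (bv i))"
   using zf[OF mod_homD(1)[OF bh basis_closed]] bb i(2) by simp
  also have "z (b e k (bv i)) \<oplus> \<ominus> z (b e k (bv i)) = \<zero>"
   using mod_homD(1)[OF mod_hom_comp[OF bh z] basis_closed] i(2) by (intro r_neg) simp
  finally show ?thesis .
 qed
 then have "v \<in> lspan R ?I (q.fker ?I ?J X)" using Xc vc by (intro q.flat_system) auto
 then have "\<exists>u. (\<forall>l<fm_pred n k. u l \<in> CR) \<and> (\<forall>j<n k. v (Inl j) = dot R ?L u (%l. M k j l [^] p ^ e))"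
 proof (induction rule: lspan.induct)
  case (zero v)
  have "\<forall>j<n k. v (Inl j) = dot R ?L (%_. \<zero>) (%l. M k j l [^] p ^ e)"
   using zero M_closed by (auto intro!: dot_zero[symmetric])
  then show ?case by (intro exI[of _ "%_. \<zero>"]) auto
 next
  case (step x g s v)
  obtain u where u: "\<forall>l<fm_pred n k. u l \<in> CR" "\<forall>j<n k. x (Inl j) = dot R ?L u (%l. M k j l [^] p ^ e)"
   using step(5) by blast
  obtain y where y: "g = (%i. y i [^] p ^ e)" "\<forall>i. y i \<in> CR" "\<forall>j\<in>?J. dot R ?I y (%i. X i j) = \<zero>"
   using step(2) by (auto simp: q.fker_def)
  let ?y = "%x. dot R ?N (%j. y (Inl j)) x"
  have yh: "?y \<in> mod_hom R (P k) S" using y(2) by (intro form_hom) auto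
  have yb: "?y (bv j) = y (Inl j)" if "j < n k" for j using that y(2) by (intro dot_basis) auto
  have "?y (D 0 k x) = \<zero>" if x: "x \<in> carrier (P (Suc k))" for x
  proof (rule lin_ext_zero_on_basis[OF self_module x mod_hom_comp[OF D_hom yh], simplified])
   fix m assume m: "m < n (Suc k)"
   have "dot R ?I y (%i. X i (Inl m)) = ?y (d k (bv m)) \<oplus> dot R ?L (%l. y (Inr l)) (%l. \<zero>)"
    using m y(2) fm_closed[OF db] by (subst dot_Plus) (auto simp: X_def)
   also have "dot R ?L (%l. y (Inr l)) (%l. \<zero>) = dot R ?L (%l. \<zero>) (%l. y (Inr l))"
    using y(2) by (intro dot_comm) auto
   also have "... = \<zero>" using y(2) by (intro dot_zero) auto
   finally have "?y (d k (bv m)) = \<zero>" using y(3) m mod_homD(1)[OF yh db[OF m]] by auto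
   moreover have "D 0 k (bv m) = d k (bv m)"
    using D_basis[OF m, of 0] fm_closed[OF db[OF m]] by simp
   ultimately show "?y (D 0 k (bv m)) = \<zero>" by simp
  qed
  \<comment> \<open>The second family of equations, read for the untwisted solution y, says that y B
    is a coboundary on the first twist.\<close>
  moreover have "cob 1 k (%x. ?y (B k x))"
   unfolding cob_iff[OF mod_hom_comp[OF chain_mapD(1)[OF B_chain] yh]]
  proof (intro exI[of _ "%l. \<ominus> y (Inr l)"] conjI allI impI)
   fix i assume i: "i < n k"
   have "dot R ?I y (%t. X t (Inr i)) = ?y (B k (bv i)) \<oplus> dot R ?L (%l. y (Inr l)) (%l. M k i l [^] p)"
    using i y(2) fm_closed[OF Bb] M_closed by (subst dot_Plus) (auto simp: X_def)
   then have 0: "?y (B k (bv i)) \<oplus> dot R ?L (%l. y (Inr l)) (%l. M k i l [^] p) = \<zero>" using y(3) i by auto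
   have "dot R ?L (%l. y (Inr l)) (%l. M k i l [^] p) \<in> CR" using y(2) M_closed[OF i] by (intro dot_closed) auto
   moreover have "?y (B k (bv i)) \<in> CR" using mod_homD(1)[OF yh Bb[OF i]] by simp
   ultimately have "?y (B k (bv i)) = \<ominus> dot R ?L (%l. y (Inr l)) (%l. M k i l [^] p)"
    using minus_equality[OF 0] by simp
   also have "... = dot R ?L (%l. \<ominus> y (Inr l)) (%l. M k i l [^] p)"
    using y(2) M_closed[OF i] by (intro dot_uminus[symmetric]) auto
   finally show "?y (B k (bv i)) = dot R ?L (%l. \<ominus> y (Inr l)) (%l. M k i l [^] p ^ 1)" by simp
  qed (use y(2) in simp)
  ultimately have "cob 0 k ?y" using twist_injective_0[OF yh] by blast
  then obtain t where t: "\<forall>l<fm_pred n k. t l \<in> CR" "\<forall>j<n k. y (Inl j) = dot R ?L t (%l. M k j l [^] p ^ 0)"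
   unfolding cob_iff[OF yh] using yb by auto
  \<comment> \<open>From y = t M follows y^q = t^q M^q by additivity of the \<open>q\<close>-th
    power, so t^q is what the new generator adds to u.\<close>
  show ?case
  proof (intro exI[of _ "%l. u l \<oplus> s \<otimes> t l [^] p ^ e"] conjI allI impI)
   fix j assume j: "j < n k"
   have "g (Inl j) = dot R ?L t (%l. M k j l [^] p ^ 0) [^] p ^ e" using y(1) t(2) j by simp
   also have "... = dot R ?L t (%l. M k j l) [^] p ^ e" using t M_closed[OF j] by (intro arg_cong[where f = "%x. x [^] p ^ e"] dot_cong) auto
   also have "... = dot R ?L (%l. t l [^] p ^ e) (%l. M k j l [^] p ^ e)"
    using t(1) M_closed[OF j] by (intro dot_frob[OF frq]) auto
   finally have "v (Inl j) = dot R ?L u (%l. M k j l [^] p ^ e) \<oplus> s \<otimes> dot R ?L (%l. t l [^] p ^ e) (%l. M k j l [^] p ^ e)"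
    using step(4) u(2) j by auto
   also have "... = dot R ?L (%l. u l \<oplus> s \<otimes> t l [^] p ^ e) (%l. M k j l [^] p ^ e)"
    using u(1) t(1) M_closed[OF j] step(3) by (intro dot_lin[symmetric]) auto
   finally show "v (Inl j) = dot R ?L (%l. u l \<oplus> s \<otimes> t l [^] p ^ e) (%l. M k j l [^] p ^ e)" .
  qed (use u t step(3) in auto)
 qed
 then show ?thesis unfolding cob_iff[OF z] by (simp add: v_def \<zeta>_def)
qed

end

section \<open>Comparison with the standard resolution\<close>

abbreviation "res_cplx R M \<equiv> (%k. free_module R (res_basis R M k))"

abbreviation (in cring) "rcob M \<equiv> coboundary R (res_cplx R M) (%k. res_bd R)"

context cring
begin

lemma quot_facts:
 assumes J: "ideal J R"
 shows "module R (cyclic_module R J)"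
  and "!!C. C \<in> carrier (cyclic_module R J) ==> \<exists>a\<in>CR. C = J +> a"
  and "(%r. J +> r) \<in> mod_hom R (SM) (cyclic_module R J)"
  and "!!a. a \<in> CR ==> J +> a = \<zero>\<^bsub>cyclic_module R J\<^esub> \<longleftrightarrow> a \<in> J"
proof -
 let ?M = "cyclic_module R J"
 interpret J: ideal J R by fact
 interpret Q: cring "R Quot J" by (rule J.quotient_is_cring[OF is_cring])
 interpret \<pi>: ring_hom_cring R "R Quot J" "(+>) J" by (rule J.rcos_ring_hom_cring[OF is_cring])
 have eqs: "carrier ?M = carrier (R Quot J)" "add ?M = add (R Quot J)"
  "zero ?M = zero (R Quot J)" "!!r x. r \<odot>\<^bsub>?M\<^esub> x = (J +> r) \<otimes>\<^bsub>R Quot J\<^esub> x"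
  by (simp_all add: ring_as_module_def)
 show "module R ?M"
 proof (rule moduleI)
  show "cring R" by (rule is_cring)
  show "abelian_group ?M"
  proof (rule abelian_groupI)
   fix x assume "x \<in> carrier ?M"
   then show "\<exists>y\<in>carrier ?M. y \<oplus>\<^bsub>?M\<^esub> x = \<zero>\<^bsub>?M\<^esub>"
    by (intro bexI[of _ "\<ominus>\<^bsub>R Quot J\<^esub> x"]) (simp_all add: eqs Q.l_neg)
  qed (simp_all add: eqs Q.a_assoc, simp add: Q.a_comm)
 qed (simp_all add: eqs Q.l_distr Q.r_distr Q.m_assoc)
 show "\<exists>a\<in>CR. C = J +> a" if "C \<in> carrier ?M" for C
 proof -
  have "C \<in> carrier (R Quot J)" using that by (simp only: eqs)
  then have "C \<in> (\<Union>t\<in>CR. {J +> t})" unfolding FactRing_def A_RCOSETS_def' by simp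
  then show ?thesis by (elim UN_E) (rule bexI, rule singletonD)
 qed
 show "(%r. J +> r) \<in> mod_hom R (SM) ?M"
  by (auto simp: mod_hom_def eqs)
 show "J +> a = \<zero>\<^bsub>?M\<^esub> \<longleftrightarrow> a \<in> J" if "a \<in> CR" for a
  using quotient_eq_iff_same_a_r_cos[OF J that zero_closed] that \<pi>.hom_zero by (simp add: eqs minus_eq)
qed

lemma quot_map:
 assumes J: "ideal J R" and J': "ideal J' R" and sub: "J' \<subseteq> J"
 shows "a \<in> CR ==> J <+>\<^bsub>R\<^esub> (J' +> a) = J +> a"
  and "(%C. J <+>\<^bsub>R\<^esub> C) \<in> mod_hom R (cyclic_module R J') (cyclic_module R J)"
proof -
 let ?M = "cyclic_module R J" and ?M' = "cyclic_module R J'"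
 interpret J: ideal J R by fact
 interpret J': ideal J' R by fact
 show e: "J <+>\<^bsub>R\<^esub> (J' +> a) = J +> a" if a: "a \<in> CR" for a
 proof (intro equalityI subsetI)
  fix x assume "x \<in> J <+>\<^bsub>R\<^esub> (J' +> a)"
  then obtain j j' where j: "j \<in> J" "j' \<in> J'" "x = j \<oplus> (j' \<oplus> a)" by (auto simp: set_add_def' a_r_coset_def')
  have "j' \<in> J" using j sub by blast
  then have "x = (j \<oplus> j') \<oplus> a" "j \<oplus> j' \<in> J" using j a by (auto simp: a_assoc)
  then show "x \<in> J +> a" unfolding a_r_coset_def' by blast
 next
  fix x assume "x \<in> J +> a"
  then obtain j where j: "j \<in> J" "x = j \<oplus> a" by (auto simp: a_r_coset_def')
  then have "x = j \<oplus> (\<zero> \<oplus> a)" using a by simp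
  moreover have "\<zero> \<in> J'" by simp
  ultimately show "x \<in> J <+>\<^bsub>R\<^esub> (J' +> a)" using j unfolding set_add_def' a_r_coset_def' by blast
 qed
 note q = quot_facts[OF J] and q' = quot_facts[OF J']
 note h = mod_homD[OF q(3)] and h' = mod_homD[OF q'(3)]
 interpret M: module R "cyclic_module R J" by (rule q(1))
 show "(%C. J <+>\<^bsub>R\<^esub> C) \<in> mod_hom R ?M' ?M"
  unfolding mod_hom_def
 proof (intro CollectI conjI ballI funcsetI)
  fix C assume "C \<in> carrier ?M'"
  then obtain a where a: "a \<in> CR" "C = J' +> a" using q'(2) by blast
  show "J <+>\<^bsub>R\<^esub> C \<in> carrier ?M" using e[OF a(1)] a h(1) by simp
  fix C' assume "C' \<in> carrier ?M'"
  then obtain a' where a': "a' \<in> CR" "C' = J' +> a'" using q'(2) by blast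
  have "J' +> (a \<oplus> a') = (J' +> a) \<oplus>\<^bsub>?M'\<^esub> (J' +> a')" using h'(2)[of a a'] a(1) a'(1) by simp
  moreover have "J +> (a \<oplus> a') = (J +> a) \<oplus>\<^bsub>?M\<^esub> (J +> a')" using h(2)[of a a'] a(1) a'(1) by simp
  ultimately show "J <+>\<^bsub>R\<^esub> (C \<oplus>\<^bsub>?M'\<^esub> C') = (J <+>\<^bsub>R\<^esub> C) \<oplus>\<^bsub>?M\<^esub> (J <+>\<^bsub>R\<^esub> C')"
   unfolding a(2) a'(2) using e[OF a(1)] e[OF a'(1)] e[of "a \<oplus> a'"] a(1) a'(1) by simp
 next
  fix r C assume r: "r \<in> CR" and "C \<in> carrier ?M'"
  then obtain a where a: "a \<in> CR" "C = J' +> a" using q'(2) by blast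
  have "J' +> (r \<otimes> a) = r \<odot>\<^bsub>?M'\<^esub> (J' +> a)" using h'(3)[OF r, of a] a(1) by simp
  moreover have "J +> (r \<otimes> a) = r \<odot>\<^bsub>?M\<^esub> (J +> a)" using h(3)[OF r, of a] a(1) by simp
  ultimately show "J <+>\<^bsub>R\<^esub> (r \<odot>\<^bsub>?M'\<^esub> C) = r \<odot>\<^bsub>?M\<^esub> (J <+>\<^bsub>R\<^esub> C)"
   unfolding a(2) using e[OF a(1)] e[of "r \<otimes> a"] r a(1) by simp
 qed
qed

lemma res_acyclic: "acyclic_cplx R (res_cplx R M) (%k. res_bd R)"
proof -
 have "res_bd R \<in> mod_hom R (res_cplx R M (Suc k)) (res_cplx R M k)" for k
  using res_bd_hom[of M k] unfolding res_module_def .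
 moreover have "res_bd R ` carrier (res_cplx R M (Suc (Suc k))) =
   {f \<in> carrier (res_cplx R M (Suc k)). res_bd R f = (%_. \<zero>)}" for k
  using res_exact_Suc[of M k] unfolding res_module_def .
 ultimately show ?thesis unfolding acyclic_cplx_def cplx_def using free_module_module
  by (auto simp del: res_basis.simps)
qed

lemma res_map_chain:
 assumes "module R M" "module R M'" "h \<in> mod_hom R M M'"
 shows "chain_map R (res_cplx R M) (%k. res_bd R) (res_cplx R M') (%k. res_bd R) (%k. res_map R h)"
proof -
 note r = res_map_chain_map[OF assms]
 have "res_map R h \<in> mod_hom R (res_cplx R M k) (res_cplx R M' k)" for k
 proof -
  have "res_map R h f \<in> carrier (res_cplx R M' k)" if "f \<in> carrier (res_cplx R M k)" for f
   unfolding res_map_def using that r(1)[of _ k] by (intro lin_extend_free(2)) (auto intro: basis_vec_closed)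
  moreover have "f \<in> carrier (FM UNIV)" if "f \<in> carrier (res_cplx R M k)" for f
   by (rule free_module_mono[OF that subset_UNIV])
  ultimately show ?thesis using mod_homD(2,3)[OF res_map_hom_UNIV[of h]] unfolding mod_hom_def by simp
 qed
 then show ?thesis unfolding chain_map_def using r(3) unfolding res_module_def by blast
qed

end

section \<open>Comparison of finite and standard resolutions of R/I^[p^e]\<close>

context frob_res
begin

abbreviation "Jp e \<equiv> frobenius_power R I (p ^ e)"
abbreviation "Mp e \<equiv> cyclic_module R (Jp e)"
abbreviation "Rs e \<equiv> res_cplx R (Mp e)"

lemma Jp_ideal: "ideal (Jp e) R"
 using fp_ideal[OF idealD(1)[OF I]] .

lemma Jp_Suc: "Jp (Suc e) \<subseteq> Jp e"
proof -
 have "Jp (Suc e) = FP (Jp e) (p ^ 1)"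
  using fp_fp[OF frq frq I, of e 1] by (simp add: mult.commute)
 then show ?thesis using fp_sub[OF Jp_ideal] ppos by simp
qed

lemma aug_im: "res_bd R ` carrier (Rs e 1) = {f \<in> carrier (Rs e 0). res_aug R (Mp e) f = \<zero>\<^bsub>Mp e\<^esub>}"
 using module.res_exact_0(2)[OF quot_facts(1)[OF Jp_ideal]] unfolding res_module_def .

lemma aug_hom: "res_aug R (Mp e) \<in> mod_hom R (Rs e 0) (Mp e)"
 using module.res_aug_hom[OF quot_facts(1)[OF Jp_ideal]] unfolding res_module_def .

definition "gen1 e = Gen (Jp e +> \<one>)"

lemma gen1: "gen1 e \<in> res_basis R (Mp e) 0"
 using mod_homD(1)[OF quot_facts(3)[OF Jp_ideal]] by (simp add: gen1_def)

lemma aug_basis: "m \<in> carrier (Mp e) ==> res_aug R (Mp e) (bv (Gen m)) = m"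
proof -
 assume m: "m \<in> carrier (Mp e)"
 interpret M: module R "Mp e" by (rule quot_facts(1)[OF Jp_ideal])
 show ?thesis unfolding res_aug_def using m by (subst M.lin_extend_basis_vec[where B = "Gen ` carrier (Mp e)"]) auto
qed

text \<open>The degree-0 formula is kept in the conclusion because it makes the lifts for e and e +
  1 commute with \<open>res_map\<close> exactly in degree 0: the class of 1 goes to the class of
  1.\<close>

lemma ex_from_finite: "\<exists>f. (\<forall>x. f 0 x = x 0 \<odot>\<^bsub>Rs e 0\<^esub> bv (gen1 e)) \<and>
  chain_map R P (D e) (Rs e) (%k. res_bd R) f \<and>
  (\<forall>x\<in>carrier (P 0). res_aug R (Mp e) (f 0 x) = Jp e +> x 0)"
proof -
 interpret F: module R "Rs e 0" by (rule free_module_module)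
 interpret P0: module R "P 0" by (rule free_module_module)
 let ?b = "bv (gen1 e)"
 let ?f = "%x. x 0 \<odot>\<^bsub>Rs e 0\<^esub> ?b"
 have bc: "?b \<in> carrier (Rs e 0)" by (rule basis_vec_closed[OF gen1])
 note aug = mod_homD[OF aug_hom]
 have fh: "?f \<in> mod_hom R (P 0) (Rs e 0)"
  unfolding mod_hom_def
 proof (intro CollectI conjI ballI funcsetI)
  fix x assume x: "x \<in> carrier (P 0)"
  show "?f x \<in> carrier (Rs e 0)" by (rule F.smult_closed[OF fm_closed[OF x] bc])
  fix y assume y: "y \<in> carrier (P 0)"
  show "?f (x \<oplus>\<^bsub>P 0\<^esub> y) = ?f x \<oplus>\<^bsub>Rs e 0\<^esub> ?f y"
   using F.smult_l_distr[OF fm_closed[OF x] fm_closed[OF y] bc] by simp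
 next
  fix r x assume r: "r \<in> CR" and x: "x \<in> carrier (P 0)"
  show "?f (r \<odot>\<^bsub>P 0\<^esub> x) = r \<odot>\<^bsub>Rs e 0\<^esub> ?f x"
   using F.smult_assoc1[OF r fm_closed[OF x] bc] by simp
 qed
 have af: "res_aug R (Mp e) (?f x) = Jp e +> x 0" if x: "x \<in> carrier (P 0)" for x
 proof -
  have "res_aug R (Mp e) (?f x) = x 0 \<odot>\<^bsub>Mp e\<^esub> res_aug R (Mp e) ?b" by (rule aug(3)[OF fm_closed[OF x] bc])
  also have "res_aug R (Mp e) ?b = Jp e +> \<one>" using aug_basis gen1 by (auto simp: gen1_def)
  also have "x 0 \<odot>\<^bsub>Mp e\<^esub> (Jp e +> \<one>) = Jp e +> x 0"
   using mod_homD(3)[OF quot_facts(3)[OF Jp_ideal] fm_closed[OF x], of \<one> e] fm_closed[OF x] by simp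
  finally show ?thesis .
 qed
 have "\<exists>f. f 0 = ?f \<and> chain_map R P (D e) (Rs e) (%k. res_bd R) f"
 proof (rule chain_map_lift[OF D_cplx res_acyclic fh], intro ballI)
  fix x assume x: "x \<in> carrier (P 1)"
  have Dx: "D e 0 x \<in> carrier (P 0)" "D e 0 x 0 \<in> Jp e" using im_D0[of e] x by auto
  have "?f (D e 0 x) \<in> {f \<in> carrier (Rs e 0). res_aug R (Mp e) f = \<zero>\<^bsub>Mp e\<^esub>}"
   using mod_homD(1)[OF fh Dx(1)] af[OF Dx(1)] quot_facts(4)[OF Jp_ideal fm_closed[OF Dx(1)]] Dx(2) by auto
  then show "?f (D e 0 x) \<in> res_bd R ` carrier (Rs e 1)" unfolding aug_im .
 qed
 then obtain f where f: "f 0 = ?f" "chain_map R P (D e) (Rs e) (%k. res_bd R) f" by blast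
 then show ?thesis using af by (intro exI[of _ f] conjI) simp_all
qed

text \<open>In degree 0 the basis element of a coset is sent to a chosen representative
  \<open>rp\<close> of it.\<close>

lemma ex_to_finite: "\<exists>g. chain_map R (Rs e) (%k. res_bd R) P (D e) g \<and>
  (\<forall>x\<in>carrier (Rs e 0). Jp e +> g 0 x 0 = res_aug R (Mp e) x)"
proof -
 interpret P0: module R "P 0" by (rule free_module_module)
 interpret M: module R "Mp e" by (rule quot_facts(1)[OF Jp_ideal])
 note q = quot_facts[OF Jp_ideal]
 have "\<forall>C\<in>carrier (Mp e). \<exists>a. a \<in> CR \<and> C = Jp e +> a" using q(2) by blast
 then obtain rp where rp: "\<forall>C\<in>carrier (Mp e). rp C \<in> CR \<and> C = Jp e +> rp C" by metis
 have b0: "bv (0::nat) \<in> carrier (P 0)" by (rule basis_vec_closed) (simp add: n0)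
 let ?h = "%c. rp (gen_of c) \<odot>\<^bsub>P 0\<^esub> bv (0::nat)"
 have h: "?h \<in> res_basis R (Mp e) 0 \<rightarrow> carrier (P 0)"
  using rp by (auto intro!: P0.smult_closed b0 simp del: free_module_simps)
 let ?g = "lin_extend R (P 0) ?h"
 have gh: "?g \<in> mod_hom R (Rs e 0) (P 0)" by (rule P0.lin_extend_hom[OF h])
 have ga: "Jp e +> ?g x 0 = res_aug R (Mp e) x" if x: "x \<in> carrier (Rs e 0)" for x
 proof (rule lin_list_vec[OF q(1) mod_hom_comp[OF coord_hom[OF gh] q(3)] aug_hom _ x])
  fix c assume c: "c \<in> res_basis R (Mp e) 0"
  then obtain m where m: "c = Gen m" "m \<in> carrier (Mp e)" by auto
  have "?g (bv c) = ?h c" by (rule P0.lin_extend_basis_vec[OF c h])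
  then have "?g (bv c) 0 = rp m" using rp m by (simp add: basis_vec_def)
  then show "Jp e +> ?g (bv c) 0 = res_aug R (Mp e) (bv c)"
   using rp m aug_basis by simp
 qed
 have "\<exists>g. g 0 = ?g \<and> chain_map R (Rs e) (%k. res_bd R) P (D e) g"
 proof (rule chain_map_lift[OF acyclic_cplxD(1)[OF res_acyclic] D_acyclic gh], intro ballI)
  fix x assume x: "x \<in> carrier (Rs e 1)"
  then have "res_bd R x \<in> {f \<in> carrier (Rs e 0). res_aug R (Mp e) f = \<zero>\<^bsub>Mp e\<^esub>}" unfolding aug_im[symmetric] by blast
  then have r: "res_bd R x \<in> carrier (Rs e 0)" "res_aug R (Mp e) (res_bd R x) = \<zero>\<^bsub>Mp e\<^esub>" by blast+
  have gr: "?g (res_bd R x) \<in> carrier (P 0)" by (rule mod_homD(1)[OF gh r(1)])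
  have "?g (res_bd R x) 0 \<in> Jp e" using ga[OF r(1)] r(2) q(4)[OF fm_closed[OF gr]] by simp
  then show "?g (res_bd R x) \<in> D e 0 ` carrier (P 1)" unfolding im_D0 using gr by blast
 qed
 then obtain g where g: "g 0 = ?g" "chain_map R (Rs e) (%k. res_bd R) P (D e) g" by blast
 then show ?thesis using ga by (intro exI[of _ g] conjI) simp_all
qed

text \<open>Transport to the finite resolutions: pulling z f back along \<open>b e\<close> gives, up
  to a coboundary, the pullback of z along \<open>res_map\<close> and then f', which is a
  coboundary. So \<open>twist_injective\<close> applies to z f; pulling back along g and using that
  f g is homotopic to the identity returns to z.\<close>

theorem transition_injective:
 assumes z: "z \<in> mod_hom R (Rs e k) S" and cyc: "\<forall>x\<in>carrier (Rs e (Suc k)). z (res_bd R x) = \<zero>"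
  and cob: "rcob (Mp (Suc e)) S k (%x. z (res_map R (%C. Jp e <+>\<^bsub>R\<^esub> C) x))"
 shows "rcob (Mp e) S k z"
proof -
 let ?h = "%C. Jp e <+>\<^bsub>R\<^esub> C"
 interpret F: module R "Rs e 0" by (rule free_module_module)
 interpret M: module R "Mp e" by (rule quot_facts(1)[OF Jp_ideal])
 note q = quot_facts[OF Jp_ideal] and h = quot_map[OF Jp_ideal Jp_ideal Jp_Suc]
 obtain f where f0: "\<forall>x. f 0 x = x 0 \<odot>\<^bsub>Rs e 0\<^esub> bv (gen1 e)" and f: "chain_map R P (D e) (Rs e) (%k. res_bd R) f"
  and fa: "\<forall>x\<in>carrier (P 0). res_aug R (Mp e) (f 0 x) = Jp e +> x 0" using ex_from_finite by blast
 obtain f' where f0': "\<forall>x. f' 0 x = x 0 \<odot>\<^bsub>Rs (Suc e) 0\<^esub> bv (gen1 (Suc e))"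
  and f': "chain_map R P (D (Suc e)) (Rs (Suc e)) (%k. res_bd R) f'" using ex_from_finite by blast
 obtain g where g: "chain_map R (Rs e) (%k. res_bd R) P (D e) g"
  and ga: "\<forall>x\<in>carrier (Rs e 0). Jp e +> g 0 x 0 = res_aug R (Mp e) x" using ex_to_finite by blast
 have rm: "chain_map R (Rs (Suc e)) (%k. res_bd R) (Rs e) (%k. res_bd R) (%k. res_map R ?h)"
  by (rule res_map_chain[OF q(1) q(1) h(2)])
 have zf: "(%x. z (f k x)) \<in> mod_hom R (P k) S" by (rule mod_hom_comp[OF chain_mapD(1)[OF f] z])
 have zfc: "\<forall>x\<in>carrier (P (Suc k)). z (f k (D e k x)) = \<zero>"
 proof
  fix x assume x: "x \<in> carrier (P (Suc k))"
  have "z (f k (D e k x)) = z (res_bd R (f (Suc k) x))" using chain_mapD(2)[OF f x] by simp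
  then show "z (f k (D e k x)) = \<zero>" using cyc mod_homD(1)[OF chain_mapD(1)[OF f] x] by simp
 qed
 have cob': "cob (Suc e) k (%x. z (res_map R ?h (f' k x)))"
  using coboundary_pull[OF f' cob] .
 have "cob (Suc e) k (%x. z (f k (b e k x)))"
 proof (rule coboundary_homotopic[where z = z and v = "%k x. res_map R ?h (f' k x)" and u = "%k x. f k (b e k x)",
    OF D_cplx res_acyclic chain_map_comp[OF b_chain f] chain_map_comp[OF f' rm] _ self_module z _ cob'])
  show "\<forall>x\<in>carrier (P 0). f 0 (b e 0 x) \<ominus>\<^bsub>Rs e 0\<^esub> res_map R ?h (f' 0 x) \<in> res_bd R ` carrier (Rs e 1)"
  proof
   fix x assume x: "x \<in> carrier (P 0)"
   have bc: "bv (gen1 (Suc e)) \<in> carrier (Rs (Suc e) 0)" by (rule basis_vec_closed[OF gen1])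
   have "res_map R ?h (f' 0 x) = x 0 \<odot>\<^bsub>Rs e 0\<^esub> res_map R ?h (bv (gen1 (Suc e)))"
    using mod_homD(3)[OF chain_mapD(1)[OF rm] fm_closed[OF x] bc] f0' by simp
   also have "res_map R ?h (bv (gen1 (Suc e))) = bv (gen1 e)"
    by (simp add: res_map_basis gen1_def h(1) del: power_Suc)
   finally have "res_map R ?h (f' 0 x) = f 0 x" using f0 by simp
   moreover have "f 0 x \<in> carrier (Rs e 0)" by (rule mod_homD(1)[OF chain_mapD(1)[OF f] x])
   ultimately have "f 0 (b e 0 x) \<ominus>\<^bsub>Rs e 0\<^esub> res_map R ?h (f' 0 x) = \<zero>\<^bsub>Rs e 0\<^esub>"
    using b0[OF x] by (simp only: F.minus_eq F.r_neg)
   moreover have "\<zero>\<^bsub>Rs e 0\<^esub> \<in> res_bd R ` carrier (Rs e 1)"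
    unfolding aug_im using F.zero_closed mod_hom_zero[OF free_module_module q(1) aug_hom] by blast
   ultimately show "f 0 (b e 0 x) \<ominus>\<^bsub>Rs e 0\<^esub> res_map R ?h (f' 0 x) \<in> res_bd R ` carrier (Rs e 1)" by simp
  qed
 qed (use cyc in simp)
 then have "cob e k (%x. z (f k x))" by (rule twist_injective[OF zf zfc])
 then have cobg: "rcob (Mp e) S k (%x. z (f k (g k x)))" using coboundary_pull[OF g] by blast
 show ?thesis
 proof (rule coboundary_homotopic[where z = z and v = "%k x. f k (g k x)" and u = "%k x. x",
    OF acyclic_cplxD(1)[OF res_acyclic] res_acyclic chain_map_id[OF acyclic_cplxD(1)[OF res_acyclic]]
     chain_map_comp[OF g f] _ self_module z _ cobg])
  show "\<forall>x\<in>carrier (Rs e 0). x \<ominus>\<^bsub>Rs e 0\<^esub> f 0 (g 0 x) \<in> res_bd R ` carrier (Rs e 1)"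
  proof
   fix x assume x: "x \<in> carrier (Rs e 0)"
   have gx: "g 0 x \<in> carrier (P 0)" by (rule mod_homD(1)[OF chain_mapD(1)[OF g] x])
   have fg: "f 0 (g 0 x) \<in> carrier (Rs e 0)" by (rule mod_homD(1)[OF chain_mapD(1)[OF f] gx])
   have "res_aug R (Mp e) (f 0 (g 0 x)) = res_aug R (Mp e) x" using fa ga x gx by simp
   then have "res_aug R (Mp e) (x \<ominus>\<^bsub>Rs e 0\<^esub> f 0 (g 0 x)) = \<zero>\<^bsub>Mp e\<^esub>"
    using mod_hom_diff[OF free_module_module q(1) aug_hom x fg] mod_homD(1)[OF aug_hom x] by (simp only: M.minus_eq M.r_neg)
   then show "x \<ominus>\<^bsub>Rs e 0\<^esub> f 0 (g 0 x) \<in> res_bd R ` carrier (Rs e 1)"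
    unfolding aug_im using F.minus_closed[OF x fg] by blast
  qed
 qed (use cyc in simp)
qed

end

section \<open>Ext and local cohomology\<close>

lemma (in cring) Hom_module_group:
 assumes N: "module R N" and M: "module R M"
 shows "abelian_group (Hom_module R M N)"
proof (rule abelian_groupI)
 interpret N: module R N by fact
 interpret M: module R M by fact
 let ?H = "Hom_module R M N"
 have car: "carrier ?H = mod_hom R M N \<inter> extensional (carrier M)"
  and add: "!!f g. f \<oplus>\<^bsub>?H\<^esub> g = (\<lambda>x\<in>carrier M. f x \<oplus>\<^bsub>N\<^esub> g x)"
  and zero: "\<zero>\<^bsub>?H\<^esub> = (\<lambda>x\<in>carrier M. \<zero>\<^bsub>N\<^esub>)"
  by (simp_all add: Hom_module_def)
 have restr: "restrict f (carrier M) \<in> carrier ?H" if "f \<in> mod_hom R M N" for f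
  using that unfolding car mod_hom_def by auto
 have val: "f x \<in> carrier N" if "f \<in> carrier ?H" "x \<in> carrier M" for f x
  using that mod_homD(1)[of f R M N x] by (simp add: car)
 have ext: "f = g" if "f \<in> carrier ?H" "g \<in> extensional (carrier M)" "!!x. x \<in> carrier M ==> f x = g x" for f g
  using that unfolding car by (intro extensionalityI[of f "carrier M" g]) auto
 show z: "\<zero>\<^bsub>?H\<^esub> \<in> carrier ?H" unfolding zero by (rule restr[OF mod_hom_zero_closed[OF N]])
 fix f assume f: "f \<in> carrier ?H"
 then have fh: "f \<in> mod_hom R M N" by (simp add: car)
 show "\<zero>\<^bsub>?H\<^esub> \<oplus>\<^bsub>?H\<^esub> f = f"
  by (rule ext[OF f, symmetric]) (simp_all add: add zero val[OF f])
 have "(%x. \<zero>\<^bsub>N\<^esub> \<ominus>\<^bsub>N\<^esub> f x) \<in> mod_hom R M N" by (rule mod_hom_diff_closed[OF N mod_hom_zero_closed[OF N] fh])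
 from restr[OF this] show "\<exists>y\<in>carrier ?H. y \<oplus>\<^bsub>?H\<^esub> f = \<zero>\<^bsub>?H\<^esub>"
  by (rule bexI[rotated]) (auto simp: add zero N.minus_eq N.l_neg val[OF f] intro!: restrict_ext)
 fix g assume g: "g \<in> carrier ?H"
 then have gh: "g \<in> mod_hom R M N" by (simp add: car)
 show fg: "f \<oplus>\<^bsub>?H\<^esub> g \<in> carrier ?H" unfolding add by (rule restr[OF mod_hom_add_closed[OF N fh gh]])
 show "f \<oplus>\<^bsub>?H\<^esub> g = g \<oplus>\<^bsub>?H\<^esub> f"
  unfolding add by (rule restrict_ext) (simp add: N.a_comm val[OF f] val[OF g])
 fix h assume h: "h \<in> carrier ?H"
 show "(f \<oplus>\<^bsub>?H\<^esub> g) \<oplus>\<^bsub>?H\<^esub> h = f \<oplus>\<^bsub>?H\<^esub> (g \<oplus>\<^bsub>?H\<^esub> h)"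
  unfolding add by (rule restrict_ext) (simp add: N.a_assoc val[OF f] val[OF g] val[OF h])
qed

lemma (in cring) Ext_cochains_simps:
 shows "carrier (Ext_cochains R M N i) = mod_hom R (res_cplx R M i) N \<inter> extensional (carrier (res_cplx R M i))"
  and "f \<oplus>\<^bsub>Ext_cochains R M N i\<^esub> g = (\<lambda>x\<in>carrier (res_cplx R M i). f x \<oplus>\<^bsub>N\<^esub> g x)"
  and "\<zero>\<^bsub>Ext_cochains R M N i\<^esub> = (\<lambda>x\<in>carrier (res_cplx R M i). \<zero>\<^bsub>N\<^esub>)"
 by (simp_all add: Ext_cochains_def Hom_module_def res_module_def)

lemma (in cring) Ext_cochains_group: "module R N ==> abelian_group (Ext_cochains R M N i)"
 unfolding Ext_cochains_def res_module_def by (rule Hom_module_group[OF _ free_module_module])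

lemma (in cring) Ext_cocycles_iff:
 "\<phi> \<in> Ext_cocycles R M N i \<longleftrightarrow> \<phi> \<in> carrier (Ext_cochains R M N i) \<and>
  (\<forall>x\<in>carrier (res_cplx R M (Suc i)). \<phi> (res_bd R x) = \<zero>\<^bsub>N\<^esub>)"
 unfolding Ext_cocycles_def Ext_diff_def Ext_cochains_simps res_module_def
 by (auto simp: restrict_def fun_eq_iff simp del: res_basis.simps split: if_splits)

text \<open>Bridge between Ext, whose cochains are extensional functions, and
  \<open>coboundary\<close>, which looks only at values on the carriers.\<close>

lemma (in cring) Ext_coboundaries_iff:
 assumes N: "module R N"
 shows "\<phi> \<in> Ext_coboundaries R M N i \<longleftrightarrow> \<phi> \<in> carrier (Ext_cochains R M N i) \<and>
  rcob M N i \<phi>"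
proof (cases i)
 case 0
 have "\<phi> = (\<lambda>x\<in>carrier (res_cplx R M 0). \<zero>\<^bsub>N\<^esub>)"
  if "\<phi> \<in> extensional (carrier (res_cplx R M 0))" "\<forall>x\<in>carrier (res_cplx R M 0). \<phi> x = \<zero>\<^bsub>N\<^esub>"
  using that by (intro extensionalityI[of \<phi> "carrier (res_cplx R M 0)"]) auto
 moreover have "(\<lambda>x\<in>carrier (res_cplx R M 0). \<zero>\<^bsub>N\<^esub>) \<in> carrier (Ext_cochains R M N 0)"
  using abelian_group.axioms(1)[OF Ext_cochains_group[OF N], THEN abelian_monoid.zero_closed]
  unfolding Ext_cochains_simps(3) .
 ultimately show ?thesis unfolding 0 by (auto simp: Ext_cochains_simps simp del: res_basis.simps)
next
 case (Suc k)
 note bd = cplxD(2)[OF acyclic_cplxD(1)[OF res_acyclic[of M]], of k]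
 show ?thesis
 proof
  assume "\<phi> \<in> Ext_coboundaries R M N i"
  then obtain w where w: "w \<in> carrier (Ext_cochains R M N k)"
   "\<phi> = (\<lambda>x\<in>carrier (res_cplx R M (Suc k)). w (res_bd R x))"
   by (auto simp: Suc Ext_diff_def res_module_def simp del: res_basis.simps)
  have wh: "w \<in> mod_hom R (res_cplx R M k) N" using w(1) by (simp add: Ext_cochains_simps)
  interpret F: module R "res_cplx R M (Suc k)" by (rule free_module_module)
  have "\<phi> \<in> mod_hom R (res_cplx R M (Suc k)) N"
   using mod_hom_comp[OF bd wh] unfolding mod_hom_def w(2)
   by (auto simp del: res_basis.simps free_module_simps)
  then show "\<phi> \<in> carrier (Ext_cochains R M N i) \<and> rcob M N i \<phi>"
   using wh by (auto simp: Suc Ext_cochains_simps w(2) simp del: res_basis.simps)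
 next
  assume *: "\<phi> \<in> carrier (Ext_cochains R M N i) \<and> rcob M N i \<phi>"
  then obtain w where w: "w \<in> mod_hom R (res_cplx R M k) N" "\<forall>x\<in>carrier (res_cplx R M (Suc k)). \<phi> x = w (res_bd R x)"
   by (auto simp: Suc simp del: res_basis.simps)
  let ?w = "restrict w (carrier (res_cplx R M k))"
  interpret F: module R "res_cplx R M k" by (rule free_module_module)
  have wc: "?w \<in> carrier (Ext_cochains R M N k)"
   using w(1) unfolding Ext_cochains_simps mod_hom_def by (auto simp del: res_basis.simps free_module_simps)
  have "\<phi> = Ext_diff R M k ?w"
  proof (rule extensionalityI[of _ "carrier (res_cplx R M (Suc k))"])
   show "\<phi> \<in> extensional (carrier (res_cplx R M (Suc k)))" using * by (simp add: Suc Ext_cochains_simps del: res_basis.simps)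
   show "Ext_diff R M k ?w \<in> extensional (carrier (res_cplx R M (Suc k)))" by (simp add: Ext_diff_def res_module_def del: res_basis.simps)
   fix x assume x: "x \<in> carrier (res_cplx R M (Suc k))"
   show "\<phi> x = Ext_diff R M k ?w x"
    using x w(2) mod_homD(1)[OF bd x] by (simp add: Ext_diff_def res_module_def del: res_basis.simps)
  qed
  then show "\<phi> \<in> Ext_coboundaries R M N i" using wc by (auto simp: Suc)
 qed
qed

lemma (in cring) Ext_coboundaries_subgroup:
 assumes N: "module R N"
 shows "abelian_subgroup (Ext_coboundaries R M N i) (Ext_cochains R M N i)"
proof (rule abelian_subgroupI3[OF additive_subgroupI Ext_cochains_group[OF N]])
 let ?X = "Ext_cochains R M N i"
 interpret X: abelian_group ?X by (rule Ext_cochains_group[OF N])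
 interpret N: module R N by fact
 note iff = Ext_coboundaries_iff[OF N, of _ M i]
 note C = acyclic_cplxD(1)[OF res_acyclic[of M]]
 have sum: "\<phi> \<oplus>\<^bsub>?X\<^esub> \<psi> \<in> Ext_coboundaries R M N i"
  if "\<phi> \<in> Ext_coboundaries R M N i" "\<psi> \<in> Ext_coboundaries R M N i" for \<phi> \<psi>
 proof -
  have c: "\<phi> \<in> carrier ?X" "\<psi> \<in> carrier ?X" "rcob M N i \<phi>"
   "rcob M N i \<psi>" using that iff by auto
  have "rcob M N i (\<phi> \<oplus>\<^bsub>?X\<^esub> \<psi>)"
   by (rule coboundary_cong[OF coboundary_add[OF N c(3,4) C]]) (simp add: Ext_cochains_simps)
  then show ?thesis using iff X.a_closed[OF c(1,2)] by blast
 qed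
 have zero: "\<zero>\<^bsub>?X\<^esub> \<in> Ext_coboundaries R M N i"
 proof -
  have "rcob M N i \<zero>\<^bsub>?X\<^esub>"
   by (rule coboundary_cong[OF coboundary_zero[OF N]]) (simp add: Ext_cochains_simps)
  then show ?thesis using iff by simp
 qed
 show "subgroup (Ext_coboundaries R M N i) (add_monoid ?X)"
 proof (rule X.add.subgroupI)
  fix \<phi> assume \<phi>: "\<phi> \<in> Ext_coboundaries R M N i"
  then have c: "\<phi> \<in> carrier ?X" "rcob M N i \<phi>" using iff by auto
  have "rcob M N i (\<ominus>\<^bsub>?X\<^esub> \<phi>)"
  proof (rule coboundary_cong[OF coboundary_smult[OF N c(2), of "\<ominus> \<one>"]], simp, intro ballI)
   fix x assume x: "x \<in> carrier (res_cplx R M i)"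
   have m: "\<ominus>\<^bsub>?X\<^esub> \<phi> \<in> carrier ?X" using c(1) by simp
   have v: "\<phi> x \<in> carrier N" "(\<ominus>\<^bsub>?X\<^esub> \<phi>) x \<in> carrier N"
    using mod_homD(1)[of _ R "res_cplx R M i" N x] c(1) m x unfolding Ext_cochains_simps by blast+
   have "(\<ominus>\<^bsub>?X\<^esub> \<phi> \<oplus>\<^bsub>?X\<^esub> \<phi>) x = \<zero>\<^bsub>?X\<^esub> x" using X.l_neg[OF c(1)] by simp
   then have "(\<ominus>\<^bsub>?X\<^esub> \<phi>) x \<oplus>\<^bsub>N\<^esub> \<phi> x = \<zero>\<^bsub>N\<^esub>" using x by (simp add: Ext_cochains_simps)
   then have "(\<ominus>\<^bsub>?X\<^esub> \<phi>) x = \<ominus>\<^bsub>N\<^esub> \<phi> x" using N.M.minus_equality v by metis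
   then show "(\<ominus> \<one>) \<odot>\<^bsub>N\<^esub> \<phi> x = (\<ominus>\<^bsub>?X\<^esub> \<phi>) x"
    using N.smult_l_minus[OF one_closed v(1)] N.smult_one[OF v(1)] by simp
  qed
  then show "\<ominus>\<^bsub>?X\<^esub> \<phi> \<in> Ext_coboundaries R M N i" using iff c(1) by simp
 qed (use iff zero sum in auto)
qed

lemma (in cring) Ext_carrier:
 "carrier (Ext R i M N) = (%\<phi>. Ext_coboundaries R M N i +>\<^bsub>Ext_cochains R M N i\<^esub> \<phi>) ` Ext_cocycles R M N i"
 by (auto simp: Ext_def quotient_module_def A_RCOSETS_def' a_r_coset_def')

lemma (in cring) Ext_cochain_diff:
 assumes N: "module R N" and c: "\<phi> \<in> carrier (Ext_cochains R M N i)" "\<psi> \<in> carrier (Ext_cochains R M N i)"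
  and x: "x \<in> carrier (res_cplx R M i)"
 shows "(\<phi> \<ominus>\<^bsub>Ext_cochains R M N i\<^esub> \<psi>) x = \<phi> x \<ominus>\<^bsub>N\<^esub> \<psi> x"
proof -
 let ?X = "Ext_cochains R M N i"
 interpret X: abelian_group ?X by (rule Ext_cochains_group[OF N])
 interpret N: module R N by fact
 have m: "\<phi> \<ominus>\<^bsub>?X\<^esub> \<psi> \<in> carrier ?X" using c by (rule X.minus_closed)
 have v: "\<phi> x \<in> carrier N" "\<psi> x \<in> carrier N" "(\<phi> \<ominus>\<^bsub>?X\<^esub> \<psi>) x \<in> carrier N"
  using mod_homD(1)[of _ R "res_cplx R M i" N x] c m x unfolding Ext_cochains_simps by blast+
 have "(\<phi> \<ominus>\<^bsub>?X\<^esub> \<psi>) \<oplus>\<^bsub>?X\<^esub> \<psi> = \<phi>" using c by (simp add: X.minus_eq X.a_assoc X.l_neg)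
 then have "(\<phi> \<ominus>\<^bsub>?X\<^esub> \<psi>) x \<oplus>\<^bsub>N\<^esub> \<psi> x = \<phi> x" using x by (auto simp: Ext_cochains_simps dest: fun_cong[of _ _ x])
 then show ?thesis using v by (metis N.M.add.inv_solve_right' N.M.minus_eq)
qed

text \<open>Representatives of one coset differ by a coboundary, which pulls back to a coboundary;
  so the union defining \<open>Ext_map\<close> is a single coset.\<close>

lemma (in cring) Ext_map_coset:
 assumes N: "module R N" and M: "module R M" "module R M'" and h: "h \<in> mod_hom R M' M"
  and \<phi>: "\<phi> \<in> carrier (Ext_cochains R M N i)"
 shows "(\<lambda>f\<in>carrier (res_cplx R M' i). \<phi> (res_map R h f)) \<in> carrier (Ext_cochains R M' N i)"
  and "Ext_map R i h M' N (Ext_coboundaries R M N i +>\<^bsub>Ext_cochains R M N i\<^esub> \<phi>) =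
   Ext_coboundaries R M' N i +>\<^bsub>Ext_cochains R M' N i\<^esub> (\<lambda>f\<in>carrier (res_cplx R M' i). \<phi> (res_map R h f))"
proof -
 let ?tr = "%\<phi>. \<lambda>f\<in>carrier (res_cplx R M' i). \<phi> (res_map R h f)"
 let ?X = "Ext_cochains R M N i" and ?X' = "Ext_cochains R M' N i"
 let ?B = "Ext_coboundaries R M N i" and ?B' = "Ext_coboundaries R M' N i"
 interpret X: abelian_group ?X by (rule Ext_cochains_group[OF N])
 interpret X': abelian_group ?X' by (rule Ext_cochains_group[OF N])
 interpret B: abelian_subgroup ?B ?X by (rule Ext_coboundaries_subgroup[OF N])
 interpret B': abelian_subgroup ?B' ?X' by (rule Ext_coboundaries_subgroup[OF N])
 interpret N: module R N by fact
 interpret F: module R "res_cplx R M' i" by (rule free_module_module)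
 note ch = res_map_chain[OF M(2,1) h]
 have rc: "res_map R h f \<in> carrier (res_cplx R M i)" if "f \<in> carrier (res_cplx R M' i)" for f
  using mod_homD(1)[OF chain_mapD(1)[OF ch] that] .
 have tr: "?tr \<phi> \<in> carrier ?X'" if "\<phi> \<in> carrier ?X" for \<phi>
 proof -
  have "\<phi> \<in> mod_hom R (res_cplx R M i) N" using that by (simp add: Ext_cochains_simps)
  from mod_hom_comp[OF chain_mapD(1)[OF ch] this] show ?thesis
   unfolding Ext_cochains_simps mod_hom_def by (auto simp del: free_module_simps)
 qed
 show "?tr \<phi> \<in> carrier ?X'" by (rule tr[OF \<phi>])
 have trB: "?tr \<beta> \<in> ?B'" if "\<beta> \<in> ?B" for \<beta>
 proof -
  have \<beta>: "\<beta> \<in> carrier ?X" "rcob M N i \<beta>"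
   using that Ext_coboundaries_iff[OF N] by auto
  have "rcob M' N i (?tr \<beta>)"
   by (rule coboundary_cong[OF coboundary_pull[OF ch \<beta>(2)]]) simp
  then show ?thesis using Ext_coboundaries_iff[OF N] tr[OF \<beta>(1)] by blast
 qed
 have eq: "?B' +>\<^bsub>?X'\<^esub> ?tr \<psi> = ?B' +>\<^bsub>?X'\<^esub> ?tr \<phi>" if \<psi>: "\<psi> \<in> ?B +>\<^bsub>?X\<^esub> \<phi>" for \<psi>
 proof -
  obtain \<beta> where \<beta>: "\<beta> \<in> ?B" "\<psi> = \<beta> \<oplus>\<^bsub>?X\<^esub> \<phi>" using \<psi> by (auto simp: a_r_coset_def')
  have "?tr \<psi> = ?tr \<beta> \<oplus>\<^bsub>?X'\<^esub> ?tr \<phi>"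
   unfolding \<beta>(2) Ext_cochains_simps using rc by (intro restrict_ext) simp
  then have "?tr \<psi> \<in> ?B' +>\<^bsub>?X'\<^esub> ?tr \<phi>" using trB[OF \<beta>(1)] unfolding a_r_coset_def' by blast
  then show ?thesis using B'.a_repr_independence'[OF _ tr[OF \<phi>]] by simp
 qed
 have "\<phi> \<in> ?B +>\<^bsub>?X\<^esub> \<phi>" by (rule B.a_rcos_self[OF \<phi>])
 then show "Ext_map R i h M' N (?B +>\<^bsub>?X\<^esub> \<phi>) = ?B' +>\<^bsub>?X'\<^esub> ?tr \<phi>"
  unfolding Ext_map_def res_module_def using eq by blast
qed

section \<open>Direct limits along injective maps\<close>

lemma seq_map_inj:
 assumes "!!s x. x \<in> C s ==> f s x \<in> C (Suc s)" "!!s. inj_on (f s) (C s)"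
 shows "inj_on (seq_map f t k) (C t) \<and> seq_map f t k ` C t \<subseteq> C (t + k)"
proof (induction k)
 case (Suc k)
 have "inj_on (f (t + k) \<circ> seq_map f t k) (C t)"
  using Suc inj_on_subset[OF assms(2)] by (intro comp_inj_on) auto
 then show ?case using Suc assms(1)[of _ "t + k"] by (auto simp: comp_def image_subset_iff)
qed simp

text \<open>Two elements of the same stage that agree in the limit agree after equally many
  transition maps, and a composite of injective maps is injective.\<close>

lemma dirlim_incl_inj:
 assumes "!!s x. x \<in> carrier (M s) ==> f s x \<in> carrier (M (Suc s))" "!!s. inj_on (f s) (carrier (M s))"
 shows "inj_on (dirlim_incl M f t) (carrier (M t))"
proof (rule inj_onI)
 fix x y assume x: "x \<in> carrier (M t)" and y: "y \<in> carrier (M t)" and eq: "dirlim_incl M f t x = dirlim_incl M f t y"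
 have "(t, y) \<in> dirlim_incl M f t y" using y by (auto simp: dirlim_incl_def dirlim_rel_def)
 then have "(t, y) \<in> dirlim_incl M f t x" using eq by simp
 then obtain j k where "t + j = t + k" "seq_map f t j x = seq_map f t k y"
  by (auto simp: dirlim_incl_def dirlim_rel_def)
 then show "x = y" using seq_map_inj[of "%s. carrier (M s)" f t j, OF assms] x y by (auto dest: inj_onD)
qed

lemma (in cring) self_minus:
 assumes "x \<in> CR" "y \<in> CR"
 shows "x \<ominus>\<^bsub>self_module R\<^esub> y = x \<ominus> y"
proof -
 interpret S: module R "SM" by (rule self_module)
 have "\<ominus>\<^bsub>self_module R\<^esub> y = \<ominus> y" using S.M.minus_equality[of "\<ominus> y" y] assms by (simp add: l_neg)
 then show ?thesis by (simp add: a_minus_def)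
qed

context frob_res
begin

lemma Ext_transition_props:
 shows "C \<in> carrier (Ext_system R Jp i t) ==> Ext_transition R Jp i t C \<in> carrier (Ext_system R Jp i (Suc t))"
  and "inj_on (Ext_transition R Jp i t) (carrier (Ext_system R Jp i t))"
proof -
 let ?h = "%C. Jp t <+>\<^bsub>R\<^esub> C" and ?M = "Mp t" and ?M' = "Mp (Suc t)"
 let ?X = "Ext_cochains R ?M S i" and ?X' = "Ext_cochains R ?M' S i"
 let ?B = "Ext_coboundaries R ?M S i" and ?B' = "Ext_coboundaries R ?M' S i"
 let ?tr = "%\<phi>. \<lambda>f\<in>carrier (Rs (Suc t) i). \<phi> (res_map R ?h f)"
 interpret X: abelian_group ?X by (rule Ext_cochains_group[OF self_module])
 interpret X': abelian_group ?X' by (rule Ext_cochains_group[OF self_module])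
 interpret B: abelian_subgroup ?B ?X by (rule Ext_coboundaries_subgroup[OF self_module])
 interpret B': abelian_subgroup ?B' ?X' by (rule Ext_coboundaries_subgroup[OF self_module])
 note q = quot_facts(1)[OF Jp_ideal]
 note h = quot_map(2)[OF Jp_ideal Jp_ideal Jp_Suc, of t]
 note ch = res_map_chain[OF q q h]
 note em = Ext_map_coset[OF self_module q q h, of _ i]
 have tr_eq: "Ext_transition R Jp i t (?B +>\<^bsub>?X\<^esub> \<phi>) = ?B' +>\<^bsub>?X'\<^esub> ?tr \<phi>" if "\<phi> \<in> carrier ?X" for \<phi>
  unfolding Ext_transition_def using em(2)[OF that] .
 have rc: "res_map R ?h f \<in> carrier (Rs t k)" if "f \<in> carrier (Rs (Suc t) k)" for f k
  using mod_homD(1)[OF chain_mapD(1)[OF ch] that] .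
 have cyc: "?tr \<phi> \<in> Ext_cocycles R ?M' S i" if \<phi>: "\<phi> \<in> Ext_cocycles R ?M S i" for \<phi>
  unfolding Ext_cocycles_iff
 proof (intro conjI ballI)
  have c: "\<phi> \<in> carrier ?X" "\<forall>x\<in>carrier (Rs t (Suc i)). \<phi> (res_bd R x) = \<zero>" using \<phi> by (auto simp: Ext_cocycles_iff)
  show "?tr \<phi> \<in> carrier ?X'" by (rule em(1)[OF c(1)])
  fix x assume x: "x \<in> carrier (Rs (Suc t) (Suc i))"
  have "res_bd R x \<in> carrier (Rs (Suc t) i)" using mod_homD(1)[OF cplxD(2)[OF acyclic_cplxD(1)[OF res_acyclic]] x] .
  then have "?tr \<phi> (res_bd R x) = \<phi> (res_bd R (res_map R ?h x))" using chain_mapD(2)[OF ch x] by simp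
  then show "?tr \<phi> (res_bd R x) = \<zero>\<^bsub>S\<^esub>" using c(2) rc[OF x] by simp
 qed
 have sys: "carrier (Ext_system R Jp i s) = (%\<phi>. Ext_coboundaries R (Mp s) S i +>\<^bsub>Ext_cochains R (Mp s) S i\<^esub> \<phi>) ` Ext_cocycles R (Mp s) S i" for s
  unfolding Ext_system_def by (rule Ext_carrier)
 have cc: "\<phi> \<in> carrier ?X" if "\<phi> \<in> Ext_cocycles R ?M S i" for \<phi> using that by (simp add: Ext_cocycles_iff)
 show "C \<in> carrier (Ext_system R Jp i t) ==> Ext_transition R Jp i t C \<in> carrier (Ext_system R Jp i (Suc t))"
 proof -
  assume "C \<in> carrier (Ext_system R Jp i t)"
  then obtain \<phi> where \<phi>: "\<phi> \<in> Ext_cocycles R ?M S i" "C = ?B +>\<^bsub>?X\<^esub> \<phi>" unfolding sys by blast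
  show ?thesis unfolding \<phi>(2) tr_eq[OF cc[OF \<phi>(1)]] sys by (rule imageI[OF cyc[OF \<phi>(1)]])
 qed
 show "inj_on (Ext_transition R Jp i t) (carrier (Ext_system R Jp i t))"
 proof (rule inj_onI)
  fix U V assume "U \<in> carrier (Ext_system R Jp i t)" "V \<in> carrier (Ext_system R Jp i t)"
   and eq: "Ext_transition R Jp i t U = Ext_transition R Jp i t V"
  then obtain \<phi> \<psi> where \<phi>: "\<phi> \<in> Ext_cocycles R ?M S i" "U = ?B +>\<^bsub>?X\<^esub> \<phi>"
   and \<psi>: "\<psi> \<in> Ext_cocycles R ?M S i" "V = ?B +>\<^bsub>?X\<^esub> \<psi>" unfolding sys by blast
  note c = cc[OF \<phi>(1)] cc[OF \<psi>(1)]
  \<comment> \<open>Injectivity on classes is reduced to a kernel statement for one cocycle, the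
    difference of two representatives.\<close>
  let ?d = "\<phi> \<ominus>\<^bsub>?X\<^esub> \<psi>"
  have dc: "?d \<in> carrier ?X" by (rule X.minus_closed[OF c])
  have dv: "?d x = \<phi> x \<ominus> \<psi> x" if "x \<in> carrier (Rs t i)" for x
   
   using Ext_cochain_diff[OF self_module c that] self_minus c
    mod_homD(1)[of \<phi> R "Rs t i" S, OF _ that] mod_homD(1)[of \<psi> R "Rs t i" S, OF _ that]
   by (simp only: Ext_cochains_simps(1) Int_iff self_simps)
  have "?B' +>\<^bsub>?X'\<^esub> ?tr \<phi> = ?B' +>\<^bsub>?X'\<^esub> ?tr \<psi>" using eq unfolding \<phi>(2) \<psi>(2) tr_eq[OF c(1)] tr_eq[OF c(2)] .
  then have "?tr \<phi> \<ominus>\<^bsub>?X'\<^esub> ?tr \<psi> \<in> ?B'" using B'.coset_eq_iff[OF em(1)[OF c(1)] em(1)[OF c(2)]] by blast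
  then have "rcob (Mp (Suc t)) S i (?tr \<phi> \<ominus>\<^bsub>?X'\<^esub> ?tr \<psi>)"
   using Ext_coboundaries_iff[OF self_module] by blast
  then have cob: "rcob (Mp (Suc t)) S i (%x. ?d (res_map R ?h x))"
  proof (rule coboundary_cong, intro ballI)
   fix x assume x: "x \<in> carrier (Rs (Suc t) i)"
   have "(?tr \<phi> \<ominus>\<^bsub>?X'\<^esub> ?tr \<psi>) x = ?tr \<phi> x \<ominus> ?tr \<psi> x"
    using Ext_cochain_diff[OF self_module em(1)[OF c(1)] em(1)[OF c(2)] x] self_minus
     mod_homD(1)[of "?tr \<phi>" R "Rs (Suc t) i" S, OF _ x] mod_homD(1)[of "?tr \<psi>" R "Rs (Suc t) i" S, OF _ x]
     em(1)[OF c(1)] em(1)[OF c(2)] by (simp only: Ext_cochains_simps(1) Int_iff self_simps)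
   then show "(?tr \<phi> \<ominus>\<^bsub>?X'\<^esub> ?tr \<psi>) x = ?d (res_map R ?h x)" using dv[OF rc[OF x]] x by simp
  qed
  have "rcob (Mp t) S i ?d"
  proof (rule transition_injective[OF _ _ cob])
   show "?d \<in> mod_hom R (Rs t i) S" using dc by (simp add: Ext_cochains_simps)
   show "\<forall>x\<in>carrier (Rs t (Suc i)). ?d (res_bd R x) = \<zero>"
   proof
    fix x assume x: "x \<in> carrier (Rs t (Suc i))"
    have "res_bd R x \<in> carrier (Rs t i)" using mod_homD(1)[OF cplxD(2)[OF acyclic_cplxD(1)[OF res_acyclic]] x] .
    then show "?d (res_bd R x) = \<zero>" using dv \<phi>(1) \<psi>(1) x by (simp add: Ext_cocycles_iff minus_eq)
   qed
  qed
  then have "?d \<in> ?B" using Ext_coboundaries_iff[OF self_module] dc by blast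
  then show "U = V" unfolding \<phi>(2) \<psi>(2) using B.coset_eq_iff[OF c] by blast
 qed
qed

lemma local_cohomology_map_inj: "inj_on (local_cohomology_map R Jp i t) (carrier (Ext R i (Mp t) S))"
 using dirlim_incl_inj[of "Ext_system R Jp i" "Ext_transition R Jp i" t, OF Ext_transition_props]
 unfolding local_cohomology_map_def by (simp add: Ext_system_def)

end

theorem theorem1p3:
 fixes R :: "('r, 'x) ring_scheme" and \<aa> :: "'r set" and p :: nat
 assumes "regular_ring R"
  and "p > 0" and "contains_field_of_char R p"
  and "ideal \<aa> R"
  and "F_pure (R Quot \<aa>) p"
 shows "\<forall>i t. inj_on
      (local_cohomology_map R (\<lambda>t. frobenius_power R \<aa> (p ^ t)) i t)
      (carrier (Ext R i (cyclic_module R (frobenius_power R \<aa> (p ^ t))) (self_module R)))"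
proof -
 interpret cring R using assms(1) by (simp add: regular_ring_def)
 interpret noeth R
  using assms(1) by (simp add: regular_ring_def noeth_def is_cring)
 have pr: "normalization_semidom_class.prime p" "add_pow R p \<one>\<^bsub>R\<^esub> = \<zero>\<^bsub>R\<^esub>" using char_prime assms by blast+
 have p2: "p \<ge> 2" using pr(1) by (rule prime_ge_2_nat)
 have frp: "frob R p" using frob_prime pr by blast
 have pure: "lin_pure R \<aa> p" using F_pure_lin_pure assms by blast
 obtain n d where nd: "n 0 = (1::nat)" "acyclic_cplx R (\<lambda>k. free_module R {..<n k}) d"
  "d 0 ` carrier (free_module R {..<n 1}) = {x \<in> carrier (free_module R {..<n 0}). x 0 \<in> \<aa>}"
  using ex_resolution[OF assms(4)] by blast
 interpret frob_res R p \<aa> n d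
  by (intro frob_res.intro frob_res_axioms.intro noeth_axioms assms(4) nd frobenius_flat[OF assms(1) frp p2]
    fedder[OF assms(1) frp p2 assms(4) pure])
 show ?thesis using local_cohomology_map_inj by blast
qed

end
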